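(* Let $\mathcal S$ be one of the five genus-zero sets of steps $\mathcal S_1,\dots,\mathcal S_5$ (listed in the context), with step weights $d_{i,j}>0$ for $(i,j)\in\mathcal S$ and Boltzmann weights $a,b>0$, and let $Q(x,y)$ be the generating function of weighted quadrant walks with interacting boundaries. Then $Q(x,y)$ has the following nature in the variables $x$ and $y$: \begin{enumerate} \item If $\mathcal S\in\{\mathcal S_1,\mathcal S_2\}$ and $a+b=ab$, then $Q(x,y)$ is rational, and \[ Q(x,0)=\frac{1}{1-x\,\dfrac{a d_{1,0}t+ab\,d_{1,-1}d_{0,1}t^2}{1-ab\,d_{1,-1}d_{-1,1}t^2}},\qquad Q(0,y)=\frac{1}{1-y\,\dfrac{b d_{0,1}t+ab\,d_{-1,1}d_{1,0}t^2}{1-ab\,d_{1,-1}d_{-1,1}t^2}}. \] \item If $\mathcal S=\mathcal S_3$ and $a=b=2$, then $Q(x,y)$ is algebraic of degree $4$, and \[ Q(x,0)=\frac{1}{\sqrt{1-x^2\dfrac{4d_{1,1}d_{1,-1}t^2}{1-4d_{1,-1}d_{-1,1}t^2}}},\qquad Q(0,y)=\frac{1}{\sqrt{1-y^2\dfrac{4d_{1,1}d_{-1,1}t^2}{1-4d_{1,-1}d_{-1,1}t^2}}}. \] \item In all other cases, $Q(x,y)$ is neither $x$-D-algebraic nor $y$-D-algebraic. \end{enumerate}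
   Context: The five genus-zero sets of steps are $\mathcal S_1=\{(1,-1),(-1,1),(0,1)\}$, $\mathcal S_2=\{(1,-1),(-1,1),(1,0),(0,1)\}$, $\mathcal S_3=\{(1,-1),(-1,1),(1,1)\}$, $\mathcal S_4=\{(1,-1),(-1,1),(0,1),(1,1)\}$, $\mathcal S_5=\{(1,-1),(-1,1),(1,0),(0,1),(1,1)\}$. A weighting consists of real numbers $d_{i,j}>0$ for $(i,j)\in\mathcal S$ (with the convention $d_{i,j}=0$ for $(i,j)\in\{(1,0),(0,1),(1,1)\}\setminus\mathcal S$) and Boltzmann weights $a,b>0$. A quadrant walk of length $n$ is a sequence $v_1,\dots,v_n$ of steps of $\mathcal S$ such that every partial sum $v_1+\dots+v_k$ ($k\le n$) has nonnegative coordinates; $(i,j)$ denotes its endpoint, $n_v$ the number of occurrences of the step $v$, $n_x$ the number of indices $k\ge1$ such that $v_1+\dots+v_k$ lies on the $x$-axis (second coordinate $0$) and $n_y$ the number of indices $k\ge 1$ such that it lies on the $y$-axis. Its weight is $\prod_{v\in\mathcal S}d_v^{n_v}\,a^{n_x}b^{n_y}$, and $Q(x,y)=\sum_{w}\mathrm{weight}(w)x^iy^jt^n$, the sum over all quadrant walks; it is a formal power series in $t$ with polynomial coefficients in $x,y$, and $Q(x,0)$, $Q(0,y)$ are its specializations. The nature refers to $Q$ as a function of $x$ and $y$ (the variable $t$ being a fixed sufficiently small positive real number transcendental over $\mathbb Q((d_{i,j}),a,b)$). A series is $x$-D-algebraic (resp. $y$-D-algebraic) if it satisfies a nontrivial polynomial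 differential equation with respect to $x$ (resp. $y$) with coefficients in $\mathbb C(x,y,t)$; it is rational if it lies in $\mathbb C(x,y,t)$, algebraic if it is algebraic over $\mathbb C(x,y,t)$. *)

theory Defs
  imports "HOL-Analysis.Analysis" "HOL-Library.Poly_Mapping"
begin

definition S1 :: "(int \<times> int) set" where "S1 = {(1,-1),(-1,1),(0,1)}"
definition S2 :: "(int \<times> int) set" where "S2 = {(1,-1),(-1,1),(1,0),(0,1)}"
definition S3 :: "(int \<times> int) set" where "S3 = {(1,-1),(-1,1),(1,1)}"
definition S4 :: "(int \<times> int) set" where "S4 = {(1,-1),(-1,1),(0,1),(1,1)}"
definition S5 :: "(int \<times> int) set" where "S5 = {(1,-1),(-1,1),(1,0),(0,1),(1,1)}"

definition px :: "(int \<times> int) list \<Rightarrow> nat \<Rightarrow> int" where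
  "px w k = sum_list (map fst (take k w))"
definition py :: "(int \<times> int) list \<Rightarrow> nat \<Rightarrow> int" where
  "py w k = sum_list (map snd (take k w))"

definition walks :: "(int \<times> int) set \<Rightarrow> nat \<Rightarrow> (int \<times> int) list set" where
  "walks S n = {w. length w = n \<and> set w \<subseteq> S \<and>
      (\<forall>k\<in>{1..n}. 0 \<le> px w k \<and> 0 \<le> py w k)}"

definition nx :: "(int \<times> int) list \<Rightarrow> nat" where
  "nx w = card {k\<in>{1..length w}. py w k = 0}"
definition ny :: "(int \<times> int) list \<Rightarrow> nat" where
  "ny w = card {k\<in>{1..length w}. px w k = 0}"

definition weight :: "(int \<times> int) set \<Rightarrow> (int \<times> int \<Rightarrow> real) \<Rightarrow> real \<Rightarrow> real
    \<Rightarrow> (int \<times> int) list \<Rightarrow> real" where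
  "weight S d a b w = (\<Prod>v\<in>S. d v ^ count_list w v) * a ^ nx w * b ^ ny w"

definition Qgf :: "(int \<times> int) set \<Rightarrow> (int \<times> int \<Rightarrow> real) \<Rightarrow> real \<Rightarrow> real \<Rightarrow> real
    \<Rightarrow> complex \<Rightarrow> complex \<Rightarrow> complex" where
  "Qgf S d a b t x y = suminf (\<lambda>n. complex_of_real (t ^ n) *
      (\<Sum>w\<in>walks S n. complex_of_real (weight S d a b w) *
          x ^ nat (px w n) * y ^ nat (py w n)))"

definition moneval :: "(nat \<Rightarrow>\<^sub>0 nat) \<Rightarrow> (nat \<Rightarrow> 'a::comm_ring_1) \<Rightarrow> 'a" where
  "moneval m v = (\<Prod>i\<in>Poly_Mapping.keys m. v i ^ Poly_Mapping.lookup m i)"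

definition mpeval :: "((nat \<Rightarrow>\<^sub>0 nat) \<Rightarrow>\<^sub>0 'a::comm_ring_1) \<Rightarrow> (nat \<Rightarrow> 'a) \<Rightarrow> 'a" where
  "mpeval p v = (\<Sum>m\<in>Poly_Mapping.keys p. Poly_Mapping.lookup p m * moneval m v)"

definition deg_in :: "nat \<Rightarrow> ((nat \<Rightarrow>\<^sub>0 nat) \<Rightarrow>\<^sub>0 'a::zero) \<Rightarrow> nat" where
  "deg_in i p = Max (insert 0 ((\<lambda>m. Poly_Mapping.lookup m i) ` Poly_Mapping.keys p))"

definition vars_in :: "nat set \<Rightarrow> ((nat \<Rightarrow>\<^sub>0 nat) \<Rightarrow>\<^sub>0 'a::zero) \<Rightarrow> bool" where
  "vars_in V p \<longleftrightarrow> (\<forall>m\<in>Poly_Mapping.keys p. Poly_Mapping.keys m \<subseteq> V)"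

definition transcendental_over :: "real list \<Rightarrow> real \<Rightarrow> bool" where
  "transcendental_over ps t \<longleftrightarrow>
     (\<forall>P :: (nat \<Rightarrow>\<^sub>0 nat) \<Rightarrow>\<^sub>0 real. (\<forall>m. Poly_Mapping.lookup P m \<in> \<rat>) \<longrightarrow>
        mpeval P (\<lambda>i. if i < length ps then ps ! i else t) = 0 \<longrightarrow>
        (\<forall>z. mpeval P (\<lambda>i. if i < length ps then ps ! i else z) = 0))"

definition is_rational2 :: "(complex \<Rightarrow> complex \<Rightarrow> complex) \<Rightarrow> bool" where
  "is_rational2 F \<longleftrightarrow> (\<exists>P R. vars_in {0,1} P \<and> vars_in {0,1} R \<and> R \<noteq> 0 \<and>
     (\<exists>r>0. \<forall>x y. norm x < r \<and> norm y < r \<longrightarrow>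
        F x y * mpeval R (\<lambda>i. if i = 0 then x else y) = mpeval P (\<lambda>i. if i = 0 then x else y)))"

definition alg_annihilates :: "(complex \<Rightarrow> complex \<Rightarrow> complex) \<Rightarrow> ((nat \<Rightarrow>\<^sub>0 nat) \<Rightarrow>\<^sub>0 complex) \<Rightarrow> bool" where
  "alg_annihilates F P \<longleftrightarrow> P \<noteq> 0 \<and> vars_in {0,1,2} P \<and>
     (\<exists>r>0. \<forall>x y. norm x < r \<and> norm y < r \<longrightarrow>
        mpeval P (\<lambda>i. if i = 0 then x else if i = 1 then y else F x y) = 0)"

definition algebraic_deg2 :: "(complex \<Rightarrow> complex \<Rightarrow> complex) \<Rightarrow> nat \<Rightarrow> bool" where
  "algebraic_deg2 F n \<longleftrightarrow> (\<exists>P. alg_annihilates F P \<and> deg_in 2 P = n) \<and>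
     (\<forall>P. alg_annihilates F P \<longrightarrow> n \<le> deg_in 2 P)"

definition x_D_algebraic :: "(complex \<Rightarrow> complex \<Rightarrow> complex) \<Rightarrow> bool" where
  "x_D_algebraic F \<longleftrightarrow> (\<exists>P :: (nat \<Rightarrow>\<^sub>0 nat) \<Rightarrow>\<^sub>0 complex. P \<noteq> 0 \<and>
     (\<exists>r>0. \<forall>x y. norm x < r \<and> norm y < r \<longrightarrow>
        mpeval P (\<lambda>i. if i = 0 then x else if i = 1 then y
                       else (deriv ^^ (i - 2)) (\<lambda>u. F u y) x) = 0))"

definition y_D_algebraic :: "(complex \<Rightarrow> complex \<Rightarrow> complex) \<Rightarrow> bool" where
  "y_D_algebraic F \<longleftrightarrow> (\<exists>P :: (nat \<Rightarrow>\<^sub>0 nat) \<Rightarrow>\<^sub>0 complex. P \<noteq> 0 \<and>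
     (\<exists>r>0. \<forall>x y. norm x < r \<and> norm y < r \<longrightarrow>
        mpeval P (\<lambda>i. if i = 0 then x else if i = 1 then y
                       else (deriv ^^ (i - 2)) (\<lambda>u. F x u) y) = 0))"

end

theory Submission
 imports Defs "HOL-Complex_Analysis.Complex_Analysis" "HOL-Computational_Algebra.Fundamental_Theorem_Algebra"
begin

text \<open>For small \<open>t\<close> the kernel of the functional equation of \<open>Q\<close> vanishes on a rational curve
\<open>1/x = X(s)\<close>, \<open>1/y = Y(s)\<close> with \<open>X(1/s) = X(s)\<close> and \<open>Y(1/s) = Y(qs)\<close>. On this curve the functional equation
becomes a linear first-order \<open>q\<close>-difference equation with rational coefficients for the Laurent series of \<open>Q(0,y)\<close>.
If the logarithmic derivative of its coefficient does not telescope, an argument of Kolchin-Ostrowski type shows that a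
differentially algebraic solution forces a rational one; if the coefficient is essentially constant, an isolated pole
of the inhomogeneous term on its \<open>q\<close>-orbit excludes differentially algebraic solutions. For small \<open>t\<close> the sizes of the
roots of the two quadratic polynomials \<open>n\<^sub>A\<close>, \<open>n\<^sub>B\<close> in the equation separate their \<open>q\<close>-orbits and rule out
all rational solutions outside the two exceptional cases. In these cases the equation is homogeneous, its solution is
unique up to a constant, and it can be written down.\<close>

section \<open>Polynomials in countably many variables\<close>

text \<open>The dilation factor \<open>q = h^2\<close> grows without bound as t tends to 0, whereas
  the roots of the two quadratics are known up to a constant factor \<open>R\<close>. Once
  \<open>q\<close> is large against \<open>R\<close>, absolute values alone decide which points can
  share an orbit and leave at most one candidate exponent; the remaining coincidences are algebraic
  identities between products of roots, and these single out the exceptional parameters. Uniform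
  root bounds need the centre \<open>(ex, ey)\<close> of the kernel conic to stay bounded, which is
  true if the step (1,1) is present. Otherwise the centre escapes, but the conic passes through X =
  Y = 0, the quadratics share a root, and its factors cancel from the coefficient: hence separate
  treatments of the second and the first step set, where this root has modulus about sqrt h and 1
  respectively. In the Kolchin-Ostrowski type argument the top part of a relation is tested on a
  solution of the homogeneous equation. No such Laurent series is constructed; only its logarithmic
  derivative \<open>U\<close> is, and with it the ratios of its derivatives to itself.\<close>

abbreviation lookup where "lookup == Poly_Mapping.lookup"
abbreviation keys where "keys == Poly_Mapping.keys"
abbreviation single where "single == Poly_Mapping.single"
abbreviation cr where "cr == complex_of_real"

type_synonym 'a mp = "(nat \<Rightarrow>\<^sub>0 nat) \<Rightarrow>\<^sub>0 'a"

lemma moneval_superset: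
 assumes "finite A" "keys m<=A"
 shows "moneval m v = (PROD i:A. v i^lookup m i)"
 unfolding moneval_def using assms
 by (intro prod.mono_neutral_left) (auto simp: in_keys_iff)

lemma mpeval_superset:
 assumes "finite A" "keys p<=A"
 shows "mpeval p v = (SUM m:A. lookup p m*moneval m v)"
 unfolding mpeval_def using assms
 by (intro sum.mono_neutral_left) (auto simp: in_keys_iff)

lemma moneval_0 [simp]: "moneval 0 v = 1"
 by (simp add: moneval_def)

lemma moneval_add: "moneval (m + n) v = moneval m v * moneval n v"
proof -
 let ?A = "keys m Un keys n"
 have "moneval (m + n) v = (PROD i:?A. v i^lookup (m + n) i)"
  using Poly_Mapping.keys_add[of m n] by (intro moneval_superset) auto
 also have "... = (PROD i:?A. v i^lookup m i)*(PROD i:?A. v i^lookup n i)"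
  by (simp add: lookup_add power_add prod.distrib)
 also have "... = moneval m v * moneval n v"
  by (simp add: moneval_superset[of ?A m] moneval_superset[of ?A n])
 finally show ?thesis .
qed

lemma moneval_single [simp]: "moneval (single i k) v = v i^k"
 by (cases "k = 0") (auto simp: moneval_def)

lemma mpeval_add: "mpeval (p + r) v = mpeval p v + mpeval r v"
proof -
 let ?A = "keys p Un keys r"
 have "mpeval (p + r) v = (SUM m:?A. lookup (p + r) m*moneval m v)"
  using Poly_Mapping.keys_add[of p r] by (intro mpeval_superset) auto
 thus ?thesis
  by (simp add: lookup_add distrib_right sum.distrib mpeval_superset[of ?A p] mpeval_superset[of ?A r])
qed

lemma mpeval_0 [simp]: "mpeval 0 v = 0"
 by (simp add: mpeval_def)

lemma mpeval_single [simp]: "mpeval (single m c) v = c*moneval m v"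
 by (cases "c = 0") (auto simp: mpeval_def)

lemma mpeval_1 [simp]: "mpeval 1 v = 1"
 using mpeval_single[of 0 1 v] by (simp del: mpeval_single)

lemma mpeval_uminus [simp]: "mpeval (-p) v = - mpeval p v"
 using mpeval_add[of p "- p" v] by (simp add: eq_neg_iff_add_eq_0 add.commute)

lemma mpeval_diff: "mpeval (p - r) v = mpeval p v - mpeval r v"
 using mpeval_add[of p "- r" v] by simp

lemma mpeval_sum: "mpeval (sum f A) v = (SUM x:A. mpeval (f x) v)"
 by (induction A rule: infinite_finite_induct) (auto simp: mpeval_add)

lemma mp_sum_singles:
 fixes p :: "'a :: comm_monoid_add mp"
 shows "p = (SUM m:keys p. single m (lookup p m))"
proof (rule poly_mapping_eqI)
 fix k
 show "lookup p k = lookup (SUM m:keys p. single m (lookup p m)) k"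
  by (cases "k : keys p")
    (auto simp: lookup_sum lookup_single when_def in_keys_iff sum.delta)
qed

lemma mpeval_mult: "mpeval (p*r) v = mpeval p v * mpeval r v"
proof -
 have "p*r = (SUM m:keys p. single m (lookup p m)) *
        (SUM n:keys r. single n (lookup r n))"
  by (simp flip: mp_sum_singles)
 also have "... = (SUM m:keys p. SUM n:keys r.
   single (m + n) (lookup p m*lookup r n))"
  by (simp add: sum_product mult_single)
 finally have "mpeval (p*r) v = (SUM m:keys p. SUM n:keys r.
   (lookup p m*moneval m v)*(lookup r n*moneval n v))"
  by (simp add: mpeval_sum moneval_add mult_ac)
 thus ?thesis by (simp add: mpeval_def sum_product)
qed

lemma mpeval_power: "mpeval (p^n) v = mpeval p v^n"
 by (induction n) (auto simp: mpeval_mult)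

lemma mpeval_prod: "mpeval (prod f A) v = (PROD x:A. mpeval (f x) v)"
 by (induction A rule: infinite_finite_induct) (auto simp: mpeval_mult)

definition coeffs_in :: "'a set => 'a::zero mp => bool" where
 "coeffs_in K p \<longleftrightarrow> (ALL m. lookup p m : K)"

text \<open>The action of an endomorphism \<open>si\<close> on relations: if \<open>w i\<close>
  takes the value \<open>si (v i)\<close> at \<open>v\<close>, this polynomial takes the value
  \<open>si (mpeval P v)\<close> there.\<close>

definition poly_subst :: "('a => 'a) => 'a::comm_ring_1 mp => (nat => 'a mp) => 'a mp" where
 "poly_subst si P w =
   (SUM m:keys P. single 0 (si (lookup P m))*moneval m w)"

lemma mpeval_moneval: "mpeval (moneval m w) v = moneval m (%i. mpeval (w i) v)"
 by (simp add: moneval_def mpeval_prod mpeval_power)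

lemma mpeval_poly_subst:
 "mpeval (poly_subst si P w) v =
   (SUM m:keys P. si (lookup P m)*moneval m (%i. mpeval (w i) v))"
 by (simp add: poly_subst_def mpeval_sum mpeval_mult mpeval_moneval)

locale subfield =
 fixes K :: "'a :: field set"
 assumes zero_in [simp]: "0 : K" and one_in [simp]: "1 : K"
  and add_in: "x : K ==> y : K ==> x + y : K"
  and uminus_in: "x : K ==> - x : K"
  and mult_in: "x : K ==> y : K ==> x*y : K"
  and inverse_in: "x : K ==> inverse x : K"
begin

lemma diff_in: "x : K ==> y : K ==> x - y : K"
 using add_in[of x "- y"] uminus_in[of y] by simp

lemma divide_in: "x : K ==> y : K ==> x/y : K"
 using mult_in[of x "inverse y"] inverse_in[of y] by (simp add: divide_inverse)

lemma power_in: "x : K ==> x^n : K"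
 by (induction n) (auto intro: mult_in)

lemma sum_in: "(!!x. x : A ==> f x : K) ==> sum f A : K"
 by (induction A rule: infinite_finite_induct) (auto intro: add_in)

lemma of_nat_in: "of_nat n : K"
 by (induction n) (auto intro: add_in)

lemma coeffs_in_single: "c : K ==> coeffs_in K (single m c)"
 by (auto simp: coeffs_in_def lookup_single when_def)

lemma coeffs_in_0: "coeffs_in K 0"
 by (simp add: coeffs_in_def)

lemma coeffs_in_1: "coeffs_in K 1"
 using coeffs_in_single[of 1 0] by simp

lemma coeffs_in_add: "coeffs_in K p ==> coeffs_in K r ==> coeffs_in K (p + r)"
 by (auto simp: coeffs_in_def lookup_add intro: add_in)

lemma coeffs_in_diff: "coeffs_in K p ==> coeffs_in K r ==> coeffs_in K (p - r)"
 by (auto simp: coeffs_in_def lookup_minus intro: diff_in)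

lemma coeffs_in_sum: "(!!x. x : A ==> coeffs_in K (f x)) ==> coeffs_in K (sum f A)"
 by (induction A rule: infinite_finite_induct) (auto intro: coeffs_in_add coeffs_in_0)

lemma coeffs_in_mult:
 assumes "coeffs_in K p" "coeffs_in K r"
 shows "coeffs_in K (p*r)"
proof -
 have "p*r = (SUM m:keys p. single m (lookup p m)) *
        (SUM n:keys r. single n (lookup r n))"
  by (simp flip: mp_sum_singles)
 also have "... = (SUM m:keys p. SUM n:keys r.
   single (m + n) (lookup p m*lookup r n))"
  by (simp add: sum_product mult_single)
 also have "coeffs_in K ..."
  using assms by (intro coeffs_in_sum coeffs_in_single mult_in) (auto simp: coeffs_in_def)
 finally show ?thesis .
qed

lemma coeffs_in_power: "coeffs_in K p ==> coeffs_in K (p^n)"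
 by (induction n) (auto intro: coeffs_in_mult coeffs_in_1)

lemma coeffs_in_moneval: "(!!i. coeffs_in K (w i)) ==> coeffs_in K (moneval m w)"
proof -
 assume w: "!!i. coeffs_in K (w i)"
 have "finite A ==> coeffs_in K (PROD i:A. w i^lookup m i)" for A
  by (induction A rule: finite_induct) (auto intro: coeffs_in_mult coeffs_in_1 coeffs_in_power w)
 thus ?thesis by (simp add: moneval_def)
qed

lemma coeffs_in_poly_subst:
 assumes "coeffs_in K P" "!!i. coeffs_in K (w i)" "!!x. x : K ==> si x : K"
 shows "coeffs_in K (poly_subst si P w)"
 unfolding poly_subst_def using assms
 by (intro coeffs_in_sum coeffs_in_mult coeffs_in_single coeffs_in_moneval) (auto simp: coeffs_in_def)

end

section \<open>Weights of monomials and leading terms\<close>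

definition wt :: "(nat => nat) => (nat \<Rightarrow>\<^sub>0 nat) => nat" where
 "wt om m = (SUM i:keys m. lookup m i * om i)"

lemma wt_superset:
 assumes "finite A" "keys m<=A"
 shows "wt om m = (SUM i:A. lookup m i * om i)"
 unfolding wt_def using assms
 by (intro sum.mono_neutral_left) (auto simp: in_keys_iff)

lemma wt_0 [simp]: "wt om 0 = 0"
 by (simp add: wt_def)

lemma wt_add: "wt om (m + n) = wt om m + wt om n"
proof -
 let ?A = "keys m Un keys n"
 have "wt om (m + n) = (SUM i:?A. lookup (m + n) i * om i)"
  using Poly_Mapping.keys_add[of m n] by (intro wt_superset) auto
 thus ?thesis
  by (simp add: lookup_add distrib_right sum.distrib wt_superset[of ?A m] wt_superset[of ?A n])
qed

lemma wt_single [simp]: "wt om (single i k) = k * om i"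
 by (cases "k = 0") (auto simp: wt_def)

text \<open>The coefficient \<open>c\<close> may be 0, and then all monomials weigh less than
  \<open>m\<close>; this keeps products of leading terms free of side conditions over an arbitrary
  commutative ring.\<close>

definition lead :: "(nat => nat) => 'a::comm_ring_1 mp => (nat \<Rightarrow>\<^sub>0 nat) => 'a => bool" where
 "lead om p m c \<longleftrightarrow> (ALL k:keys (p - single m c). wt om k < wt om m)"

lemma keys_add_wt:
 assumes "ALL k:keys p. wt om k < W" "ALL k:keys r. wt om k < W"
 shows "ALL k:keys (p + r). wt om k < W"
 using Poly_Mapping.keys_add[of p r] assms by blast

lemma lead_mult:
 assumes "lead om p m c" "lead om r n d"
 shows "lead om (p*r) (m + n) (c*d)"
proof -
 let ?p = "p - single m c" and ?r = "r - single n d"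
 have eq: "p*r - single (m + n) (c*d) =
   ?p*?r + (?p * single n d + single m c*?r)"
  by (simp add: algebra_simps mult_single)
 have 1: "wt om k < wt om (m + n)" if "k : keys (?p*?r)" for k
 proof -
  obtain a b where ab: "k = a + b" "a : keys ?p" "b : keys ?r"
   using `k : _` Poly_Mapping.keys_mult[of ?p ?r] by blast
  hence "wt om a < wt om m" "wt om b < wt om n" using assms by (auto simp: lead_def)
  thus ?thesis by (simp add: ab wt_add)
 qed
 have 2: "wt om k < wt om (m + n)" if "k : keys (?p * single n d)" for k
 proof -
  obtain a b where ab: "k = a + b" "a : keys ?p" "b : keys (single n d)"
   using `k : _` Poly_Mapping.keys_mult[of ?p "single n d"] by blast
  hence "wt om a < wt om m" "b = n" using assms by (auto simp: lead_def split: if_splits)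
  thus ?thesis by (simp add: ab wt_add)
 qed
 have 3: "wt om k < wt om (m + n)" if "k : keys (single m c*?r)" for k
 proof -
  obtain a b where ab: "k = a + b" "a : keys (single m c)" "b : keys ?r"
   using `k : _` Poly_Mapping.keys_mult[of "single m c" ?r] by blast
  hence "a = m" "wt om b < wt om n" using assms by (auto simp: lead_def split: if_splits)
  thus ?thesis by (simp add: ab wt_add)
 qed
 show ?thesis unfolding lead_def eq
  by (intro keys_add_wt) (use 1 2 3 in auto)
qed

lemma lead_const [simp]: "lead om (single m c) m c"
 by (simp add: lead_def)

lemma lead_power: "lead om p m c ==> lead om (p^n) (SUM _<n. m) (c^n)"
proof (induction n)
 case 0
 show ?case using lead_const[of om 0 1] by simp
next
 case (Suc n)
 have "lead om (p*p^n) (m + (SUM _<n. m)) (c * c^n)"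
  by (rule lead_mult[OF Suc.prems Suc.IH[OF Suc.prems]])
 moreover have "(SUM _<Suc n. m) = m + (SUM _<n. m)" by (simp only: sum.lessThan_Suc add.commute)
 ultimately show ?case by (simp only: power_Suc)
qed

lemma single_sum_const: "(SUM _<n. single i (1::nat)) = single i n"
 by (induction n) (auto simp flip: single_add)

lemma lead_moneval:
 fixes w :: "nat => 'a::comm_ring_1 mp"
 assumes "!!i. lead om (w i) (single i 1) (c i)"
 shows "lead om (moneval m w) m (moneval m c)"
proof -
 have *: "lead om (PROD i:A. w i^lookup m i)
   (SUM i:A. single i (lookup m i)) (PROD i:A. c i^lookup m i)"
  if "finite A" for A
  using that
 proof (induction A rule: finite_induct)
  case empty
  show ?case using lead_const[of om 0 1] by simp
 next
  case (insert x A)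
  have "lead om (w x^lookup m x) (single x (lookup m x)) (c x^lookup m x)"
   using lead_power[OF assms, of x "lookup m x"] by (simp only: single_sum_const)
  from lead_mult[OF this insert.IH] insert.hyps show ?case by simp
 qed
 have "(SUM i:keys m. single i (lookup m i)) = m"
 proof (rule poly_mapping_eqI)
  fix k
  show "lookup (SUM i:keys m. single i (lookup m i)) k = lookup m k"
   by (cases "k : keys m")
    (auto simp: lookup_sum lookup_single when_def in_keys_iff sum.delta)
 qed
 with *[of "keys m"] show ?thesis by (simp add: moneval_def)
qed

lemma lookup_single_0_mult:
 "lookup (single 0 c*p) (N :: nat \<Rightarrow>\<^sub>0 nat) = c*lookup p N"
 for p :: "'a :: comm_ring_1 mp"
proof -
 have "single 0 c*p = Poly_Mapping.map ((*) c) p"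
  by (simp add: mult_map_scale_conv_mult)
 thus ?thesis by (simp add: map.rep_eq when_def)
qed

lemma lookup_lead:
 assumes "lead om p m c" "wt om m<=wt om N"
 shows "lookup p N = (if N = m then c else 0)"
proof -
 have "N ~: keys (p - single m c)"
  using assms by (force simp: lead_def)
 hence "lookup p N - lookup (single m c) N = 0"
  by (simp add: in_keys_iff flip: lookup_minus)
 thus ?thesis by (auto simp: lookup_single when_def)
qed

text \<open>Each substituted polynomial has its own variable as only heaviest term, so substitution
  is diagonal on monomials of top weight: no monomial other than \<open>N\<close> can contribute to
  the coefficient at \<open>N\<close>.\<close>

lemma lookup_poly_subst_top:
 fixes w :: "nat => 'a::comm_ring_1 mp"
 assumes w: "!!i. lead om (w i) (single i 1) (c i)"
  and top: "!!m. m : keys P ==> wt om m<=W"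
  and N: "wt om N>=W" and "si 0 = 0"
 shows "lookup (poly_subst si P w) N = si (lookup P N)*moneval N c"
proof -
 have "lookup (poly_subst si P w) N =
   (SUM m:keys P. si (lookup P m)*lookup (moneval m w) N)"
  by (simp add: poly_subst_def lookup_sum lookup_single_0_mult)
 also have "... = (SUM m:keys P. si (lookup P m)*(if N = m then moneval m c else 0))"
  by (intro sum.cong refl arg_cong2[where f = "(*)"] lookup_lead[OF lead_moneval[OF w]])
    (use top N order_trans in blast)
 also have "... = si (lookup P N)*moneval N c"
  using `si 0 = 0` by (auto simp: if_distrib sum.delta in_keys_iff cong: if_cong)
 finally show ?thesis .
qed

lemma keys_poly_subst_wt:
 fixes w :: "nat => 'a::comm_ring_1 mp"
 assumes w: "!!i. lead om (w i) (single i 1) (c i)"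
  and top: "!!m. m : keys P ==> wt om m<=W" and "si 0 = 0"
  and N: "N : keys (poly_subst si P w)"
 shows "wt om N<=W"
proof (rule ccontr)
 assume "~ wt om N<=W"
 hence "lookup (poly_subst si P w) N = si (lookup P N)*moneval N c"
  using assms by (intro lookup_poly_subst_top) auto
 moreover have "lookup P N = 0" using top `~ wt om N<=W` by (auto simp flip: not_in_keys_iff_lookup_eq_zero)
 ultimately show False using N `si 0 = 0` by (simp add: in_keys_iff)
qed

declare One_nat_def [simp del]

section \<open>Algebraic dependence\<close>

context subfield
begin

definition alg_dep :: "(nat => 'a) => bool" where
 "alg_dep v \<longleftrightarrow> (EX P. P~=0 & coeffs_in K P & mpeval P v = 0)"

end

lemma wt_cong:
 assumes "!!i. i : keys m ==> om i = om' i"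
 shows "wt om m = wt om' m"
 using assms by (simp add: wt_def)

text \<open>A new weight is made larger than the sum of the weights of all monomials of
  \<open>M n\<close>. It depends on all earlier weights, hence a growing list instead of a recursion
  on a single number.\<close>

primrec weight_list :: "(nat => (nat \<Rightarrow>\<^sub>0 nat) set) => nat => nat list" where
 "weight_list M 0 = []"
| "weight_list M (Suc n) = weight_list M n @ [Suc (SUM m:M n. wt (%i. weight_list M n ! i) m)]"

lemma length_weight_list [simp]: "length (weight_list M n) = n"
 by (induction n) auto

lemma nth_weight_list:
 assumes "i < n" shows "weight_list M n ! i = weight_list M (Suc i) ! i"
 using assms
proof (induction n)
 case (Suc n)
 show ?case
 proof (cases "i = n")
  case False
  hence "i < n" using Suc.prems by simp
  have "weight_list M (Suc n) ! i = weight_list M n ! i"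
   using `i < n` by (simp add: nth_append)
  thus ?thesis using Suc.IH[OF `i < n`] by (simp only:)
 qed simp
qed simp

lemma ex_weights:
 fixes M :: "nat => (nat \<Rightarrow>\<^sub>0 nat) set"
 assumes "!!i. finite (M i)" "!!i m. m : M i ==> keys m<={..<i}"
 shows "EX om. ALL i. om i > 0 & (ALL m:M i. wt om m < om i)"
proof -
 define om where "om i = weight_list M (Suc i) ! i" for i
 have "wt om m < om i" if "m : M i" for i m
 proof -
  have "wt om m = wt (%j. weight_list M i ! j) m"
   using assms(2)[OF that] unfolding om_def by (intro wt_cong nth_weight_list[symmetric]) auto
  also have "...<=(SUM m:M i. wt (%j. weight_list M i ! j) m)"
   using assms(1) that by (intro member_le_sum) auto
  also have "... < om i" by (simp add: om_def nth_append)
  finally show ?thesis .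
 qed
 moreover have "om i > 0" for i by (simp add: om_def nth_append)
 ultimately show ?thesis by blast
qed

lemma lead_linear:
 assumes "ALL m:keys f. wt om m < om i"
 shows "lead om (single (single i 1) c + f) (single i 1) c"
 using assms by (simp add: lead_def)

context subfield
begin

text \<open>Substituting the right-hand sides into a relation for \<open>w\<close> gives one for
  \<open>v\<close>. It might collapse to zero; weights that let each variable outweigh its tail
  \<open>f i\<close> rule this out, because a monomial of top weight survives up to a product of the
  nonzero \<open>c i\<close>.\<close>

lemma alg_dep_triangular:
 assumes dep: "alg_dep w"
  and c: "!!i. c i : K" "!!i. c i~=0"
  and f: "!!i. coeffs_in K (f i)" "!!i m. m : keys (f i) ==> keys m<={..<i}"
  and w: "!!i. w i = c i * v i + mpeval (f i) v"
 shows "alg_dep v"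
proof -
 obtain P where P: "P~=0" "coeffs_in K P" "mpeval P w = 0"
  using dep by (auto simp: alg_dep_def)
 obtain om where om: "!!i. om i > 0" "!!i m. m : keys (f i) ==> wt om m < om i"
  using ex_weights[of "%i. keys (f i)"] f by (metis finite_keys)
 define g where "g i = single (single i 1) (c i) + f i" for i
 have lead: "lead om (g i) (single i 1) (c i)" for i
  unfolding g_def by (rule lead_linear) (use om in auto)
 define Q where "Q = poly_subst (%x. x) P g"
 have "coeffs_in K Q" unfolding Q_def g_def
  by (intro coeffs_in_poly_subst coeffs_in_add coeffs_in_single P c f)
 moreover have "mpeval Q v = 0"
 proof -
  have "(%i. mpeval (g i) v) = w"
   by (auto simp: g_def mpeval_add w)
  thus ?thesis using P(3) by (simp add: Q_def mpeval_poly_subst mpeval_def[of P])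
 qed
 moreover have "Q~=0"
 proof -
  define W where "W = Max (wt om ` keys P)"
  have ne: "keys P~={}" using P(1) by simp
  then obtain N where N: "N : keys P" "wt om N = W"
   using Max_in[of "wt om ` keys P"] unfolding W_def by fastforce
  have "lookup Q N = lookup P N*moneval N c" unfolding Q_def
   by (rule lookup_poly_subst_top[where W = W and om = om]) (use lead N in "auto simp: W_def")
  moreover have "moneval N c~=0" using c(2) by (simp add: moneval_def)
  ultimately have "lookup Q N~=0" using N by (simp add: in_keys_iff)
  thus ?thesis by auto
 qed
 ultimately show ?thesis by (auto simp: alg_dep_def)
qed

end

lemma moneval_const: "moneval m (%_. c) = c^wt (%_. 1) m"
 by (simp add: moneval_def wt_def power_sum)

section \<open>Difference fields and minimal relations\<close>

locale difference_field = subfield K for K :: "'a :: field set" +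
 fixes si :: "'a => 'a"
 assumes sig_add: "si (x + y) = si x + si y" and sig_mult: "si (x*y) = si x * si y"
  and sig_1 [simp]: "si 1 = 1" and sig_in: "x : K ==> si x : K"
  and char0: "of_nat (Suc n)~=(0 :: 'a)"
begin

lemma sig_0 [simp]: "si 0 = 0"
 using sig_add[of 0 0] by (metis add_0 add_cancel_right_left)

lemma sig_uminus: "si (-x) = - si x"
 using sig_add[of x "- x"] by (simp add: eq_neg_iff_add_eq_0 add.commute)

lemma sig_diff: "si (x - y) = si x - si y"
 using sig_add[of x "- y"] by (simp add: sig_uminus)

lemma sig_power: "si (x^n) = si x^n"
 by (induction n) (auto simp: sig_mult)

lemma sig_sum: "si (sum f A) = (SUM x:A. si (f x))"
 by (induction A rule: infinite_finite_induct) (auto simp: sig_add)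

lemma sig_prod: "si (prod f A) = (PROD x:A. si (f x))"
 by (induction A rule: infinite_finite_induct) (auto simp: sig_mult)

lemma sig_of_nat: "si (of_nat n) = of_nat n"
 by (induction n) (auto simp: sig_add)

lemma sig_eq_0_iff [simp]: "si x = 0 \<longleftrightarrow> x = 0"
proof
 assume "si x = 0"
 show "x = 0"
 proof (rule ccontr)
  assume "x~=0"
  hence "si x * si (inverse x) = 1" by (simp flip: sig_mult)
  thus False using `si x = 0` by simp
 qed
qed simp

lemma sig_inverse: "si (inverse x) = inverse (si x)"
proof (cases "x = 0")
 case False
 hence "si x * si (inverse x) = 1" by (simp flip: sig_mult)
 thus ?thesis by (metis inverse_unique)
qed simp

lemma sig_divide: "si (x/y) = si x/si y"
 by (simp add: divide_inverse sig_mult sig_inverse)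

lemma sig_mpeval: "si (mpeval P v) =
  (SUM m:keys P. si (lookup P m)*moneval m (%i. si (v i)))"
 by (simp add: mpeval_def sig_sum sig_mult moneval_def sig_prod sig_power)

text \<open>A relation of minimal weight, with as few top-weight monomials as possible, is
  semi-invariant: otherwise its shift, suitably normalised, would give a smaller relation.\<close>

lemma minimal_relation:
 assumes dep: "alg_dep v" and ga: "ga : K"
  and w: "!!i. coeffs_in K (w i)" "!!i. mpeval (w i) v = si (v i)"
   "!!i. lead om (w i) (single i 1) ga"
 shows "EX P M. coeffs_in K P & mpeval P v = 0 & lookup P M = 1 &
  (ALL m:keys P. wt om m<=wt om M) &
  poly_subst si P w = single 0 (ga^wt (%_. 1) M)*P"
proof -
 define Rel where "Rel P \<longleftrightarrow> P~=0 & coeffs_in K P & mpeval P v = 0" for P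
 define top where "top P = Max (wt om ` keys P)" for P :: "'a mp"
 define cnt where "cnt P = card {m:keys P. wt om m = top P}" for P :: "'a mp"
 have top_ge: "wt om m<=top P" if "m : keys P" for m P
  using that by (auto simp: top_def)
 have top_in: "EX m:keys P. wt om m = top P" if "P~=0" for P
  using Max_in[of "wt om ` keys P"] that unfolding top_def by fastforce
 obtain P0 where P0: "Rel P0" using dep by (auto simp: alg_dep_def Rel_def)
 obtain P1 where P1: "Rel P1" "!!Q. Rel Q ==> top P1<=top Q"
  using ex_has_least_nat[of Rel P0 top] P0 by blast
 obtain P2 where P2: "Rel P2" "top P2 = top P1"
   "!!Q. Rel Q ==> top Q = top P1 ==> cnt P2<=cnt Q"
  using ex_has_least_nat[of "%P. Rel P & top P = top P1" P1 cnt] P1 by blast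
 define W where "W = top P2"
 obtain M where M: "M : keys P2" "wt om M = W"
  using top_in P2(1) unfolding W_def Rel_def by blast
 define a where "a = lookup P2 M"
 have a: "a~=0" "a : K"
  using M P2(1) by (auto simp: a_def Rel_def coeffs_in_def in_keys_iff)
 define P where "P = single 0 (inverse a)*P2"
 have lookup_P: "lookup P m = inverse a*lookup P2 m" for m
  by (simp add: P_def lookup_single_0_mult)
 have keys_P: "keys P = keys P2"
  using a by (auto simp: in_keys_iff lookup_P)
 have cP: "coeffs_in K P" unfolding P_def
  using P2(1) a by (intro coeffs_in_mult coeffs_in_single inverse_in) (auto simp: Rel_def)
 have eP: "mpeval P v = 0" using P2(1) by (simp add: P_def mpeval_mult Rel_def)
 have PM: "lookup P M = 1" using a by (simp add: lookup_P a_def)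
 define D where "D = wt (%_. 1) M"
 \<comment> \<open>\<open>Q\<close> is again a relation, since \<open>si\<close> maps
   \<open>mpeval P v = 0\<close> to 0. The factor \<open>ga^D\<close> is chosen to cancel the
   coefficient at \<open>M\<close>, which was normalised to 1 and is therefore fixed by
   \<open>si\<close>.\<close>
 define Q where "Q = poly_subst si P w - single 0 (ga^D)*P"
 have wtP: "wt om m<=W" if "m : keys P" for m
  using that top_ge by (simp add: keys_P W_def)
 have "Q = 0"
 proof (rule ccontr)
  assume "Q~=0"
  have "coeffs_in K Q" unfolding Q_def
   by (intro coeffs_in_diff coeffs_in_poly_subst coeffs_in_mult coeffs_in_single power_in cP w ga sig_in)
  moreover have "mpeval Q v = si (mpeval P v) - ga^D*mpeval P v"
   by (simp add: Q_def mpeval_diff mpeval_mult mpeval_poly_subst w sig_mpeval)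
  ultimately have RQ: "Rel Q" using `Q~=0` eP by (simp add: Rel_def)
  have keysQ: "wt om m<=W" if "m : keys Q" for m
  proof (rule ccontr)
   assume "~ wt om m<=W"
   hence "m ~: keys P" "m ~: keys (poly_subst si P w)"
    using wtP keys_poly_subst_wt[OF w(3), of P W si m] by auto
   thus False using that
    by (auto simp: Q_def in_keys_iff lookup_minus lookup_single_0_mult)
  qed
  have "top Q>=W" using P1(2)[OF RQ] P2(2) by (simp add: W_def)
  moreover obtain m0 where "m0 : keys Q" "wt om m0 = top Q"
   using top_in[OF `Q~=0`] by blast
  ultimately have topQ: "top Q = W" using keysQ[of m0] by simp
  have lookupQ: "lookup Q N = si (lookup P N) * ga^wt (%_. 1) N - ga^D*lookup P N"
   if "wt om N = W" for N
   using lookup_poly_subst_top[OF w(3), of P W N si] wtP that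
   by (simp add: Q_def lookup_minus lookup_single_0_mult moneval_const)
  \<comment> \<open>On top weight the shift only rescales coefficients: no new monomial appears
    there and \<open>M\<close> disappears, against the minimality of \<open>cnt P2\<close>.\<close>
  have "{m:keys Q. wt om m = top Q}<={m:keys P2. wt om m = top P2} - {M}"
  proof safe
   fix m assume m: "m : keys Q" "wt om m = top Q"
   show "m : keys P2"
   proof (rule ccontr)
    assume "m ~: keys P2"
    hence "lookup P m = 0" by (auto simp: lookup_P in_keys_iff)
    thus False using m lookupQ[of m] by (simp add: topQ in_keys_iff)
   qed
   show "wt om m = top P2" using m topQ by (simp add: W_def)
  next
   assume "M : keys Q"
   thus False using lookupQ[of M] M PM by (simp add: in_keys_iff D_def)
  qed
  hence "cnt Q < cnt P2" unfolding cnt_def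
   using M by (intro psubset_card_mono) (auto simp: W_def)
  moreover have "cnt P2<=cnt Q" using P2(3)[OF RQ] topQ P2(2) by (simp add: W_def)
  ultimately show False by simp
 qed
 hence "poly_subst si P w = single 0 (ga^D)*P" by (simp add: Q_def)
 thus ?thesis using cP eP PM wtP M(2) D_def by blast
qed

end

subsection \<open>The Kolchin--Ostrowski argument\<close>

abbreviation tdeg :: "(nat \<Rightarrow>\<^sub>0 nat) => nat" where "tdeg == wt (%_. 1)"
abbreviation unit_exp :: "nat => nat \<Rightarrow>\<^sub>0 nat" where "unit_exp i == single i 1"

lemma exp_split:
 assumes "lookup m k > 0"
 shows "m = (m - unit_exp k) + unit_exp k"
 by (rule poly_mapping_eqI) (use assms in "auto simp: lookup_add lookup_minus lookup_single when_def")

lemma lookup_single_mult: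
 fixes p :: "'a :: comm_ring_1 mp"
 shows "lookup (single (unit_exp k) c*p) N =
  (if lookup N k > 0 then c*lookup p (N - unit_exp k) else 0)"
proof -
 have "single (unit_exp k) c*p =
   single (unit_exp k) c*(SUM m:keys p. single m (lookup p m))"
  by (simp flip: mp_sum_singles)
 also have "... = (SUM m:keys p. single (unit_exp k + m) (c*lookup p m))"
  by (simp add: sum_distrib_left mult_single)
 finally have eq: "lookup (single (unit_exp k) c*p) N =
   (SUM m:keys p. if unit_exp k + m = N then c*lookup p m else 0)"
  by (simp add: lookup_sum lookup_single when_def)
 show ?thesis
 proof (cases "lookup N k > 0")
  case True
  have "unit_exp k + m = N \<longleftrightarrow> m = N - unit_exp k" for m
   using exp_split[OF True] by (metis add.commute add_diff_cancel_left')
  thus ?thesis using True eq by (auto simp: sum.delta in_keys_iff)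
 next
  case False
  hence "unit_exp k + m~=N" for m by (auto simp: lookup_add)
  thus ?thesis using False eq by simp
 qed
qed

text \<open>The degree drops by exactly one, so in the expansion exactly one factor contributes its
  constant \<open>de j\<close> and all others contribute \<open>ga\<close>. The induction splits a
  single factor off the product.\<close>

lemma lookup_prod_affine:
 fixes ga :: "'a :: comm_ring_1" and de :: "nat => 'a"
 defines "w == %i. single (unit_exp i) ga + single 0 (de i)"
 assumes "tdeg m = Suc (tdeg N)"
 shows "(ALL j. m = N + unit_exp j -->
      lookup (moneval m w) N = of_nat (lookup m j) * ga^tdeg N * de j)
    & ((ALL j. m~=N + unit_exp j) --> lookup (moneval m w) N = 0)"
 using assms(2)
proof (induction "tdeg m" arbitrary: m N rule: less_induct)
 case less
 have "m~=0" using less.prems by auto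
 hence "keys m~={}" by simp
 then obtain k where k: "k : keys m" by blast
 define m' where "m' = m - unit_exp k"
 have m: "m = m' + unit_exp k" unfolding m'_def
  using k by (intro exp_split) (simp add: in_keys_iff)
 have deg: "tdeg m' = tdeg N" using less.prems by (simp add: m wt_add)
 have lw: "lead (%_. 1) (w i) (unit_exp i) ga" for i
  unfolding w_def by (rule lead_linear) auto
 have top: "lookup (moneval m' w) N = (if N = m' then ga^tdeg N else 0)"
  unfolding lookup_lead[OF lead_moneval[OF lw] eq_refl[OF deg]] moneval_const deg ..
 \<comment> \<open>The factor split off supplies either its variable (first summand) or its constant
   (second summand).\<close>
 have rec: "lookup (moneval m w) N =
   (if lookup N k > 0 then ga*lookup (moneval m' w) (N - unit_exp k) else 0)
   + de k*lookup (moneval m' w) N"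
 proof -
  have "moneval m w = single (unit_exp k) ga*moneval m' w + single 0 (de k)*moneval m' w"
   by (simp add: m moneval_add w_def algebra_simps)
  thus ?thesis by (simp only: lookup_add lookup_single_mult lookup_single_0_mult)
 qed
 have IH: "(ALL j. m' = N - unit_exp k + unit_exp j -->
      lookup (moneval m' w) (N - unit_exp k) =
       of_nat (lookup m' j) * ga^(tdeg N - 1) * de j)
    & ((ALL j. m'~=N - unit_exp k + unit_exp j) --> lookup (moneval m' w) (N - unit_exp k) = 0)"
  and degN: "tdeg N > 0"
  if "lookup N k > 0"
 proof -
  have s: "N = (N - unit_exp k) + unit_exp k" by (rule exp_split[OF that])
  have t: "tdeg N = Suc (tdeg (N - unit_exp k))" using arg_cong[OF s, of tdeg] unfolding wt_add by simp
  show "tdeg N > 0" using t by simp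
  have "tdeg m' < tdeg m" by (simp add: m wt_add)
  from less.hyps[OF this, of "N - unit_exp k"] t deg
  show "(ALL j. m' = N - unit_exp k + unit_exp j -->
      lookup (moneval m' w) (N - unit_exp k) =
       of_nat (lookup m' j) * ga^(tdeg N - 1) * de j)
    & ((ALL j. m'~=N - unit_exp k + unit_exp j) --> lookup (moneval m' w) (N - unit_exp k) = 0)"
   by simp
 qed
 show ?case
 proof (intro conjI allI impI)
  fix j assume j: "m = N + unit_exp j"
  show "lookup (moneval m w) N = of_nat (lookup m j) * ga^tdeg N * de j"
  proof (cases "j = k")
   case True
   hence [simp]: "m' = N" using j m by simp
   have lm: "lookup m j = Suc (lookup N k)" using True by (simp add: m lookup_add)
   show ?thesis
   proof (cases "lookup N k > 0")
    case pos: True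
    have "lookup (moneval m' w) (N - unit_exp k) = of_nat (lookup N k) * ga^(tdeg N - 1) * de k"
     using conjunct1[OF IH[OF pos], rule_format, of k] exp_split[OF pos] `m' = N` by metis
    moreover have "ga^tdeg N = ga * ga^(tdeg N - 1)" using power_minus_mult[OF degN[OF pos], of ga] by (simp only: mult.commute)
    ultimately have "ga*lookup (moneval m' w) (N - unit_exp k)
      = of_nat (lookup N k) * ga^tdeg N * de k" by (simp add: mult_ac)
    thus ?thesis using pos top lm True unfolding rec by (simp add: algebra_simps)
   next
    case False
    thus ?thesis using top lm `j = k` unfolding rec by simp
   qed
  next
   case False
   have "lookup N k = Suc (lookup m' k)"
    using arg_cong[OF j[unfolded m], of "%f. lookup f k"] False
    by (simp add: lookup_add lookup_single)
   hence pos: "lookup N k > 0" by simp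
   have ne: "N~=m'"
   proof
    assume "N = m'"
    hence "unit_exp k = unit_exp j" using j m by simp
    hence "lookup (unit_exp k) k = lookup (unit_exp j) k" by simp
    thus False using False by (simp add: lookup_single)
   qed
   have "m' + unit_exp k = (N - unit_exp k + unit_exp j) + unit_exp k"
    using trans[OF trans[OF m[symmetric] j] arg_cong[OF exp_split[OF pos], of "%x. x + unit_exp j"]]
    by (simp only: add_ac)
   hence "m' = N - unit_exp k + unit_exp j" by simp
   hence "lookup (moneval m' w) (N - unit_exp k) = of_nat (lookup m' j) * ga^(tdeg N - 1) * de j"
    using IH[OF pos] by blast
   moreover have "ga^tdeg N = ga * ga^(tdeg N - 1)" using power_minus_mult[OF degN[OF pos], of ga] by (simp only: mult.commute)
   moreover have "lookup m j = lookup m' j" using False by (simp add: m lookup_add lookup_single)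
   ultimately have "ga*lookup (moneval m' w) (N - unit_exp k)
     = of_nat (lookup m j) * ga^tdeg N * de j" by (simp add: mult_ac)
   thus ?thesis using pos top ne unfolding rec by simp
  qed
 next
  assume no: "ALL j. m~=N + unit_exp j"
  have "N~=m'" using no m by blast
  moreover have "ALL j. m'~=N - unit_exp k + unit_exp j" if pos: "lookup N k > 0"
  proof (intro allI notI)
   fix j assume "m' = N - unit_exp k + unit_exp j"
   hence "m = (N - unit_exp k + unit_exp k) + unit_exp j" using m by (simp only: add_ac)
   hence "m = N + unit_exp j" by (simp only: exp_split[OF pos, symmetric])
   thus False using no by blast
  qed
  ultimately show "lookup (moneval m w) N = 0"
   using IH top unfolding rec by auto
 qed
qed

context difference_field
begin

text \<open>The minimal relation is semi-invariant under the shift. Compare the coefficients of a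
  monomial \<open>N\<close> one degree below the top: the top monomials
  \<open>N + unit_exp j\<close> feed into it through \<open>de j\<close>, and their coefficients are
  invariant under \<open>si\<close>.\<close>

theorem kolchin_ostrowski:
 assumes dep: "alg_dep v" and ga: "ga : K" "ga~=0" and de: "!!i. de i : K"
  and v: "!!i. si (v i) = ga * v i + de i"
 shows "EX I c p. finite I & (ALL i. c i : K & si (c i) = c i) & (EX i:I. c i~=0) & p : K &
  (SUM i:I. c i * de i) = ga*p - si p"
proof -
 define w where "w = (%i. single (unit_exp i) ga + single 0 (de i))"
 have w: "coeffs_in K (w i)" "mpeval (w i) v = si (v i)" "lead (%_. 1) (w i) (unit_exp i) ga" for i
  unfolding w_def using v ga de
  by (auto intro!: coeffs_in_add coeffs_in_single lead_linear simp: mpeval_add split: if_splits)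
 from minimal_relation[OF dep ga(1) w] obtain P M where PM: "coeffs_in K P & mpeval P v = 0 &
   lookup P M = 1 & (ALL m:keys P. tdeg m<=tdeg M) &
   poly_subst si P w = single 0 (ga^tdeg M)*P" by (elim exE)
 have P: "coeffs_in K P" "mpeval P v = 0" "lookup P M = 1"
   "!!m. m : keys P ==> tdeg m<=tdeg M"
   "poly_subst si P w = single 0 (ga^tdeg M)*P"
  using PM by simp_all
 \<comment> \<open>In degree zero the relation would be the constant 1.\<close>
 have "tdeg M~=0"
 proof
  assume 0: "tdeg M = 0"
  have z: "m = 0" if "tdeg m = 0" for m
   using that by (auto simp: wt_def in_keys_iff intro!: poly_mapping_eqI)
  have "P = single 0 1"
  proof (rule poly_mapping_eqI)
   fix m
   show "lookup P m = lookup (single 0 1) m"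
    using P(3) P(4)[of m] z[of m] z[OF 0] 0
    by (cases "m = 0") (auto simp: lookup_single in_keys_iff lookup_one)
  qed
  thus False using P(2) by simp
 qed
 hence "M~=0" by auto
 hence "keys M~={}" by simp
 then obtain i where i: "i : keys M" by blast
 define N where "N = M - unit_exp i"
 have M: "M = N + unit_exp i" unfolding N_def
  using i by (intro exp_split) (simp add: in_keys_iff)
 define n where "n = tdeg N"
 have dM: "tdeg M = Suc n" by (simp add: M wt_add n_def)
 have inj: "j = k" if "N + unit_exp j = N + unit_exp k" for j k
 proof -
  have "lookup (unit_exp j) k = lookup (unit_exp k) k" using that by simp
  thus ?thesis by (auto simp: lookup_single when_def split: if_splits)
 qed
 define I where "I = {j. N + unit_exp j : keys P}"
 have finI: "finite I"
 proof -
  have "inj (%j. N + unit_exp j)" by (rule injI) (rule inj)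
  thus ?thesis unfolding I_def using finite_vimageI[of "keys P" "%j. N + unit_exp j"]
   by (simp add: vimage_def)
 qed
 define c where "c j = lookup P (N + unit_exp j) * of_nat (Suc (lookup N j))" for j
 \<comment> \<open>In top degree the two sides of the semi-invariance differ only by
   \<open>si\<close> on the coefficient.\<close>
 have sc: "si (lookup P (N + unit_exp j)) = lookup P (N + unit_exp j)" for j
 proof -
  have d: "tdeg (N + unit_exp j) = tdeg M" by (simp add: wt_add dM n_def)
  have "lookup (poly_subst si P w) (N + unit_exp j) =
    si (lookup P (N + unit_exp j)) * ga^tdeg M"
   using lookup_poly_subst_top[OF w(3), of P "tdeg M" "N + unit_exp j" si] P(4) d
   by (simp add: moneval_const)
  thus ?thesis using ga(2) by (simp add: P(5) lookup_single_0_mult)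
 qed
 have val: "lookup (moneval m w) N =
   (if m = N then ga^n else SUM j:I. if m = N + unit_exp j then of_nat (Suc (lookup N j)) * ga^n * de j else 0)"
  if m: "m : keys P" for m
 proof (cases "tdeg m = Suc n")
  case True
  hence ne: "m~=N" by (auto simp: n_def)
  have pa: "(ALL j. m = N + unit_exp j -->
      lookup (moneval m w) N = of_nat (lookup m j) * ga^tdeg N * de j)
    & ((ALL j. m~=N + unit_exp j) --> lookup (moneval m w) N = 0)"
   unfolding w_def by (rule lookup_prod_affine) (use True n_def in simp)
  show ?thesis
  proof (cases "EX j. m = N + unit_exp j")
   case True
   then obtain j where j: "m = N + unit_exp j" by blast
   have "j : I" using m j by (simp add: I_def)
   have "m = N + unit_exp k \<longleftrightarrow> k = j" for k using inj j by blast
   hence "(SUM k:I. if m = N + unit_exp k then of_nat (Suc (lookup N k)) * ga^n * de k else 0)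
     = of_nat (Suc (lookup N j)) * ga^n * de j"
    using finI `j : I` by (simp add: sum.delta)
   moreover have "lookup m j = Suc (lookup N j)" by (simp add: j lookup_add)
   ultimately show ?thesis using pa j ne by (auto simp: n_def)
  next
   case False
   thus ?thesis using pa ne by auto
  qed
 next
  case False
  hence le: "tdeg m<=n" using P(4)[OF m] dM by simp
  have "m~=N + unit_exp j" for j using le by (auto simp: wt_add n_def)
  thus ?thesis using lookup_lead[OF lead_moneval[OF w(3)], of m N] le
   by (auto simp: moneval_const n_def)
 qed
 define p where "p = lookup P N"
 have "lookup (poly_subst si P w) N =
   (SUM m:keys P. si (lookup P m)*lookup (moneval m w) N)"
  by (simp add: poly_subst_def lookup_sum lookup_single_0_mult)
 also have "... = (SUM m:keys P. (if m = N then si p * ga^n else 0) +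
   (SUM j:I. if m = N + unit_exp j then si (lookup P m)*(of_nat (Suc (lookup N j)) * ga^n * de j) else 0))"
 proof (intro sum.cong refl, goal_cases)
  case (1 m)
  have "m~=N + unit_exp j" if "m = N" for j
  proof
   assume "m = N + unit_exp j"
   from arg_cong[OF this, of tdeg] that show False by (simp add: wt_add)
  qed
  thus ?case using val[OF 1] by (auto simp: p_def sum_distrib_left intro!: sum.cong)
 qed
 also have "... = (SUM m:keys P. (if m = N then si p * ga^n else 0)) +
   (SUM j:I. SUM m:keys P. if m = N + unit_exp j then si (lookup P m)*(of_nat (Suc (lookup N j)) * ga^n * de j) else 0)"
  unfolding sum.distrib by (subst sum.swap) simp
 also have "... = si p * ga^n + (SUM j:I. c j * de j) * ga^n"
 proof (rule arg_cong2[where f = "(+)"])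
  show "(SUM m:keys P. (if m = N then si p * ga^n else 0)) = si p * ga^n"
   by (auto simp: sum.delta p_def in_keys_iff)
  show "(SUM j:I. SUM m:keys P. if m = N + unit_exp j then si (lookup P m)*(of_nat (Suc (lookup N j)) * ga^n * de j) else 0)
   = (SUM j:I. c j * de j) * ga^n"
   unfolding sum_distrib_right
   by (intro sum.cong refl) (auto simp: sum.delta I_def sc c_def simp del: of_nat_Suc)
 qed
 finally have lk: "lookup (poly_subst si P w) N = si p * ga^n + (SUM j:I. c j * de j) * ga^n" .
 define T where "T = (SUM j:I. c j * de j)"
 have "lookup (poly_subst si P w) N = ga^Suc n*p"
  unfolding P(5) lookup_single_0_mult dM p_def ..
 hence "(ga*p) * ga^n = (si p + T) * ga^n"
  using lk unfolding T_def[symmetric] by (simp add: algebra_simps)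
 hence "ga*p = si p + T" using ga(2) mult_right_cancel[of "ga^n" "ga*p" "si p + T"] by simp
 hence eq: "(SUM j:I. c j * de j) = ga*p - si p" unfolding T_def[symmetric] by simp
 have P1: "lookup P (N + unit_exp i) = 1" by (rule subst[of M "N + unit_exp i" "%z. lookup P z = 1", OF M P(3)])
 have iI: "i : I" unfolding I_def mem_Collect_eq in_keys_iff P1 by simp
 \<comment> \<open>\<open>c i\<close> is the exponent of the variable i in \<open>M\<close>, a
   positive integer, hence nonzero in characteristic zero.\<close>
 have ci: "c i~=0" unfolding c_def P1 using char0[of "lookup N i"] by (simp del: of_nat_Suc)
 have cK: "c j : K & si (c j) = c j" for j
 proof
  show "c j : K" unfolding c_def
   by (rule mult_in[OF P(1)[unfolded coeffs_in_def, rule_format] of_nat_in])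
  show "si (c j) = c j" unfolding c_def sig_mult sig_of_nat sc ..
 qed
 have pK: "p : K" using P(1) by (simp add: p_def coeffs_in_def)
 show ?thesis
  by (intro exI[of _ I] exI[of _ c] exI[of _ p] conjI allI finI cK[THEN conjunct1] cK[THEN conjunct2]
    bexI[of _ i] iI ci pK eq)
qed

end

section \<open>Formal Laurent series and rational functions\<close>

definition toR :: "complex poly => complex fls" where
 "toR p = fps_to_fls (fps_of_poly p)"

lemma toR_add: "toR (p + r) = toR p + toR r"
 by (simp add: toR_def fps_of_poly_add)

lemma toR_mult: "toR (p*r) = toR p*toR r"
 by (simp add: toR_def fps_of_poly_mult fls_times_fps_to_fls)

lemma toR_0 [simp]: "toR 0 = 0" by (simp add: toR_def)
lemma toR_1 [simp]: "toR 1 = 1" by (simp add: toR_def)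

lemma toR_uminus: "toR (-p) = - toR p"
 by (simp add: toR_def fps_of_poly_uminus)

lemma toR_diff: "toR (p - r) = toR p - toR r"
 by (simp add: toR_def fps_of_poly_diff)

lemma toR_power: "toR (p^n) = toR p^n"
 by (induction n) (auto simp: toR_mult)

lemma toR_eq_iff [simp]: "toR p = toR r \<longleftrightarrow> p = r"
 by (simp add: toR_def)

lemma toR_eq_0_iff [simp]: "toR p = 0 \<longleftrightarrow> p = 0"
 using toR_eq_iff[of p 0] by (simp del: toR_eq_iff)

lemma toR_const: "toR [:c:] = fls_const c"
 by (simp add: toR_def fps_of_poly_const)

lemma toR_pCons: "toR (pCons c p) = fls_const c + fls_X*toR p"
 by (simp add: toR_def fps_of_poly_pCons fls_times_fps_to_fls mult.commute)

lemma toR_smult: "toR (smult c p) = fls_const c*toR p"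
 using toR_mult[of "[:c:]" p] by (simp add: toR_const)

text \<open>Rational functions are kept inside the Laurent series at 0, so that a single field
  carries both the coefficients and the unknown series.\<close>

definition ratfun :: "complex fls set" where
 "ratfun = {f. EX N D. D~=0 & f*toR D = toR N}"

lemma ratfunI: "D~=0 ==> f*toR D = toR N ==> f : ratfun"
 by (auto simp: ratfun_def)

lemma ratfun_toR: "toR p : ratfun"
 by (rule ratfunI[of 1 _ p]) auto

interpretation rat: subfield ratfun
proof
 show "0 : ratfun" "1 : ratfun" using ratfun_toR[of 0] ratfun_toR[of 1] by auto
next
 fix x y assume "x : ratfun" "y : ratfun"
 then obtain N D N' D' where *: "D~=0" "x*toR D = toR N" "D'~=0" "y*toR D' = toR N'"
  by (auto simp: ratfun_def)
 have "(x + y)*toR (D*D') = (x*toR D)*toR D' + (y*toR D')*toR D"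
  by (simp add: toR_mult algebra_simps)
 thus "x + y : ratfun" using*by (intro ratfunI[of "D*D'" _ "N*D' + N'*D"]) (auto simp: toR_mult toR_add)
 have "(x*y)*toR (D*D') = (x*toR D)*(y*toR D')"
  by (simp add: toR_mult algebra_simps)
 thus "x*y : ratfun" using*by (intro ratfunI[of "D*D'" _ "N*N'"]) (auto simp: toR_mult)
next
 fix x assume "x : ratfun"
 then obtain N D where *: "D~=0" "x*toR D = toR N" by (auto simp: ratfun_def)
 thus "- x : ratfun" by (intro ratfunI[of D _ "- N"]) (auto simp: toR_uminus)
 show "inverse x : ratfun"
 proof (cases "x = 0")
  case True
  thus ?thesis using ratfun_toR[of 0] by simp
 next
  case False
  hence "toR N~=0" using*by (metis mult_eq_0_iff toR_eq_0_iff)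
  moreover have "inverse x*toR N = toR D" using*False by (simp add: field_simps)
  ultimately show ?thesis by (intro ratfunI[of N _ D]) auto
 qed
qed

lemma ratfun_const: "fls_const c : ratfun"
 using ratfun_toR[of "[:c:]"] by (simp add: toR_const)

lemma ratfun_X: "fls_X : ratfun"
 using ratfun_toR[of "[:0,1:]"] by (simp add: toR_pCons)

text \<open>The Euler derivation is preferred to the ordinary derivative because it commutes with s
  -> q s; all derivatives of a solution then satisfy equations with the same leading
  coefficient.\<close>

definition theta :: "complex fls => complex fls" where
 "theta f = fls_X*fls_deriv f"

lemma theta_nth: "fls_nth (theta f) n = of_int n*fls_nth f n"
 by (simp add: theta_def fls_X_times_conv_shift)

lemma theta_add: "theta (f + g) = theta f + theta g"
 by (simp add: theta_def algebra_simps)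
lemma theta_mult: "theta (f*g) = theta f*g + f*theta g"
 by (simp add: theta_def algebra_simps)
lemma theta_0 [simp]: "theta 0 = 0" by (simp add: theta_def)
lemma theta_1 [simp]: "theta 1 = 0" by (simp add: theta_def)
lemma theta_const [simp]: "theta (fls_const c) = 0" by (simp add: theta_def)
lemma theta_diff: "theta (f - g) = theta f - theta g" by (simp add: theta_def algebra_simps)
lemma theta_X [simp]: "theta fls_X = fls_X" by (simp add: theta_def)
lemma theta_sum: "theta (sum f A) = (SUM x:A. theta (f x))"
 by (induction A rule: infinite_finite_induct) (auto simp: theta_add)

lemma theta_inverse: "theta (inverse f) = - theta f*inverse f^2"
proof (cases "f = 0")
 case False
 have "theta (f*inverse f) = 0" using False by simp
 hence "f*theta (inverse f) = - (theta f*inverse f)"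
  by (simp add: theta_mult eq_neg_iff_add_eq_0 add.commute)
 thus ?thesis using False by (simp add: power2_eq_square field_simps)
qed simp

lemma theta_toR: "theta (toR p) = toR ([:0,1:]*pderiv p)"
 by (simp add: theta_def toR_def fps_of_poly_pderiv fls_deriv_fps_to_fls fps_of_poly_mult
   fls_times_fps_to_fls fps_of_poly_pCons)

lemma theta_ratfun: "f : ratfun ==> theta f : ratfun"
proof -
 assume "f : ratfun"
 then obtain N D where *: "D~=0" "f*toR D = toR N" by (auto simp: ratfun_def)
 hence f: "f = toR N*inverse (toR D)" by (simp add: field_simps)
 show ?thesis unfolding f theta_mult theta_inverse theta_toR
  by (intro rat.add_in rat.mult_in rat.uminus_in rat.power_in rat.inverse_in ratfun_toR)
qed

lemma theta_pow_ratfun: "f : ratfun ==> (theta ^^ n) f : ratfun"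
 by (induction n) (auto intro: theta_ratfun)

lemma theta_pow_add: "(theta ^^ n) (f + g) = (theta ^^ n) f + (theta ^^ n) g"
 by (induction n) (auto simp: theta_add)
lemma theta_pow_diff: "(theta ^^ n) (f - g) = (theta ^^ n) f - (theta ^^ n) g"
 by (induction n) (auto simp: theta_diff)

lemma theta_pow_mult:
 "(theta ^^ n) (f*g) = (SUM j<=n. of_nat (n choose j)*(theta ^^ j) f*(theta ^^ (n - j)) g)"
proof (induction n)
 case (Suc n)
 let ?F = "%j. (theta ^^ j) f" and ?G = "%j. (theta ^^ j) g"
 have of_nat: "theta (of_nat m) = 0" for m :: nat
  by (induction m) (auto simp: theta_add)
 have "(theta ^^ Suc n) (f*g) = (SUM j<=n. of_nat (n choose j)*?F (Suc j)*?G (n - j))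
   + (SUM j<=n. of_nat (n choose j)*?F j*?G (Suc (n - j)))"
  by (simp add: Suc theta_sum theta_mult of_nat sum.distrib)
 also have "(SUM j<=n. of_nat (n choose j)*?F j*?G (Suc (n - j))) =
   (SUM j<=Suc n. of_nat (n choose j)*?F j*?G (Suc n - j))"
  by (simp add: Suc_diff_le)
 also have "... = ?F 0*?G (Suc n) + (SUM j<=n. of_nat (n choose Suc j)*?F (Suc j)*?G (n - j))"
  by (subst sum.atMost_Suc_shift) simp
 also have "(SUM j<=n. of_nat (n choose j)*?F (Suc j)*?G (n - j)) + ... =
   ?F 0*?G (Suc n) + (SUM j<=n. of_nat (Suc n choose Suc j)*?F (Suc j)*?G (n - j))"
  by (simp add: sum.distrib[symmetric] algebra_simps)
 also have "... = (SUM j<=Suc n. of_nat (Suc n choose j)*?F j*?G (Suc n - j))"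
  by (subst sum.atMost_Suc_shift) simp
 finally show ?case .
qed simp

text \<open>The modulus condition gives \<open>q\<close> infinite multiplicative order and lets
  absolute values decide membership in an orbit.\<close>

locale qdil =
 fixes q :: complex
 assumes q_gt1: "norm q > 1"
begin

lemma q_nz [simp]: "q~=0" using q_gt1 by auto

lemma q_powi_eq_1_iff: "q powi n = 1 \<longleftrightarrow> n = 0"
proof
 assume "q powi n = 1"
 hence "norm q powi n = 1" by (metis norm_one norm_power_int)
 moreover have "norm q powi n > 1" if "n > 0" using q_gt1 that by (simp add: one_less_power_int)
 moreover have "norm q powi n < 1" if "n < 0"
 proof -
  have "norm q powi (-n) > 1" using q_gt1 that by (simp add: one_less_power_int)
  thus ?thesis by (simp add: power_int_minus field_simps)
 qed
 ultimately show "n = 0" by (metis less_irrefl linorder_neqE_linordered_idom)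
qed simp

definition dil :: "complex fls => complex fls" where
 "dil f = fls_compose_fps f (fps_const q*fps_X)"

lemma dil_nth: "fls_nth (dil f) n = fls_nth f n*q powi n"
 by (simp add: dil_def fls_nth_fls_compose_fps_linear)

lemma dil_add: "dil (f + g) = dil f + dil g"
 by (intro fls_eqI) (simp add: dil_nth algebra_simps)

lemma dil_mult: "dil (f*g) = dil f*dil g"
 by (simp add: dil_def fls_compose_fps_mult)

lemma dil_1 [simp]: "dil 1 = 1" by (simp add: dil_def)
lemma dil_const [simp]: "dil (fls_const c) = fls_const c" by (simp add: dil_def)
lemma dil_X [simp]: "dil fls_X = fls_const q*fls_X"
 by (simp add: dil_def fls_times_fps_to_fls)

lemma dil_theta: "dil (theta f) = theta (dil f)"
 by (intro fls_eqI) (simp add: dil_nth theta_nth)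

lemma dil_theta_pow: "dil ((theta ^^ n) f) = (theta ^^ n) (dil f)"
 by (induction n) (auto simp: dil_theta)

lemma dil_toR: "dil (toR p) = toR (pcompose p [:0,q:])"
proof (induction p)
 case 0
 show ?case by (simp add: dil_def)
next
 case (pCons c p)
 show ?case
  by (simp add: toR_pCons dil_add dil_mult pCons pcompose_pCons toR_add toR_mult toR_const toR_smult mult_ac)
qed

lemma pcompose_lin_nz: "p~=0 ==> pcompose p [:0,q:]~=0"
 using pcompose_eq_0[of p "[:0,q:]"] by auto

lemma dil_ratfun: "f : ratfun ==> dil f : ratfun"
proof -
 assume "f : ratfun"
 then obtain N D where *: "D~=0" "f*toR D = toR N" by (auto simp: ratfun_def)
 have "dil f*toR (pcompose D [:0,q:]) = toR (pcompose N [:0,q:])"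
  using arg_cong[OF *(2), of dil] by (simp add: dil_mult dil_toR)
 thus ?thesis using pcompose_lin_nz[OF *(1)] by (intro ratfunI)
qed

sublocale difference_field ratfun dil
proof
 fix n show "of_nat (Suc n)~=(0 :: complex fls)"
  by (metis fls_const_nonzero fls_of_nat of_nat_neq_0)
qed (auto simp: dil_add dil_mult dil_ratfun)

text \<open>The coefficient of index n is multiplied by \<open>q powi n\<close>, which equals 1 only
  for n = 0.\<close>

lemma dil_fixed:
 assumes "dil f = f"
 shows "f = fls_const (fls_nth f 0)"
proof (rule fls_eqI)
 fix n
 have "fls_nth f n*q powi n = fls_nth f n" using arg_cong[OF assms, of "%f. fls_nth f n"] by (simp add: dil_nth)
 thus "fls_nth f n = fls_nth (fls_const (fls_nth f 0)) n" using q_powi_eq_1_iff[of n] by (cases "n = 0") auto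
qed

end

section \<open>Poles of rational functions along an orbit of the dilation\<close>

text \<open>A formal Laurent series at 0 cannot be evaluated at \<open>z\<close>, so pole orders are
  expressed through polynomial numerators and denominators, \<open>D\<close> collecting the factors
  that do not vanish at \<open>z\<close>.\<close>

definition pole_le :: "complex => nat => complex fls => bool" where
 "pole_le z k f \<longleftrightarrow> (EX N D. poly D z~=0 & f*toR D*toR [:-z,1:]^k = toR N)"

text \<open>For \<open>k = 0\<close> this means a finite nonzero value at \<open>z\<close>, which
  makes exact orders additive under multiplication.\<close>

definition pole_eq :: "complex => nat => complex fls => bool" where
 "pole_eq z k f \<longleftrightarrow> (EX N D. poly D z~=0 & poly N z~=0 & f*toR D*toR [:-z,1:]^k = toR N)"

lemma pole_leI: "poly D z~=0 ==> f*toR D*toR [:-z,1:]^k = toR N ==> pole_le z k f"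
 unfolding pole_le_def by blast

lemma pole_eqI: "poly D z~=0 ==> poly N z~=0 ==> f*toR D*toR [:-z,1:]^k = toR N ==> pole_eq z k f"
 unfolding pole_eq_def by blast

lemma pole_eq_imp_le: "pole_eq z k f ==> pole_le z k f"
 unfolding pole_eq_def pole_le_def by blast

lemma pole_le_mono:
 assumes "pole_le z k f" "k<=k'" shows "pole_le z k' f"
proof -
 obtain N D where *: "poly D z~=0" "f*toR D*toR [:-z,1:]^k = toR N"
  using assms(1) unfolding pole_le_def by blast
 have "f*toR D*toR [:-z,1:]^k' = (f*toR D*toR [:-z,1:]^k)*toR [:-z,1:]^(k' - k)"
  using assms(2) by (simp add: mult.assoc flip: power_add)
 also have "... = toR (N*[:-z,1:]^(k' - k))" unfolding *(2) by (simp add: toR_mult toR_power)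
 finally show ?thesis by (rule pole_leI[OF *(1)])
qed

lemma pole_eq_not_le:
 assumes "pole_eq z k f" "pole_le z j f" "j < k" shows False
proof -
 obtain N D where 1: "poly D z~=0" "poly N z~=0" "f*toR D*toR [:-z,1:]^k = toR N"
  using assms(1) unfolding pole_eq_def by blast
 obtain N' D' where 2: "poly D' z~=0" "f*toR D'*toR [:-z,1:]^j = toR N'"
  using assms(2) unfolding pole_le_def by blast
 have "toR (N*D') = (f*toR D*toR [:-z,1:]^k)*toR D'" by (simp add: 1 toR_mult)
 also have "toR [:-z,1:]^k = toR [:-z,1:]^j*toR [:-z,1:]^(k - j)"
  using assms(3) by (simp flip: power_add)
 also have "(f*toR D*(toR [:-z,1:]^j*toR [:-z,1:]^(k - j)))*toR D' =
   (f*toR D'*toR [:-z,1:]^j)*toR D*toR [:-z,1:]^(k - j)"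
  by (simp add: mult_ac)
 also have "... = toR (N'*D*[:-z,1:]^(k - j))" unfolding 2(2) by (simp add: toR_mult toR_power)
 finally have "N*D' = N'*D*[:-z,1:]^(k - j)" by simp
 hence "poly (N*D') z = poly (N'*D*[:-z,1:]^(k - j)) z" by simp
 moreover have "(0::complex)^(k - j) = 0" using assms(3) by simp
 ultimately show False using 1(1,2) 2(1) by (simp del: power_0_left)
qed

lemma pole_add_aux:
 assumes "f*toR D*toR [:-z,1:]^k = toR N" "g*toR D'*toR [:-z,1:]^j = toR N'" "j<=k"
 shows "(f + g)*toR (D*D')*toR [:-z,1:]^k = toR (N*D' + N'*D*[:-z,1:]^(k - j))"
proof -
 have "toR [:-z,1:]^k = toR [:-z,1:]^j*toR [:-z,1:]^(k - j)"
  using assms(3) by (simp flip: power_add)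
 hence "(f + g)*toR (D*D')*toR [:-z,1:]^k =
   (f*toR D*toR [:-z,1:]^k)*toR D' + (g*toR D'*toR [:-z,1:]^j)*toR D*toR [:-z,1:]^(k - j)"
  by (simp add: toR_mult algebra_simps)
 thus ?thesis unfolding assms(1,2) by (simp add: toR_mult toR_add toR_power)
qed

lemma pole_le_add:
 assumes "pole_le z k f" "pole_le z k g" shows "pole_le z k (f + g)"
proof -
 obtain N D N' D' where *: "poly D z~=0" "f*toR D*toR [:-z,1:]^k = toR N"
   "poly D' z~=0" "g*toR D'*toR [:-z,1:]^k = toR N'"
  using assms unfolding pole_le_def by blast
 show ?thesis using pole_add_aux[OF *(2,4)]*by (intro pole_leI[of "D*D'"]) auto
qed

lemma pole_eq_add:
 assumes "pole_eq z k f" "pole_le z j g" "j < k" shows "pole_eq z k (f + g)"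
proof -
 obtain N D where 1: "poly D z~=0" "poly N z~=0" "f*toR D*toR [:-z,1:]^k = toR N"
  using assms(1) unfolding pole_eq_def by blast
 obtain N' D' where 2: "poly D' z~=0" "g*toR D'*toR [:-z,1:]^j = toR N'"
  using assms(2) unfolding pole_le_def by blast
 have "(0::complex)^(k - j) = 0" using assms(3) by simp
 hence "poly (N*D' + N'*D*[:-z,1:]^(k - j)) z~=0" using 1(1,2) 2(1) assms(3)
  by (simp add: zero_power del: power_0_left)
 thus ?thesis using pole_add_aux[OF 1(3) 2(2)] 1(1) 2(1) assms(3)
  by (intro pole_eqI[of "D*D'"]) auto
qed

lemma pole_le_mult:
 assumes "pole_le z k f" "pole_le z j g" shows "pole_le z (k + j) (f*g)"
proof -
 obtain N D N' D' where *: "poly D z~=0" "f*toR D*toR [:-z,1:]^k = toR N"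
   "poly D' z~=0" "g*toR D'*toR [:-z,1:]^j = toR N'"
  using assms unfolding pole_le_def by blast
 have "(f*g)*toR (D*D')*toR [:-z,1:]^(k + j) = (f*toR D*toR [:-z,1:]^k)*(g*toR D'*toR [:-z,1:]^j)"
  by (simp add: toR_mult power_add mult_ac)
 also have "... = toR (N*N')" unfolding*by (simp add: toR_mult)
 finally show ?thesis using*by (intro pole_leI[of "D*D'"]) auto
qed

lemma pole_eq_mult:
 assumes "pole_eq z k f" "pole_eq z j g" shows "pole_eq z (k + j) (f*g)"
proof -
 obtain N D N' D' where *: "poly D z~=0" "poly N z~=0" "f*toR D*toR [:-z,1:]^k = toR N"
   "poly D' z~=0" "poly N' z~=0" "g*toR D'*toR [:-z,1:]^j = toR N'"
  using assms unfolding pole_eq_def by blast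
 have "(f*g)*toR (D*D')*toR [:-z,1:]^(k + j) = (f*toR D*toR [:-z,1:]^k)*(g*toR D'*toR [:-z,1:]^j)"
  by (simp add: toR_mult power_add mult_ac)
 also have "... = toR (N*N')" unfolding*by (simp add: toR_mult)
 finally show ?thesis using*by (intro pole_eqI[of "D*D'" _ "N*N'"]) auto
qed

lemma pole_le_toR: "pole_le z 0 (toR p)"
 by (rule pole_leI[of 1]) auto

lemma pole_eq_toR: "poly p z~=0 ==> pole_eq z 0 (toR p)"
 by (rule pole_eqI[of 1 _ p]) auto

lemma pole_le_const: "pole_le z 0 (fls_const c)"
 using pole_le_toR[of z "[:c:]"] by (simp add: toR_const)

lemma pole_le_cmult: "pole_le z k f ==> pole_le z k (fls_const c*f)"
 using pole_le_mult[OF pole_le_const] by fastforce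

lemma pole_eq_cmult: "pole_eq z k f ==> c~=0 ==> pole_eq z k (fls_const c*f)"
 using pole_eq_mult[of z 0 "fls_const c" k f] pole_eq_toR[of "[:c:]" z] by (simp add: toR_const)

lemma pole_le_0: "pole_le z k 0"
 by (rule pole_leI[of 1 _ _ _ 0]) auto

lemma pole_le_sum: "(!!i. i : I ==> pole_le z k (f i)) ==> pole_le z k (sum f I)"
 by (induction I rule: infinite_finite_induct) (auto intro: pole_le_add pole_le_0)

lemma fls_const_minus_1: "fls_const (-1) = (-1 :: complex fls)"
 by (intro fls_eqI) simp

lemma pole_le_uminus: "pole_le z k f ==> pole_le z k (-f)"
 using pole_le_cmult[of z k f "- 1"] by (simp add: fls_const_minus_1)

lemma pole_eq_uminus: "pole_eq z k f ==> pole_eq z k (-f)"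
 using pole_eq_cmult[of z k f "- 1"] by (simp add: fls_const_minus_1)

lemma pole_le_diff: "pole_le z k f ==> pole_le z k g ==> pole_le z k (f - g)"
 using pole_le_add[of z k f "- g"] pole_le_uminus[of z k g] by simp

lemma theta_power: "theta (f^Suc k) = of_nat (Suc k)*theta f*f^k"
proof (induction k)
 case (Suc k)
 have "theta (f^Suc (Suc k)) = theta f*f^Suc k + f*theta (f^Suc k)"
  by (simp add: theta_mult)
 thus ?case unfolding Suc.IH by (simp add: algebra_simps)
qed simp

lemma pole_theta_aux:
 assumes "f*toR D*toR [:-z,1:]^k = toR N"
 shows "theta f*toR (D*D)*toR [:-z,1:]^Suc k =
  toR ([:-z,1:]*(D*([:0,1:]*pderiv N) - ([:0,1:]*pderiv D)*N) - of_nat k*[:0,1:]*D*N)"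
proof -
 define L where "L = toR [:-z,1:]"
 define s where "s = toR [:0,1:]"
 have thL: "theta L = s" unfolding L_def s_def theta_toR by (simp add: pderiv_pCons)
 have Lk: "L*theta (L^k) = of_nat k * s*L^k"
 proof (cases k)
  case (Suc j)
  show ?thesis unfolding Suc theta_power thL unfolding power_Suc by (simp only: mult_ac)
 qed simp
 have "theta (toR N) = theta f*toR D*L^k + f*theta (toR D)*L^k + f*toR D*theta (L^k)"
  unfolding assms[symmetric] L_def by (simp add: theta_mult algebra_simps)
 hence "toR D*L*theta (toR N) = theta f*toR (D*D)*L^Suc k + L*theta (toR D)*(f*toR D*L^k)
   + toR D*f*toR D*(L*theta (L^k))"
  by (simp only: toR_mult power_Suc distrib_left distrib_right mult_ac)
 moreover have "toR D*f*toR D*(L*theta (L^k)) = of_nat k * s*toR D*(f*toR D*L^k)"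
  unfolding Lk by (simp only: mult_ac)
 moreover have "f*toR D*L^k = toR N" using assms by (simp only: L_def)
 ultimately have "toR D*L*theta (toR N) = theta f*toR (D*D)*L^Suc k
   + L*theta (toR D)*toR N + of_nat k * s*toR D*toR N" by (simp only:)
 hence "theta f*toR (D*D)*L^Suc k =
   toR D*L*theta (toR N) - L*theta (toR D)*toR N - of_nat k * s*toR D*toR N"
  by (simp add: diff_eq_eq)
 moreover have "of_nat k = toR (of_nat k)" by (induction k) (auto simp: toR_add)
 ultimately show ?thesis unfolding L_def s_def theta_toR
  by (simp only: toR_mult toR_diff right_diff_distrib mult_ac)
qed

lemma pole_le_theta: "pole_le z k f ==> pole_le z (Suc k) (theta f)"
proof -
 assume "pole_le z k f"
 then obtain N D where *: "poly D z~=0" "f*toR D*toR [:-z,1:]^k = toR N"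
  unfolding pole_le_def by blast
 show ?thesis by (rule pole_leI[OF _ pole_theta_aux[OF *(2)]]) (use*in simp)
qed

text \<open>The leading term of the derivative carries the factor \<open>- k z\<close>, which is why
  a genuine pole at a nonzero point is required.\<close>

lemma pole_eq_theta:
 assumes "pole_eq z k f" "k>=1" "z~=0" shows "pole_eq z (Suc k) (theta f)"
proof -
 obtain N D where *: "poly D z~=0" "poly N z~=0" "f*toR D*toR [:-z,1:]^k = toR N"
  using assms(1) unfolding pole_eq_def by blast
 show ?thesis by (rule pole_eqI[OF _ _ pole_theta_aux[OF *(3)]]) (use*assms in auto)
qed

lemma pole_le_theta_pow: "pole_le z k f ==> pole_le z (k + i) ((theta ^^ i) f)"
 by (induction i) (auto intro: pole_le_theta)

lemma pole_eq_theta_pow: "pole_eq z k f ==> k>=1 ==> z~=0 ==> pole_eq z (k + i) ((theta ^^ i) f)"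
 by (induction i) (auto intro: pole_eq_theta)

lemma ratfun_pole:
 assumes "f : ratfun"
 shows "EX k. pole_le z k f"
proof -
 obtain N D where *: "D~=0" "f*toR D = toR N" using assms by (auto simp: ratfun_def)
 obtain D' where D': "D = [:-z,1:] ^ order z D*D'" "~ [:-z,1:] dvd D'"
  using order_decomp[OF *(1)] by blast
 have "f*toR D'*toR [:-z,1:] ^ order z D = f*toR D"
  by (subst (2) D'(1)) (simp add: toR_mult toR_power mult_ac)
 hence "pole_le z (order z D) f" using D'(2) *(2)
  by (intro pole_leI[of D']) (auto simp: poly_eq_0_iff_dvd)
 thus ?thesis by blast
qed

lemma ratfun_finite_poles:
 assumes "f : ratfun" shows "finite {z. ~ pole_le z 0 f}"
proof -
 obtain N D where *: "D~=0" "f*toR D = toR N" using assms by (auto simp: ratfun_def)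
 have "pole_le z 0 f" if "poly D z~=0" for z using that*by (intro pole_leI[of D]) auto
 hence "{z. ~ pole_le z 0 f}<={z. poly D z = 0}" by auto
 thus ?thesis using poly_roots_finite[OF *(1)] finite_subset by blast
qed

definition pole_order :: "complex => complex fls => nat" where
 "pole_order z f = (LEAST k. pole_le z k f)"

lemma pole_order_le: "f : ratfun ==> pole_le z (pole_order z f) f"
 unfolding pole_order_def using ratfun_pole by (metis LeastI)

lemma pole_order_eq:
 assumes "f : ratfun" "pole_order z f>=1"
 shows "pole_eq z (pole_order z f) f"
proof -
 define k where "k = pole_order z f"
 obtain N D where *: "poly D z~=0" "f*toR D*toR [:-z,1:]^k = toR N"
  using pole_order_le[OF assms(1), of z] unfolding pole_le_def k_def by blast
 have "poly N z~=0"
 proof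
  assume "poly N z = 0"
  then obtain N' where N': "N = [:-z,1:]*N'" by (metis poly_eq_0_iff_dvd dvdE)
  obtain j where j: "k = Suc j" using assms(2) by (metis k_def not0_implies_Suc not_one_le_zero)
  have "toR [:-z,1:]*(f*toR D*toR [:-z,1:]^j) = toR [:-z,1:]*toR N'"
   using *(2) unfolding N' j toR_mult by (simp only: power_Suc mult_ac)
  hence "f*toR D*toR [:-z,1:]^j = toR N'"
   by (subst (asm) mult_left_cancel) auto
  hence "pole_le z j f" using *(1) by (intro pole_leI)
  hence "k<=j" unfolding k_def pole_order_def by (rule Least_le)
  thus False using j by simp
 qed
 thus ?thesis unfolding k_def[symmetric] using*by (intro pole_eqI)
qed

lemma pole_order_0D: "f : ratfun ==> pole_order z f = 0 ==> pole_le z 0 f"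
 using pole_order_le by metis

lemma pole_order_0I: "pole_le z 0 f ==> pole_order z f = 0"
 unfolding pole_order_def by (metis Least_le le_zero_eq)

context qdil
begin

lemma pole_dil_aux:
 assumes "f*toR D*toR [:-(q*z),1:]^k = toR N"
 shows "dil f*toR (smult (q^k) (pcompose D [:0,q:]))*toR [:-z,1:]^k = toR (pcompose N [:0,q:])"
proof -
 have "pcompose [:-(q*z),1:] [:0,q:] = smult q [:-z,1:]"
  by (simp add: pcompose_pCons)
 hence "dil (toR [:-(q*z),1:]) = fls_const q*toR [:-z,1:]"
  by (simp only: dil_toR toR_smult)
 thus ?thesis
  using arg_cong[OF assms, of dil]
  by (simp add: dil_mult dil_toR sig_power toR_smult power_mult_distrib fls_const_power mult_ac)
qed

lemma pole_le_dil: "pole_le (q*z) k f ==> pole_le z k (dil f)"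
proof -
 assume "pole_le (q*z) k f"
 then obtain N D where *: "poly D (q*z)~=0" "f*toR D*toR [:-(q*z),1:]^k = toR N"
  unfolding pole_le_def by blast
 show ?thesis by (rule pole_leI[OF _ pole_dil_aux[OF *(2)]]) (use*in "auto simp: poly_pcompose mult.commute")
qed

lemma pole_eq_dil: "pole_eq (q*z) k f ==> pole_eq z k (dil f)"
proof -
 assume "pole_eq (q*z) k f"
 then obtain N D where *: "poly D (q*z)~=0" "poly N (q*z)~=0" "f*toR D*toR [:-(q*z),1:]^k = toR N"
  unfolding pole_eq_def by blast
 show ?thesis by (rule pole_eqI[OF _ _ pole_dil_aux[OF *(3)]]) (use*in "auto simp: poly_pcompose mult.commute")
qed

lemma q_powi_inj: "z~=0 ==> z*q powi m = z*q powi n ==> m = n"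
proof -
 assume "z~=0" "z*q powi m = z*q powi n"
 hence "q powi (m - n) = 1" by (simp add: power_int_diff)
 thus "m = n" by (simp add: q_powi_eq_1_iff)
qed

lemma finite_orbit_poles:
 assumes "f : ratfun" "z~=0"
 shows "finite {n. pole_order (z*q powi n) f~=0}"
proof -
 have "(%n. z*q powi n) ` {n. pole_order (z*q powi n) f~=0}<={z. ~ pole_le z 0 f}"
  using pole_order_0I by auto
 hence "finite ((%n. z*q powi n) ` {n. pole_order (z*q powi n) f~=0})"
  using ratfun_finite_poles[OF assms(1)] finite_subset by blast
 thus ?thesis by (rule finite_imageD) (auto intro!: inj_onI dest: q_powi_inj[OF assms(2)])
qed

text \<open>The rightmost and the leftmost pole of maximal order of \<open>p\<close> on the orbit
  produce two different poles of that order of \<open>\<mu> p - \<sigma> p\<close>.\<close>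

lemma no_telescoper:
 assumes z0: "z0~=0" and k: "k>=1" and ps: "pole_eq z0 k ps"
  and others: "!!n. n~=0 ==> pole_le (z0*q powi n) (k - 1) ps"
  and p: "p : ratfun" and mu: "mu~=0" and eq: "ps = fls_const mu*p - dil p"
 shows False
proof -
 define P where "P n = pole_order (z0*q powi n) p" for n
 define A where "A = {n. P n~=0}"
 have finA: "finite A" unfolding A_def P_def by (rule finite_orbit_poles[OF p z0])
 define K0 where "K0 = Max (insert 0 (P ` A))"
 have K0: "P n<=K0" for n
 proof (cases "n : A")
  case True thus ?thesis using finA by (auto simp: K0_def)
 next
  case False thus ?thesis by (simp add: A_def)
 qed
 have step: "q*(z0*q powi n) = z0*q powi (n + 1)" for n
  by (simp add: power_int_add mult_ac)
 have lep: "pole_le (z0*q powi n) (P n) p" for n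
  unfolding P_def by (rule pole_order_le[OF p])
 have ledp: "pole_le (z0*q powi n) (P (n + 1)) (dil p)" for n
  using lep[of "n + 1"] by (intro pole_le_dil) (simp only: step)
 have eqp: "pole_eq (z0*q powi n) (P n) p" if "P n>=1" for n
  using that unfolding P_def by (rule pole_order_eq[OF p])
 have eqdp: "pole_eq (z0*q powi n) (P (n + 1)) (dil p)" if "P (n + 1)>=1" for n
  using eqp[OF that] by (intro pole_eq_dil) (simp only: step)
 \<comment> \<open>If all orders of \<open>p\<close> on the orbit were below \<open>k\<close>, so
   would be the order of \<open>ps\<close> at \<open>z0\<close>.\<close>
 have K0k: "K0>=k"
 proof (rule ccontr)
  assume "~ K0>=k"
  hence "P 0<=k - 1" "P 1<=k - 1" using K0[of 0] K0[of 1] by auto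
  hence "pole_le z0 (k - 1) ps" unfolding eq
   using pole_le_mono[OF lep[of 0]] pole_le_mono[OF ledp[of 0]]
   by (intro pole_le_diff pole_le_cmult) auto
  thus False using pole_eq_not_le[OF ps, of "k - 1"] k by simp
 qed
 define B where "B = {n. P n = K0}"
 have BA: "B<=A" using K0k k by (auto simp: B_def A_def)
 have finB: "finite B" using BA finA finite_subset by blast
 have "B~={}"
 proof -
  have "K0 : insert 0 (P ` A)" unfolding K0_def using finA by (intro Max_in) auto
  thus ?thesis using K0k k by (auto simp: B_def)
 qed
 define n1 where "n1 = Max B"
 define n0 where "n0 = Min B"
 have n1: "P n1 = K0" "P (n1 + 1) < K0"
 proof -
  show "P n1 = K0" using Max_in[OF finB `B~={}`] by (simp add: B_def n1_def)
  have "n1 + 1 ~: B" using Max_ge[OF finB, of "n1 + 1"] by (auto simp: n1_def)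
  thus "P (n1 + 1) < K0" using K0[of "n1 + 1"] by (simp add: B_def)
 qed
 have n0: "P n0 = K0" "P (n0 - 1) < K0"
 proof -
  show "P n0 = K0" using Min_in[OF finB `B~={}`] by (simp add: B_def n0_def)
  have "n0 - 1 ~: B" using Min_le[OF finB, of "n0 - 1"] by (auto simp: n0_def)
  thus "P (n0 - 1) < K0" using K0[of "n0 - 1"] by (simp add: B_def)
 qed
 have le01: "n0<=n1" using finB `B~={}` by (simp add: n0_def n1_def)
 have 1: "pole_eq (z0*q powi n1) K0 ps"
 proof -
  have "pole_eq (z0*q powi n1) K0 (fls_const mu*p)"
   using eqp[of n1] n1 K0k k mu by (intro pole_eq_cmult) auto
  from pole_eq_add[OF this pole_le_uminus[OF ledp[of n1]] n1(2)]
  show ?thesis by (simp add: eq)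
 qed
 have 2: "pole_eq (z0*q powi (n0 - 1)) K0 ps"
 proof -
  have "pole_eq (z0*q powi (n0 - 1)) K0 (-dil p)"
   using eqdp[of "n0 - 1"] n0 K0k k by (intro pole_eq_uminus) auto
  from pole_eq_add[OF this pole_le_cmult[OF lep[of "n0 - 1"]] n0(2), of mu]
  show ?thesis by (simp add: eq)
 qed
 \<comment> \<open>Only the point of index 0 carries an order above \<open>k - 1\<close>, so both
   extreme points must have index 0; this contradicts \<open>n0 - 1 < n1\<close>.\<close>
 have lt: "k - 1 < K0" using K0k k by simp
 have "n1 = 0" using pole_eq_not_le[OF 1 others lt] by blast
 moreover have "n0 - 1 = 0" using pole_eq_not_le[OF 2 others lt] by blast
 ultimately show False using le01 by simp
qed

definition isolated_pole :: "complex => nat => complex fls => bool" where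
 "isolated_pole z0 k ph \<longleftrightarrow> z0~=0 & k>=1 & pole_eq z0 k ph &
   (ALL n. n~=0 --> pole_le (z0*q powi n) (k - 1) ph)"

text \<open>\<open>theta\<close> raises pole orders by at most one, and by exactly one at
  \<open>z0\<close>. The term with the largest index having \<open>c i~=0\<close> therefore
  dominates, and the combination has an isolated pole again, which no telescoping expression
  has.\<close>

lemma isolated_pole_operator:
 assumes iso: "isolated_pole z0 k ph" and I: "finite I" "i0 : I" "c i0~=0"
  and p: "p : ratfun" and mu: "mu~=0"
 shows "(SUM i:I. fls_const (c i)*(theta ^^ i) ph)~=fls_const mu*p - dil p"
proof
 assume eq: "(SUM i:I. fls_const (c i)*(theta ^^ i) ph) = fls_const mu*p - dil p"
 define ps where "ps = (SUM i:I. fls_const (c i)*(theta ^^ i) ph)"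
 define J where "J = Max {i:I. c i~=0}"
 have J: "J : I" "c J~=0"
  using Max_in[of "{i:I. c i~=0}"] I unfolding J_def by auto
 have Jmax: "i<=J" if "i : I" "c i~=0" for i
  using that I unfolding J_def by (intro Max_ge) auto
 have z0: "z0~=0" "k>=1" "pole_eq z0 k ph" and oth: "!!n. n~=0 ==> pole_le (z0*q powi n) (k - 1) ph"
  using iso by (auto simp: isolated_pole_def)
 have split: "ps = fls_const (c J)*(theta ^^ J) ph + (SUM i:I - {J}. fls_const (c i)*(theta ^^ i) ph)"
  unfolding ps_def by (rule sum.remove[OF I(1) J(1)])
 have "pole_le z0 (k + J - 1) (SUM i:I - {J}. fls_const (c i)*(theta ^^ i) ph)"
 proof (rule pole_le_sum)
  fix i assume i: "i : I - {J}"
  show "pole_le z0 (k + J - 1) (fls_const (c i)*(theta ^^ i) ph)"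
  proof (cases "c i = 0")
   case True thus ?thesis using pole_le_0 by simp
  next
   case False
   hence "i < J" using Jmax[of i] i by force
   thus ?thesis
    by (intro pole_le_cmult pole_le_mono[OF pole_le_theta_pow[OF pole_eq_imp_le[OF z0(3)]]]) auto
  qed
 qed
 moreover have "pole_eq z0 (k + J) (fls_const (c J)*(theta ^^ J) ph)"
  by (intro pole_eq_cmult pole_eq_theta_pow z0 J)
 ultimately have 1: "pole_eq z0 (k + J) ps" unfolding split
  using z0(2) pole_eq_add[of z0 "k + J" _ "k + J - 1"] by simp
 have 2: "pole_le (z0*q powi n) (k + J - 1) ps" if "n~=0" for n
  unfolding ps_def
 proof (rule pole_le_sum)
  fix i assume i: "i : I"
  show "pole_le (z0*q powi n) (k + J - 1) (fls_const (c i)*(theta ^^ i) ph)"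
  proof (cases "c i = 0")
   case True thus ?thesis using pole_le_0 by simp
  next
   case False
   hence "i<=J" using Jmax[of i] i by force
   thus ?thesis using z0(2)
    by (intro pole_le_cmult pole_le_mono[OF pole_le_theta_pow[OF oth[OF that]]]) auto
  qed
 qed
 show False
  by (rule no_telescoper[OF z0(1) _ 1 2 p mu]) (use z0 eq ps_def in auto)
qed

end

section \<open>Differential transcendence\<close>

definition Dalg :: "complex fls => bool" where
 "Dalg f \<longleftrightarrow> rat.alg_dep (%i. (theta ^^ i) f)"

lemma keys_sum_subset: "keys (sum f A)<=(UN x:A. keys (f x))"
proof (induction A rule: infinite_finite_induct)
 case (insert x A)
 thus ?case using Poly_Mapping.keys_add[of "f x" "sum f A"] by auto
qed auto

definition affine_form :: "(nat => 'a) => 'a => nat => 'a::comm_ring_1 mp" where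
 "affine_form a b i = (SUM j<i. single (unit_exp j) (a j)) + single 0 b"

lemma keys_affine_form: "m : keys (affine_form a b i) ==> m = 0 | (EX j<i. m = unit_exp j)"
proof -
 assume m: "m : keys (affine_form a b i)"
 have "m : keys (SUM j<i. single (unit_exp j) (a j)) | m : keys (single 0 b)"
  using subsetD[OF Poly_Mapping.keys_add m[unfolded affine_form_def]] by simp
 thus ?thesis
 proof
  assume "m : keys (SUM j<i. single (unit_exp j) (a j))"
  from subsetD[OF keys_sum_subset this]
  obtain j where "j < i" "m : keys (single (unit_exp j) (a j))"
   by (elim UN_E) (simp only: lessThan_iff)
  thus ?thesis by (auto split: if_splits)
 qed (auto split: if_splits)
qed

lemma mpeval_affine_form: "mpeval (affine_form a b i) v = (SUM j<i. a j * v j) + b"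
 by (simp add: affine_form_def mpeval_add mpeval_sum)

lemma coeffs_affine_form: "(!!j. a j : ratfun) ==> b : ratfun ==> coeffs_in ratfun (affine_form a b i)"
 unfolding affine_form_def by (intro rat.coeffs_in_add rat.coeffs_in_sum rat.coeffs_in_single) auto

lemma Dalg_linear:
 assumes "rat.alg_dep w" and c: "!!i. c i : ratfun" "!!i. c i~=0"
  and a: "!!i j. a i j : ratfun" and b: "!!i. b i : ratfun"
  and w: "!!i. w i = c i * v i + ((SUM j<i. a i j * v j) + b i)"
 shows "rat.alg_dep v"
proof (rule rat.alg_dep_triangular[OF assms(1) c, where f = "%i. affine_form (a i) (b i) i"])
 show "coeffs_in ratfun (affine_form (a i) (b i) i)" for i
  by (intro coeffs_affine_form a b)
 show "m : keys (affine_form (a i) (b i) i) ==> keys m<={..<i}" for i m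
  by (drule keys_affine_form) auto
 show "w i = c i * v i + mpeval (affine_form (a i) (b i) i) v" for i
  unfolding mpeval_affine_form by (rule w)
qed

lemma theta_pow_mult_top:
 "(theta ^^ i) (g*w) = w*(theta ^^ i) g + (SUM j<i. of_nat (i choose j)*(theta ^^ (i - j)) w*(theta ^^ j) g)"
 unfolding theta_pow_mult lessThan_Suc_atMost[symmetric] sum.lessThan_Suc by (simp add: mult_ac)

text \<open>By Leibniz' rule the derivatives of \<open>f\<close> depend on those of \<open>g\<close>
  in a triangular way with diagonal entries \<open>w\<close>.\<close>

lemma Dalg_affine:
 assumes "Dalg f" "f = w*g + w0" "w : ratfun" "w0 : ratfun" "w~=0"
 shows "Dalg g"
 unfolding Dalg_def
proof (rule Dalg_linear[where c = "%_. w" and b = "%i. (theta ^^ i) w0" and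
  a = "%i j. of_nat (i choose j)*(theta ^^ (i - j)) w"])
 show "rat.alg_dep (%i. (theta ^^ i) f)" using assms(1) by (simp add: Dalg_def)
 show "(theta ^^ i) f = w*(theta ^^ i) g + ((SUM j<i. of_nat (i choose j)*(theta ^^ (i - j)) w*(theta ^^ j) g) + (theta ^^ i) w0)" for i
  using theta_pow_mult_top[of i g w] by (simp add: assms(2) theta_pow_add mult.commute)
qed (use assms in "auto intro!: theta_pow_ratfun rat.mult_in rat.of_nat_in")

context qdil
begin

text \<open>For a constant multiplier every derivative of \<open>M\<close> satisfies the same
  equation with \<open>de\<close> replaced by its derivative. A dependence would thus telescope a
  combination of derivatives of \<open>de\<close>, whose coefficients are invariant under the
  dilation and hence constants; the isolated pole forbids this.\<close>

theorem isolated_pole_not_Dalg: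
 assumes M: "dil M = fls_const mu*M + de" and mu: "mu~=0" and de: "de : ratfun"
  and iso: "isolated_pole z0 k de"
 shows "~ Dalg M"
proof
 assume "Dalg M"
 have v: "dil ((theta ^^ i) M) = fls_const mu*(theta ^^ i) M + (theta ^^ i) de" for i
 proof -
  have "(theta ^^ i) (fls_const mu*M) = fls_const mu*(theta ^^ i) M"
   by (induction i) (auto simp: theta_mult)
  thus ?thesis by (simp add: dil_theta_pow M theta_pow_add)
 qed
 have "EX I c p. finite I & (ALL i. c i : ratfun & dil (c i) = c i) & (EX i:I. c i~=0) & p : ratfun &
   (SUM i:I. c i*(theta ^^ i) de) = fls_const mu*p - dil p"
  by (rule kolchin_ostrowski[of "%i. (theta ^^ i) M"])
   (use `Dalg M` mu de v in "simp_all add: Dalg_def ratfun_const theta_pow_ratfun")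
 then obtain I c p where *: "finite I" "ALL i. c i : ratfun & dil (c i) = c i" "EX i:I. c i~=0"
   "p : ratfun" "(SUM i:I. c i*(theta ^^ i) de) = fls_const mu*p - dil p"
  by (elim exE conjE)
 define c' where "c' i = fls_nth (c i) 0" for i
 have c: "c i = fls_const (c' i)" for i unfolding c'_def using *(2) by (intro dil_fixed) auto
 obtain i0 where i0: "i0 : I" "c' i0~=0" using *(3) c by (metis fls_const_0)
 have "(SUM i:I. fls_const (c' i)*(theta ^^ i) de) = fls_const mu*p - dil p"
  using *(5) by (simp only: c)
 with isolated_pole_operator[of z0 k de I i0 c' p mu, OF iso *(1) i0 *(4) mu] show False by (rule notE)
qed

text \<open>Applied to the logarithmic derivative of the multiplier: no nontrivial operator in
  \<open>theta\<close> with constant coefficients turns it into a coboundary of the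
  dilation.\<close>

definition nontele :: "complex fls => bool" where
 "nontele g \<longleftrightarrow> (ALL I c p. finite I --> p : ratfun -->
   (SUM i:I. fls_const (c i)*(theta ^^ i) g) = p - dil p --> (ALL i:I. c i = 0))"

lemma isolated_pole_nontele: "isolated_pole z0 k g ==> nontele g"
 unfolding nontele_def
proof (intro allI impI ballI)
 fix I :: "nat set" and c p i
 assume *: "isolated_pole z0 k g" "finite I" "p : ratfun"
  "(SUM i:I. fls_const (c i)*(theta ^^ i) g) = p - dil p" "i : I"
 show "c i = 0"
  using isolated_pole_operator[of z0 k g I i c p 1]*by auto
qed

text \<open>Only the class modulo coboundaries matters, because \<open>theta\<close> and constants
  commute with the dilation.\<close>

lemma nontele_coboundary:
 assumes "nontele g1" "g = g1 + (dil h - h)" "h : ratfun"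
 shows "nontele g"
 unfolding nontele_def
proof (intro allI impI)
 fix I :: "nat set" and c p assume *: "finite I" "p : ratfun" "(SUM i:I. fls_const (c i)*(theta ^^ i) g) = p - dil p"
 define h' where "h' = (SUM i:I. fls_const (c i)*(theta ^^ i) h)"
 have "(SUM i:I. fls_const (c i)*(theta ^^ i) g) =
   (SUM i:I. fls_const (c i)*(theta ^^ i) g1) + (dil h' - h')"
  unfolding assms(2) h'_def sig_sum dil_mult dil_const dil_theta_pow
   theta_pow_add theta_pow_diff sum_subtractf[symmetric] sum.distrib[symmetric]
  by (intro sum.cong refl) (simp only: right_diff_distrib distrib_left)
 hence "(SUM i:I. fls_const (c i)*(theta ^^ i) g1) = (p - dil p) - (dil h' - h')"
  using *(3) by (metis add_diff_cancel_right')
 hence "(SUM i:I. fls_const (c i)*(theta ^^ i) g1) = (p + h') - dil (p + h')"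
  by (simp add: dil_add)
 moreover have "p + h' : ratfun" unfolding h'_def
  by (intro rat.add_in*rat.sum_in rat.mult_in ratfun_const theta_pow_ratfun assms)
 ultimately show "ALL i:I. c i = 0" using assms(1) *(1) unfolding nontele_def by blast
qed

end

subsection \<open>First order equations with non-telescoping coefficient\<close>

text \<open>\<open>r\<close> is the homogeneous component of degree \<open>n\<close>, possibly zero,
  and everything else has smaller degree.\<close>

definition homog_lead :: "'a::comm_ring_1 mp => 'a mp => nat => bool" where
 "homog_lead p r n \<longleftrightarrow> (ALL k:keys r. tdeg k = n) & (ALL k:keys (p - r). tdeg k < n)"

lemma keys_multE:
 assumes "k : keys (p*r)"
 obtains a b where "k = a + b" "a : keys p" "b : keys r"
 using subsetD[OF Poly_Mapping.keys_mult assms] that by auto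

lemma homog_lead_mult:
 assumes "homog_lead p r n" "homog_lead p' r' n'"
 shows "homog_lead (p*p') (r*r') (n + n')"
proof -
 have r: "!!k. k : keys r ==> tdeg k = n" "!!k. k : keys r' ==> tdeg k = n'"
  and l: "!!k. k : keys (p - r) ==> tdeg k < n" "!!k. k : keys (p' - r') ==> tdeg k < n'"
  using assms by (auto simp: homog_lead_def)
 have eq: "p*p' - r*r' = (p - r)*(p' - r') + ((p - r)*r' + r*(p' - r'))"
  by (simp add: algebra_simps)
 have k1: "tdeg k < n + n'" if "k : keys ((p - r)*(p' - r'))" for k
 proof -
  from that obtain a b where "k = a + b" "a : keys (p - r)" "b : keys (p' - r')"
   by (rule keys_multE)
  thus ?thesis using l(1)[of a] l(2)[of b] by (simp add: wt_add)
 qed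
 have k2: "tdeg k < n + n'" if "k : keys ((p - r)*r')" for k
 proof -
  from that obtain a b where "k = a + b" "a : keys (p - r)" "b : keys r'"
   by (rule keys_multE)
  thus ?thesis using l(1)[of a] r(2)[of b] by (simp add: wt_add)
 qed
 have k3: "tdeg k < n + n'" if "k : keys (r*(p' - r'))" for k
 proof -
  from that obtain a b where "k = a + b" "a : keys r" "b : keys (p' - r')"
   by (rule keys_multE)
  thus ?thesis using r(1)[of a] l(2)[of b] by (simp add: wt_add)
 qed
 have k4: "tdeg k = n + n'" if "k : keys (r*r')" for k
 proof -
  from that obtain a b where "k = a + b" "a : keys r" "b : keys r'"
   by (rule keys_multE)
  thus ?thesis using r(1)[of a] r(2)[of b] by (simp add: wt_add)
 qed
 have "ALL k:keys ((p - r)*(p' - r') + ((p - r)*r' + r*(p' - r'))). tdeg k < n + n'"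
  by (intro keys_add_wt ballI k1 k2 k3)
 thus ?thesis unfolding homog_lead_def eq using k4 by blast
qed

lemma homog_lead_1: "homog_lead 1 1 0"
 by (simp add: homog_lead_def)

lemma homog_lead_power: "homog_lead p r n ==> homog_lead (p^k) (r^k) (k*n)"
 by (induction k) (auto intro: homog_lead_1 homog_lead_mult)

lemma homog_lead_moneval:
 assumes "!!i. homog_lead (w i) (w' i) 1"
 shows "homog_lead (moneval m w) (moneval m w') (tdeg m)"
proof -
 have "finite A ==> homog_lead (PROD i:A. w i^lookup m i) (PROD i:A. w' i^lookup m i)
   (SUM i:A. lookup m i*1)" for A
  by (induction A rule: finite_induct) (auto intro!: homog_lead_1 homog_lead_mult homog_lead_power[OF assms, simplified])
 from this[of "keys m"] show ?thesis by (simp add: moneval_def wt_def)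
qed

definition homog_part :: "nat => 'a::comm_ring_1 mp => 'a mp" where
 "homog_part D p = (SUM m:{m:keys p. tdeg m = D}. single m (lookup p m))"

lemma lookup_homog_part: "lookup (homog_part D p) N = (if tdeg N = D then lookup p N else 0)"
proof -
 have "lookup (homog_part D p) N =
   (SUM m:{m:keys p. tdeg m = D}. if m = N then lookup p m else 0)"
  by (simp add: homog_part_def lookup_sum lookup_single when_def)
 also have "... = (if tdeg N = D then lookup p N else 0)"
  by (subst sum.delta) (auto simp: in_keys_iff)
 finally show ?thesis .
qed

lemma keys_homog_part: "keys (homog_part D p) = {m:keys p. tdeg m = D}"
 by (auto simp: in_keys_iff lookup_homog_part split: if_splits)

text \<open>Affine substitutions do not raise degrees, so the top homogeneous part sees the linear
  parts \<open>w'\<close> only.\<close>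

lemma homog_part_poly_subst:
 assumes w: "!!i. homog_lead (w i) (w' i) 1" and top: "!!m. m : keys P ==> tdeg m<=D"
 shows "homog_part D (poly_subst si P w) = poly_subst si (homog_part D P) w'"
proof (rule poly_mapping_eqI)
 fix N
 have hl: "homog_lead (moneval m w) (moneval m w') (tdeg m)" for m by (rule homog_lead_moneval[OF w])
 have hom: "lookup (moneval m w') N = 0" if "tdeg m~=tdeg N" for m
  using conjunct1[OF hl[unfolded homog_lead_def], rule_format, of N m] that by (auto simp: in_keys_iff)
 have low: "lookup (moneval m w) N = lookup (moneval m w') N" if "tdeg N>=tdeg m" for m
 proof -
  have "N ~: keys (moneval m w - moneval m w')"
   using conjunct2[OF hl[unfolded homog_lead_def], rule_format, of N m] that by auto
  thus ?thesis by (simp add: in_keys_iff lookup_minus)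
 qed
 show "lookup (homog_part D (poly_subst si P w)) N = lookup (poly_subst si (homog_part D P) w') N"
 proof (cases "tdeg N = D")
  case True
  have "lookup (poly_subst si P w) N =
    (SUM m:keys P. si (lookup P m)*lookup (moneval m w') N)"
   unfolding poly_subst_def lookup_sum lookup_single_0_mult
   using low top True by (intro sum.cong refl) auto
  also have "... = (SUM m:{m:keys P. tdeg m = D}. si (lookup P m)*lookup (moneval m w') N)"
   using True by (intro sum.mono_neutral_right) (auto simp: hom)
  also have "... = lookup (poly_subst si (homog_part D P) w') N"
   unfolding poly_subst_def lookup_sum lookup_single_0_mult keys_homog_part
   by (intro sum.cong refl) (auto simp: lookup_homog_part)
  finally show ?thesis using True by (simp add: lookup_homog_part)
 next
  case False
  have "lookup (poly_subst si (homog_part D P) w') N = 0"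
   unfolding poly_subst_def lookup_sum lookup_single_0_mult keys_homog_part
   using False by (intro sum.neutral) (auto simp: hom)
  thus ?thesis using False by (simp add: lookup_homog_part)
 qed
qed

text \<open>The logarithmic jets: \<open>x i\<close> is what \<open>\<theta> ^ i h / h\<close> would be for a solution \<open>h\<close> of \<open>\<theta> h = U h\<close>.\<close>

primrec log_jet :: "complex fls => nat => complex fls" where
 "log_jet U 0 = 1"
| "log_jet U (Suc i) = theta (log_jet U i) + U*log_jet U i"

lemma theta_of_nat: "theta (of_nat m) = 0"
 by (induction m) (auto simp: theta_add)

text \<open>For a formal h with \<open>theta h = U h\<close>, the sum \<open>T U A i\<close> stands
  for theta^i (A h) / h, and the identity is one more differentiation of it.\<close>

lemma log_jet_leibniz:
 defines "T == %U A i. (SUM j<=i. of_nat (i choose j)*(theta ^^ j) A*log_jet U (i - j))"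
 shows "T U A (Suc i) = theta (T U A i) + U*T U A i"
proof -
 let ?F = "%j. (theta ^^ j) A" and ?G = "log_jet U"
 have "theta (T U A i) + U*T U A i =
   (SUM j<=i. of_nat (i choose j)*?F (Suc j)*?G (i - j)) + (SUM j<=i. of_nat (i choose j)*?F j*?G (Suc (i - j)))"
  unfolding T_def theta_sum theta_mult sum_distrib_left sum.distrib[symmetric] theta_of_nat
  by (intro sum.cong refl) (simp add: algebra_simps)
 also have "(SUM j<=i. of_nat (i choose j)*?F j*?G (Suc (i - j))) =
   (SUM j<=Suc i. of_nat (i choose j)*?F j*?G (Suc i - j))"
  by (simp add: Suc_diff_le)
 also have "... = ?F 0*?G (Suc i) + (SUM j<=i. of_nat (i choose Suc j)*?F (Suc j)*?G (i - j))"
  by (subst sum.atMost_Suc_shift) simp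
 also have "(SUM j<=i. of_nat (i choose j)*?F (Suc j)*?G (i - j)) + ... =
   ?F 0*?G (Suc i) + (SUM j<=i. of_nat (Suc i choose Suc j)*?F (Suc j)*?G (i - j))"
  by (simp add: sum.distrib[symmetric] algebra_simps)
 also have "... = T U A (Suc i)"
  unfolding T_def by (subst sum.atMost_Suc_shift) simp
 finally show ?thesis by simp
qed

text \<open>The reading of the previous lemma with A = U, since theta^(i+1) h = theta^i (U
  h).\<close>

lemma log_jet_rec: "log_jet U (Suc i) = (SUM j<=i. of_nat (i choose j)*(theta ^^ j) U*log_jet U (i - j))"
proof (induction i)
 case (Suc i)
 show ?case unfolding log_jet_leibniz Suc[symmetric] by simp
qed simp

lemma log_jet_poly:
 "EX X. coeffs_in ratfun X & (ALL m:keys X. keys m<={..<i}) &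
   mpeval X (%j. (theta ^^ j) U) = log_jet U i"
proof (induction i rule: less_induct)
 case (less i)
 show ?case
 proof (cases i)
  case 0
  show ?thesis by (rule exI[of _ 1]) (auto simp: 0 rat.coeffs_in_1)
 next
  case (Suc k)
  define X where "X j = (SOME X. coeffs_in ratfun X & (ALL m:keys X. keys m<={..<j}) &
    mpeval X (%j. (theta ^^ j) U) = log_jet U j)" for j
  have X: "coeffs_in ratfun (X j) & (ALL m:keys (X j). keys m<={..<j}) &
    mpeval (X j) (%j. (theta ^^ j) U) = log_jet U j" if "j<=k" for j
   unfolding X_def by (rule someI_ex) (use less[of j] that Suc in simp)
  define Z where "Z = (SUM j<=k. single (unit_exp j) (of_nat (k choose j))*X (k - j))"
  have "coeffs_in ratfun Z" unfolding Z_def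
   using X by (intro rat.coeffs_in_sum rat.coeffs_in_mult rat.coeffs_in_single rat.of_nat_in) auto
  moreover have "keys m<={..<i}" if "m : keys Z" for m
  proof -
   from subsetD[OF keys_sum_subset that[unfolded Z_def]] obtain j where j: "j<=k" "m : keys (single (unit_exp j) (of_nat (k choose j))*X (k - j))"
    by (elim UN_E) (simp only: atMost_iff)
   from j(2) obtain a b where ab: "m = a + b" "a : keys (single (unit_exp j) (of_nat (k choose j) :: complex fls))"
     "b : keys (X (k - j))" by (rule keys_multE)
   have "a = unit_exp j" using ab(2) by (auto split: if_splits)
   moreover have "keys b<={..<k - j}" using X[of "k - j"] ab(3) by simp
   moreover have "keys m<=keys a Un keys b"
    unfolding ab(1) by (rule Poly_Mapping.keys_add)
   ultimately show ?thesis using j(1) Suc by (auto dest!: subsetD)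
  qed
  moreover have "mpeval Z (%j. (theta ^^ j) U) = log_jet U i"
   unfolding Z_def Suc log_jet_rec mpeval_sum mpeval_mult
   by (intro sum.cong refl) (use X in "auto simp: mult_ac")
  ultimately show ?thesis by blast
 qed
qed

context qdil
begin

text \<open>Taking logarithmic derivatives of \<open>dil p = ga^j*p\<close> would make j times
  \<open>theta ga/ga\<close> the coboundary of \<open>theta p/p\<close>.\<close>

lemma nontele_power:
 assumes nt: "nontele (theta ga/ga)" and ga: "ga~=0" and p: "p : ratfun" "p~=0" and j: "j>=1"
 shows "dil p~=ga^j*p"
proof
 assume eq: "dil p = ga^j*p"
 define l where "l = theta p/p"
 obtain i where i: "j = Suc i" using j by (cases j) auto
 have "theta (dil p) = of_nat j*theta ga * ga^i*p + ga^j*theta p"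
  unfolding eq theta_mult i theta_power by simp
 hence "dil l = (of_nat j*theta ga * ga^i*p + ga^j*theta p)/(ga^j*p)"
  by (simp add: l_def sig_divide dil_theta eq)
 also have "... = of_nat j*(theta ga/ga) + l"
  using ga p by (simp add: l_def i field_simps)
 finally have "(SUM i:{0}. fls_const (of_nat j)*(theta ^^ i) (theta ga/ga)) = (-l) - dil (-l)"
  by (simp add: sig_uminus fls_of_nat)
 moreover have "- l : ratfun" unfolding l_def by (intro rat.uminus_in rat.divide_in theta_ratfun p)
 ultimately have "of_nat j = (0::complex)"
  using nt[unfolded nontele_def, rule_format, of "{0}" "- l" "%_. of_nat j" 0] by simp
 thus False using j by simp
qed

lemma nontele_degree:
 assumes nt: "nontele (theta ga/ga)" and ga: "ga~=0" and p: "p : ratfun" "p~=0"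
  and eq: "dil p * ga^m = ga^n*p"
 shows "m = n"
proof (rule ccontr)
 assume "m~=n"
 then consider "m < n" | "n < m" by linarith
 thus False
 proof cases
  case 1
  hence "ga^n = ga^m * ga^(n - m)" by (simp flip: power_add)
  hence "dil p = ga^(n - m)*p" using eq ga by (simp add: field_simps)
  thus False using nontele_power[OF nt ga p, of "n - m"] 1 by simp
 next
  case 2
  hence "ga^m = ga^n * ga^(m - n)" by (simp flip: power_add)
  hence "dil p * ga^(m - n) = p" using eq ga by (simp add: field_simps)
  hence "inverse (dil p) = ga^(m - n)*inverse p"
   using p(2) by (metis inverse_eq_divide mult.commute mult_eq_0_iff nonzero_divide_mult_cancel_left divide_inverse)
  hence "dil (inverse p) = ga^(m - n)*inverse p" by (simp only: sig_inverse)
  thus False using nontele_power[OF nt ga rat.inverse_in[OF p(1)], of "m - n"] 2 p(2) by simp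
 qed
qed

text \<open>The jets are triangular over the derivatives of \<open>U\<close>. These satisfy shift
  equations with multiplier 1, so a dependence among them would telescope a combination of
  derivatives of \<open>g\<close>.\<close>

lemma log_jet_indep:
 assumes nt: "nontele g" "g : ratfun" and U: "dil U = U + g"
 shows "~ rat.alg_dep (%i. log_jet U (Suc i))"
proof
 assume dep: "rat.alg_dep (%i. log_jet U (Suc i))"
 have "rat.alg_dep (%i. (theta ^^ i) U)"
 proof -
  define X where "X j = (SOME X. coeffs_in ratfun X & (ALL m:keys X. keys m<={..<j}) &
    mpeval X (%j. (theta ^^ j) U) = log_jet U j)" for j
  have X: "coeffs_in ratfun (X j) & (ALL m:keys (X j). keys m<={..<j}) &
    mpeval (X j) (%j. (theta ^^ j) U) = log_jet U j" for j
   unfolding X_def by (rule someI_ex) (rule log_jet_poly)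
  define Z where "Z i = (SUM j<i. single (unit_exp j) (of_nat (i choose j))*X (i - j))" for i
  show ?thesis
  proof (rule rat.alg_dep_triangular[OF dep, where c = "%_. 1" and f = Z])
   show "coeffs_in ratfun (Z i)" for i unfolding Z_def
    using X by (intro rat.coeffs_in_sum rat.coeffs_in_mult rat.coeffs_in_single rat.of_nat_in) auto
   show "keys m<={..<i}" if "m : keys (Z i)" for i m
   proof -
    from subsetD[OF keys_sum_subset that[unfolded Z_def]] obtain j where j: "j < i" "m : keys (single (unit_exp j) (of_nat (i choose j))*X (i - j))"
     by (elim UN_E) (simp only: lessThan_iff)
    from j(2) obtain a b where ab: "m = a + b" "a : keys (single (unit_exp j) (of_nat (i choose j) :: complex fls))"
      "b : keys (X (i - j))" by (rule keys_multE)
    have "a = unit_exp j" using ab(2) by (auto split: if_splits)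
    moreover have "keys b<={..<i - j}" using X[of "i - j"] ab(3) by simp
    moreover have "keys m<=keys a Un keys b"
     unfolding ab(1) by (rule Poly_Mapping.keys_add)
    ultimately show ?thesis using j(1) by (auto dest!: subsetD)
   qed
   show "log_jet U (Suc i) = 1*(theta ^^ i) U + mpeval (Z i) (%j. (theta ^^ j) U)" for i
    unfolding log_jet_rec lessThan_Suc_atMost[symmetric] sum.lessThan_Suc Z_def mpeval_sum mpeval_mult
    using X by (simp add: mult_ac)
  qed auto
 qed
 hence "EX I c p. finite I & (ALL i. c i : ratfun & dil (c i) = c i) & (EX i:I. c i~=0) & p : ratfun &
   (SUM i:I. c i*(theta ^^ i) g) = 1*p - dil p"
  by (rule kolchin_ostrowski) (use nt(2) in "simp_all add: theta_pow_ratfun dil_theta_pow U theta_pow_add")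
 then obtain I c p where *: "finite I" "ALL i. c i : ratfun & dil (c i) = c i" "EX i:I. c i~=0"
   "p : ratfun" "(SUM i:I. c i*(theta ^^ i) g) = 1*p - dil p"
  by (elim exE conjE)
 define c' where "c' i = fls_nth (c i) 0" for i
 have c: "c i = fls_const (c' i)" for i unfolding c'_def using *(2) by (intro dil_fixed) auto
 have "(SUM i:I. fls_const (c' i)*(theta ^^ i) g) = p - dil p" using *(5) by (simp only: c mult_1)
 hence "ALL i:I. c' i = 0" using nt(1) *(1,4) unfolding nontele_def by blast
 thus False using *(3) c by (metis fls_const_0)
qed

text \<open>Solved coefficientwise by dividing by \<open>q^n - 1\<close>; this explains the
  assumption on the coefficients of index at most 0.\<close>

lemma ex_log_solution:
 assumes "!!n. n<=0 ==> fls_nth g n = 0"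
 shows "EX U. dil U = U + g"
proof -
 define U where "U = fps_to_fls (Abs_fps (%n. fls_nth g (int n)/(q^n - 1)))"
 have "dil U = U + g"
 proof (rule fls_eqI)
  fix n :: int
  show "fls_nth (dil U) n = fls_nth (U + g) n"
  proof (cases "n<=0")
   case True
   hence "fls_nth U n = 0" using assms[of n] by (simp add: U_def)
   thus ?thesis using assms[OF True] by (simp add: dil_nth)
  next
   case False
   define m where "m = nat n"
   have n: "n = int m" "m > 0" using False by (auto simp: m_def)
   have "q^m~=1" using q_powi_eq_1_iff[of n] n by simp
   thus ?thesis by (simp add: dil_nth U_def n field_simps)
  qed
 qed
 thus ?thesis by blast
qed

text \<open>If dil h = ga h, then ga dil (theta^i h / h) = theta^i (ga h) / h, and the equation for
  \<open>U\<close> is the logarithmic derivative of the one for h. Only these ratios enter, so h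
  itself is not constructed.\<close>

lemma dil_log_jet:
 assumes U: "dil U = U + theta ga/ga" and ga: "ga~=0"
 shows "ga*dil (log_jet U i) = (SUM j<=i. of_nat (i choose j)*(theta ^^ j) ga*log_jet U (i - j))"
proof (induction i)
 case (Suc i)
 define T where "T = (SUM j<=i. of_nat (i choose j)*(theta ^^ j) ga*log_jet U (i - j))"
 have "dil (log_jet U i) = T/ga" using Suc ga by (simp add: T_def field_simps)
 hence "ga*dil (log_jet U (Suc i)) = ga*(theta (T/ga) + (U + theta ga/ga)*(T/ga))"
  by (simp add: dil_add dil_mult dil_theta U)
 also have "theta (T/ga) = theta T/ga - T*theta ga/ga^2"
  using ga by (simp add: divide_inverse theta_mult theta_inverse mult_ac power_inverse)
 also have "ga*(theta T/ga - T*theta ga/ga^2 + (U + theta ga/ga)*(T/ga)) = theta T + U*T"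
  using ga by (simp add: field_simps power2_eq_square)
 also have "... = (SUM j<=Suc i. of_nat (Suc i choose j)*(theta ^^ j) ga*log_jet U (Suc i - j))"
  unfolding T_def by (rule log_jet_leibniz[symmetric])
 finally show ?case .
qed simp

end

lemma poly_subst_superset:
 assumes "finite A" "keys P<=A" "si 0 = 0"
 shows "poly_subst si P w = (SUM m:A. single 0 (si (lookup P m))*moneval m w)"
 unfolding poly_subst_def using assms
 by (intro sum.mono_neutral_left) (auto simp: in_keys_iff)

lemma poly_subst_add:
 assumes "!!x y. si (x + y) = si x + si y" "si 0 = 0"
 shows "poly_subst si (P + R) w = poly_subst si P w + poly_subst si R w"
proof -
 let ?A = "keys P Un keys R"
 have 1: "poly_subst si (P + R) w = (SUM m:?A. single 0 (si (lookup (P + R) m))*moneval m w)"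
  by (intro poly_subst_superset) (simp_all add: Poly_Mapping.keys_add assms(2))
 have 2: "poly_subst si P w = (SUM m:?A. single 0 (si (lookup P m))*moneval m w)"
  by (rule poly_subst_superset) (use assms(2) in auto)
 have 3: "poly_subst si R w = (SUM m:?A. single 0 (si (lookup R m))*moneval m w)"
  by (rule poly_subst_superset) (use assms(2) in auto)
 show ?thesis unfolding 1 2 3 lookup_add assms(1) single_add distrib_right sum.distrib ..
qed

lemma poly_subst_single:
 assumes "si 0 = 0"
 shows "poly_subst si (single m c) w = single 0 (si c)*moneval m w"
 by (cases "c = 0") (auto simp: poly_subst_def assms)

lemma keys_single_var_power:
 assumes "!!k. k : keys p ==> EX j. k = single 0 j"
  and "k : keys (p^n)"
 shows "EX j. k = single (0::nat) (j::nat)"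
 using assms(2)
proof (induction n arbitrary: k)
 case 0
 hence "k = single 0 0" by simp
 thus ?case by blast
next
 case (Suc n)
 from Suc.prems obtain a b where ab: "k = a + b" "a : keys p" "b : keys (p^n)"
  unfolding power_Suc by (rule keys_multE)
 obtain i j where "a = single 0 i" "b = single 0 j"
  using assms(1)[OF ab(2)] Suc.IH[OF ab(3)] by blast
 hence "k = single 0 (i + j)" using ab(1) by (simp add: single_add)
 thus ?case by blast
qed

text \<open>For large \<open>B\<close> these weights compare monomials by total degree first and by
  \<open>wt (%i. i)\<close> second.\<close>

lemma wt_shift: "wt (%i. B + i) m = B*tdeg m + wt (%i. i) m"
 by (simp add: wt_def sum_distrib_left algebra_simps sum.distrib)

lemma ex_top_wt:
 assumes "P~=0"
 shows "EX N:keys P. ALL m:keys P. wt om m<=wt om N"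
proof -
 have "keys P~={}" using assms by simp
 hence "Max (wt om ` keys P) : wt om ` keys P" by (intro Max_in) auto
 then obtain N where N: "N : keys P" "wt om N = Max (wt om ` keys P)" by auto
 thus ?thesis by (intro bexI[of _ N]) auto
qed

text \<open>Because \<open>x 0 = 1\<close>, evaluation at \<open>x\<close> forgets the exponent of
  the variable 0. In a homogeneous polynomial that exponent is determined by the others, so no two
  monomials merge.\<close>

lemma homog_relation_zero:
 assumes indep: "~ rat.alg_dep (%i. x (Suc i))" and x0: "x 0 = 1"
  and Q: "coeffs_in ratfun Q" "!!m. m : keys Q ==> tdeg m = D" "mpeval Q x = 0"
 shows "Q = 0"
proof (rule ccontr)
 assume "Q~=0"
 define sh where "sh m = Poly_Mapping.map_key Suc m" for m :: "nat \<Rightarrow>\<^sub>0 nat"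
 have lsh: "lookup (sh m) i = lookup m (Suc i)" for m i
  by (simp add: sh_def map_key.rep_eq)
 have ksh: "keys m<=insert 0 (Suc ` keys (sh m))" for m
 proof
  fix i assume "i : keys m"
  thus "i : insert 0 (Suc ` keys (sh m))"
   by (cases i) (auto simp: in_keys_iff lsh)
 qed
 have inj: "m = n" if "sh m = sh n" "tdeg m = D" "tdeg n = D" for m n
 proof -
  have S: "lookup m (Suc i) = lookup n (Suc i)" for i
   using that(1) lsh by metis
  have t: "tdeg k = lookup k 0 + (SUM i:keys (sh k). lookup k (Suc i))" for k
  proof -
   have "tdeg k = (SUM i:insert 0 (Suc ` keys (sh k)). lookup k i*1)"
    by (rule wt_superset) (use ksh in auto)
   thus ?thesis by (simp add: sum.reindex)
  qed
  have "lookup m 0 = lookup n 0"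
   using t[of m] t[of n] that S by simp
  hence "lookup m i = lookup n i" for i using S by (cases i) auto
  thus ?thesis by (intro poly_mapping_eqI)
 qed
 have mon: "moneval m x = moneval (sh m) (%i. x (Suc i))" for m
 proof -
  have "moneval m x = (PROD i:insert 0 (Suc ` keys (sh m)). x i^lookup m i)"
   by (rule moneval_superset) (use ksh in auto)
  also have "... = (PROD i:keys (sh m). x (Suc i)^lookup m (Suc i))"
   by (simp add: x0 prod.reindex)
  finally show ?thesis by (simp add: moneval_def lsh)
 qed
 define Q' where "Q' = (SUM m:keys Q. single (sh m) (lookup Q m))"
 have "coeffs_in ratfun Q'" unfolding Q'_def
  using Q(1) by (intro rat.coeffs_in_sum rat.coeffs_in_single) (auto simp: coeffs_in_def)
 moreover have "mpeval Q' (%i. x (Suc i)) = 0"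
  using Q(3) by (simp add: Q'_def mpeval_sum mpeval_def[of Q] mon)
 moreover have "Q'~=0"
 proof -
  have "keys Q~={}" using `Q~=0` by simp
  then obtain N where N: "N : keys Q" by blast
  have "lookup Q' (sh N) = (SUM m:keys Q. if m = N then lookup Q m else 0)"
   unfolding Q'_def lookup_sum lookup_single when_def
   by (intro sum.cong refl) (use inj Q(2) N in auto)
  also have "... = lookup Q N" using N by (simp add: sum.delta)
  finally have "lookup Q' (sh N)~=0" using N by (simp add: in_keys_iff)
  thus ?thesis by auto
 qed
 ultimately have "rat.alg_dep (%i. x (Suc i))" unfolding rat.alg_dep_def by blast
 thus False using indep by blast
qed

context qdil
begin

text \<open>Testing on the log jets, which solve the homogeneous equation and are independent, pins
  the top homogeneous part of a minimal relation down to a power of the variable 0. A coefficient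
  one degree lower then solves the inhomogeneous equation up to an integer factor.\<close>

theorem nontele_Dalg:
 assumes ga: "ga : ratfun" "ga~=0" and nt: "nontele (theta ga/ga)"
  and reg: "!!n. n<=0 ==> fls_nth (theta ga/ga) n = 0"
  and de: "de : ratfun" and G: "dil G = ga*G + de" and alg: "Dalg G"
 shows "(EX p:ratfun. dil p = ga*p + de) & (de = 0 --> G = 0)"
proof -
 define v where "v i = (theta ^^ i) G" for i
 define a where "a i j = of_nat (i choose j)*(theta ^^ (i - j)) ga" for i j
 define w where "w i = single (unit_exp i) ga + affine_form (a i) ((theta ^^ i) de) i" for i
 define w' where "w' i = single (unit_exp i) ga + affine_form (a i) 0 i" for i
 have aK: "a i j : ratfun" for i j unfolding a_def
  by (intro rat.mult_in rat.of_nat_in theta_pow_ratfun ga)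
 have wK: "coeffs_in ratfun (w i)" for i unfolding w_def
  by (intro rat.coeffs_in_add rat.coeffs_in_single coeffs_affine_form aK theta_pow_ratfun ga de)
 have wv: "mpeval (w i) v = dil (v i)" for i
  unfolding v_def dil_theta_pow G w_def mpeval_add mpeval_affine_form theta_pow_add
  using theta_pow_mult_top[of i G ga] by (simp add: a_def mult.commute[of ga G])
 have lead: "lead (%i. B + i) (w i) (unit_exp i) ga" if "B>=1" for B i
  unfolding w_def
 proof (rule lead_linear, rule ballI)
  fix m assume "m : keys (affine_form (a i) ((theta ^^ i) de) i)"
  thus "wt (%i. B + i) m < B + i" using keys_affine_form[of m] that by fastforce
 qed
 have hl: "homog_lead (w i) (w' i) 1" for i
 proof -
  have "tdeg k = 1" if "k : keys (w' i)" for k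
  proof -
   have "k : keys (single (unit_exp i) ga) |
     k : keys (SUM j<i. single (unit_exp j) (a i j))"
    using subsetD[OF Poly_Mapping.keys_add that[unfolded w'_def]] by (simp add: affine_form_def)
   thus ?thesis
   proof
    assume "k : keys (single (unit_exp i) ga)"
    thus ?thesis by (auto split: if_splits)
   next
    assume "k : keys (SUM j<i. single (unit_exp j) (a i j))"
    from subsetD[OF keys_sum_subset this] show ?thesis by (auto split: if_splits)
   qed
  qed
  moreover have "w i - w' i = single 0 ((theta ^^ i) de)"
   by (simp add: w_def w'_def affine_form_def)
  ultimately show ?thesis by (auto simp: homog_lead_def split: if_splits)
 qed
 from minimal_relation[of v ga w "%i. 1 + i"] alg ga wK wv lead[of 1]
 have "EX P M. coeffs_in ratfun P & mpeval P v = 0 & lookup P M = 1 &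
  (ALL m:keys P. wt (%i. 1 + i) m<=wt (%i. 1 + i) M) &
  poly_subst dil P w = single 0 (ga^tdeg M)*P"
  by (simp add: Dalg_def v_def[abs_def])
 then obtain P M where PM: "coeffs_in ratfun P & mpeval P v = 0 & lookup P M = 1 &
  (ALL m:keys P. wt (%i. 1 + i) m<=wt (%i. 1 + i) M) &
  poly_subst dil P w = single 0 (ga^tdeg M)*P" by (elim exE)
 define D where "D = tdeg M"
 have P: "coeffs_in ratfun P" "mpeval P v = 0" "lookup P M = 1"
   and sub: "poly_subst dil P w = single 0 (ga^D)*P"
  using PM by (simp_all add: D_def)
 have lK: "lookup P m : ratfun" for m using P(1) by (simp add: coeffs_in_def)
 have "P~=0" using P(3) by auto
 \<comment> \<open>With \<open>B\<close> large the heaviest monomial \<open>N\<close> has maximal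
   total degree; its coefficient satisfies a homogeneous equation that forces this degree to be
   \<open>D\<close>.\<close>
 have degP: "tdeg m<=D" if m: "m : keys P" for m
 proof -
  define B where "B = Suc (SUM m:keys P. wt (%i. i) m)"
  have B: "wt (%i. i) m < B" if "m : keys P" for m
   using member_le_sum[of m "keys P" "wt (%i. i)"] that by (simp add: B_def)
  obtain N where N: "N : keys P" "!!m. m : keys P ==> wt (%i. B + i) m<=wt (%i. B + i) N"
   using ex_top_wt[OF `P~=0`, of "%i. B + i"] by blast
  have "lookup (poly_subst dil P w) N = dil (lookup P N)*moneval N (%_. ga)"
   by (rule lookup_poly_subst_top[OF lead N(2)]) (auto simp: B_def)
  hence "dil (lookup P N) * ga^tdeg N = ga^D*lookup P N"
   unfolding sub lookup_single_0_mult moneval_const by simp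
  hence "tdeg N = D" using nontele_degree[OF nt ga(2) lK] N(1) by (simp add: in_keys_iff)
  hence "B*tdeg m + wt (%i. i) m < B*D + B"
   using N(2)[OF m] B[OF N(1)] by (simp add: wt_shift)
  hence "B*tdeg m < B*Suc D" by simp
  thus ?thesis by (simp only: mult_less_cancel1 less_Suc_eq_le)
 qed
 obtain U where U: "dil U = U + theta ga/ga" using ex_log_solution[OF reg] by blast
 define x where "x = log_jet U"
 have indep: "~ rat.alg_dep (%i. x (Suc i))" unfolding x_def
  by (rule log_jet_indep[OF nt _ U]) (intro rat.divide_in theta_ratfun ga)
 have w'x: "mpeval (w' i) x = ga*dil (x i)" for i
 proof -
  have "(SUM j<=i. of_nat (i choose j)*(theta ^^ j) ga*log_jet U (i - j)) =
    (SUM j<=i. of_nat (i choose j)*(theta ^^ (i - j)) ga*log_jet U j)"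
   by (rule sum.reindex_bij_witness[of _ "%j. i - j" "%j. i - j"]) (auto simp: binomial_symmetric[symmetric])
  also have "... = (SUM j<i. a i j*x j) + ga*x i"
   unfolding lessThan_Suc_atMost[symmetric] sum.lessThan_Suc by (simp add: a_def x_def)
  finally show ?thesis unfolding x_def dil_log_jet[OF U ga(2)] w'_def mpeval_add mpeval_affine_form
   by (simp add: x_def)
 qed
 \<comment> \<open>The value of the top part on a solution of the homogeneous equation, divided by
   the D-th power of that solution. This normalisation turns semi-invariance into
   invariance.\<close>
 define E where "E = mpeval (homog_part D P) x"
 have "dil E = E"
 proof -
  have "ga^D*E = mpeval (homog_part D (poly_subst dil P w)) x"
  proof -
   have "homog_part D (single 0 (ga^D)*P) = single 0 (ga^D)*homog_part D P"
    by (rule poly_mapping_eqI) (simp add: lookup_homog_part lookup_single_0_mult)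
   thus ?thesis unfolding sub by (simp add: mpeval_mult E_def)
  qed
  also have "... = mpeval (poly_subst dil (homog_part D P) w') x"
   by (simp add: homog_part_poly_subst[OF hl degP])
  also have "... = (SUM m:keys (homog_part D P). ga^D*(dil (lookup (homog_part D P) m)*moneval m (%i. dil (x i))))"
   unfolding mpeval_poly_subst
  proof (intro sum.cong refl)
   fix m assume "m : keys (homog_part D P)"
   hence "tdeg m = D" by (simp add: keys_homog_part)
   hence "moneval m (%i. mpeval (w' i) x) = ga^D*moneval m (%i. dil (x i))"
    unfolding w'x using moneval_const[of m ga] by (simp add: moneval_def power_mult_distrib prod.distrib)
   thus "dil (lookup (homog_part D P) m)*moneval m (%i. mpeval (w' i) x) =
     ga^D*(dil (lookup (homog_part D P) m)*moneval m (%i. dil (x i)))"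
    by (simp only: mult_ac)
  qed
  also have "... = ga^D*dil E" unfolding E_def sig_mpeval by (simp add: sum_distrib_left)
  finally show ?thesis using ga(2) by simp
 qed
 then obtain ep where ep: "E = fls_const ep" using dil_fixed by blast
 \<comment> \<open>The monomial subtracted takes the value \<open>ep\<close> at \<open>x\<close>,
   since \<open>x 0 = 1\<close>. What remains is a homogeneous relation between independent
   jets.\<close>
 have PD: "homog_part D P = single (single 0 D) (fls_const ep)"
 proof -
  let ?Q = "homog_part D P - single (single 0 D) (fls_const ep)"
  have "?Q = 0"
  proof (rule homog_relation_zero[OF indep])
   show "x 0 = 1" by (simp add: x_def)
   show "coeffs_in ratfun ?Q"
    by (intro rat.coeffs_in_diff rat.coeffs_in_single ratfun_const)
      (use P(1) in "auto simp: coeffs_in_def lookup_homog_part")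
   show "mpeval ?Q x = 0" using ep by (simp add: mpeval_diff E_def x_def)
   fix m assume m: "m : keys ?Q"
   show "tdeg m = D"
   proof (rule ccontr)
    assume "tdeg m~=D"
    moreover have "m~=single 0 D" using `tdeg m~=D` by auto
    ultimately show False using m by (auto simp: in_keys_iff lookup_minus lookup_homog_part lookup_single)
   qed
  qed
  thus ?thesis by simp
 qed
 have M: "M = single 0 D" and eps1: "ep = 1"
 proof -
  have "lookup (homog_part D P) M = 1" by (simp add: lookup_homog_part D_def P(3))
  hence 1: "(if single 0 D = M then fls_const ep else 0) = 1"
   by (simp add: PD lookup_single when_def)
  show M: "M = single 0 D" using 1 by (auto split: if_splits)
  have "fls_const ep = 1" using 1 M by simp
  from arg_cong[OF this, of "%f. fls_nth f 0"] show "ep = 1" by simp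
 qed
 define X where "X = single (single (0::nat) D) (1 :: complex fls)"
 define P' where "P' = P - X"
 have PX: "P = P' + X" by (simp add: P'_def)
 have lP': "lookup P' m = (if tdeg m = D then 0 else lookup P m)" for m
 proof -
  have "lookup P' m = lookup P m - lookup X m"
   by (simp add: P'_def lookup_minus)
  moreover have "lookup P m = lookup X m" if "tdeg m = D"
   using arg_cong[OF PD, of "%p. lookup p m"] that by (simp add: lookup_homog_part X_def eps1)
  moreover have "lookup X m = 0" if "tdeg m~=D"
   using that by (auto simp: X_def lookup_single when_def)
  ultimately show ?thesis by auto
 qed
 have degP': "tdeg m < D" if "m : keys P'" for m
  using that degP[of m] by (auto simp: in_keys_iff lP' split: if_splits)
 have "D~=0"
 proof
  assume "D = 0"
  hence "P' = 0" using degP' by (metis all_not_in_conv keys_eq_empty less_zeroE)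
  hence "mpeval P v = 1" using PX `D = 0` by (simp add: X_def)
  thus False using P(2) by simp
 qed
 \<comment> \<open>The defect of the leading term: with X_0 for the variable 0 it is (ga X_0 + de)^D
   - ga^D X_0^D.\<close>
 define Z where "Z = w 0^D - single 0 (ga^D)*X"
 have w0: "w 0 = single (unit_exp 0) ga + single 0 de"
  by (simp add: w_def affine_form_def)
 have key: "single 0 (ga^D)*P' = poly_subst dil P' w + Z"
 proof -
  have "poly_subst dil P w = poly_subst dil P' w + w 0^D"
   unfolding PX poly_subst_add[of dil, OF dil_add sig_0] X_def poly_subst_single[of dil, OF sig_0] by simp
  thus ?thesis using sub unfolding Z_def PX by (simp add: algebra_simps)
 qed
 have Zkey: "EX j. k = single 0 j" if "k : keys Z" for k
 proof -
  have "k : keys (w 0^D) | k : keys X"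
   using that by (auto simp: Z_def in_keys_iff lookup_minus lookup_single_0_mult)
  thus ?thesis
  proof
   assume "k : keys (w 0^D)"
   thus ?thesis
   proof (rule keys_single_var_power[rotated])
    fix k assume "k : keys (w 0)"
    hence "k : keys (single (unit_exp 0) ga) | k : keys (single 0 de)"
     using subsetD[OF Poly_Mapping.keys_add, of k] unfolding w0 by blast
    hence "k = unit_exp 0 | k = single 0 0" by (auto split: if_splits)
    thus "EX j. k = single 0 j" by blast
   qed
  qed (auto simp: X_def)
 qed
 have Z1: "lookup Z (single 0 (D - 1)) = of_nat D * ga^(D - 1) * de"
 proof -
  let ?N = "single 0 (D - 1) :: nat \<Rightarrow>\<^sub>0 nat"
  have e: "single 0 D = ?N + unit_exp 0"
  proof -
   have "single 0 D = (single 0 (D - 1 + 1) :: nat \<Rightarrow>\<^sub>0 nat)" using `D~=0` by simp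
   also have "... = ?N + unit_exp 0" by (rule single_add)
   finally show ?thesis .
  qed
  have "lookup (moneval (single 0 D) (%i. single (unit_exp i) ga + single 0 de)) ?N
    = of_nat (lookup (single 0 D :: nat \<Rightarrow>\<^sub>0 nat) 0) * ga^tdeg ?N * de"
   by (rule conjunct1[OF lookup_prod_affine, rule_format, OF _ e]) (use `D~=0` in simp)
  hence "lookup (w 0^D) ?N = of_nat D * ga^(D - 1) * de" by (simp add: w0)
  moreover have "lookup X ?N = 0"
  proof -
  have "single 0 D~=?N"
  proof
   assume "single 0 D = ?N"
   from arg_cong[OF this, of tdeg] show False using `D~=0` by simp
  qed
  thus ?thesis by (simp add: X_def lookup_single when_def)
  qed
  ultimately show ?thesis by (simp add: Z_def lookup_minus lookup_single_0_mult)
 qed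
 have Dnz: "of_nat D~=(0 :: complex fls)" using char0[of "D - 1"] `D~=0` by simp
 have Z0: "Z = 0" if "de = 0"
 proof -
  have "single (unit_exp 0) ga^n = single (single 0 n) (ga^n)" for n
  proof (induction n)
   case (Suc n)
   have "unit_exp 0 + single 0 n = single 0 (Suc n)"
    unfolding single_add[symmetric] by (simp only: plus_1_eq_Suc)
   thus ?case unfolding power_Suc Suc mult_single by (simp only:)
  qed simp
  thus ?thesis unfolding Z_def w0 that X_def by (simp add: mult_single del: single_one)
 qed
 show ?thesis
 \<comment> \<open>If \<open>P'\<close> vanishes, the relation itself reads G^D = 0.\<close>
 proof (cases "P' = 0")
  case True
  hence "Z = 0" using key by (simp add: poly_subst_def)
  hence "de = 0" using Z1 Dnz ga(2) by simp
  moreover have "G = 0" using P(2) True `D~=0` by (simp add: PX X_def v_def)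
  ultimately show ?thesis by (auto intro!: bexI[of _ 0])
 next
  case False
  define B where "B = Suc (SUM m:keys P'. wt (%i. i) m)"
  have B1: "B>=1" by (simp add: B_def)
  obtain N where N: "N : keys P'" "!!m. m : keys P' ==> wt (%i. B + i) m<=wt (%i. B + i) N"
   using ex_top_wt[OF False, of "%i. B + i"] by blast
  define j where "j = tdeg N"
  have jD: "j < D" using degP'[OF N(1)] by (simp add: j_def)
  have look: "ga^D*lookup P' K = dil (lookup P' K) * ga^tdeg K + lookup Z K"
   if "wt (%i. B + i) K>=wt (%i. B + i) N" for K
  proof -
   have "lookup (poly_subst dil P' w) K = dil (lookup P' K)*moneval K (%_. ga)"
    by (rule lookup_poly_subst_top[OF lead[OF B1] N(2) that]) auto
   thus ?thesis using arg_cong[OF key, of "%p. lookup p K"]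
    by (simp add: lookup_add lookup_single_0_mult moneval_const)
  qed
  define p where "p = lookup P' N"
  have p: "p~=0" "p : ratfun" using N(1) lK by (auto simp: p_def in_keys_iff lP')
  have no: False if "lookup Z N = 0"
  proof -
   have "dil p * ga^j = ga^D*p" using look[of N] that by (simp add: p_def j_def)
   from nontele_degree[OF nt ga(2) p(2,1) this] jD show False by simp
  qed
  hence "N : keys Z" by (auto simp: in_keys_iff)
  then obtain j' where "N = single 0 j'" using Zkey by blast
  hence N0: "N = single 0 j" by (simp add: j_def)
  have "de~=0" using no Z0 by auto
  \<comment> \<open>Otherwise the power \<open>D - 1\<close> of the variable 0 outweighs all of
    \<open>P'\<close>, and comparing coefficients there would kill a nonzero multiple of
    \<open>de\<close>.\<close>
  have "j = D - 1"
  proof (rule ccontr)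
   assume "j~=D - 1"
   hence lt: "j < D - 1" using jD by simp
   let ?K = "single 0 (D - 1) :: nat \<Rightarrow>\<^sub>0 nat"
   have gt: "wt (%i. B + i) ?K > wt (%i. B + i) N" using lt B1 by (simp add: N0)
   hence "lookup P' ?K = 0" using N(2)[of ?K] by (auto simp: in_keys_iff)
   hence "lookup Z ?K = 0" using look[of ?K] gt by simp
   thus False using Z1 Dnz ga(2) `de~=0` by simp
  qed
  hence "ga^D*p = dil p * ga^(D - 1) + of_nat D * ga^(D - 1) * de"
   using look[of N] Z1 by (simp add: p_def j_def[symmetric] N0)
  moreover have "ga^D = ga * ga^(D - 1)" using `D~=0` by (cases D) auto
  ultimately have "ga*p * ga^(D - 1) = (dil p + of_nat D * de) * ga^(D - 1)"
   by (simp add: algebra_simps)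
  hence eq: "ga*p = dil p + of_nat D * de" using ga(2) by simp
  \<comment> \<open>Division by the integer \<open>- D\<close> turns the coefficient equation into
    the original inhomogeneous one.\<close>
  define p' where "p' = - (p / of_nat D)"
  have "dil p' = - (dil p / of_nat D)" by (simp add: p'_def sig_uminus sig_divide sig_of_nat)
  also have "dil p = ga*p - of_nat D * de" using eq by simp
  also have "- ((ga*p - of_nat D * de) / of_nat D) = ga*p' + de"
   using Dnz by (simp add: p'_def field_simps)
  finally have "dil p' = ga*p' + de" .
  moreover have "p' : ratfun" unfolding p'_def by (intro rat.uminus_in rat.divide_in rat.of_nat_in p)
  ultimately show ?thesis using `de~=0` by blast
 qed
qed

end

subsection \<open>Logarithmic derivatives of products of linear factors\<close>

definition lin :: "complex => complex fls" where "lin z = toR [:-z,1:]"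
definition dlog :: "complex => complex fls" where "dlog z = fls_X/lin z"

lemma lin_eq: "lin z = fls_X - fls_const z"
 by (simp add: lin_def toR_pCons flip: fls_const_uminus)

lemma lin_nz [simp]: "lin z~=0" by (simp add: lin_def)
lemma lin_ratfun: "lin z : ratfun" unfolding lin_def by (rule ratfun_toR)
lemma dlog_ratfun: "dlog z : ratfun" unfolding dlog_def by (intro rat.divide_in ratfun_X lin_ratfun)

lemma theta_lin: "theta (lin z) = fls_X" by (simp add: lin_eq theta_diff)

lemma pole_eq_inverse_lin: "pole_eq z 1 (inverse (lin z))"
 by (rule pole_eqI[of 1 _ 1]) (auto simp: lin_def)

lemma pole_le_inverse_toR: "poly p z~=0 ==> pole_le z 0 (inverse (toR p))"
 by (rule pole_leI[of p _ _ _ 1]) (auto intro!: left_inverse)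

lemma pole_le_X: "pole_le z 0 fls_X"
 using pole_le_toR[of z "[:0,1:]"] by (simp add: toR_pCons)

lemma pole_eq_X: "z~=0 ==> pole_eq z 0 fls_X"
 using pole_eq_toR[of "[:0,1:]" z] by (simp add: toR_pCons)

lemma pole_eq_dlog: "z~=0 ==> pole_eq z 1 (dlog z)"
 unfolding dlog_def divide_inverse using pole_eq_mult[OF pole_eq_X pole_eq_inverse_lin] by simp

lemma pole_le_dlog: "z~=u ==> pole_le z 0 (dlog u)"
 unfolding dlog_def divide_inverse lin_def
 using pole_le_mult[OF pole_le_X pole_le_inverse_toR, of "[:-u,1:]" z] by simp

lemma dlog_nth: "z~=0 ==> n<=0 ==> fls_nth (dlog z) n = 0"
proof -
 assume "z~=0" "n<=0"
 have 0: "fls_subdegree (lin z) = 0"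
  unfolding lin_def toR_def fls_subdegree_fls_to_fps using `z~=0` by (simp add: subdegree_eq_0)
 have "fls_subdegree (dlog z) = 1"
  unfolding dlog_def by (subst fls_divide_subdegree) (auto simp: 0)
 thus ?thesis using `n<=0` by simp
qed

context qdil
begin

lemma dil_dlog: "dil (dlog (z*q)) = dlog z"
proof -
 have "dil (lin (z*q)) = fls_const q*lin z"
  unfolding lin_eq sig_diff dil_X dil_const by (simp add: right_diff_distrib mult.commute)
 thus ?thesis by (simp add: dlog_def sig_divide)
qed

lemma dlog_shift_nat: "EX H:ratfun. dlog z = dlog (z*q^n) + (dil H - H)"
proof (induction n)
 case 0
 show ?case by (rule bexI[of _ 0]) (auto simp: rat.zero_in)
next
 case (Suc n)
 then obtain H where H: "H : ratfun" "dlog z = dlog (z*q^n) + (dil H - H)" by blast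
 let ?H = "H + dlog (z*q^Suc n)"
 have "dlog (z*q^n) = dil (dlog (z*q^Suc n))"
  using dil_dlog[of "z*q^n"] by (simp add: mult_ac)
 hence "dlog z = dlog (z*q^Suc n) + (dil ?H - ?H)" using H(2) by (simp add: dil_add)
 thus ?case using H(1) dlog_ratfun by (intro bexI[of _ ?H]) (auto intro: rat.add_in)
qed

definition in_orbit :: "complex => complex => bool" where
 "in_orbit z0 z \<longleftrightarrow> (EX n::int. z = z0*q powi n)"

text \<open>Moving a pole one step along its orbit changes \<open>dlog\<close> by a coboundary, so
  modulo coboundaries only the orbit counts.\<close>

lemma dlog_shift:
 assumes "in_orbit z0 z"
 shows "EX H:ratfun. dlog z = dlog z0 + (dil H - H)"
proof -
 obtain n where n: "z = z0*q powi n" using assms by (auto simp: in_orbit_def)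
 show ?thesis
 proof (cases "n>=0")
  case True
  define m where "m = nat n"
  have "z = z0*q^m" using n True by (simp add: m_def power_int_def)
  with dlog_shift_nat[of z0 m] obtain H where H: "H : ratfun" "dlog z0 = dlog z + (dil H - H)" by auto
  thus ?thesis by (intro bexI[of _ "- H"]) (auto simp: sig_uminus intro: rat.uminus_in)
 next
  case False
  define m where "m = nat (-n)"
  have "z0 = z*q^m" using n False by (simp add: m_def power_int_def field_simps)
  with dlog_shift_nat[of z m] show ?thesis by auto
 qed
qed

text \<open>Modulo coboundaries all poles on the orbit of \<open>z0\<close> are collected at
  \<open>z0\<close>, and the remainder \<open>R\<close> has no pole on that orbit. A nonzero net
  multiplicity leaves an isolated simple pole.\<close>

lemma nontele_dlog_sum:
 fixes xs :: "(complex \<times> int) list"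
 assumes z0: "z0~=0"
  and sum: "(\<Sum>(z, e)\<leftarrow>xs. if in_orbit z0 z then e else 0)~=0"
 shows "nontele (\<Sum>(z, e)\<leftarrow>xs. fls_const (of_int e)*dlog z)"
proof -
 have dec: "EX R H. R : ratfun & H : ratfun & (ALL n. pole_le (z0*q powi n) 0 R) &
   (\<Sum>(z, e)\<leftarrow>xs. fls_const (of_int e)*dlog z) =
    fls_const (of_int (\<Sum>(z, e)\<leftarrow>xs. if in_orbit z0 z then e else 0))*dlog z0 + R + (dil H - H)"
  for xs :: "(complex \<times> int) list"
 proof (induction xs)
  case Nil
  show ?case by (rule exI[of _ 0], rule exI[of _ 0]) (auto simp: rat.zero_in pole_le_0)
 next
  case (Cons x xs)
  obtain z e where x: "x = (z, e)" by (cases x)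
  obtain R H where RH: "R : ratfun" "H : ratfun" "!!n. pole_le (z0*q powi n) 0 R"
    "(\<Sum>(z, e)\<leftarrow>xs. fls_const (of_int e)*dlog z) =
     fls_const (of_int (\<Sum>(z, e)\<leftarrow>xs. if in_orbit z0 z then e else 0))*dlog z0 + R + (dil H - H)"
   using Cons.IH by blast
  define m where "m = (\<Sum>(z, e)\<leftarrow>xs. if in_orbit z0 z then e else 0)"
  show ?case
  proof (cases "in_orbit z0 z")
   case True
   obtain H' where H': "H' : ratfun" "dlog z = dlog z0 + (dil H' - H')" using dlog_shift[OF True] by blast
   let ?H = "H + fls_const (of_int e)*H'"
   have 1: "fls_const (of_int (e + m)) = fls_const (of_int e) + fls_const (of_int m :: complex)"
    by (simp flip: fls_plus_const)
   have "(\<Sum>(z, e)\<leftarrow>x # xs. fls_const (of_int e)*dlog z) = fls_const (of_int e)*dlog z +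
     (fls_const (of_int m)*dlog z0 + R + (dil H - H))"
    using RH(4) by (simp add: x m_def)
   also have "... = fls_const (of_int (e + m))*dlog z0 + R + (dil ?H - ?H)"
    unfolding 1 H'(2) dil_add dil_mult dil_const by (simp add: algebra_simps)
   finally have "(\<Sum>(z, e)\<leftarrow>x # xs. fls_const (of_int e)*dlog z) =
     fls_const (of_int (\<Sum>(z, e)\<leftarrow>x # xs. if in_orbit z0 z then e else 0))*dlog z0 + R + (dil ?H - ?H)"
    using True by (simp add: x m_def)
   moreover have "?H : ratfun" by (intro rat.add_in rat.mult_in ratfun_const RH H')
   ultimately show ?thesis using RH(1,3) by (intro exI[of _ R] exI[of _ ?H]) auto
  next
   case False
   let ?R = "R + fls_const (of_int e)*dlog z"
   have "(\<Sum>(z, e)\<leftarrow>x # xs. fls_const (of_int e)*dlog z) =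
     fls_const (of_int (\<Sum>(z, e)\<leftarrow>x # xs. if in_orbit z0 z then e else 0))*dlog z0 + ?R + (dil H - H)"
    using RH(4) False by (simp add: x algebra_simps)
   moreover have "?R : ratfun" by (intro rat.add_in rat.mult_in ratfun_const RH dlog_ratfun)
   moreover have "pole_le (z0*q powi n) 0 ?R" for n
    using False by (intro pole_le_add RH pole_le_cmult pole_le_dlog) (auto simp: in_orbit_def)
   ultimately show ?thesis using RH(2) by blast
  qed
 qed
 define m where "m = (\<Sum>(z, e)\<leftarrow>xs. if in_orbit z0 z then e else 0)"
 obtain R H where RH: "R : ratfun" "H : ratfun" "!!n. pole_le (z0*q powi n) 0 R"
    "(\<Sum>(z, e)\<leftarrow>xs. fls_const (of_int e)*dlog z) = fls_const (of_int m)*dlog z0 + R + (dil H - H)"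
  using dec[of xs] m_def by blast
 have m: "m~=0" using sum by (simp add: m_def)
 have "isolated_pole z0 1 (fls_const (of_int m)*dlog z0 + R)"
  unfolding isolated_pole_def
 proof (intro conjI allI impI)
  show "pole_eq z0 1 (fls_const (of_int m)*dlog z0 + R)"
   using RH(3)[of 0] m z0 by (intro pole_eq_add[where j = 0] pole_eq_cmult pole_eq_dlog) auto
  show "pole_le (z0*q powi n) (1 - 1) (fls_const (of_int m)*dlog z0 + R)" if "n~=0" for n
  proof -
   have "z0*q powi n~=z0" using q_powi_inj[OF z0, of n 0] that by auto
   thus ?thesis using RH(3)[of n] by (auto intro!: pole_le_add pole_le_cmult pole_le_dlog)
  qed
 qed (use z0 in auto)
 from nontele_coboundary[OF isolated_pole_nontele[OF this] RH(4,2)] show ?thesis .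
qed

lemma theta_log_mult:
 "f~=0 ==> g~=0 ==> theta (f*g)/(f*g) = theta f/f + theta g/g"
 by (simp add: theta_mult field_simps)

lemma theta_log_inverse: "f~=0 ==> theta (inverse f)/inverse f = - (theta f/f)"
 unfolding theta_inverse divide_inverse by (simp add: power2_eq_square)

text \<open>The coefficient of the \<open>q\<close>-difference equation, in terms of the roots of \<open>n\<^sub>A\<close> and \<open>n\<^sub>B\<close>.\<close>

definition gam :: "complex => complex => complex => complex => complex fls" where
 "gam p1 p2 r1 r2 = fls_const (p1*p2/(r1*r2))*(lin (1/p1)*lin (1/p2)*lin r1*lin r2) *
   inverse (lin p1*lin p2*lin (1/r1)*lin (1/r2))"

lemma gam_ratfun: "gam p1 p2 r1 r2 : ratfun"
 unfolding gam_def by (intro rat.mult_in rat.inverse_in lin_ratfun ratfun_const)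

lemma gam_nz: "p1~=0 ==> p2~=0 ==> r1~=0 ==> r2~=0 ==> gam p1 p2 r1 r2~=0"
 by (simp add: gam_def)

lemma gam_dlog:
 assumes nz: "p1~=0" "p2~=0" "r1~=0" "r2~=0"
 shows "theta (gam p1 p2 r1 r2)/gam p1 p2 r1 r2 =
  (\<Sum>(z, e)\<leftarrow>[(1/p1, 1), (1/p2, 1), (r1, 1), (r2, 1), (p1, -1), (p2, -1), (1/r1, -1), (1/r2, -1)].
    fls_const (of_int e)*dlog z)"
proof -
 have c: "fls_const (p1*p2/(r1*r2))~=0" using nz by simp
 have l: "theta (lin z)/lin z = dlog z" for z by (simp add: dlog_def theta_lin)
 show ?thesis unfolding gam_def
  using c by (simp add: theta_log_mult theta_log_inverse l fls_const_minus_1 del: fls_const_eq_0_iff)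
qed

lemma gam_dlog_nth:
 assumes nz: "p1~=0" "p2~=0" "r1~=0" "r2~=0" and n: "n<=0"
 shows "fls_nth (theta (gam p1 p2 r1 r2)/gam p1 p2 r1 r2) n = 0"
 unfolding gam_dlog[OF nz] using dlog_nth[OF _ n] nz by simp

lemma gam_nontele:
 assumes nz: "p1~=0" "p2~=0" "r1~=0" "r2~=0" and z0: "z0~=0"
  and "o\<^sub>z = (%z. if in_orbit z0 z then 1 else 0 :: int)"
  and "o\<^sub>z (1/p1) + o\<^sub>z (1/p2) + o\<^sub>z r1 + o\<^sub>z r2 - o\<^sub>z p1 - o\<^sub>z p2 - o\<^sub>z (1/r1) - o\<^sub>z (1/r2)~=0"
 shows "nontele (theta (gam p1 p2 r1 r2)/gam p1 p2 r1 r2)"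
 unfolding gam_dlog[OF nz]
proof (rule nontele_dlog_sum[OF z0])
 have e: "(if P then - 1 else 0) = - (if P then 1 else 0 :: int)" for P by simp
 have "(\<Sum>(z, e)\<leftarrow>[(1/p1, 1), (1/p2, 1), (r1, 1), (r2, 1), (p1, - 1), (p2, - 1), (1/r1, - 1), (1/r2, - 1)].
   if in_orbit z0 z then e else 0) =
  o\<^sub>z (1/p1) + o\<^sub>z (1/p2) + o\<^sub>z r1 + o\<^sub>z r2 - o\<^sub>z p1 - o\<^sub>z p2 - o\<^sub>z (1/r1) - o\<^sub>z (1/r2)"
  unfolding assms(6) by (simp add: e split del: if_split)
 thus "(\<Sum>(z, e)\<leftarrow>[(1/p1, 1 :: int), (1/p2, 1), (r1, 1), (r2, 1), (p1, - 1), (p2, - 1), (1/r1, - 1), (1/r2, - 1)].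
   if in_orbit z0 z then e else 0)~=0"
  using assms(7) by (simp only: not_False_eq_True)
qed

end

subsection \<open>Absence of rational solutions\<close>

text \<open>The roots of the denominator are divided out one at a time: without a pole at a root,
  the numerator vanishes there too.\<close>

lemma no_poles_imp_poly:
 assumes "p : ratfun" "!!z. pole_le z 0 p"
 shows "EX N. p = toR N"
proof -
 obtain N D where "D~=0" "p*toR D = toR N" using assms(1) by (auto simp: ratfun_def)
 thus ?thesis
 proof (induction "degree D" arbitrary: N D rule: less_induct)
  case less
  show ?case
  proof (cases "degree D = 0")
   case True
   then obtain d where d: "D = [:d:]" "d~=0" using less.prems(1) by (metis degree_eq_zeroE pCons_0_0)
   have "p = toR (smult (1/d) N)"
    using less.prems(2) d by (simp add: toR_const toR_smult field_simps flip: less.prems(2) fls_const_mult_const)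
      (simp add: mult.assoc[symmetric])
   thus ?thesis by blast
  next
   case False
   then obtain z where z: "poly D z = 0"
    using alg_closed_imp_poly_has_root[of D] by auto
   obtain N' D' where *: "poly D' z~=0" "p*toR D' = toR N'" using assms(2)[of z] unfolding pole_le_def by auto
   have "toR (N*D') = p*toR D*toR D'" by (simp add: toR_mult less.prems)
   also have "... = (p*toR D')*toR D" by (simp only: mult_ac)
   also have "... = toR (N'*D)" unfolding *(2) by (simp add: toR_mult)
   finally have "N*D' = N'*D" by simp
   hence "poly (N*D') z = 0" using z by simp
   hence "poly N z = 0" using *(1) by simp
   then obtain N1 D1 where 1: "N = [:-z,1:]*N1" "D = [:-z,1:]*D1"
    using z by (metis poly_eq_0_iff_dvd dvdE)
   have "D1~=0" using 1(2) less.prems(1) by auto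
   have "degree D = Suc (degree D1)" unfolding 1(2) using `D1~=0` by (subst degree_mult_eq) auto
   moreover have "toR [:-z,1:]*(p*toR D1) = toR [:-z,1:]*toR N1"
    using less.prems(2) unfolding 1 toR_mult by (simp only: mult_ac)
   hence "p*toR D1 = toR N1" by (subst (asm) mult_left_cancel) auto
   ultimately show ?thesis using less.hyps[of D1 N1] `D1~=0` by simp
  qed
 qed
qed

lemma laurent_polynomial:
 assumes p: "p : ratfun" "!!z. z~=0 ==> pole_le z 0 p"
 shows "EX N k. p*fls_X^k = toR N & (k = 0 | poly N 0~=0)"
proof -
 define k where "k = pole_order 0 p"
 have X: "fls_X = toR [:0,1:]" by (simp add: toR_pCons)
 obtain N0 D0 where *: "poly D0 0~=0" "p*toR D0*toR [:-0,1:]^k = toR N0" "k = 0 | poly N0 0~=0"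
 proof (cases "k = 0")
  case True
  with pole_order_le[OF p(1), of 0] that show ?thesis unfolding pole_le_def k_def by auto
 next
  case False
  with pole_order_eq[OF p(1), of 0] that show ?thesis unfolding pole_eq_def k_def by auto
 qed
 have "p*fls_X^k : ratfun" by (intro rat.mult_in p rat.power_in ratfun_X)
 moreover have "pole_le z 0 (p*fls_X^k)" for z
 proof (cases "z = 0")
  case True
  thus ?thesis using*by (intro pole_leI[of D0 _ _ _ N0]) (auto simp: X mult_ac)
 next
  case False
  have "pole_le z 0 (fls_X^k)" unfolding X toR_power[symmetric] by (rule pole_le_toR)
  thus ?thesis using pole_le_mult[OF p(2)[OF False], of 0] by simp
 qed
 ultimately obtain N where N: "p*fls_X^k = toR N" using no_poles_imp_poly by blast
 have "toR (N*D0) = toR N0" unfolding toR_mult N[symmetric] using *(2) by (simp add: X mult_ac)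
 hence "N*D0 = N0" by simp
 hence "poly N 0~=0" if "poly N0 0~=0" using that by auto
 thus ?thesis using N *(3) by blast
qed

context qdil
begin

text \<open>On an orbit with poles, the leftmost pole, moved back one step by \<open>dil\<close>,
  must meet a zero of \<open>al1\<close>, and the rightmost one a zero of \<open>al2\<close>, unless
  \<open>be\<close> interferes; \<open>bad\<close> vanishes wherever \<open>be\<close> may have a
  pole. The second point is a positive power of \<open>q\<close> times the first, and
  \<open>chain\<close> excludes this.\<close>

lemma chain_no_poles:
 assumes p: "p : ratfun" and eq: "toR al1*dil p = toR al2*p + be" and be: "!!u. u~=0 ==> bad u~=0 ==> pole_le u 0 be"
  and chain: "!!u v m. u~=0 ==> poly al1 u = 0 | bad u = 0 ==> poly al2 v = 0 | bad v = 0 ==> m>=1 ==> v~=q^m*u"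
  and z: "z~=0"
 shows "pole_le z 0 p"
proof (rule ccontr)
 assume np: "~ pole_le z 0 p"
 define P where "P n = pole_order (z*q powi n) p" for n
 define A where "A = {n. P n~=0}"
 have finA: "finite A" unfolding A_def P_def by (rule finite_orbit_poles[OF p z])
 have "P 0~=0" unfolding P_def using np pole_order_0D[OF p, of z] by auto
 hence ne: "A~={}" by (auto simp: A_def)
 define n1 where "n1 = Max A"
 define n0 where "n0 = Min A"
 have 1: "P n1~=0" "P (n1 + 1) = 0"
  using Max_in[OF finA ne] Max_ge[OF finA, of "n1 + 1"] by (auto simp: A_def n1_def)
 have 0: "P n0~=0" "P (n0 - 1) = 0"
  using Min_in[OF finA ne] Min_le[OF finA, of "n0 - 1"] by (auto simp: A_def n0_def)
 have le: "n0<=n1" using finA ne by (simp add: n0_def n1_def)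
 have step: "q*(z*q powi n) = z*q powi (n + 1)" for n
  by (simp add: power_int_add mult_ac)
 have nz: "z*q powi n~=0" for n using z by simp
 \<comment> \<open>At \<open>u\<close>, one step before the leftmost pole, \<open>dil p\<close> has
   a pole and \<open>p\<close> has none; at the rightmost pole \<open>v\<close> it is the other way
   round.\<close>
 define u where "u = z*q powi (n0 - 1)"
 define v where "v = z*q powi n1"
 have "poly al1 u = 0 | bad u = 0"
 proof (rule ccontr)
  assume no: "~ (poly al1 u = 0 | bad u = 0)"
  have ek: "pole_eq (z*q powi n0) (P n0) p" unfolding P_def
   by (rule pole_order_eq[OF p]) (use 0(1) P_def in simp)
  have "pole_eq u (P n0) (dil p)" unfolding u_def
   by (rule pole_eq_dil) (use ek in "simp only: step, simp")
  hence "pole_eq u (P n0) (toR al1*dil p)"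
   using pole_eq_mult[OF pole_eq_toR, of al1 u "P n0" "dil p"] no by simp
  moreover have "pole_le u 0 (toR al2*p + be)"
  proof -
   have "pole_le u 0 p" using pole_order_0D[OF p] 0(2) by (simp add: P_def u_def)
   thus ?thesis using pole_le_mult[OF pole_le_toR, of u 0 p al2] be[of u] no nz[of "n0 - 1"]
    by (intro pole_le_add) (auto simp: u_def)
  qed
  ultimately show False using pole_eq_not_le[of u "P n0" _ 0] 0(1) by (simp add: eq)
 qed
 moreover have "poly al2 v = 0 | bad v = 0"
 proof (rule ccontr)
  assume no: "~ (poly al2 v = 0 | bad v = 0)"
  have "pole_eq v (P n1) p" unfolding P_def v_def
   by (rule pole_order_eq[OF p]) (use 1(1) P_def in simp)
  hence "pole_eq v (P n1) (toR al2*p)"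
   using pole_eq_mult[OF pole_eq_toR, of al2 v "P n1" p] no by simp
  moreover have "pole_le v 0 (toR al1*dil p - be)"
  proof -
   have "pole_le (z*q powi (n1 + 1)) 0 p" using pole_order_0D[OF p] 1(2) by (simp add: P_def)
   hence "pole_le v 0 (dil p)" unfolding v_def by (intro pole_le_dil) (simp only: step)
   thus ?thesis using pole_le_mult[OF pole_le_toR, of v 0 "dil p" al1] be[of v] no nz[of n1]
    by (intro pole_le_diff) (auto simp: v_def)
  qed
  ultimately show False using pole_eq_not_le[of v "P n1" _ 0] 1(1) by (simp add: eq)
 qed
 moreover have "v = q^nat (n1 - n0 + 1)*u"
 proof -
  have "q^nat (n1 - n0 + 1) = q powi (n1 - n0 + 1)" using le by (simp add: power_int_def)
  hence "q^nat (n1 - n0 + 1)*u = z*q powi ((n1 - n0 + 1) + (n0 - 1))"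
   unfolding u_def by (subst power_int_add) (auto simp: mult_ac)
  thus ?thesis by (simp add: v_def)
 qed
 moreover have "1<=nat (n1 - n0 + 1)" "u~=0" using le nz[of "n0 - 1"] by (auto simp: u_def)
 ultimately show False using chain[of u v "nat (n1 - n0 + 1)"] by blast
qed

text \<open>With \<open>m = n\<^sub>B p\<close> the equation forces \<open>m\<close> to be a Laurent polynomial, then a constant.\<close>

theorem no_rational_solution:
 assumes nz: "p1~=0" "p2~=0" "r1~=0" "r2~=0" "c~=0"
  and C1: "!!x y m. x : {p1, p2} ==> y : {p1, p2} ==> m>=1 ==> x*y*q^m~=1"
  and C2: "!!x y m. x : {p1, p2} ==> y : {r1, r2} ==> m>=1 ==> y~=q^m*x"
  and C3: "!!x y m. x : {r1, r2} ==> y : {r1, r2} ==> m>=2 ==> x*y~=q^m"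
  and R0: "!!m. r1*r2*q^m~=p1*p2" and rq: "r1*r2~=q" and pp: "p1*p2~=1"
  and p: "p : ratfun"
  and eq: "toR ([:-p1,1:]*[:-p2,1:]*[:1,-r1:]*[:1,-r2:])*dil p =
    toR ([:1,-p1:]*[:1,-p2:]*[:-r1,1:]*[:-r2,1:])*p +
    fls_const c*fls_X*toR ([:1,-p1:]*[:1,-p2:] - [:-p1,1:]*[:-p2,1:])"
 shows False
proof -
 \<comment> \<open>Division by \<open>fls_X\<close> absorbs the factor \<open>fls_X\<close> of the
   inhomogeneous term.\<close>
 define m where "m = toR ([:-r1,1:]*[:-r2,1:])*p/fls_X"
 define c' where "c' = c*(1 - p1*p2)"
 have c': "c'~=0" using nz pp by (simp add: c'_def)
 have mK: "m : ratfun" unfolding m_def by (intro rat.divide_in rat.mult_in ratfun_toR ratfun_X p)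
 define al1 where "al1 = [:q:]*([:-p1,1:]*[:-p2,1:]*[:1,-r1:]*[:1,-r2:])"
 define al2 where "al2 = ([:-r1,q:]*[:-r2,q:])*([:1,-p1:]*[:1,-p2:])"
 define be where "be = ([:-r1,q:]*[:-r2,q:])*[:c',0,-c':]"
 have dilr: "dil (toR ([:-r1,1:]*[:-r2,1:])) = toR ([:-r1,q:]*[:-r2,q:])"
  unfolding dil_toR by (simp add: pcompose_pCons algebra_simps)
 have E: "toR al1*dil m = toR al2*m + toR be"
 proof -
  have dm: "fls_const q*fls_X*dil m = toR ([:-r1,q:]*[:-r2,q:])*dil p"
   unfolding m_def sig_divide dil_mult dilr dil_X by (simp add: field_simps)
  have pm: "toR ([:-r1,1:]*[:-r2,1:])*p = fls_X*m" unfolding m_def times_divide_eq_right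
   by (rule nonzero_mult_div_cancel_left[symmetric]) simp
  have rhs: "fls_const c*toR ([:1,-p1:]*[:1,-p2:] - [:-p1,1:]*[:-p2,1:]) = toR [:c',0,-c':]"
  proof -
   have "[:1,-p1:]*[:1,-p2:] - [:-p1,1:]*[:-p2,1:] = [:1 - p1*p2,0,-(1 - p1*p2):]"
    by (simp add: algebra_simps)
   thus ?thesis unfolding toR_smult[symmetric] by (simp add: c'_def algebra_simps)
  qed
  have "fls_X*(toR al1*dil m) = toR ([:-p1,1:]*[:-p2,1:]*[:1,-r1:]*[:1,-r2:])*(fls_const q*fls_X*dil m)"
   unfolding al1_def toR_mult[of "[:q:]"] toR_const by (simp only: mult_ac)
  also have "... = toR ([:-r1,q:]*[:-r2,q:]) *
    (toR ([:-p1,1:]*[:-p2,1:]*[:1,-r1:]*[:1,-r2:])*dil p)"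
   unfolding dm by (simp only: mult_ac)
  also have "... = toR ([:-r1,q:]*[:-r2,q:]) *
    (toR ([:1,-p1:]*[:1,-p2:])*(toR ([:-r1,1:]*[:-r2,1:])*p) +
     fls_X*(fls_const c*toR ([:1,-p1:]*[:1,-p2:] - [:-p1,1:]*[:-p2,1:])))"
  proof -
   have "toR ([:1,-p1:]*[:1,-p2:]*[:-r1,1:]*[:-r2,1:])*p =
     toR ([:1,-p1:]*[:1,-p2:])*(toR ([:-r1,1:]*[:-r2,1:])*p)"
    by (simp only: toR_mult mult_ac)
   thus ?thesis unfolding eq by (simp only: mult_ac)
  qed
  also have "... = fls_X*(toR al2*m + toR be)"
   unfolding pm rhs al2_def be_def toR_mult[of "[:-r1,q:]*[:-r2,q:]"] by (simp only: distrib_left mult_ac)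
  finally show ?thesis by (subst (asm) mult_left_cancel) auto
 qed
 \<comment> \<open>The quadratic factor introduced with \<open>m\<close> is shifted by the dilation
   and costs one further power of \<open>q\<close>; this is why products of two of the roots
   \<open>r1\<close>, \<open>r2\<close> have to avoid \<open>q^m\<close> only for
   \<open>m>=2\<close>.\<close>
 have chain: "v~=q^n*u" if u: "u~=0" "poly al1 u = 0" and v: "poly al2 v = 0" and n: "n>=1" for u v n
 proof
  assume vu: "v = q^n*u"
  from u have "u = p1 | u = p2 | u*r1 = 1 | u*r2 = 1"
   unfolding al1_def poly_mult mult_eq_0_iff by (auto simp: add_eq_0_iff mult.commute)
  then consider (p) x where "x : {p1, p2}" "u = x" | (r) y where "y : {r1, r2}" "u*y = 1" by blast
  note cu = this
  from v have "q * v = r1 | q * v = r2 | v * p1 = 1 | v * p2 = 1"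
   unfolding al2_def poly_mult mult_eq_0_iff by (auto simp: add_eq_0_iff mult.commute)
  then consider (r) y where "y : {r1, r2}" "q * v = y" | (p) x where "x : {p1, p2}" "v * x = 1" by blast
  note cv = this
  show False
  proof (cases rule: cu)
   case (p x)
   show False
   proof (cases rule: cv)
    case (r y)
    have "y = q^Suc n*x" using r(2) vu p(2) by (simp add: mult_ac)
    thus False using C2[OF p(1) r(1), of "Suc n"] by simp
   next
    case (p x')
    have "x*x'*q^n = 1" using p(2) vu `u = x` by (simp add: mult_ac)
    thus False using C1[OF `x : {p1, p2}` p(1) n] by simp
   qed
  next
   case (r y)
   hence y0: "y~=0" by auto
   show False
   proof (cases rule: cv)
    case (r y')
    have "y*y' = (u*y)*q^Suc n" using r(2) vu by (simp add: mult_ac)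
    hence "y*y' = q^Suc n" using `u*y = 1` by simp
    thus False using C3[OF `y : {r1, r2}` r(1), of "Suc n"] n by simp
   next
    case (p x)
    have "y = y*(v * x)" using p(2) by simp
    also have "... = (u*y)*(q^n*x)" using vu by (simp add: mult_ac)
    finally have "y = q^n*x" using `u*y = 1` by simp
    thus False using C2[OF p(1) `y : {r1, r2}` n] by simp
   qed
  qed
 qed
 have "pole_le z 0 m" if "z~=0" for z
  by (rule chain_no_poles[OF mK E, where bad = "%_. 1"]) (use chain that pole_le_toR in auto)
 then obtain N k where N: "m*fls_X^k = toR N" "k = 0 | poly N 0~=0"
  using laurent_polynomial[OF mK] by blast
 have Nq: "toR (al1*pcompose N [:0,q:]) = toR (smult (q^k) (al2*N + be*[:0,1:]^k))"
 proof -
  have X: "fls_X = toR [:0,1:]" by (simp add: toR_pCons)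
  have "toR (pcompose N [:0,q:]) = dil m*(fls_const q*fls_X)^k"
   unfolding dil_toR[symmetric] N(1)[symmetric] dil_mult sig_power dil_X ..
  hence "toR (al1*pcompose N [:0,q:]) = fls_const q^k*((toR al1*dil m)*fls_X^k)"
   unfolding toR_mult by (simp only: power_mult_distrib mult_ac)
  also have "... = fls_const q^k*(toR al2*(m*fls_X^k) + toR be*fls_X^k)"
   unfolding E by (simp only: distrib_left distrib_right mult_ac)
  also have "... = toR (smult (q^k) (al2*N + be*[:0,1:]^k))"
   unfolding N(1) unfolding toR_smult toR_add toR_mult toR_power X fls_const_power ..
  finally show ?thesis .
 qed
 hence poly_eq: "al1*pcompose N [:0,q:] = smult (q^k) (al2*N + be*[:0,1:]^k)" by simp
 \<comment> \<open>Lowest coefficients: a pole of order \<open>k\<close> at 0 would give r1 r2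
   q^(k-1) = p1 p2.\<close>
 have k0: "k = 0"
 proof (rule ccontr)
  assume k: "k~=0"
  hence N0: "poly N 0~=0" using N(2) by simp
  have "poly al1 0*poly N 0 = q^k*(poly al2 0*poly N 0)"
   using arg_cong[OF poly_eq, of "%p. poly p 0"] k by (simp add: poly_pcompose)
  hence "q*(p1*p2) = q^k*(r1*r2)" using N0 by (simp add: al1_def al2_def mult_ac)
  moreover have "q^k = q*q^(k - 1)" using k by (cases k) auto
  ultimately have "r1*r2*q^(k - 1) = p1*p2" by simp
  thus False using R0 by blast
 qed
 have poly_eq': "al1*pcompose N [:0,q:] = al2*N + be" using poly_eq by (simp add: k0)
 have co1: "al1 = [:q*(p1*p2),coeff al1 1,coeff al1 2,coeff al1 3,q*(r1*r2):]"
  unfolding al1_def by (simp add: algebra_simps numeral_eq_Suc One_nat_def)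
 have co2: "al2 = [:r1*r2,coeff al2 1,coeff al2 2,coeff al2 3,q^2*(p1*p2):]"
  unfolding al2_def by (simp add: algebra_simps numeral_eq_Suc One_nat_def)
 have cobe: "be = [:r1*r2 * c',coeff be 1,coeff be 2,coeff be 3,-(q^2 * c'):]"
  unfolding be_def by (simp add: algebra_simps numeral_eq_Suc One_nat_def)
 have d1: "degree al1 = 4" "lead_coeff al1 = q*(r1*r2)"
  using nz arg_cong[OF co1, of degree] arg_cong[OF co1, of "%p. coeff p 4"] by (simp_all add: numeral_eq_Suc)
 have d2: "degree al2<=4" "coeff al2 4 = q^2*(p1*p2)"
  using arg_cong[OF co2, of degree] arg_cong[OF co2, of "%p. coeff p 4"] by (simp_all add: numeral_eq_Suc)
 have dbe: "degree be<=4" "coeff be 4 = - (q^2 * c')"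
  using arg_cong[OF cobe, of degree] arg_cong[OF cobe, of "%p. coeff p 4"] by (simp_all add: numeral_eq_Suc)
 \<comment> \<open>Highest coefficients: a positive degree n would give r1 r2 q^(n-1) = p1
   p2.\<close>
 have dN: "degree N = 0"
 proof (rule ccontr)
  assume n: "degree N~=0"
  define n where "n = degree N"
  have Nnz: "N~=0" using n by auto
  have comp: "degree (pcompose N [:0,q:]) = n" "coeff (pcompose N [:0,q:]) n = q^n * coeff N n"
  proof -
   show d: "degree (pcompose N [:0,q:]) = n" by (simp add: n_def degree_pcompose)
   show "coeff (pcompose N [:0,q:]) n = q^n * coeff N n"
    using lead_coeff_comp[of "[:0,q:]" N] d by (simp add: n_def)
  qed
  have "coeff (al1*pcompose N [:0,q:]) (4 + n) = q*(r1*r2)*(q^n * coeff N n)"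
   using coeff_mult_degree_sum[of al1 "pcompose N [:0,q:]"] d1 comp by simp
  moreover have "coeff (al2*N) (4 + n) = q^2*(p1*p2) * coeff N n"
  proof -
   have "degree al2 = 4" using d2 nz by (intro antisym le_degree) auto
   thus ?thesis using coeff_mult_degree_sum[of al2 N] d2 by (simp add: n_def)
  qed
  moreover have "coeff be (4 + n) = 0" using dbe n by (intro coeff_eq_0) (simp add: n_def)
  ultimately have "q*(r1*r2)*(q^n * coeff N n) = q^2*(p1*p2) * coeff N n"
   using arg_cong[OF poly_eq', of "%p. coeff p (4 + n)"] by (simp only: coeff_add add_0_right)
  moreover have "coeff N n~=0" using Nnz by (simp add: n_def)
  moreover have "q^n = q*q^(n - 1)" using n by (cases n) (auto simp: n_def)
  ultimately have "r1*r2*q^(n - 1) = p1*p2" by (auto simp: power2_eq_square mult.assoc)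
  thus False using R0 by blast
 qed
 then obtain m0 where m0: "N = [:m0:]" by (rule degree_eq_zeroE)
 \<comment> \<open>For a constant \<open>m0\<close> the two extreme coefficients give two equations,
   and eliminating \<open>m0\<close> leaves q c' (r1 r2 - q) = 0.\<close>
 have e0: "q*(p1*p2)*m0 = r1*r2*m0 + r1*r2 * c'"
  using arg_cong[OF poly_eq', of "%p. coeff p 0"] unfolding m0
  by (subst (asm) co1, subst (asm) co2, subst (asm) cobe) (simp add: algebra_simps)
 have e4: "q*(r1*r2)*m0 = q^2*(p1*p2)*m0 - q^2 * c'"
  using arg_cong[OF poly_eq', of "%p. coeff p 4"] d1 d2 dbe unfolding m0
  by (simp add: algebra_simps)
 have "q*(r1*r2)*m0 = q*(q*(p1*p2)*m0) - q^2 * c'"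
  using e4 by (simp add: power2_eq_square algebra_simps)
 hence "q * c'*(r1*r2 - q) = 0" unfolding e0 by (auto simp: power2_eq_square algebra_simps)
 thus False using c' rq by simp
qed

end

lemma toR_refl_lin: "p~=0 ==> toR [:1,-p:] = fls_const (-p)*lin (1/p)"
proof -
 assume "p~=0"
 hence "[:1,-p:] = smult (-p) [:-(1/p),1:]" by simp
 thus ?thesis unfolding lin_def by (simp only: toR_smult)
qed

section \<open>Orbits separated by absolute values\<close>

context qdil
begin

lemma in_orbit_refl [simp]: "in_orbit z z"
 unfolding in_orbit_def by (rule exI[of _ 0]) simp

text \<open>Moduli along an orbit form a geometric progression, so only the exponent
  \<open>k\<close> fits between the neighbours \<open>k - 1\<close> and
  \<open>k + 1\<close>.\<close>

lemma in_orbit_exact: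
 assumes "in_orbit z0 z" "norm z0*norm q powi (k - 1) < norm z" "norm z < norm z0*norm q powi (k + 1)"
 shows "z = z0*q powi k"
proof -
 obtain n where n: "z = z0*q powi n" using assms(1) by (auto simp: in_orbit_def)
 have Q: "norm q > 1" by (rule q_gt1)
 have z0: "norm z0 > 0" using assms(2,3) by (auto simp: zero_less_norm_iff)
 have m: "norm q powi i<=norm q powi j" if "i<=j" for i j
  using that Q by (intro power_int_increasing) auto
 have "norm z0*norm q powi (k - 1) < norm z0*norm q powi n"
  using assms(2) by (simp add: n norm_mult norm_power_int)
 hence "norm q powi (k - 1) < norm q powi n" using z0 by simp
 hence 1: "k - 1 < n" using m[of n "k - 1"] by linarith
 have "norm z0*norm q powi n < norm z0*norm q powi (k + 1)"
  using assms(3) by (simp add: n norm_mult norm_power_int)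
 hence "norm q powi n < norm q powi (k + 1)" using z0 by simp
 hence 2: "n < k + 1" using m[of "k + 1" n] by linarith
 from 1 2 have "n = k" by simp
 thus ?thesis using n by simp
qed

lemma in_orbit_shift: "in_orbit z0 (z*q powi m) \<longleftrightarrow> in_orbit z0 z"
proof -
 have 1: "in_orbit z0 (z*q powi m)" if o: "in_orbit z0 z" for z m
 proof -
  from o obtain n where "z = z0*q powi n" by (auto simp: in_orbit_def)
  hence "z*q powi m = z0*q powi (n + m)" by (simp add: power_int_add)
  thus ?thesis unfolding in_orbit_def by blast
 qed
 show ?thesis
 proof
  assume "in_orbit z0 (z*q powi m)"
  hence "in_orbit z0 (z*q powi m*q powi (-m))" by (rule 1)
  moreover have "z*q powi m*q powi (-m) = z" by (simp add: power_int_minus field_simps)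
  ultimately show "in_orbit z0 z" by simp
 qed (rule 1)
qed

lemma in_orbit_inverse:
 assumes "in_orbit z (1/x)" "x~=0" "norm q powi (k - 1) < norm (z*x)" "norm (z*x) < norm q powi (k + 1)"
 shows "z*x = q powi k"
proof -
 obtain n where n: "1/x = z*q powi n" using assms(1) by (auto simp: in_orbit_def)
 have "q powi n*(z*x) = 1" using assms(2) n by (simp add: field_simps)
 hence "z*x = 1*q powi (-n)" by (simp add: power_int_minus field_simps)
 hence "in_orbit 1 (z*x)" unfolding in_orbit_def by blast
 thus ?thesis using in_orbit_exact[of 1 "z*x" k] assms(3,4) by simp
qed

lemma not_in_orbit:
 assumes "norm z0*norm q powi k < norm z" "norm z < norm z0*norm q powi (k + 1)"
 shows "~ in_orbit z0 z"
proof
 assume o: "in_orbit z0 z"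
 have mono: "norm z0*norm q powi i<=norm z0*norm q powi j" if "i<=j" for i j
  using that q_gt1 by (intro mult_left_mono power_int_increasing) auto
 have "z = z0*q powi k" using mono[of "k - 1" k] assms by (intro in_orbit_exact[OF o]) auto
 hence "norm z = norm z0*norm q powi k" by (simp add: norm_mult norm_power_int)
 thus False using assms by simp
qed

lemma norm_q_power_ge: "m>=n ==> norm q^n<=norm q^m"
 using q_gt1 by (intro power_increasing) auto

lemma ne_q_power:
 assumes "norm y < norm q^n*norm x" "m>=n" shows "y~=q^m*x"
proof
 assume "y = q^m*x"
 hence "norm y = norm q^m*norm x" by (simp add: norm_mult norm_power)
 thus False using assms(1) mult_right_mono[OF norm_q_power_ge[OF assms(2)], of "norm x"] by simp
qed

text \<open>The q-difference equation with both quadratics made monic and split over their roots;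
  \<open>[:1,-p1:]\<close> and its analogues are the reflected linear factors.\<close>

definition curve_eq :: "complex => complex => complex => complex => complex => complex fls => bool" where
 "curve_eq p1 p2 r1 r2 c g \<longleftrightarrow>
   toR ([:-p1,1:]*[:-p2,1:]*[:1,-r1:]*[:1,-r2:])*dil g =
    toR ([:1,-p1:]*[:1,-p2:]*[:-r1,1:]*[:-r2,1:])*g +
    fls_const c*fls_X*toR ([:1,-p1:]*[:1,-p2:] - [:-p1,1:]*[:-p2,1:])"

lemma curve_eq_iff:
 assumes nz: "p1~=0" "p2~=0" "r1~=0" "r2~=0"
 shows "curve_eq p1 p2 r1 r2 c g \<longleftrightarrow> dil g = gam p1 p2 r1 r2*g +
  fls_const c*fls_X*toR ([:1,-p1:]*[:1,-p2:] - [:-p1,1:]*[:-p2,1:]) /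
   toR ([:-p1,1:]*[:-p2,1:]*[:1,-r1:]*[:1,-r2:])"
proof -
 define L where "L = toR ([:-p1,1:]*[:-p2,1:]*[:1,-r1:]*[:1,-r2:])"
 define R where "R = toR ([:1,-p1:]*[:1,-p2:]*[:-r1,1:]*[:-r2,1:])"
 have L: "L = fls_const (r1*r2)*(lin p1*lin p2*lin (1/r1)*lin (1/r2))"
 proof -
  have cc: "fls_const (r1*r2) = fls_const (-r1)*fls_const (-r2)" by simp
  show ?thesis
   unfolding L_def toR_mult toR_refl_lin[OF nz(3)] toR_refl_lin[OF nz(4)] lin_def[symmetric] cc
   by (simp only: mult_ac)
 qed
 have R: "R = fls_const (p1*p2)*(lin (1/p1)*lin (1/p2)*lin r1*lin r2)"
 proof -
  have cc: "fls_const (p1*p2) = fls_const (-p1)*fls_const (-p2)" by simp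
  show ?thesis
   unfolding R_def toR_mult toR_refl_lin[OF nz(1)] toR_refl_lin[OF nz(2)] lin_def[symmetric] cc
   by (simp only: mult_ac)
 qed
 have Lnz: "L~=0" using nz unfolding L by simp
 have "fls_const (p1*p2) = fls_const (p1*p2/(r1*r2))*fls_const (r1*r2)" using nz by simp
 hence RL: "R = gam p1 p2 r1 r2*L" unfolding R L gam_def
  by (simp add: field_simps del: fls_const_mult_const)
 have "curve_eq p1 p2 r1 r2 c g \<longleftrightarrow> L*dil g = (gam p1 p2 r1 r2*L)*g +
   fls_const c*fls_X*toR ([:1,-p1:]*[:1,-p2:] - [:-p1,1:]*[:-p2,1:])"
  unfolding curve_eq_def L_def[symmetric] R_def[symmetric] RL ..
 also have "... \<longleftrightarrow> dil g = gam p1 p2 r1 r2*g +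
  fls_const c*fls_X*toR ([:1,-p1:]*[:1,-p2:] - [:-p1,1:]*[:-p2,1:])/L"
  using Lnz by (auto simp: field_simps)
 finally show ?thesis unfolding L_def .
qed

text \<open>\<open>nontele_Dalg\<close> produces a rational solution. For \<open>c = 0\<close> the
  equation is homogeneous and it yields \<open>g = 0\<close> instead, so rational solutions have to
  be excluded only for \<open>c~=0\<close>.\<close>

lemma nontele_not_Dalg:
 assumes nz: "p1~=0" "p2~=0" "r1~=0" "r2~=0"
  and nt: "nontele (theta (gam p1 p2 r1 r2)/gam p1 p2 r1 r2)"
  and nr: "!!p. c~=0 ==> p : ratfun ==> curve_eq p1 p2 r1 r2 c p ==> False"
  and g: "curve_eq p1 p2 r1 r2 c g" "g~=0"
 shows "~ Dalg g"
proof
 assume "Dalg g"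
 define de where "de = fls_const c*fls_X*toR ([:1,-p1:]*[:1,-p2:] - [:-p1,1:]*[:-p2,1:]) /
   toR ([:-p1,1:]*[:-p2,1:]*[:1,-r1:]*[:1,-r2:])"
 have "de : ratfun" unfolding de_def
  by (intro rat.divide_in rat.mult_in ratfun_const ratfun_X ratfun_toR)
 moreover have "dil g = gam p1 p2 r1 r2*g + de" using g(1) unfolding curve_eq_iff[OF nz] de_def .
 ultimately have *: "(EX p:ratfun. dil p = gam p1 p2 r1 r2*p + de) & (de = 0 --> g = 0)"
  using nontele_Dalg[OF gam_ratfun gam_nz[OF nz] nt gam_dlog_nth[OF nz]] `Dalg g` by blast
 show False
 proof (cases "c = 0")
  case True
  thus False using*g(2) by (simp add: de_def)
 next
  case False
  from * obtain p where "p : ratfun" "dil p = gam p1 p2 r1 r2*p + de" by blast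
  hence "curve_eq p1 p2 r1 r2 c p" unfolding curve_eq_iff[OF nz] de_def by simp
  thus False using nr[OF False `p : ratfun`] by blast
 qed
qed

lemma no_rational_solution_norm:
 assumes nz: "p1~=0" "p2~=0" "r1~=0" "r2~=0" "c~=0"
  and C1: "!!x y. x : {p1, p2} ==> y : {p1, p2} ==> 1 < norm x*norm y*norm q"
  and C2: "!!x y m. x : {p1, p2} ==> y : {r1, r2} ==> m>=1 ==> y~=q^m*x"
  and C3: "!!x y m. x : {r1, r2} ==> y : {r1, r2} ==> m>=2 ==> x*y~=q^m"
  and R0: "!!m. r1*r2*q^m~=p1*p2" and rq: "r1*r2~=q" and pp: "p1*p2~=1"
  and p: "p : ratfun" "curve_eq p1 p2 r1 r2 c p"
 shows False
proof (rule no_rational_solution[OF nz _ C2 C3 R0 rq pp p(1) p(2)[unfolded curve_eq_def]])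
 fix x y and m :: nat assume xy: "x : {p1, p2}" "y : {p1, p2}" "1<=m"
 show "x*y*q^m~=1"
 proof
  assume "x*y*q^m = 1"
  hence 1: "norm x*norm y*norm q^m = 1" by (metis norm_mult norm_one norm_power)
  have "norm x*norm y*norm q^1<=norm x*norm y*norm q^m"
   using norm_q_power_ge[OF xy(3)] by (intro mult_left_mono) auto
  thus False using C1[OF xy(1,2)] 1 by simp
 qed
qed auto

lemma norm_mult_bounds:
 fixes x y :: complex
 assumes "a/R<=norm x" "norm x<=a*R" "b/R<=norm y" "norm y<=b*R" "R > 0" "a > 0" "b > 0"
 shows "a*b/R^2<=norm x*norm y" "norm x*norm y<=a*b*R^2"
proof -
 have "(a/R)*(b/R)<=norm x*norm y" using assms by (intro mult_mono) auto
 thus "a*b/R^2<=norm x*norm y" by (simp add: power2_eq_square)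
 have "norm x*norm y<=(a*R)*(b*R)" using assms by (intro mult_mono) auto
 thus "norm x*norm y<=a*b*R^2" by (simp add: power2_eq_square mult_ac)
qed

lemma powi_small [simp]: "norm q powi 1 = norm q" "norm q powi 2 = norm q^2"
 by (auto simp: power_int_def)

text \<open>A product of two roots is known up to a factor \<open>R^2\<close>, and comparing two
  products costs \<open>R^4\<close>; the threshold \<open>h > R^4\<close> covers these
  comparisons.\<close>

lemma size_facts:
 fixes h R :: real
 assumes "R>=1" "h > R^4"
 shows "R^2>=1" "R^2 < h" "h > 1" "R > 0" "R^2 < h^2" "R^2 < h^2/R^2" "1 < h^2/R^2"
  "h*R^2 < h^2" "h^2*R^2 < (h^2)^2"
proof -
 have R4: "R^4 = R^2*R^2" by (simp flip: power_add)
 show 1: "R^2>=1" using assms(1) by (simp add: one_le_power)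
 have "R^2*1<=R^2*R^2" using 1 by (intro mult_left_mono) auto
 thus 2: "R^2 < h" using assms(2) R4 by linarith
 show 3: "h > 1" using 1 2 by linarith
 show Rp: "R > 0" using assms(1) by linarith
 have hh: "h < h^2" using 3 by (simp add: power2_eq_square)
 show 4: "R^2 < h^2" using 2 hh by simp
 have "R^2*R^2 < h^2" using assms(2) R4 hh by linarith
 moreover have "0 < R^2" using Rp by simp
 ultimately show 5: "R^2 < h^2/R^2" by (simp only: less_divide_eq if_True)
 show "1 < h^2/R^2" using 1 5 by linarith
 show "h*R^2 < h^2" using 2 3 mult_strict_left_mono[OF 2, of h] by (simp add: power2_eq_square)
 show "h^2*R^2 < (h^2)^2" using 3 mult_strict_left_mono[OF 4, of "h^2"] by (simp add: power2_eq_square[of "h^2"])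
qed

text \<open>\<open>u\<close> and \<open>v\<close> are the orders of magnitude of the roots of the
  two quadratics. By \<open>nd\<close> some root \<open>z0\<close> is not its own partner, the
  partner of z being 1/z or q/z respectively; its orbit then has nonzero net multiplicity in the
  coefficient of the equation.\<close>

lemma separated_roots_not_Dalg:
 assumes qh: "norm q = h^2" and R: "R>=1" "h > R^4"
  and p: "!!x. x : {p1, p2} ==> u/R<=norm x & norm x<=u*R"
  and r: "!!x. x : {r1, r2} ==> v/R<=norm x & norm x<=v * R"
  and uv: "u = 1 & v = h | u = h & v = h | u = 1 & v = 1"
  and pp: "if u = h then p1*p2 = q else p1*p2~=1"
  and rr: "if v = 1 then r1*r2 = 1 else r1*r2~=q"
  and nd: "u = 1 & (p1^2~=1 | p2^2~=1) | v = h & (r1^2~=q | r2^2~=q)"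
  and g: "curve_eq p1 p2 r1 r2 c g" "g~=0"
 shows "~ Dalg g"
proof -
 note sf = size_facts[OF R]
 have h: "h > 1" "R > 0" "h~=1" "R^2 < h" using sf by auto
 have hh: "h^2 = h*h" by (simp add: power2_eq_square)
 have u: "u>=1" "u<=v" "v<=h" "u > 0" "v > 0" using uv h by auto
 have pos: "norm x > 0" if "x : {p1, p2, r1, r2}" for x
 proof -
  have "u/R<=norm x | v/R<=norm x" using that p r by blast
  moreover have "0 < u/R" "0 < v/R" using u h by simp_all
  ultimately show ?thesis by linarith
 qed
 hence nz: "p1~=0" "p2~=0" "r1~=0" "r2~=0" by auto
 have PP: "u*u/R^2<=norm x*norm y" "norm x*norm y<=u*u*R^2" if "x : {p1, p2}" "y : {p1, p2}" for x y
  using norm_mult_bounds[of u R x u y] p[OF that(1)] p[OF that(2)] h u by auto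
 have RR: "v * v/R^2<=norm x*norm y" "norm x*norm y<=v * v * R^2" if "x : {r1, r2}" "y : {r1, r2}" for x y
  using norm_mult_bounds[of v R x v y] r[OF that(1)] r[OF that(2)] h u by auto
 have lt: "norm y < h^2*norm x" if "x : {p1, p2}" "y : {r1, r2}" for x y
 proof -
  have "norm y<=v * R" using r[OF that(2)] by simp
  also have "...<=h*R" using u h by (intro mult_right_mono) auto
  also have "... < h^2*(1/R)" using sf(8) h by (simp add: field_simps power2_eq_square)
  also have "...<=h^2*norm x" using p[OF that(1)] u h divide_right_mono[of 1 u R] by (intro mult_left_mono) auto
  finally show ?thesis .
 qed
 have lt': "norm x < norm y" if "x : {p1, p2}" "y : {r1, r2}" "u = 1" "v = h" for x y
 proof -
  have "R < h/R" using h by (simp add: field_simps power2_eq_square)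
  thus ?thesis using p[OF that(1)] r[OF that(2)] that by auto
 qed
 have pp1: "p1*p2~=1" using pp q_gt1 by (auto split: if_splits)
 have rq: "r1*r2~=q" using rr q_gt1 by (auto split: if_splits)
 have nt: "nontele (theta (gam p1 p2 r1 r2)/gam p1 p2 r1 r2)"
 proof -
  from nd consider z0 where "u = 1" "z0 : {p1, p2}" "z0^2~=1" | z0 where "v = h" "z0 : {r1, r2}" "z0^2~=q" by blast
  thus ?thesis
  proof cases
   case 1
   \<comment> \<open>Sizes force \<open>z0*x = 1\<close>, which means that \<open>z0^2\<close> or
     \<open>p1*p2\<close> is 1.\<close>
   have o1: "~ in_orbit z0 (1/x)" if x: "x : {p1, p2}" for x
   proof
    assume o: "in_orbit z0 (1/x)"
    have "1/h^2 < 1/R^2" using sf by (intro divide_strict_left_mono) auto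
    hence "z0*x = q powi 0" using PP[OF 1(2) x] 1(1) sf x nz
     by (intro in_orbit_inverse[OF o]) (auto simp: norm_mult qh power_int_minus inverse_eq_divide)
    thus False using 1 x pp1 by (auto simp: power2_eq_square mult.commute)
   qed
   \<comment> \<open>For \<open>v = 1\<close> the contributions of the mutually inverse
     \<open>r1\<close>, \<open>r2\<close> cancel; for \<open>v = h\<close> these roots lie off the
     orbit.\<close>
   have a: "1/r1 = r2" "1/r2 = r1" if "v = 1" using that rr nz by (auto simp: field_simps)
   have b: "~ in_orbit z0 y" if "y : {r1, r2}" "v = h" for y
    by (rule not_in_orbit[where k = 0]) (use lt[OF 1(2) that(1)] lt'[OF 1(2) that(1) 1(1) that(2)] in "auto simp: qh mult.commute")
   show ?thesis
   proof (rule gam_nontele[OF nz, of z0, OF _ refl], goal_cases)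
    case 2
    show ?case using o1[of p1] o1[of p2] 1(2) in_orbit_refl[of z0] a b[of r1] b[of r2] uv
     by (cases "v = 1") (auto simp only: insert_iff if_True if_False simp_thms empty_iff split: if_splits)
   qed (use 1 nz in auto)
  next
   case 2
   have o1: "~ in_orbit z0 (1/x)" if x: "x : {r1, r2}" for x
   proof
    assume o: "in_orbit z0 (1/x)"
    have "z0*x = q powi 1" using RR[OF 2(2) x] 2(1) sf x nz
     by (intro in_orbit_inverse[OF o]) (auto simp: norm_mult qh hh)
    thus False using 2 x rq by (auto simp: power2_eq_square mult.commute)
   qed
   have a: "~ in_orbit z0 y" if "y : {p1, p2}" "u = 1" for y
    by (rule not_in_orbit[where k = "- 1"])
     (use lt[OF that(1) 2(2)] lt'[OF that(1) 2(2) that(2) 2(1)] h in "auto simp: qh power_int_minus field_simps")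
   \<comment> \<open>For \<open>u = h\<close> the product \<open>p1*p2\<close> is \<open>q\<close>,
     so \<open>1/p1\<close> and \<open>p2\<close> share an orbit and their contributions
     cancel.\<close>
   have b: "in_orbit z0 (1/p1) = in_orbit z0 p2" "in_orbit z0 (1/p2) = in_orbit z0 p1" if "u = h"
    using in_orbit_shift[of z0 "1/p1" 1] in_orbit_shift[of z0 "1/p2" 1] that pp nz by (auto simp: field_simps)
   show ?thesis
   proof (rule gam_nontele[OF nz, of z0, OF _ refl], goal_cases)
    case 2
    show ?case using o1[of r1] o1[of r2] `z0 : {r1, r2}` in_orbit_refl[of z0] a[of p1] a[of p2] b uv
     by (cases "u = 1") (auto simp only: insert_iff if_True if_False simp_thms empty_iff split: if_splits)
   qed (use 2 nz in auto)
  qed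
 qed
 show ?thesis
 proof (rule nontele_not_Dalg[OF nz nt _ g])
  fix p assume cp: "c~=0" "p : ratfun" "curve_eq p1 p2 r1 r2 c p"
  show False
  proof (rule no_rational_solution_norm[OF nz cp(1) _ _ _ _ rq pp1 cp(2,3)])
   show "1 < norm x*norm y*norm q" if "x : {p1, p2}" "y : {p1, p2}" for x y
   proof -
    have "1/R^2<=u*u/R^2" using u mult_mono[of 1 u 1 u] by (intro divide_right_mono) auto
    hence "1/R^2*h^2<=norm x*norm y*h^2" using PP(1)[OF that] by (intro mult_right_mono) auto
    thus ?thesis using sf(7) by (simp add: qh)
   qed
   show "y~=q^m*x" if "x : {p1, p2}" "y : {r1, r2}" "m>=1" for x y m
    by (rule ne_q_power[OF _ that(3)]) (use lt[OF that(1,2)] in "simp add: qh")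
   show "x*y~=q^m" if "x : {r1, r2}" "y : {r1, r2}" "m>=2" for x y m
   proof -
    have "v * v * R^2<=h*h*R^2" using u by (intro mult_right_mono mult_mono) auto
    hence "norm x*norm y < (h^2)^2" using RR(2)[OF that(1,2)] sf(9) unfolding hh by linarith
    thus ?thesis using ne_q_power[of "x*y" 2 1 m] that(3) by (simp add: qh norm_mult)
   qed
   show "r1*r2*q^m~=p1*p2" for m
   proof
    assume eq: "r1*r2*q^m = p1*p2"
    hence n: "norm r1*norm r2*norm q^m = norm p1*norm p2" by (metis norm_mult norm_power)
    show False
    proof (cases "m = 0")
     case True
     show False
     proof (cases "u = v")
      case False
      hence "u = 1" "v = h" using uv by auto
      thus False using n True RR(1)[of r1 r2] PP(2)[of p1 p2] sf(6) by (simp add: hh)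
     qed (use eq True pp rr uv h in "auto split: if_splits")
    next
     case False
     have "u*u*R^2 < v * v * (h^2/R^2)"
      using u sf(6) by (intro mult_le_less_imp_less mult_mono) auto
     also have "...<=norm r1*norm r2*h^2" using mult_right_mono[OF RR(1)[of r1 r2], of "h^2"] by simp
     also have "...<=norm r1*norm r2*norm q^m"
      using norm_q_power_ge[of 1 m] False by (intro mult_left_mono) (auto simp: qh)
     finally show False using PP(2)[of p1 p2] n by simp
    qed
   qed
  qed
 qed
qed

end

section \<open>Isolated poles read off from explicit denominators\<close>

lemma order_lin: "order u [:-z,1:] = (if u = z then 1 else 0 :: nat)" for u z :: complex
 using order_power_n_n[of z 1] by (auto simp: order_0I One_nat_def)

lemma pole_le_order:
 assumes "D~=0" "f*toR D = toR N"
 shows "pole_le z (order z D) f"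
proof -
 obtain D' where D': "D = [:-z,1:] ^ order z D*D'" "~ [:-z,1:] dvd D'"
  using order_decomp[OF assms(1)] by blast
 have "f*toR D'*toR [:-z,1:] ^ order z D = f*toR D"
  by (subst (2) D'(1)) (simp add: toR_mult toR_power mult_ac)
 thus ?thesis using D'(2) assms(2) by (intro pole_leI[of D']) (auto simp: poly_eq_0_iff_dvd)
qed

lemma pole_eq_order:
 assumes "D~=0" "f*toR D = toR N" "poly N z~=0"
 shows "pole_eq z (order z D) f"
proof -
 obtain D' where D': "D = [:-z,1:] ^ order z D*D'" "~ [:-z,1:] dvd D'"
  using order_decomp[OF assms(1)] by blast
 have "f*toR D'*toR [:-z,1:] ^ order z D = f*toR D"
  by (subst (2) D'(1)) (simp add: toR_mult toR_power mult_ac)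
 thus ?thesis using D'(2) assms(2,3) by (intro pole_eqI[of D' _ N]) (auto simp: poly_eq_0_iff_dvd)
qed

text \<open>The factors are kept as a list, so that pole orders become multiplicities of list
  entries.\<close>

definition linprod :: "complex list => complex poly" where
 "linprod zs = prod_list (map (%z. [:-z,1:]) zs)"

lemma linprod_nz: "linprod zs~=0"
proof (induction zs)
 case (Cons z zs)
 have "linprod (z # zs) = [:-z,1:]*linprod zs" by (simp only: linprod_def list.map prod_list.Cons)
 moreover have "[:-z,1:]~=0" by simp
 ultimately show ?case using Cons by (metis mult_eq_0_iff)
qed (simp add: linprod_def)

lemma order_linprod: "order u (linprod zs) = count_list zs u"
proof (induction zs)
 case Nil
 show ?case by (simp add: linprod_def order_0I)
next
 case (Cons z zs)
 have e: "linprod (z # zs) = [:-z,1:]*linprod zs" by (simp only: linprod_def list.map prod_list.Cons)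
 have "[:-z,1:]*linprod zs~=0" using linprod_nz[of "z # zs"] unfolding e .
 hence "order u (linprod (z # zs)) = order u [:-z,1:] + order u (linprod zs)"
  unfolding e by (rule order_mult)
 thus ?case using Cons by (simp add: order_lin)
qed

context qdil
begin

lemma isolated_poleI:
 assumes "f*toR (linprod zs) = toR N" "poly N z0~=0" "z0~=0" "z0 : set zs"
  and "!!n. n~=0 ==> count_list zs (z0*q powi n) < count_list zs z0"
 shows "isolated_pole z0 (count_list zs z0) f"
 unfolding isolated_pole_def
proof (intro conjI allI impI)
 show "1<=count_list zs z0" using assms(4) count_list_0_iff[of zs z0] by linarith
 show "pole_eq z0 (count_list zs z0) f"
  using pole_eq_order[OF linprod_nz assms(1,2)] by (simp add: order_linprod)
 show "pole_le (z0*q powi n) (count_list zs z0 - 1) f" if "n~=0" for n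
  using pole_le_order[OF linprod_nz assms(1), of "z0*q powi n"] assms(5)[OF that]
  by (auto simp: order_linprod intro: pole_le_mono)
qed (use assms in auto)

lemma orbit_neq: "z0~=0 ==> n~=0 ==> z0*q powi n~=z0"
 using q_powi_inj[of z0 n 0] by auto

lemma in_orbitI: "in_orbit z0 (z0*q powi n)"
 unfolding in_orbit_def by blast

text \<open>The two poles of \<open>de\<close> are too close in size to be different points of one
  orbit, so \<open>z1\<close> is isolated, as a double pole if \<open>z2 = z1\<close>.\<close>

lemma antisymmetric_not_Dalg:
 assumes g: "dil g + g = de" and de: "de*toR (linprod [z1, z2]) = toR [:0,k:]"
  and nz: "k~=0" "z1~=0" "z2~=0" and sz: "norm z1 < norm q*norm z2" "norm z2 < norm q*norm z1"
 shows "~ Dalg g"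
proof -
 have "isolated_pole z1 (count_list [z1, z2] z1) de"
 proof (rule isolated_poleI[OF de])
  fix n :: int assume n: "n~=0"
  have "z1*q powi n~=z1" by (rule orbit_neq[OF nz(2) n])
  moreover have "z2 = z1" if "z1*q powi n = z2"
  proof -
   have "z2 = z1*q powi 0"
    by (rule in_orbit_exact) (use that in_orbitI[of z1 n] sz q_gt1 nz in "auto simp: power_int_minus field_simps")
   thus ?thesis by simp
  qed
  ultimately show "count_list [z1, z2] (z1*q powi n) < count_list [z1, z2] z1" by auto
 qed (use nz in auto)
 moreover have "de : ratfun" by (rule ratfunI[OF linprod_nz de])
 moreover have "dil g = fls_const (-1)*g + de" using g by (simp add: fls_const_minus_1 algebra_simps)
 ultimately show ?thesis using isolated_pole_not_Dalg[of g "- 1" de] by simp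
qed

text \<open>A common root \<open>zt\<close> enters numerator and denominator of the coefficient
  alike and drops out of the count.\<close>

lemma nontele_common:
 assumes nz: "p~=0" "zt~=0" "r~=0" and z0: "z0~=0"
  and "(if in_orbit z0 (1/p) then 1 else 0) + (if in_orbit z0 r then 1 else 0)
    - (if in_orbit z0 p then 1 else 0) - (if in_orbit z0 (1/r) then 1 else 0)~=(0 :: int)"
 shows "nontele (theta (gam p zt r zt)/gam p zt r zt)"
 by (rule gam_nontele[OF nz(1,2,3,2) z0 refl]) (use assms(5) in simp)

lemma size_facts2:
 fixes h R :: real
 assumes "R>=1" "h > R^4"
 shows "h > R^3" "h > R^2" "h > R" "h > 1" "R > 0" "h^2 > R^2" "h^2 > R" "h^2 > h*R" "h^2 > h"
proof -
 have "R^3<=R^4" "R^2<=R^4" "R^1<=R^4" "R^0<=R^4"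
  using assms(1) by (intro power_increasing; simp)+
 hence "R^3<=R^4" "R^2<=R^4" "R<=R^4" "1<=R^4" by simp_all
 thus 1: "h > R^3" "h > R^2" "h > R" "h > 1" using assms(2) by auto
 show "R > 0" using assms(1) by simp
 show hh: "h^2 > h" using 1 by (simp add: power2_eq_square)
 show "h^2 > R^2" "h^2 > R" using hh 1 by linarith+
 show "h^2 > h*R" using mult_strict_left_mono[OF 1(3), of h] 1 by (simp add: power2_eq_square)
qed

text \<open>The common root has modulus about sqrt h, and the products \<open>u\<close>,
  \<open>v\<close> of the two pairs of roots are controlled, so the sizes of the remaining roots
  \<open>p\<close> and \<open>r\<close> are known. On the orbit of \<open>p\<close> the coefficient
  has a pole that neither \<open>1/p\<close> nor \<open>r\<close> cancels.\<close>

lemma regime_zeta: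
 assumes qh: "norm q = h^2" and R: "R>=1" "h > R^4"
  and zt: "h/R<=norm zt^2" "norm zt^2<=h*R" and pz: "p * zt = u" and rz: "r * zt = v"
  and u1: "u~=1" and vq: "v~=q" and vu: "v~=q*u"
  and cs: "(1/R<=norm u & norm u<=R & h^2/R<=norm v & norm v<=h^2*R)
   | (u = q & h^2/R<=norm v & norm v<=h^2*R) | (1/R<=norm u & norm u<=R & v = 1)"
  and g: "curve_eq p zt r zt c g" "g~=0"
 shows "~ Dalg g"
proof -
 note sf = size_facts2[OF R]
 define Q where "Q = h^2"
 define Z where "Z = norm zt^2"
 have Q: "Q > 1" "norm q = Q" using qh q_gt1 by (auto simp: Q_def)
 have R0: "R > 0" "h > 0" using sf by auto
 have Zb: "h/R<=Z" "Z<=h*R" using zt by (auto simp: Z_def)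
 have Z1: "Z > 1" using Zb(1) sf R0 by (smt (verit) less_divide_eq_1_pos)
 have Zpos: "norm zt > 0" using Z1 by (auto simp: Z_def)
 have ztnz: "zt~=0" using Zpos by auto
 have ZQ: "Z < Q" using Zb(2) sf by (simp add: Q_def)
 have unz: "norm u > 0" using cs R0 Q by auto
 have vnz: "norm v > 0" using cs R0 sf(4) by auto (smt (verit) divide_pos_pos zero_less_power)+
 have nz: "p~=0" "r~=0" using pz rz unz vnz by auto
 have p: "norm p = norm u/norm zt" and r: "norm r = norm v/norm zt"
  using Zpos by (simp_all add: pz[symmetric] rz[symmetric] norm_mult)
 have ZZ: "norm zt*norm zt = Z" by (simp add: Z_def power2_eq_square)
 have umin: "1/R<=norm u" using cs Q R by (auto simp: divide_le_eq) (smt (verit) mult_le_cancel_left1)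
 have uRQ: "R < Q*norm u"
 proof -
  have "R*R < Q" using sf by (simp add: Q_def power2_eq_square)
  hence "R < Q*(1/R)" using R0 by (simp add: field_simps)
  also have "...<=Q*norm u" using umin Q by (intro mult_left_mono) auto
  finally show ?thesis .
 qed
 have hRQ: "h*R < Q" and RQ: "R < Q" using sf by (simp_all add: Q_def)
 have vmax: "norm v<=Q*R" using cs R Q by (auto simp: Q_def) (smt (verit) mult_le_cancel_left1 power2_eq_square)
 have Zu: "Z < Q*norm u"
 proof -
  have "h*R < Q*(1/R)"
  proof -
   have "h*(R*R) < h*h" using sf by (simp add: power2_eq_square)
   thus ?thesis using R0 by (simp add: field_simps Q_def power2_eq_square)
  qed
  also have "...<=Q*norm u" using umin Q by (intro mult_left_mono) auto
  finally show ?thesis using Zb by simp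
 qed
 have vZ: "norm v < Q*Z"
 proof -
  have "R < h/R" using sf R0 by (simp add: field_simps power2_eq_square)
  hence "R < Z" using Zb by simp
  hence "Q*R < Q*Z" using Q by simp
  thus ?thesis using vmax by simp
 qed
 have nt: "nontele (theta (gam p zt r zt)/gam p zt r zt)"
 proof -
  have o1: "~ in_orbit p (1/p)"
  proof (cases "u = q")
   case False
   hence ub: "1/R<=norm u" "norm u<=R" using cs by auto
   have u2: "(1/R)^2<=norm u^2" "norm u^2<=R^2" using ub R0 by (auto intro!: power_mono)
   have 1: "norm u^2 < Z"
   proof -
    have "R^2*R < h" using sf(1) by (simp add: power3_eq_cube power2_eq_square)
    hence "R^2 < h/R" using R0 by (simp add: field_simps)
    thus ?thesis using u2 Zb by simp
   qed
   have 2: "Z < norm u^2*Q"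
   proof -
    have "h*(R*R^2) < h*h" using sf(1) R0 by (simp add: power3_eq_cube power2_eq_square)
    hence "h*R < (1/R)^2*Q" using R0 by (simp add: field_simps Q_def power2_eq_square)
    also have "...<=norm u^2*Q" using u2 Q by (intro mult_right_mono) auto
    finally show ?thesis using Zb by simp
   qed
   show ?thesis
    by (rule not_in_orbit[where k = 0])
      (use 1 2 unz Zpos in "auto simp: norm_divide p Q field_simps Z_def power2_eq_square")
  next
   case True
   hence up: "norm u = Q" using Q by simp
   show ?thesis
    by (rule not_in_orbit[where k = "- 2"])
      (use Z1 ZQ Q Zpos in "auto simp: norm_divide p up Q field_simps Z_def power_int_def power2_eq_square")
  qed
  \<comment> \<open>In each regime the sizes leave a single exponent, which gives
    \<open>v = q*u\<close> or \<open>v = u\<close>; both are excluded.\<close>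
  have o2: "~ in_orbit p r"
  proof
   assume o: "in_orbit p r"
   consider "1/R<=norm u & norm u<=R & h^2/R<=norm v & norm v<=h^2*R"
    | "u = q & h^2/R<=norm v & norm v<=h^2*R" | "1/R<=norm u & norm u<=R & v = 1"
    using cs by blast
   thus False
   proof cases
    case 1
    have "norm u < norm v"
    proof -
     have "R < Q/R" using sf R0 by (simp add: field_simps Q_def power2_eq_square)
     thus ?thesis using 1 by (simp add: Q_def)
    qed
    moreover have "norm v < norm u*Q^2"
    proof -
     have "Q*R < Q*(Q*norm u)" using uRQ Q by simp
     thus ?thesis using vmax by (simp add: power2_eq_square mult_ac)
    qed
    ultimately have "r = p*q powi 1"
     using Zpos by (intro in_orbit_exact[OF o]) (auto simp: p r Q divide_strict_right_mono power2_eq_square field_simps)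
    hence "v = q*u" using pz rz by auto
    thus False using vu by simp
   next
    case 2
    hence up: "norm u = Q" using Q by simp
    have "1 < norm v"
    proof -
     have "1 < Q/R" using sf R0 by (simp add: Q_def)
     thus ?thesis using 2 by (simp add: Q_def)
    qed
    moreover have "norm v < Q*Q"
    proof -
     have "Q*R < Q*Q" using Q RQ by (intro mult_strict_left_mono) auto
     thus ?thesis using vmax by simp
    qed
    ultimately have "r = p*q powi 0"
     using Zpos Q by (intro in_orbit_exact[OF o]) (auto simp: p r up field_simps power_int_minus)
    hence "v = u" using pz rz by auto
    thus False using vq 2 by simp
   next
    case 3
    have "norm u < Q" using 3 sf by (simp add: Q_def)
    moreover have "1 < norm u*Q" using uRQ R by (simp add: mult.commute)
    ultimately have "r = p*q powi 0"
     using Zpos Q 3 by (intro in_orbit_exact[OF o]) (auto simp: p r field_simps power_int_minus)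
    hence "v = u" using pz rz by auto
    thus False using u1 3 by simp
   qed
  qed
  show ?thesis by (rule nontele_common[OF nz(1) ztnz nz(2) nz(1)]) (use o1 o2 in auto)
 qed
 show ?thesis
 proof (rule nontele_not_Dalg[OF nz(1) ztnz nz(2) ztnz nt _ g])
  fix P assume cp: "c~=0" "P : ratfun" "curve_eq p zt r zt c P"
  show False
  proof (rule no_rational_solution_norm[OF nz(1) ztnz nz(2) ztnz cp(1) _ _ _ _ _ _ cp(2,3)])
   show "r * zt~=q" "p * zt~=1" using rz pz vq u1 by auto
   show "1 < norm x*norm y*norm q" if "x : {p, zt}" "y : {p, zt}" for x y
   proof -
    have pp: "1 < norm p*norm p*Q"
    proof -
     have "Z < norm u*norm u*Q"
     proof (cases "u = q")
      case True
      hence up: "norm u = Q" using Q by simp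
      have "Z < Q*1*1" using ZQ by simp
      also have "...<=Q*Q*Q" using Q by (intro mult_mono) auto
      finally show ?thesis by (simp add: up)
     next
      case False
      have "h*(R*R^2) < h*h" using sf(1) R0 by (simp add: power3_eq_cube power2_eq_square)
      hence "h*R < (1/R)*(1/R)*Q" using R0 by (simp add: field_simps Q_def power2_eq_square)
      also have "...<=norm u*norm u*Q" using umin Q R0 by (intro mult_mono) auto
      finally show ?thesis using Zb by simp
     qed
     hence "1 < norm u*norm u*Q/Z" using Z1 by (simp add: pos_less_divide_eq)
     thus ?thesis by (simp add: p ZZ)
    qed
    have pz': "1 < norm p*norm zt*Q" using uRQ R Zpos by (simp add: p mult.commute)
    have zz: "1 < norm zt*norm zt*Q" using Z1 Q by (simp add: ZZ less_1_mult)
    show ?thesis using that pp pz' zz Q by (auto simp: mult.commute)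
   qed
   show "y~=q^m*x" if xy: "x : {p, zt}" "y : {r, zt}" "m>=1" for x y m
   proof -
    have 1: "r~=q^m*p"
    proof
     assume "r = q^m*p"
     hence vm: "v = q^m*u" using pz rz by auto
     hence nm: "norm v = Q^m*norm u" by (simp add: norm_mult norm_power Q)
     show False
     proof (cases "m = 1")
      case True thus False using vm vu by simp
     next
      case False
      hence "Q^2<=Q^m" using that(3) Q by (intro power_increasing) auto
      hence "Q^2*norm u<=norm v" using nm by (simp add: mult_right_mono)
      moreover have "Q*R < Q^2*norm u" using uRQ Q by (simp add: power2_eq_square)
      ultimately show False using vmax by simp
     qed
    qed
    have 2: "r~=q^m * zt"
     by (rule ne_q_power[OF _ that(3)]) (use vZ Zpos Q in "simp add: r field_simps Z_def power2_eq_square")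
    have 3: "zt~=q^m*p"
     by (rule ne_q_power[OF _ that(3)]) (use Zu Zpos Q in "simp add: p field_simps Z_def power2_eq_square")
    have 4: "zt~=q^m * zt"
     by (rule ne_q_power[OF _ that(3)]) (use Zpos Q in simp)
    show ?thesis using xy 1 2 3 4 by auto
   qed
   show "x*y~=q^m" if xy: "x : {r, zt}" "y : {r, zt}" "m>=2" for x y m
   proof -
    have QQ: "Q < Q^2" using Q by (simp add: power2_eq_square)
    have "norm v * norm v < Q^2*Z"
    proof -
     have "norm v * norm v<=(Q*R)*(Q*R)" using vmax Q R0 by (intro mult_mono) auto
     also have "... = Q^2*(R*R)" by (simp add: power2_eq_square)
     also have "... < Q^2*Z"
     proof -
      have "R*R*R < h" using sf(1) by (simp add: power3_eq_cube)
      hence "R*R < h/R" using R0 by (simp add: field_simps)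
      thus ?thesis using Zb Q by simp
     qed
     finally show ?thesis .
    qed
    hence "norm v * norm v/Z < Q^2" using Z1 by (simp add: pos_divide_less_eq)
    hence 1: "norm r*norm r < Q^2" by (simp add: r ZZ)
    have 2: "norm r*norm zt < Q^2"
    proof -
     have "Q*R < Q*Q" using Q RQ by (intro mult_strict_left_mono) auto
     thus ?thesis using vmax Zpos by (simp add: r power2_eq_square)
    qed
    have 3: "norm zt*norm zt < Q^2" using ZQ QQ by (simp add: ZZ)
    have "norm x*norm y < Q^2" using xy(1,2) 1 2 3 by (auto simp: mult.commute)
    thus ?thesis using ne_q_power[of "x*y" 2 1 m] that(3) by (simp add: Q norm_mult)
   qed
   show "r * zt*q^m~=p * zt" for m
   proof
    assume "r * zt*q^m = p * zt"
    hence e: "v * q^m = u" using rz pz by simp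
    hence n: "norm v * Q^m = norm u" by (metis norm_mult norm_power Q(2))
    show False
    proof (cases "m = 0")
     case True
     hence "v = u" using e by simp
     thus False using cs
     proof (elim disjE conjE)
      assume "norm u<=R" "h^2/R<=norm v"
      moreover have "R < h^2/R" using sf R0 by (simp add: field_simps power2_eq_square)
      ultimately show False using `v = u` by simp
     qed (use `v = u` u1 vq in auto)
    next
     case False
     have "Q^1<=Q^m" using False Q by (intro power_increasing) auto
     hence "norm v * Q<=norm u" using n vnz mult_left_mono[of "Q^1" "Q^m" "norm v"] by simp
     moreover have "norm u < norm v * Q"
     proof -
      have "R*R < Q*Q" using RQ R0 by (intro mult_strict_mono) auto
      hence 1: "R < Q*(Q/R)" using R0 by (simp add: field_simps)
      have "Q*1 < Q*(Q/R)" using RQ R0 Q by (intro mult_strict_left_mono) auto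
      hence 2: "Q < Q*(Q/R)" by simp
      have 3: "Q*(Q/R)<=norm v * Q" if "Q/R<=norm v"
       using mult_left_mono[OF that, of Q] Q by (simp add: mult.commute)
      from cs show ?thesis
      proof (elim disjE conjE)
       assume "norm u<=R" "h^2/R<=norm v"
       thus ?thesis using 1 3 by (simp add: Q_def)
      next
       assume "u = q" "h^2/R<=norm v"
       thus ?thesis using 2 3 Q(2) by (simp add: Q_def)
      next
       assume "norm u<=R" "v = 1"
       thus ?thesis using RQ by simp
      qed
     qed
     ultimately show False by simp
    qed
   qed
  qed
 qed
qed

end

subsection \<open>The two quadratic polynomials of the curve\<close>

text \<open>On the curve, \<open>nA\<close> and \<open>nA'\<close> become, up to constants, the
  coefficients of the series of Q(x,0) in the unshifted and the shifted relation; \<open>nB\<close>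
  and \<open>nB'\<close> play this role for Q(0,y). Each primed quadratic is the reflection of the
  unprimed one.\<close>

definition nA :: "complex => complex => complex => complex => complex poly" where
 "nA A ex ey h = [:A - h\<^sup>2,(h^2 + 1)*A*ex - (A + 1)*h*ey,A*h^2 - 1:]"
definition nA' :: "complex => complex => complex => complex => complex poly" where
 "nA' A ex ey h = [:A*h^2 - 1,(h^2 + 1)*A*ex - (A + 1)*h*ey,A - h\<^sup>2:]"
definition nB :: "complex => complex => complex => complex => complex poly" where
 "nB B ex ey h = [:h\<^sup>2*(B*h^2 - 1),h*((h^2 + 1)*B*ey - (B + 1)*h*ex),B - h\<^sup>2:]"
definition nB' :: "complex => complex => complex => complex => complex poly" where
 "nB' B ex ey h = [:B - h\<^sup>2,h*((h^2 + 1)*B*ey - (B + 1)*h*ex),h\<^sup>2*(B*h^2 - 1):]"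

lemma quadratic_roots:
 fixes c0 c1 c2 :: complex
 assumes "c2~=0"
 obtains z1 z2 where "c2*(z1 + z2) = - c1" "c2*(z1*z2) = c0"
proof
 define s where "s = csqrt (c1^2 - 4 * c0 * c2)"
 have s: "s * s = c1 * c1 - 4 * c0 * c2" by (simp add: s_def power2_eq_square[symmetric])
 show "c2*((-c1 + s)/(2 * c2) + (-c1 - s)/(2 * c2)) = - c1" using assms by (simp add: field_simps)
 have "c2*((-c1 + s)/(2 * c2)*((-c1 - s)/(2 * c2))) = (c1 * c1 - s * s)/(4 * c2)"
  using assms by (simp add: field_simps)
 thus "c2*((-c1 + s)/(2 * c2)*((-c1 - s)/(2 * c2))) = c0" unfolding s using assms by (simp add: field_simps)
qed

lemma quadratic_factor:
 assumes "c2*(z1 + z2) = - c1" "c2*(z1*z2) = (c0::complex)"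
 shows "[:c0,c1,c2:] = smult c2 ([:-z1,1:]*[:-z2,1:])"
  "[:c2,c1,c0:] = smult c2 ([:1,-z1:]*[:1,-z2:])"
 using assms by (simp_all add: algebra_simps eq_neg_iff_add_eq_0)

lemma quadratic_root_le:
 fixes z :: complex
 assumes "c0 + c1*z + c2*z^2 = 0" "norm c0<=M" "norm c1<=M" "m<=norm c2" "m > 0"
 shows "norm z<=max 1 (2*M/m)"
proof (cases "norm z<=1")
 case False
 have M: "M>=0" by (rule order_trans[OF norm_ge_zero assms(2)])
 have "c0 + c1*z = - (c2*(z*z))" using assms(1) unfolding eq_neg_iff_add_eq_0 power2_eq_square .
 hence "norm (c0 + c1*z) = norm (c2*(z*z))" by (simp only: norm_minus_cancel)
 hence "norm c2*(norm z*norm z) = norm (c0 + c1*z)" by (simp only: norm_mult)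
 also have "...<=norm c0 + norm c1*norm z" using norm_triangle_ineq[of c0 "c1*z"] by (simp add: norm_mult)
 also have "...<=M*norm z + M*norm z"
 proof (intro add_mono mult_right_mono assms)
  have "M*1<=M*norm z" using False M by (intro mult_left_mono) auto
  thus "norm c0<=M*norm z" using assms(2) by simp
 qed auto
 finally have "norm c2*norm z*norm z<=2*M*norm z" by (simp add: mult_ac)
 hence "norm c2*norm z<=2*M" by (rule mult_right_le_imp_le) (use False in linarith)
 moreover have "m*norm z<=norm c2*norm z" using assms(4) by (intro mult_right_mono) auto
 ultimately have "norm z<=2*M/m" using assms(5) by (simp add: field_simps)
 thus ?thesis by simp
qed simp

text \<open>The lower bound is the upper bound for the reciprocal, a root of the reversed
  quadratic.\<close>

lemma quadratic_root_bounds: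
 fixes z :: complex
 assumes "c0 + c1*z + c2*z^2 = 0" "norm c0<=M" "norm c1<=M" "norm c2<=M"
  "m<=norm c0" "m<=norm c2" "m > 0" "R = max 1 (2*M/m)"
 shows "1/R<=norm z & norm z<=R"
proof -
 have z: "z~=0" using assms by auto
 have "c2 + c1*(1/z) + c0*(1/z)^2 = (c0 + c1*z + c2*z^2)/z^2"
  using z by (simp add: field_simps power2_eq_square)
 hence "norm (1/z)<=R" using quadratic_root_le[of c2 c1 "1/z" c0 M m] assms by simp
 hence "1/R<=norm z" using z assms(8) by (simp add: norm_divide field_simps)
 thus ?thesis using quadratic_root_le[OF assms(1,2,3,6,7)] assms(8) by simp
qed

lemma ex_bound_threshold:
 fixes R H :: real
 assumes "R>=1" "H > 0" "P R H" shows "EX R>=1. EX H>0. P R H"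
 using assms by blast

text \<open>With \<open>w = 1/h\<close> this is \<open>nA\<close> divided by \<open>h^2\<close>. As
  \<open>w\<close> tends to 0 the extreme coefficients tend to -1 and \<open>A\<close>, both
  nonzero, so the roots stay in a fixed annulus.\<close>

lemma scaled_root_bounds:
 fixes A :: complex
 assumes "A~=0" "M>=0"
 shows "EX R>=1. EX et>0. ALL w e1 e2 z. norm w < et --> norm e1<=M --> norm e2<=M -->
  (A*w^2 - 1) + ((1 + w^2)*A*e1 - (A + 1)*w*e2)*z + (A - w\<^sup>2)*z^2 = 0 -->
  1/R<=norm z & norm z<=R"
proof -
 define m where "m = min (norm A) 1/2"
 define K where "K = (2*norm A + (norm A + 1))*(M + 1) + 1"
 define et where "et = min 1 (min (norm A/2) (1/(2*norm A)))"
 have nA: "norm A > 0" using assms by simp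
 have m: "m > 0" "m<=norm A/2" "m<=1/2" using nA by (auto simp: m_def)
 have et: "et > 0" using nA by (simp add: et_def)
 have K1: "norm A + 2<=K" "2*norm A*M + (norm A + 1)*M<=K" unfolding K_def using assms(2) nA
  by (auto simp: algebra_simps)
 show ?thesis
 proof (rule ex_bound_threshold[of "max 1 (2*K/m)" et]; (intro allI impI conjI)?)
  fix w e1 e2 z assume w: "norm w < et" and e: "norm e1<=M" "norm e2<=M"
   and z: "(A*w^2 - 1) + ((1 + w^2)*A*e1 - (A + 1)*w*e2)*z + (A - w\<^sup>2)*z^2 = 0"
  have w1: "norm w<=1" "norm w<=norm A/2" "norm w<=1/(2*norm A)" using w by (auto simp: et_def)
  have "norm w*norm w<=norm w*1" using w1 by (intro mult_left_mono) auto
  hence ww: "norm (w^2)<=norm w" by (simp add: norm_mult power2_eq_square)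
  have Aw: "norm (A*w^2)<=1/2"
  proof -
   have "norm A*norm (w^2)<=norm A*(1/(2*norm A))" using ww w1 by (intro mult_left_mono) auto
   thus ?thesis using nA by (simp add: norm_mult)
  qed
  have "norm ((1 + w^2)*A*e1 - (A + 1)*w*e2)<=norm (1 + w^2)*norm A*norm e1 + norm (A + 1)*norm w*norm e2"
   using norm_triangle_ineq4[of "(1 + w^2)*A*e1" "(A + 1)*w*e2"] by (simp add: norm_mult)
  also have "...<=2*norm A*M + (norm A + 1)*1*M"
  proof (intro add_mono mult_mono)
   show "norm (1 + w^2)<=2" using norm_triangle_ineq[of 1 "w^2"] ww w1 by simp
   show "norm (A + 1)<=norm A + 1" using norm_triangle_ineq[of A 1] by simp
  qed (use e w1 assms nA in auto)
  finally have c1: "norm ((1 + w^2)*A*e1 - (A + 1)*w*e2)<=K" using K1 by simp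
  have "norm (A*w^2 - 1)<=norm (A*w^2) + 1" "1 - norm (A*w^2)<=norm (A*w^2 - 1)"
   using norm_triangle_ineq4[of "A*w^2" 1] norm_triangle_ineq2[of 1 "A*w^2"]
   by (simp_all add: norm_minus_commute)
  hence c0: "norm (A*w^2 - 1)<=K" "m<=norm (A*w^2 - 1)" using Aw m K1 nA by linarith+
  have "norm (A - w\<^sup>2)<=norm A + norm (w^2)" "norm A - norm (w^2)<=norm (A - w\<^sup>2)"
   by (rule norm_triangle_ineq4 norm_triangle_ineq2)+
  hence c2: "norm (A - w\<^sup>2)<=K" "m<=norm (A - w\<^sup>2)" using ww w1 m K1 nA by linarith+
  have "1/max 1 (2*K/m)<=norm z & norm z<=max 1 (2*K/m)"
   by (rule quadratic_root_bounds[OF z c0(1) c1 c2(1) c0(2) c2(2) m(1) refl])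
  thus "1/max 1 (2*K/m)<=norm z" "norm z<=max 1 (2*K/m)" by auto
 qed (use et in auto)
qed

text \<open>In the four cases the roots of \<open>nA\<close> have size \<open>1\<close> (\<open>A \<noteq> 0\<close>) or \<open>h\<close> (\<open>A = 0\<close>), those of \<open>nB\<close>
  size `h` (`B~=0`) or `1` (`B = 0`).\<close>

definition roots_bounded :: "complex => complex => complex => complex => complex => real => bool" where
 "roots_bounded A B ex ey h R \<longleftrightarrow>
   (ALL z. poly (nA A ex ey h) z = 0 --> (if A = 0 then norm h else 1)/R<=norm z & norm z<=(if A = 0 then norm h else 1)*R) &
   (ALL z. poly (nB B ex ey h) z = 0 --> (if B = 0 then 1 else norm h)/R<=norm z & norm z<=(if B = 0 then 1 else norm h)*R)"

lemma nA_root_bounds: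
 assumes "M>=0"
 shows "EX R>=1. EX H>0. ALL h ex ey z. norm h > H --> norm ex<=M --> norm ey<=M --> poly (nA A ex ey h) z = 0 -->
   (if A = 0 then norm h else 1)/R<=norm z & norm z<=(if A = 0 then norm h else 1)*R"
proof (cases "A = 0")
 case False
 obtain R et where R: "R>=1" "et > 0" and b: "!!w e1 e2 z. norm w < et ==> norm e1<=M ==> norm e2<=M ==>
  (A*w^2 - 1) + ((1 + w^2)*A*e1 - (A + 1)*w*e2)*z + (A - w\<^sup>2)*z^2 = 0 ==>
  1/R<=norm z & norm z<=R"
  using scaled_root_bounds[OF False assms] by (elim exE conjE) blast
 show ?thesis
 proof (rule ex_bound_threshold[of R "1/et"]; (intro allI impI conjI)?)
  fix h ex ey z :: complex assume h: "norm h > 1/et" and e: "norm ex<=M" "norm ey<=M" and z: "poly (nA A ex ey h) z = 0"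
  have "0 < 1/et" using R by simp
  hence hp: "norm h > 0" using h by linarith
  have w: "norm (1/h) < et" using h R hp by (simp add: norm_divide field_simps)
  have "(A*(1/h)^2 - 1) + ((1 + (1/h)^2)*A*ex - (A + 1)*(1/h)*ey)*z + (A - (1/h)\<^sup>2)*z^2
    = poly (nA A ex ey h) z/h^2" using hp by (simp add: nA_def field_simps power2_eq_square)
  from b[OF w e, of z] this z False
  show "(if A = 0 then norm h else 1)/R<=norm z" "norm z<=(if A = 0 then norm h else 1)*R" by auto
 qed (use R in auto)
next
 case True
 define R where "R = max 1 (2*(M + 1)/1)"
 show ?thesis
 proof (rule ex_bound_threshold[of R 1]; (intro allI impI conjI)?)
  fix h ex ey z :: complex assume h: "norm h > 1" and e: "norm ex<=M" "norm ey<=M" and z: "poly (nA A ex ey h) z = 0"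
  have hp: "h~=0" using h by auto
  \<comment> \<open>For \<open>A = 0\<close> the rescaled root \<open>z/h\<close> satisfies a
    quadratic with extreme coefficients 1 and a bounded middle one.\<close>
  have "1 + ey*(z/h) + 1*(z/h)^2 = - poly (nA A ex ey h) z/h^2"
   using hp True by (simp add: nA_def field_simps power2_eq_square)
  hence "1/R<=norm (z/h) & norm (z/h)<=R" using e assms z
   by (intro quadratic_root_bounds[OF _ _ _ _ _ _ _ R_def, where ?c1.0 = ey and ?c0.0 = 1 and ?c2.0 = 1]) auto
  hence "1/R<=norm z/norm h" "norm z/norm h<=R" by (auto simp: norm_divide)
  moreover have "norm h > 0" using h by linarith
  ultimately show "(if A = 0 then norm h else 1)/R<=norm z" "norm z<=(if A = 0 then norm h else 1)*R"
   using True by (auto simp: pos_le_divide_eq pos_divide_le_eq mult.commute)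
 qed (auto simp: R_def)
qed

text \<open>Exchanging x and y acts on the parameter of the curve as s -> h/s.\<close>

lemma nB_nA_root:
 assumes "h~=0" "z~=0" "poly (nB B ex ey h) z = 0"
 shows "poly (nA B ey ex h) (h/z) = 0"
proof -
 have "poly (nA B ey ex h) (h/z) = poly (nB B ex ey h) z/z^2"
  using assms(1,2) by (simp add: nA_def nB_def field_simps power2_eq_square)
 thus ?thesis using assms(3) by simp
qed

lemma nB_root_bounds:
 assumes "M>=0"
 shows "EX R>=1. EX H>0. ALL h ex ey z. norm h > H --> norm ex<=M --> norm ey<=M --> poly (nB B ex ey h) z = 0 -->
   (if B = 0 then 1 else norm h)/R<=norm z & norm z<=(if B = 0 then 1 else norm h)*R"
proof -
 obtain R H where R: "R>=1" "H > 0" and b: "!!h ex ey z. norm h > H ==> norm ex<=M ==> norm ey<=M ==> poly (nA B ex ey h) z = 0 ==>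
   (if B = 0 then norm h else 1)/R<=norm z & norm z<=(if B = 0 then norm h else 1)*R"
  using nA_root_bounds[OF assms, of B] by (elim exE conjE) blast
 define H' where "H' = max H (1 + 1/norm B)"
 show ?thesis
 proof (rule ex_bound_threshold[of R H']; (intro allI impI conjI)?)
  fix h ex ey z :: complex assume h: "norm h > H'" and e: "norm ex<=M" "norm ey<=M" and z: "poly (nB B ex ey h) z = 0"
  have h1: "norm h > 0" "norm h > H" "norm h > 1 + 1/norm B" using h R by (auto simp: H'_def)
  have h2: "norm h > 1" using h1(3) by (smt (verit) divide_nonneg_nonneg norm_ge_zero)
  have "B*h^2~=1"
  proof (cases "B = 0")
   case False
   have "norm B*(1/norm B) < norm B*norm h" using h1(3) False by (intro mult_strict_left_mono) auto
   hence "1 < norm B*norm h" using False by simp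
   also have "...<=norm B*(norm h*norm h)" using h2 mult_left_mono[of 1 "norm h" "norm h"] by (intro mult_left_mono) auto
   also have "... = norm (B*h^2)" by (simp add: norm_mult norm_power power2_eq_square)
   finally show ?thesis by auto
  qed simp
  hence z0: "z~=0" using z h1 by (auto simp: nB_def)
  have hz: "h~=0" using h1 by auto
  have *: "(if B = 0 then norm h else 1)/R<=norm (h/z) & norm (h/z)<=(if B = 0 then norm h else 1)*R"
   by (rule b[OF h1(2) e(2,1) nB_nA_root[OF hz z0 z]])
  have nz: "norm z > 0" using z0 by simp
  show "(if B = 0 then 1 else norm h)/R<=norm z" "norm z<=(if B = 0 then 1 else norm h)*R"
   using*nz h1(1) R by (auto simp: norm_divide field_simps split: if_splits)
 qed (use R in "auto simp: H'_def")
qed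

lemma ex_roots_bounded:
 assumes "M>=0"
 shows "EX R>=1. EX H>0. ALL h ex ey. norm h > H --> norm ex<=M --> norm ey<=M --> roots_bounded A B ex ey h R"
proof -
 obtain R1 H1 where 1: "R1>=1" "H1 > 0" "!!h ex ey z. norm h > H1 ==> norm ex<=M ==> norm ey<=M ==> poly (nA A ex ey h) z = 0 ==>
   (if A = 0 then norm h else 1)/R1<=norm z & norm z<=(if A = 0 then norm h else 1)*R1"
  using nA_root_bounds[OF assms, of A] by (elim exE conjE) blast
 obtain R2 H2 where 2: "R2>=1" "H2 > 0" "!!h ex ey z. norm h > H2 ==> norm ex<=M ==> norm ey<=M ==> poly (nB B ex ey h) z = 0 ==>
   (if B = 0 then 1 else norm h)/R2<=norm z & norm z<=(if B = 0 then 1 else norm h)*R2"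
  using nB_root_bounds[OF assms, of B] by (elim exE conjE) blast
 have mono: "x/max R1 R2<=x/R & x*R<=x*max R1 R2" if "R : {R1, R2}" "x>=0" for x R
  using that 1(1) 2(1) by (auto intro!: divide_left_mono mult_left_mono)
 show ?thesis
 proof (rule ex_bound_threshold[of "max R1 R2" "max H1 H2"]; (intro allI impI conjI)?)
  fix h ex ey :: complex assume h: "norm h > max H1 H2" and e: "norm ex<=M" "norm ey<=M"
  show "roots_bounded A B ex ey h (max R1 R2)"
   unfolding roots_bounded_def
  proof (intro conjI allI impI)
   fix z assume "poly (nA A ex ey h) z = 0"
   from 1(3)[OF _ e this] h mono[of R1 "if A = 0 then norm h else 1"]
   show "(if A = 0 then norm h else 1)/max R1 R2<=norm z" "norm z<=(if A = 0 then norm h else 1)*max R1 R2"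
    by (auto intro: order_trans)
  next
   fix z assume "poly (nB B ex ey h) z = 0"
   from 2(3)[OF _ e this] h mono[of R2 "if B = 0 then 1 else norm h"]
   show "(if B = 0 then 1 else norm h)/max R1 R2<=norm z" "norm z<=(if B = 0 then 1 else norm h)*max R1 R2"
    by (auto intro: order_trans)
  qed
 qed (use 1 2 in auto)
qed

context qdil
begin

definition kernel_eq :: "complex => complex => complex => complex => complex => complex => complex fls => bool" where
 "kernel_eq A B ex ey h k g \<longleftrightarrow>
   toR (nA A ex ey h*nB' B ex ey h)*dil g =
    toR (nA' A ex ey h*nB B ex ey h)*g + fls_const k*fls_X*toR (nA' A ex ey h - nA A ex ey h)"

lemma kernel_eq_curve_eq:
 assumes A: "A*h^2 - 1~=0" "(A*h^2 - 1)*(p1 + p2) = - ((h^2 + 1)*A*ex - (A + 1)*h*ey)"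
   "(A*h^2 - 1)*(p1*p2) = A - h\<^sup>2"
  and B: "B - h\<^sup>2~=0" "(B - h\<^sup>2)*(r1 + r2) = - (h*((h^2 + 1)*B*ey - (B + 1)*h*ex))"
   "(B - h\<^sup>2)*(r1*r2) = h^2*(B*h^2 - 1)"
  and g: "kernel_eq A B ex ey h k g"
 shows "curve_eq p1 p2 r1 r2 (k/(B - h\<^sup>2)) g"
proof -
 define a b where "a = A*h^2 - 1" and "b = B - h\<^sup>2"
 have ab: "a~=0" "b~=0" using A B by (auto simp: a_def b_def)
 have 1: "nA A ex ey h = smult a ([:-p1,1:]*[:-p2,1:])" "nA' A ex ey h = smult a ([:1,-p1:]*[:1,-p2:])"
  unfolding nA_def nA'_def a_def by (rule quadratic_factor[OF A(2,3)])+
 have 2: "nB B ex ey h = smult b ([:-r1,1:]*[:-r2,1:])" "nB' B ex ey h = smult b ([:1,-r1:]*[:1,-r2:])"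
  unfolding nB_def nB'_def b_def by (rule quadratic_factor[OF B(2,3)])+
 define P1 P2 L1 L2 where "P1 = toR ([:-p1,1:]*[:-p2,1:])" and "P2 = toR ([:1,-p1:]*[:1,-p2:])"
  and "L1 = toR ([:-r1,1:]*[:-r2,1:])" and "L2 = toR ([:1,-r1:]*[:1,-r2:])"
 define ca cb where "ca = fls_const a" and "cb = fls_const b"
 have cab: "ca~=0" "cb~=0" using ab by (auto simp: ca_def cb_def)
 have "ca * cb*(P1*L2*dil g) = ca * cb*(P2*L1*g) + fls_const k*fls_X*(ca*(P2 - P1))"
  using g unfolding ca_def cb_def kernel_eq_def 1 2 toR_diff toR_mult toR_smult P1_def P2_def L1_def L2_def
  by (simp only: toR_mult algebra_simps)
 also have "fls_const k = cb*fls_const (k/b)" using ab by (simp add: cb_def)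
 finally have "(ca * cb)*(P1*L2*dil g) = (ca * cb)*(P2*L1*g + fls_const (k/b)*fls_X*(P2 - P1))"
  by (simp only: algebra_simps)
 hence "P1*L2*dil g = P2*L1*g + fls_const (k/b)*fls_X*(P2 - P1)" using cab by (simp only: mult_cancel_left mult_eq_0_iff simp_thms)
 thus ?thesis unfolding curve_eq_def b_def[symmetric] toR_mult toR_diff P1_def P2_def L1_def L2_def
  by (simp only: toR_mult mult.assoc)
qed

end

section \<open>Parameters for which a gauge makes the multiplier constant\<close>

context qdil
begin

lemma count_list_off_orbit:
 assumes "z0~=0" "n~=0" "!!z. z : set zs ==> z~=z0 ==> ~ in_orbit z0 z"
 shows "count_list zs (z0*q powi n) = 0"
proof -
 have "z0*q powi n~=z0" by (rule orbit_neq[OF assms(1,2)])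
 thus ?thesis using assms(3) in_orbitI[of z0 n] by (auto simp: count_list_0_iff)
qed

lemma poly_lin2: "poly (smult c ([:-z1,1:]*[:-z2,1:])) z = c*((z - z1)*(z - z2))" for z :: complex
 by (simp add: algebra_simps)

text \<open>Here \<open>n\<^sub>A (q s)\<close> is \<open>q\<close> times the reflected polynomial of \<open>n\<^sub>A\<close>, so that \<open>g / n\<^sub>A\<close> satisfies an equation with constant coefficient.\<close>

lemma T00_equation:
 assumes q: "q = h^2" and g: "kernel_eq 0 0 ex ey h k g"
 shows "dil (g/toR (nA 0 ex ey h)) = fls_const (1/q)*(g/toR (nA 0 ex ey h)) +
  fls_const (k*(q - 1)/q)*fls_X*toR [:1,0,-1:]/toR (nA 0 ex ey h*nA' 0 ex ey h*nB 0 ex ey h)"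
proof -
 define P P' N where "P = toR (nA 0 ex ey h)" and "P' = toR (nA' 0 ex ey h)" and "N = toR (nB 0 ex ey h)"
 have h: "h~=0" using q q_nz by auto
 have nz: "P~=0" "P'~=0" "N~=0" using h by (auto simp: P_def P'_def N_def nA_def nA'_def nB_def)
 have dP: "dil P = fls_const q*P'"
  unfolding P_def P'_def dil_toR toR_smult[symmetric] nA_def nA'_def
  by (simp add: pcompose_pCons q power2_eq_square algebra_simps)
 have e: "nB' 0 ex ey h = nB 0 ex ey h" by (simp add: nB_def nB'_def)
 have d: "nA' 0 ex ey h - nA 0 ex ey h = smult (q - 1) [:1,0,-1:]" by (simp add: nA_def nA'_def q)
 define D where "D = toR [:1,0,-1:]"
 have g': "P*N*dil g = P'*N*g + fls_const k*fls_X*(fls_const (q - 1)*D)"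
  using g unfolding kernel_eq_def e d toR_mult toR_smult P_def P'_def N_def D_def .
 have c: "fls_const (1/q) = 1/fls_const q" "fls_const (k*(q - 1)/q) = fls_const k*fls_const (q - 1)/fls_const q"
  by (simp_all add: eq_divide_eq)
 have qz: "fls_const q~=0" by simp
 have "dil (g/P) = dil g/(fls_const q*P')" by (simp add: sig_divide dP)
 also have "dil g = (P'*N*g + fls_const k*fls_X*(fls_const (q - 1)*D))/(P*N)"
  using g' nz by (simp add: field_simps)
 finally show ?thesis
  unfolding toR_mult P_def[symmetric] P'_def[symmetric] N_def[symmetric] D_def[symmetric] c
  using nz qz by (simp add: divide_simps mult_ac)
qed

text \<open>Division by \<open>nA\<close> makes the multiplier the constant \<open>1/q\<close>. The
  denominator of the inhomogeneous term collects the roots of \<open>nA\<close>, \<open>nA'\<close>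
  and \<open>nB\<close>; where an isolated pole sits depends on the model and is left to
  \<open>iso\<close>.\<close>

lemma T00_not_Dalg:
 assumes q: "q = h^2" and g: "kernel_eq 0 0 ex ey h k g" and k: "k~=0"
  and p: "- 1*(p1 + p2) = - (-h*ey)" "p1*p2 = q"
  and r: "- q*(r1 + r2) = - (-q*ex)" "r1*r2 = 1"
  and iso: "!!de K. K~=0 ==>
   de*toR (linprod [p1, p2, 1/p1, 1/p2, r1, r2]) = toR (smult K ([:0,1:]*[:1,0,-1:])) ==> EX z0 m. isolated_pole z0 m de"
 shows "~ Dalg g"
proof
 assume "Dalg g"
 define P where "P = toR (nA 0 ex ey h)"
 define de where "de = fls_const (k*(q - 1)/q)*fls_X*toR [:1,0,-1:]/toR (nA 0 ex ey h*nA' 0 ex ey h*nB 0 ex ey h)"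
 have "P~=0" by (simp add: P_def nA_def)
 hence "Dalg (g/P)" using Dalg_affine[OF `Dalg g`, of P "g/P" 0] by (simp add: P_def ratfun_toR rat.zero_in)
 moreover have "~ Dalg (g/P)"
 proof -
  define K where "K = k*(q - 1)/q/(-q*q)"
  have K: "K~=0" using k q_gt1 by (auto simp: K_def)
  define L where "L = toR (linprod [p1, p2, 1/p1, 1/p2, r1, r2])"
  have L: "L~=0" by (simp add: L_def linprod_nz)
  have nz: "p1~=0" "p2~=0" using p(2) by auto
  have Dn: "nA 0 ex ey h*nA' 0 ex ey h*nB 0 ex ey h = smult (-q*q) (linprod [p1, p2, 1/p1, 1/p2, r1, r2])"
  proof -
   define a1 a2 b1 b2 c1 c2 where abc: "a1 = [:-p1,1:]" "a2 = [:-p2,1:]" "b1 = [:-(1/p1),1:]"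
    "b2 = [:-(1/p2),1:]" "c1 = [:-r1,1:]" "c2 = [:-r2,1:]"
   have 1: "[:1,-p1:] = smult (-p1) b1" "[:1,-p2:] = smult (-p2) b2" using nz by (simp_all add: abc)
   have p': "- 1*(p1*p2) = - q" and r': "- q*(r1*r2) = - q" using p r by simp_all
   have "nA 0 ex ey h = smult (-1) ([:-p1,1:]*[:-p2,1:])" "nA' 0 ex ey h = smult (-1) ([:1,-p1:]*[:1,-p2:])"
    using quadratic_factor[OF p(1) p'] by (simp_all add: nA_def nA'_def q)
   moreover have "nB 0 ex ey h = smult (-q) ([:-r1,1:]*[:-r2,1:])"
    using quadratic_factor(1)[OF r(1) r'] by (simp add: nB_def q power2_eq_square)
   ultimately have 2: "nA 0 ex ey h = smult (-1) (a1*a2)" "nA' 0 ex ey h = smult (-1) (smult (-p1) b1 * smult (-p2) b2)"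
    "nB 0 ex ey h = smult (-q) (c1 * c2)" unfolding 1 abc by blast+
   have "nA 0 ex ey h*nA' 0 ex ey h*nB 0 ex ey h = smult ((-1)*(-1)*(-q)*(-p1)*(-p2)) (a1*a2*(b1*b2)*(c1 * c2))"
    unfolding 2 by (simp add: mult_ac)
   also have "(-1)*(-1)*(-q)*(-p1)*(-p2) = - q*q" using p(2) by simp
   finally show ?thesis unfolding abc by (simp only: linprod_def list.map prod_list.Cons prod_list.Nil mult_1_right mult.assoc)
  qed
  have "de = fls_const (k*(q - 1)/q)*fls_X*toR [:1,0,-1:]/(fls_const (-q*q)*L)"
   unfolding de_def Dn toR_smult L_def ..
  also have "fls_const (k*(q - 1)/q) = fls_const (-q*q)*fls_const K" by (simp add: K_def)
  finally have "de = fls_const (-q*q)*(fls_const K*(fls_X*toR [:1,0,-1:]))/(fls_const (-q*q)*L)" by (simp only: mult.assoc)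
  also have "... = fls_const K*(fls_X*toR [:1,0,-1:])/L" by (rule nonzero_mult_divide_mult_cancel_left) simp
  finally have "de*L = fls_const K*(fls_X*toR [:1,0,-1:])" using L by simp
  also have "... = toR (smult K ([:0,1:]*[:1,0,-1:]))" unfolding toR_smult toR_mult by (simp add: toR_pCons)
  finally obtain z0 m where "isolated_pole z0 m de" using iso[OF K] unfolding L_def by blast
  thus ?thesis unfolding P_def de_def
   by (rule isolated_pole_not_Dalg[OF T00_equation[OF q g], rotated 2])
    (auto intro!: rat.divide_in rat.mult_in ratfun_const ratfun_X ratfun_toR)
 qed
 ultimately show False by blast
qed

text \<open>If the last root is \<open>1\<close> or \<open>- 1\<close>, it cancels against a zero of the numerator.\<close>

lemma linprod_cancel:
 assumes "de*toR (linprod (zs @ [r])) = toR (smult K ([:0,1:]*[:1,0,-1:]))" "r^2 = 1"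
 shows "de*toR (linprod zs) = toR (smult K ([:0,1:]*[:-r,-1:]))"
proof -
 have 1: "linprod (zs @ [r]) = linprod zs*[:-r,1:]"
  by (simp only: linprod_def map_append prod_list.append list.map prod_list.Cons prod_list.Nil mult_1_right)
 have 2: "[:1,0,-1:] = [:-r,-1:]*[:-r,1:]" using assms(2) by (simp add: power2_eq_square)
 have "de*toR (linprod zs)*toR [:-r,1:] = de*toR (linprod (zs @ [r]))" by (simp only: 1 toR_mult mult.assoc)
 also have "... = toR (smult K ([:0,1:]*[:-r,-1:]))*toR [:-r,1:]"
  unfolding assms(1) 2 by (simp only: toR_smult toR_mult mult.assoc)
 finally show ?thesis by (simp only: mult_cancel_right toR_eq_0_iff) simp
qed

text \<open>The condition on \<open>ex\<close> removes the middle coefficient of \<open>nA\<close>,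
  so \<open>nA' = - nA\<close>, and \<open>B = 0\<close> gives \<open>nB' = nB\<close>. The equation
  thus reduces to \<open>dil g + g\<close> being rational with denominator \<open>nB\<close> up to a
  constant.\<close>

lemma T10_not_Dalg:
 assumes q: "q = h^2" and ex: "(h^2 + 1)*ex = 2*h*ey" and g: "kernel_eq 1 0 ex ey h k g" and k: "k~=0"
  and R: "R>=1" "norm q > R^2" "!!z. poly (nB 0 ex ey h) z = 0 ==> 1/R<=norm z & norm z<=R"
 shows "~ Dalg g"
proof -
 have h: "h~=0" using q q_nz by auto
 obtain r1 r2 where r: "- q*(r1 + r2) = - (-q*ex)" "- q*(r1*r2) = - q"
  using quadratic_roots[of "- q" "- q*ex" "- q"] by auto
 have B: "nB 0 ex ey h = smult (-q) ([:-r1,1:]*[:-r2,1:])"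
  using quadratic_factor(1)[OF r] by (simp add: nB_def q power2_eq_square)
 have B': "nB' 0 ex ey h = nB 0 ex ey h" by (simp add: nB_def nB'_def)
 define P N where "P = toR (nA 1 ex ey h)" and "N = toR (linprod [r1, r2])"
 have A': "nA' 1 ex ey h = - nA 1 ex ey h" using ex by (simp add: nA_def nA'_def)
 have nz: "P~=0" "N~=0" using q q_gt1 by (auto simp: P_def N_def nA_def linprod_nz)
 have BN: "toR (nB 0 ex ey h) = fls_const (-q)*N" unfolding B toR_smult N_def linprod_def by simp
 have "P*(fls_const (-q)*N)*dil g = - P*(fls_const (-q)*N)*g + fls_const k*fls_X*(-P - P)"
  using g unfolding kernel_eq_def A' B' toR_mult toR_diff toR_uminus BN P_def[symmetric] .
 hence "P*(fls_const (-q)*(N*(dil g + g))) = P*(fls_const (-2*k)*fls_X)"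
  by (simp add: algebra_simps flip: fls_const_uminus) (simp add: algebra_simps fls_const_mult_const[symmetric])
 hence "fls_const (-q)*(N*(dil g + g)) = fls_const (-2*k)*fls_X" using nz by simp
 also have "fls_const (-2*k) = fls_const (-q)*fls_const (2*k/q)" by simp
 finally have "fls_const (-q)*(N*(dil g + g)) = fls_const (-q)*(fls_const (2*k/q)*fls_X)" by (simp only: mult.assoc)
 moreover have "fls_const (-q)~=0" by simp
 ultimately have "N*(dil g + g) = fls_const (2*k/q)*fls_X" by (simp only: mult_cancel_left simp_thms)
 hence d: "(dil g + g)*toR (linprod [r1, r2]) = toR [:0,2*k/q:]"
  by (simp add: N_def toR_pCons mult_ac)
 have rb: "1/R<=norm z & norm z<=R" if "z : {r1, r2}" for z
  by (rule R(3)) (use that in "auto simp only: B poly_lin2 insert_iff empty_iff diff_self mult_zero_left mult_zero_right")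
 have "r1~=0" "r2~=0" using r(2) by auto
 moreover have "norm z < norm q*norm w" if "z : {r1, r2}" "w : {r1, r2}" for z w
 proof -
  have "norm z<=R" using rb[OF that(1)] by simp
  also have "R < norm q*(1/R)" using R(1,2) by (simp add: field_simps power2_eq_square)
  also have "...<=norm q*norm w" using rb[OF that(2)] by (intro mult_left_mono) auto
  finally show ?thesis .
 qed
 ultimately show ?thesis using k by (intro antisymmetric_not_Dalg[OF refl d]) auto
qed

text \<open>\<open>A = 0\<close> makes \<open>nA\<close> at \<open>q*s\<close> equal to
  \<open>q\<close> times \<open>nA'\<close>, and the condition on \<open>ey\<close> reduces
  \<open>nB\<close> to a multiple of s^2 - q.\<close>

lemma T01_not_Dalg:
 assumes q: "q = h^2" and ey: "(h^2 + 1)*ey = 2*h*ex" and g: "kernel_eq 0 1 ex ey h k g" and k: "k~=0"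
  and R: "R>=1" "norm q > R^2" "!!z. poly (nA 0 ex ey h) z = 0 ==> norm h/R<=norm z & norm z<=norm h*R"
 shows "~ Dalg g"
proof
 assume Dg: "Dalg g"
 have h: "h~=0" using q q_nz by auto
 obtain p1 p2 where p: "- 1*(p1 + p2) = - (-h*ey)" "- 1*(p1*p2) = - q"
  using quadratic_roots[of "- 1" "- h*ey" "- q"] by auto
 have A: "nA 0 ex ey h = smult (-1) ([:-p1,1:]*[:-p2,1:])"
  using quadratic_factor(1)[OF p] by (simp add: nA_def q)
 define P P' S where "P = toR (nA 0 ex ey h)" and "P' = toR (nA' 0 ex ey h)" and "S = toR [:-q,0,1:]"
 have nz: "P~=0" "P'~=0" "S~=0" using h by (auto simp: P_def P'_def S_def nA_def nA'_def)
 have dP: "dil P = fls_const q*P'"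
  unfolding P_def P'_def dil_toR toR_smult[symmetric] nA_def nA'_def
  by (simp add: pcompose_pCons q power2_eq_square algebra_simps)
 define S' where "S' = toR [:1,0,-q:]"
 have "dil S = fls_const (-q)*S'"
  unfolding S_def S'_def dil_toR toR_smult[symmetric] by (simp add: pcompose_pCons algebra_simps)
 hence dS: "dil S = - fls_const q*S'" by (simp add: fls_const_uminus)
 have B: "nB 1 ex ey h = smult (1 - q) [:-q,0,1:]" "nB' 1 ex ey h = smult (1 - q) [:1,0,-q:]"
  using ey by (simp_all add: nB_def nB'_def q algebra_simps)
 define c c1 where "c = fls_const (k/(q - 1))" and "c1 = fls_const (1 - q)"
 have c1: "c1~=0" using q_gt1 by (auto simp: c1_def)
 have kc: "fls_const k = - c1 * c" using q_gt1 by (auto simp: c_def c1_def simp flip: fls_const_uminus)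
 have "P*(c1*S')*dil g = P'*(c1*S)*g + - c1 * c*fls_X*(P' - P)"
  using g unfolding kernel_eq_def B toR_mult toR_diff toR_smult kc P_def P'_def S_def S'_def c1_def .
 hence "c1*(P*S'*dil g) = c1*(P'*S*g - c*fls_X*(P' - P))" by (simp add: algebra_simps)
 hence E: "P*S'*dil g = P'*S*g - c*fls_X*(P' - P)" using c1 by simp
 \<comment> \<open>The factor \<open>S/P\<close> makes the multiplier -1; the added multiple of
   \<open>fls_X/P\<close> removes \<open>P'\<close> from the denominator of the inhomogeneous
   term.\<close>
 define M where "M = S*g/P + c*fls_X/P"
 have qz: "fls_const q~=0" by simp
 have dc: "dil c = c" by (simp add: c_def)
 have "dil M = - (S'*dil g/P') + c*fls_X/P'"
  unfolding M_def using nz qz by (simp add: sig_add sig_mult sig_divide dP dS dc divide_simps mult_ac) (simp add: algebra_simps)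
 also have "S'*dil g = (P'*S*g - c*fls_X*(P' - P))/P" using E nz by (simp add: field_simps)
 finally have dM: "dil M = - ((P'*S*g - c*fls_X*(P' - P))/P/P') + c*fls_X/P'" .
 have e1: "dil M + M = (c + c)*fls_X/P" unfolding dM unfolding M_def using nz by (simp add: divide_simps) (simp add: algebra_simps)
 have e2: "(c + c)*fls_X/P*toR (linprod [p1, p2]) = toR [:0,-(k/(q - 1) + k/(q - 1)):]"
 proof -
  have P: "P = - toR (linprod [p1, p2])" unfolding P_def A toR_smult linprod_def by (simp add: fls_const_minus_1)
  have "toR [:0,-(x + x):] = - ((fls_const x + fls_const x)*fls_X)" for x
   by (simp add: toR_pCons fls_plus_const fls_const_uminus mult.commute)
  hence "toR [:0,-(k/(q - 1) + k/(q - 1)):] = - ((c + c)*fls_X)" unfolding c_def .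
  thus ?thesis unfolding P using linprod_nz[of "[p1, p2]"] by simp
 qed
 have e3: "norm z < norm q*norm w" if "z : {p1, p2}" "w : {p1, p2}" for z w
 proof -
  have pb: "norm h/R<=norm z & norm z<=norm h*R" if "z : {p1, p2}" for z
   by (rule R(3)) (use that in "auto simp only: A poly_lin2 insert_iff empty_iff diff_self mult_zero_left mult_zero_right")
  have "norm h*R < norm q*(norm h/R)" using R(1,2) h by (simp add: field_simps power2_eq_square)
  also have "...<=norm q*norm w" using pb[OF that(2)] by (intro mult_left_mono) auto
  finally show ?thesis using pb[OF that(1)] by simp
 qed
 have e4: "p1~=0" "p2~=0" using p(2) by auto
 have "~ Dalg M" by (rule antisymmetric_not_Dalg[OF e1 e2 _ e4 e3 e3]) (use k q_gt1 in auto)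
 moreover have "Dalg M"
 proof (rule Dalg_affine[OF Dg])
  show "g = (P/S)*M + (-(c*fls_X/S))" unfolding M_def using nz by (simp add: field_simps)
 qed (use nz in "auto intro!: rat.divide_in rat.mult_in rat.uminus_in ratfun_const ratfun_X ratfun_toR simp: P_def S_def c_def")
 ultimately show False by blast
qed

text \<open>For \<open>A = B = 0\<close> a gauge gives a constant multiplier. Otherwise either a
  root is available that is not its own partner, or the coincidences force one of the gauges
  \<open>T10\<close>, \<open>T01\<close>, or \<open>A = B = 1\<close> with
  \<open>ex = ey = 0\<close>, the algebraic case excluded by \<open>ne\<close>.\<close>

theorem bounded_not_Dalg:
 assumes q: "q = h^2" and R: "R>=1" "norm h > R^4" "roots_bounded A B ex ey h R"
  and nz: "A~=-1" "B~=-1" "A*q~=1" "B~=q"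
  and g: "kernel_eq A B ex ey h k g" "g~=0" and k: "A*B~=1 ==> k~=0"
  and ne: "~ (A = 1 & B = 1 & ex = 0 & ey = 0)"
 shows "~ Dalg g"
proof -
 note sf = size_facts[OF R(1,2)]
 have h: "h~=0" using q q_nz by auto
 have q1: "q~=1" "q~=-1" using q_gt1 by auto
 have az1: "A + 1~=0" "B + 1~=0" "q + 1~=0" "q - 1~=0" using nz q1 by (auto simp: eq_neg_iff_add_eq_0)
 have nq: "norm q = norm h^2" by (simp add: q norm_power)
 have az: "A*h^2 - 1~=0" "B - h\<^sup>2~=0" using nz(3,4) unfolding q by auto
 obtain p1 p2 where p: "(A*h^2 - 1)*(p1 + p2) = - ((h^2 + 1)*A*ex - (A + 1)*h*ey)" "(A*h^2 - 1)*(p1*p2) = A - h\<^sup>2"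
  using quadratic_roots[OF az(1)] by metis
 obtain r1 r2 where r: "(B - h\<^sup>2)*(r1 + r2) = - (h*((h^2 + 1)*B*ey - (B + 1)*h*ex))"
   "(B - h\<^sup>2)*(r1*r2) = h^2*(B*h^2 - 1)"
  using quadratic_roots[OF az(2)] by metis
 have fA: "nA A ex ey h = smult (A*h^2 - 1) ([:-p1,1:]*[:-p2,1:])" unfolding nA_def by (rule quadratic_factor[OF p])
 have fA': "nA' A ex ey h = smult (A*h^2 - 1) ([:1,-p1:]*[:1,-p2:])" unfolding nA'_def by (rule quadratic_factor[OF p])
 have fB: "nB B ex ey h = smult (B - h\<^sup>2) ([:-r1,1:]*[:-r2,1:])" unfolding nB_def by (rule quadratic_factor[OF r])
 have pb: "(if A = 0 then norm h else 1)/R<=norm z & norm z<=(if A = 0 then norm h else 1)*R" if "z : {p1, p2}" for z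
  using R(3) that unfolding roots_bounded_def fA poly_lin2 by fastforce
 have rb: "(if B = 0 then 1 else norm h)/R<=norm z & norm z<=(if B = 0 then 1 else norm h)*R" if "z : {r1, r2}" for z
  using R(3) that unfolding roots_bounded_def fB poly_lin2 by fastforce
 have ce: "curve_eq p1 p2 r1 r2 (k/(B - h\<^sup>2)) g" by (rule kernel_eq_curve_eq[OF az(1) p az(2) r g(1)])
 have pp: "p1*p2~=1"
 proof
  assume "p1*p2 = 1"
  hence "A*h^2 - 1 = A - h\<^sup>2" using p(2) by simp
  moreover have "(A + 1)*(q - 1) = (A*h^2 - 1) - (A - h\<^sup>2)" by (simp add: q algebra_simps)
  ultimately have "(A + 1)*(q - 1) = 0" by simp
  thus False using az1 by simp
 qed
 have rq: "r1*r2~=q"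
 proof
  assume "r1*r2 = q"
  hence "(B - h\<^sup>2)*q = h^2*(B*h^2 - 1)" using r(2) by simp
  moreover have "q*((B + 1)*(q - 1)) = h^2*(B*h^2 - 1) - (B - h\<^sup>2)*q" unfolding q[symmetric] by (simp add: algebra_simps)
  ultimately have "q*((B + 1)*(q - 1)) = 0" by simp
  thus False using az1 by simp
 qed
 \<comment> \<open>Both roots square to 1 while their product is not 1, so they are 1 and
   -1.\<close>
 have pd: "A = 1 & (q + 1)*ex = 2*h*ey" if "p1^2 = 1" "p2^2 = 1"
 proof -
  have "p1 = 1 & p2 = -1 | p1 = -1 & p2 = 1" using that pp unfolding power2_eq_1_iff by auto
  hence e: "p1 + p2 = 0" "p1*p2 = -1" by auto
  have "(A - 1)*(q + 1) = (A - h\<^sup>2) - (A*h^2 - 1)*(-1)" unfolding q[symmetric] by (simp add: algebra_simps)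
  also have "... = 0" using p(2) unfolding e by simp
  finally have "A = 1" using az1 by simp
  thus ?thesis using p(1) unfolding e by (simp add: q)
 qed
 have rd: "B = 1 & (q + 1)*ey = 2*h*ex" if "r1^2 = q" "r2^2 = q"
 proof -
  have "(r1 - r2)*(r1 + r2) = 0" using that by (simp add: power2_eq_square algebra_simps)
  moreover have "r1~=r2" using that rq by (auto simp: power2_eq_square)
  ultimately have e: "r1 + r2 = 0" by simp
  have e2: "r1*r2 = - q" using e that(1) by (simp add: power2_eq_square add_eq_0_iff)
  have "q*((B - 1)*(q + 1)) = h^2*(B*h^2 - 1) - (B - h\<^sup>2)*(-q)" unfolding q[symmetric] by (simp add: algebra_simps)
  also have "... = 0" using r(2) unfolding e2 by simp
  finally have "B = 1" using az1 by simp
  thus ?thesis using r(1) h unfolding e by (simp add: q)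
 qed
 have nR: "norm q > R^2" using sf nq by simp
 show ?thesis
 proof (cases "A = 0")
  case A0: True
  have pb': "norm h/R<=norm x & norm x<=norm h*R" if "x : {p1, p2}" for x using pb[OF that] A0 by simp
  have pq: "p1*p2 = q" using p(2) A0 by (simp add: q)
  show ?thesis
  proof (cases "B = 0")
   case B0: True
   have rb': "1/R<=norm x & norm x<=R" if "x : {r1, r2}" for x using rb[OF that] B0 by simp
   have rr: "r1*r2 = 1" using r(2) B0 h by simp
   have nzr: "p1~=0" "p2~=0" "r1~=0" "r2~=0" using pq rr by auto
   \<comment> \<open>The isolated pole is sought at \<open>r1\<close>, of size about 1. The roots of
     \<open>nA\<close> have size about \<open>h\<close> and their inverses about \<open>1/h\<close>,
     each strictly between consecutive moduli of the orbit of \<open>r1\<close>.\<close>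
   have off: "~ in_orbit r1 z" if "z : {p1, p2, 1/p1, 1/p2}" for z
   proof -
    have R0: "R > 0" and hR: "R^2 < norm h" using sf by auto
    have a: "norm r1 < norm x" "norm x < norm r1*norm q" if "x : {p1, p2}" for x
    proof -
     have "R < norm h/R" using hR R0 by (simp add: field_simps power2_eq_square)
     thus "norm r1 < norm x" using pb'[OF that] rb'[of r1] by simp
     have "norm h*(R*R) < norm h*norm h" using hR h by (simp add: power2_eq_square)
     hence "norm h*R < (1/R)*norm q" using R0 by (simp add: field_simps nq power2_eq_square)
     also have "...<=norm r1*norm q" using rb'[of r1] by (intro mult_right_mono) auto
     finally show "norm x < norm r1*norm q" using pb'[OF that] by simp
    qed
    have b: "norm r1/norm q < norm (1/x)" "norm (1/x) < norm r1" if "x : {p1, p2}" for x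
    proof -
     have xz: "norm x > 0" using that nzr by auto
     have "R*(norm h*R) < norm q" using sf(8) by (simp add: nq power2_eq_square mult_ac)
     moreover have "norm r1*norm x<=R*(norm h*R)" using rb'[of r1] pb'[OF that] R0 by (intro mult_mono) auto
     ultimately have "norm r1*norm x < norm q" by simp
     thus "norm r1/norm q < norm (1/x)" using xz h by (simp add: norm_divide field_simps)
     have "1 < (1/R)*(norm h/R)" using hR R0 by (simp add: field_simps power2_eq_square)
     also have "...<=norm r1*norm x" using rb'[of r1] pb'[OF that] R0 by (intro mult_mono) auto
     finally show "norm (1/x) < norm r1" using xz by (simp add: norm_divide field_simps)
    qed
    from that show ?thesis
    proof (elim insertE emptyE)
     assume "z = p1" thus ?thesis using a[of p1] by (intro not_in_orbit[where k = 0]) auto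
    next
     assume "z = p2" thus ?thesis using a[of p2] by (intro not_in_orbit[where k = 0]) auto
    next
     assume "z = 1/p1" thus ?thesis using b[of p1] by (intro not_in_orbit[where k = "- 1"]) (auto simp: power_int_minus field_simps)
    next
     assume "z = 1/p2" thus ?thesis using b[of p2] by (intro not_in_orbit[where k = "- 1"]) (auto simp: power_int_minus field_simps)
    qed
   qed
   have off2: "~ in_orbit r1 r2" if "r2~=r1"
   proof
    assume o: "in_orbit r1 r2"
    have "norm x < norm q*norm y" if "x : {r1, r2}" "y : {r1, r2}" for x y
    proof -
     have "norm x<=R" using rb'[OF that(1)] by simp
     also have "R < norm q*(1/R)" using R(1) nR by (simp add: field_simps power2_eq_square)
     also have "...<=norm q*norm y" using rb'[OF that(2)] by (intro mult_left_mono) auto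
     finally show ?thesis .
    qed
    from this[of r1 r2] this[of r2 r1] have "r2 = r1*q powi 0"
     by (intro in_orbit_exact[OF o]) (auto simp: power_int_minus field_simps)
    thus False using that by simp
   qed
   define zs where "zs = [p1, p2, 1/p1, 1/p2]"
   have iso': "EX m. isolated_pole r1 m de" if K: "K~=0" and de: "de*toR (linprod (zs @ [r1, r2])) = toR (smult K ([:0,1:]*[:1,0,-1:]))" for K de
   proof (cases "r1^2 = 1")
    case False
    have "isolated_pole r1 (count_list (zs @ [r1, r2]) r1) de"
    proof (rule isolated_poleI[OF de])
     show "poly (smult K ([:0,1:]*[:1,0,-1:])) r1~=0"
      using K nzr False by (simp add: power2_eq_square)
     show "count_list (zs @ [r1, r2]) (r1*q powi n) < count_list (zs @ [r1, r2]) r1" if "n~=0" for n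
     proof -
      have "count_list (zs @ [r1, r2]) (r1*q powi n) = 0"
      proof (rule count_list_off_orbit[OF nzr(3) that])
       fix z assume "z : set (zs @ [r1, r2])" "z~=r1"
       hence "z : {p1, p2, 1/p1, 1/p2} | z = r2 & r2~=r1" by (auto simp: zs_def)
       thus "~ in_orbit r1 z" using off off2 by blast
      qed
      thus ?thesis by simp
     qed
    qed (use nzr in auto)
    thus ?thesis by blast
   next
    \<comment> \<open>Then \<open>r1 = r2\<close> is 1 or -1; the numerator contains 1 - s^2, which
      cancels one of the two factors and leaves a simple pole.\<close>
    case True
    hence r12: "r2 = r1" using rr nzr by (metis mult_left_cancel power2_eq_square)
    have de': "de*toR (linprod (zs @ [r1])) = toR (smult K ([:0,1:]*[:-r1,-1:]))"
     by (rule linprod_cancel) (use de r12 True in simp_all)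
    have "isolated_pole r1 (count_list (zs @ [r1]) r1) de"
    proof (rule isolated_poleI[OF de'])
     show "poly (smult K ([:0,1:]*[:-r1,-1:])) r1~=0"
      using K nzr by simp
     show "count_list (zs @ [r1]) (r1*q powi n) < count_list (zs @ [r1]) r1" if "n~=0" for n
      using count_list_off_orbit[OF nzr(3) that, of "zs @ [r1]"] off by (auto simp: zs_def)
    qed (use nzr in auto)
    thus ?thesis by blast
   qed
   have iso: "EX z0 m. isolated_pole z0 m de" if "K~=0" "de*toR (linprod [p1, p2, 1/p1, 1/p2, r1, r2]) = toR (smult K ([:0,1:]*[:1,0,-1:]))" for K de
   proof -
    have "EX m. isolated_pole r1 m de" by (rule iso'[OF that(1)]) (use that(2) in "simp add: zs_def")
    thus ?thesis by blast
   qed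
   show ?thesis
    by (rule T00_not_Dalg[OF q g(1)[unfolded A0 B0] _ _ pq _ rr iso]) (use k p(1) r(1) A0 B0 in "auto simp: q power2_eq_square")
  next
   case B1: False
   have rb': "norm h/R<=norm x & norm x<=norm h*R" if "x : {r1, r2}" for x using rb[OF that] B1 by simp
   show ?thesis
   proof (cases "r1^2 = q & r2^2 = q")
    case False
    show ?thesis by (rule separated_roots_not_Dalg[OF nq R(1,2) pb' rb' _ _ _ _ ce g(2)]) (use False pq rq sf(3) in auto)
   next
    case True
    have B: "B = 1" and e: "(q + 1)*ey = 2*h*ex" using rd True by auto
    show ?thesis
    proof (rule T01_not_Dalg[OF q])
     show "kernel_eq 0 1 ex ey h k g" using g(1) A0 B by simp
     show "norm h/R<=norm z & norm z<=norm h*R" if "poly (nA 0 ex ey h) z = 0" for z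
      using R(3) that A0 by (auto simp: roots_bounded_def)
    qed (use e k A0 R nR in "auto simp: q[symmetric]")
   qed
  qed
 next
  case A1: False
  have pb': "1/R<=norm x & norm x<=R" if "x : {p1, p2}" for x using pb[OF that] A1 by simp
  show ?thesis
  proof (cases "B = 0")
   case B0: True
   have rb': "1/R<=norm x & norm x<=R" if "x : {r1, r2}" for x using rb[OF that] B0 by simp
   have rr: "r1*r2 = 1" using r(2) B0 h by simp
   show ?thesis
   proof (cases "p1^2 = 1 & p2^2 = 1")
    case False
    show ?thesis by (rule separated_roots_not_Dalg[of "norm h" R p1 p2 1 r1 r2 1, OF nq R(1,2) _ _ _ _ _ _ ce g(2)]) (use False pb' rb' pp rr sf(3) in auto)
   next
    case True
    have A: "A = 1" and e: "(q + 1)*ex = 2*h*ey" using pd True by auto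
    show ?thesis
    proof (rule T10_not_Dalg[OF q])
     show "kernel_eq 1 0 ex ey h k g" using g(1) A B0 by simp
     show "1/R<=norm z & norm z<=R" if "poly (nB 0 ex ey h) z = 0" for z
      using R(3) that B0 by (auto simp: roots_bounded_def)
    qed (use e k B0 R nR in "auto simp: q[symmetric]")
   qed
  next
   case B1: False
   have rb': "norm h/R<=norm x & norm x<=norm h*R" if "x : {r1, r2}" for x using rb[OF that] B1 by simp
   show ?thesis
   proof (rule separated_roots_not_Dalg[of "norm h" R p1 p2 1 r1 r2 "norm h", OF nq R(1,2) _ rb' _ _ _ _ ce g(2)])
    have "p1^2~=1 | p2\<^sup>2~=1 | r1\<^sup>2~=q | r2\<^sup>2~=q"
    proof (rule ccontr)
     assume "~ ?thesis"
     hence AB: "A = 1" "B = 1" and e: "(q + 1)*ex = 2*h*ey" "(q + 1)*ey = 2*h*ex" using pd rd by auto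
     have "(q + 1)*((q + 1)*ex) = 2*h*((q + 1)*ey)" unfolding e(1) by (simp add: mult_ac)
     also have "... = 4*q*ex" unfolding e(2) unfolding q by (simp add: power2_eq_square)
     finally have "(q - 1)^2*ex = 0" by (simp add: power2_eq_square algebra_simps)
     hence "ex = 0" using q1 by simp
     moreover have "ey = 0" using e(2) `ex = 0` q1 by (simp add: add_eq_0_iff2)
     ultimately show False using ne AB by blast
    qed
    thus "(1 :: real) = 1 & (p1^2~=1 | p2\<^sup>2~=1) | norm h = norm h & (r1^2~=q | r2\<^sup>2~=q)" by blast
   qed (use pb' pp rq sf(3) in auto)
  qed
 qed
qed

end

section \<open>Quadratics with a common root: kernels without the step (1,1)\<close>

context qdil
begin

text \<open>The product of the two roots of \<open>nA\<close>; that of the roots of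
  \<open>nB\<close> is \<open>q/mob B\<close>.\<close>

definition mob where "mob A = (A - q)/(A*q - 1)"

text \<open>For fixed \<open>C~=0\<close> the value \<open>mob C\<close> tends to -1/C as
  \<open>q\<close> grows, so a uniform \<open>R\<close> exists.\<close>

definition separated where
 "separated A B R \<longleftrightarrow> A~=-1 & B~=-1 & A*B~=1 & A*q~=1 & B~=q &
  (ALL C:{A, B}. C~=0 --> 1/R<=norm (mob C) & norm (mob C)<=R)"

lemma mob_0 [simp]: "mob 0 = q" by (simp add: mob_def)

lemma mob_eq:
 assumes "A*q~=1"
 shows "mob A = 1 \<longleftrightarrow> A = -1" "mob A = -1 \<longleftrightarrow> A = 1"
proof -
 have q1: "q - 1~=0" "q + 1~=0" using q_gt1 by (auto simp: add_eq_0_iff2)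
 have "mob A = c \<longleftrightarrow> A - q = c*(A*q - 1)" for c using assms by (simp add: mob_def divide_eq_eq)
 hence "mob A = 1 \<longleftrightarrow> (A + 1)*(q - 1) = 0" "mob A = -1 \<longleftrightarrow> (A - 1)*(q + 1) = 0" by (auto simp: algebra_simps)
 thus "mob A = 1 \<longleftrightarrow> A = -1" "mob A = -1 \<longleftrightarrow> A = 1" using q1 by (auto simp: eq_neg_iff_add_eq_0)
qed

lemma separated_mob:
 assumes s: "separated A B R" and R: "R>=1"
 shows "mob A~=1" "mob A = -1 \<longleftrightarrow> A = 1" "mob B~=1" "mob B = -1 \<longleftrightarrow> B = 1" "mob A*mob B~=1" "mob A~=0" "mob B~=0"
  "A~=0 ==> 1/R<=norm (mob A) & norm (mob A)<=R"
  "B~=0 ==> norm q/R<=norm (q/mob B) & norm (q/mob B)<=norm q*R"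
proof -
 note s = s[unfolded separated_def]
 have nz: "mob C~=0" if "C : {A, B}" for C
 proof (cases "C = 0")
  case False
  hence "1/R<=norm (mob C)" using s that by blast
  moreover have "0 < 1/R" using R by simp
  ultimately show ?thesis by auto
 qed simp
 thus "mob A~=0" "mob B~=0" by auto
 hence Bq: "B*q~=1" by (auto simp: mob_def)
 show "mob A~=1" "mob A = -1 \<longleftrightarrow> A = 1" "mob B~=1" "mob B = -1 \<longleftrightarrow> B = 1" using s mob_eq[of A] mob_eq[OF Bq] by auto
 show "mob A*mob B~=1"
 proof
  assume "mob A*mob B = 1"
  hence "(A*q - 1)*(B*q - 1) = (A - q)*(B - q)" using s Bq by (simp add: mob_def)
  hence "(A*B - 1)*((q - 1)*(q + 1)) = 0" by (simp add: algebra_simps)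
  thus False using s q_gt1 by (auto simp: add_eq_0_iff2)
 qed
 show "1/R<=norm (mob A) & norm (mob A)<=R" if "A~=0" using s that by blast
 show "norm q/R<=norm (q/mob B) & norm (q/mob B)<=norm q*R" if "B~=0"
 proof -
  have z: "1/R<=norm (mob B)" "norm (mob B)<=R" "norm (mob B) > 0" using s that nz[of B] by auto
  have "norm q/R<=norm q/norm (mob B)" using z R by (intro divide_left_mono) auto
  moreover have "norm q*(1/norm (mob B))<=norm q*R"
   using z R by (intro mult_left_mono) (simp_all add: divide_le_eq mult.commute)
  ultimately show ?thesis by (simp add: norm_divide)
 qed
qed

text \<open>The roots other than \<open>zt\<close> are recovered from the products
  \<open>mob A\<close> and \<open>q/mob B\<close>. Only \<open>A = B = 0\<close> falls outside
  \<open>regime_zeta\<close> and needs an isolated pole.\<close>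

theorem zeta_not_Dalg:
 assumes q: "q = h^2" and R: "R>=1" "norm h > R^4"
  and zt: "norm h/R<=norm zt^2" "norm zt^2<=norm h*R" "poly (nA A ex ey h) zt = 0" "poly (nB B ex ey h) zt = 0"
  and s: "separated A B R"
  and g: "kernel_eq A B ex ey h k g" "g~=0" and k: "k~=0"
 shows "~ Dalg g"
proof -
 note sf = size_facts2[OF R]
 have h: "h~=0" using q q_nz by auto
 note m = separated_mob[OF s R(1)]
 have nq: "norm q = norm h^2" by (simp add: q norm_power)
 have az: "A*q - 1~=0" "B - q~=0" using s by (auto simp: separated_def)
 have az': "A*h^2 - 1~=0" "B - h\<^sup>2~=0" using az unfolding q by auto
 have Z1: "norm zt^2 > 1"
 proof -
  have "1 < norm h/R" using sf by simp
  thus ?thesis using zt(1) by simp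
 qed
 have Zq: "norm zt^2 < norm q" using zt(2) sf nq by simp
 have zn: "zt~=0" using Z1 by auto
 define p r where "p = mob A/zt" and "r = q/mob B/zt"
 have pz: "p * zt = mob A" and rz: "r * zt = q/mob B" using zn by (simp_all add: p_def r_def)
 have p2: "(A*h^2 - 1)*(p * zt) = A - h\<^sup>2" using az unfolding q[symmetric] pz by (simp add: mob_def)
 have r2: "(B - h\<^sup>2)*(r * zt) = h^2*(B*h^2 - 1)" using az unfolding q[symmetric] rz by (simp add: mob_def)
 have p1: "(A*h^2 - 1)*(p + zt) = - ((h^2 + 1)*A*ex - (A + 1)*h*ey)"
 proof -
  define c1 where "c1 = (h^2 + 1)*A*ex - (A + 1)*h*ey"
  have "(A - h\<^sup>2) + zt * c1 + zt*(zt*(A*h^2 - 1)) = 0"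
   using zt(3) by (simp add: nA_def c1_def algebra_simps)
  hence "zt*((A*h^2 - 1)*(p + zt) + c1) = 0" unfolding p2[symmetric] by (simp add: algebra_simps)
  hence "(A*h^2 - 1)*(p + zt) + c1 = 0" using zn by simp
  thus ?thesis unfolding c1_def by (simp only: eq_neg_iff_add_eq_0)
 qed
 have r1: "(B - h\<^sup>2)*(r + zt) = - (h*((h^2 + 1)*B*ey - (B + 1)*h*ex))"
 proof -
  define c1 where "c1 = h*((h^2 + 1)*B*ey - (B + 1)*h*ex)"
  have "h^2*(B*h^2 - 1) + zt * c1 + zt*(zt*(B - h\<^sup>2)) = 0"
   using zt(4) by (simp add: nB_def c1_def[symmetric]) (simp add: algebra_simps)
  hence "zt*((B - h\<^sup>2)*(r + zt) + c1) = 0" unfolding r2[symmetric] by (simp add: algebra_simps)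
  hence "(B - h\<^sup>2)*(r + zt) + c1 = 0" using zn by simp
  thus ?thesis unfolding c1_def by (simp only: eq_neg_iff_add_eq_0)
 qed
 have ce: "curve_eq p zt r zt (k/(B - h\<^sup>2)) g" by (rule kernel_eq_curve_eq[OF az'(1) p1 p2 az'(2) r1 r2 g(1)])
 show ?thesis
 proof (cases "A = 0 & B = 0")
  case False
  show ?thesis
  proof (rule regime_zeta[OF nq R zt(1,2) pz rz m(1) _ _ _ ce g(2)])
   show "q/mob B~=q" "q/mob B~=q*mob A" using m by (auto simp: field_simps)
   show "1/R<=norm (mob A) & norm (mob A)<=R & norm h^2/R<=norm (q/mob B) & norm (q/mob B)<=norm h^2*R |
    mob A = q & norm h^2/R<=norm (q/mob B) & norm (q/mob B)<=norm h^2*R |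
    1/R<=norm (mob A) & norm (mob A)<=R & q/mob B = 1"
    using m(8,9) False unfolding nq by (cases "A = 0"; cases "B = 0") simp_all
  qed
 next
  case True
  hence A0: "A = 0" and B0: "B = 0" by auto
  have pq: "p = q/zt" and rq: "r = 1/zt" by (simp_all add: p_def r_def A0 B0)
  define zs where "zs = [p, zt, 1/p, 1/zt, r, zt]"
  \<comment> \<open>\<open>zt\<close> occurs twice, while \<open>zt/q\<close>, the only other listed
    point of its orbit, occurs once.\<close>
  have zs: "zs = [q/zt, zt, zt/q, 1/zt, 1/zt, zt]" by (simp add: zs_def pq rq)
  have iso: "isolated_pole zt (count_list zs zt) de" if K: "K~=0" and de: "de*toR (linprod zs) = toR (smult K ([:0,1:]*[:1,0,-1:]))" for K de
  proof (rule isolated_poleI[OF de _ zn])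
   have "zt\<^sup>2~=1" using Z1 by (metis less_irrefl norm_one norm_power)
   thus "poly (smult K ([:0,1:]*[:1,0,-1:])) zt~=0" using K zn by (simp add: power2_eq_square)
   show "zt : set zs" by (simp add: zs)
   fix n :: int assume n: "n~=0"
   have zp: "norm zt > 0" using zn by simp
   have a: "~ in_orbit zt (q/zt)"
    by (rule not_in_orbit[where k = 0]) (use Z1 Zq zp in "auto simp: norm_divide field_simps power2_eq_square")
   have b: "~ in_orbit zt (1/zt)"
    by (rule not_in_orbit[where k = "- 1"]) (use Z1 Zq zp q_nz in "auto simp: norm_divide field_simps power2_eq_square power_int_minus")
   have c: "zt*q powi n~=zt" by (rule orbit_neq[OF zn n])
   have d: "zt*q powi n~=q/zt" "zt*q powi n~=1/zt" using a b in_orbitI[of zt n] by metis+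
   show "count_list zs (zt*q powi n) < count_list zs zt"
    using c d by (auto simp: zs)
  qed
  have "p * zt = q" "r * zt = 1" using zn by (simp_all add: pq rq)
  thus ?thesis
   by (intro T00_not_Dalg[OF q g(1)[unfolded A0 B0] k, of p zt r zt] exI, goal_cases)
    (use p1 r1 A0 B0 iso[unfolded zs_def] in "auto simp: q power2_eq_square")
 qed
qed

end

section \<open>The model in which the common root is -1\<close>

context qdil
begin

text \<open>Here one root of \<open>nB\<close> is \<open>q\<close>, whose square \<open>q^2\<close>
  violates a condition of the general argument. Instead, after clearing denominators both
  coefficients of the equation vanish at -1, while the inhomogeneous term does not.\<close>

lemma S1_no_rational_solution:
 assumes c: "c~=0" and p: "p~=0" "p~=-1" "norm p*norm p*norm q > 1" "norm p*norm q > 1"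
  and P: "P : ratfun" "curve_eq p (-1) q (-1) c P"
 shows False
proof -
 define U b e f x1 x2 where "U = toR [:1,1:]" and "b = toR [:1,-q:]" and "e = toR [:-q,1:]" and "f = toR [:-1,1:]"
  and "x1 = toR [:-p,1:]" and "x2 = toR [:1,-p:]"
 have nz: "U~=0" "f~=0" "e~=0" by (auto simp: U_def f_def e_def)
 have e1: "dil e = fls_const q*f" "dil f = - b"
  unfolding e_def f_def b_def dil_toR toR_smult[symmetric] toR_uminus[symmetric] by (simp_all add: pcompose_pCons)
 have x12: "x2 - x1 = - (fls_const (1 + p)*f)"
  unfolding x1_def x2_def f_def toR_smult[symmetric] toR_uminus[symmetric] toR_diff[symmetric] by simp
 have "x1*U*b*U*dil P = x2*U*e*U*P + fls_const c*fls_X*((x2 - x1)*U)"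
  using P(2) unfolding curve_eq_def toR_mult toR_diff x1_def x2_def U_def b_def e_def by (simp add: algebra_simps)
 hence "U*(x1*U*b*dil P) = U*(x2*U*e*P + fls_const c*fls_X*(x2 - x1))" by (simp only: algebra_simps)
 hence E: "x1*U*b*dil P = x2*U*e*P - fls_const c*fls_X*(fls_const (1 + p)*f)"
  using nz unfolding x12 by (simp only: mult_cancel_left simp_thms) simp
 \<comment> \<open>\<open>dil\<close> maps \<open>e*f\<close> to a constant multiple of
   \<open>f*b\<close>, which absorbs the factor \<open>b\<close> on the left.\<close>
 define m where "m = e*f*P"
 define C where "C = fls_const q*fls_const c*fls_const (1 + p)"
 have "x1*U*dil m = - (fls_const q*f)*(x1*U*b*dil P)" unfolding m_def by (simp add: sig_mult e1 algebra_simps)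
 also have "... = - (fls_const q*(x2*U))*m + C*fls_X*f*f" unfolding E m_def C_def by (simp add: algebra_simps)
 finally have Em: "x1*U*dil m = - (fls_const q*(x2*U))*m + C*fls_X*f*f" .
 define al1 al2 be where "al1 = [:-p,1:]*[:1,1:]" and "al2 = smult (-q) ([:1,-p:]*[:1,1:])"
  and "be = smult (q * c*(1 + p)) ([:0,1:]*[:-1,1:]*[:-1,1:])"
 have X: "fls_X = toR [:0,1:]" by (simp add: toR_pCons)
 have E': "toR al1*dil m = toR al2*m + toR be"
  using Em unfolding al1_def al2_def be_def toR_mult toR_smult X x1_def x2_def U_def f_def C_def
  by (simp add: fls_const_uminus mult.assoc)
 have mr: "m : ratfun" unfolding m_def e_def f_def by (intro rat.mult_in ratfun_toR P)
 have ch: "v~=q^n*u" if u: "poly al1 u = 0" and v: "poly al2 v = 0" and n: "n>=1" for u v n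
 proof -
  have u': "u = p | u = -1" using u unfolding al1_def poly_mult by (auto simp: add_eq_0_iff)
  have "poly [:1,-p:] v = 0 | poly [:1,1:] v = 0" using v q_nz unfolding al2_def poly_smult poly_mult
   by (simp only: mult_eq_0_iff neg_equal_0_iff_equal simp_thms)
  hence v': "v = 1/p | v = -1" using p(1) by (auto simp: field_simps add_eq_0_iff)
  have np: "norm p > 0" using p by simp
  show ?thesis
   by (rule ne_q_power[OF _ n])
    (use u' v' np p q_gt1 in "(elim disjE; simp add: norm_divide pos_divide_less_eq mult_ac)")
 qed
 have "pole_le z 0 m" if "z~=0" for z
  by (rule chain_no_poles[OF mr E', where bad = "%_. 1"]) (use ch that pole_le_toR in auto)
 then obtain N j where N: "m*fls_X^j = toR N" using laurent_polynomial[OF mr] by blast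
 have "fls_const (q^j)*fls_X^j*dil m = dil (m*fls_X^j)"
  by (simp add: sig_mult sig_power power_mult_distrib fls_const_power mult_ac)
 hence dN: "fls_const (q^j)*fls_X^j*dil m = toR (pcompose N [:0,q:])" by (simp add: N dil_toR)
 have "toR (al1*pcompose N [:0,q:]) = toR al1*(fls_const (q^j)*fls_X^j*dil m)" by (simp only: toR_mult dN)
 also have "... = fls_const (q^j)*fls_X^j*(toR al1*dil m)" by (simp only: mult_ac)
 also have "... = fls_const (q^j)*(toR al2*(m*fls_X^j) + toR be*fls_X^j)" unfolding E' by (simp only: algebra_simps)
 also have "... = toR (smult (q^j) (al2*N + be*[:0,1:]^j))"
  unfolding N unfolding X by (simp only: toR_smult toR_add toR_mult toR_power)
 finally have "al1*pcompose N [:0,q:] = smult (q^j) (al2*N + be*[:0,1:]^j)" by simp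
 hence "poly (al1*pcompose N [:0,q:]) (-1) = poly (smult (q^j) (al2*N + be*[:0,1:]^j)) (-1)" by simp
 moreover have "poly al1 (-1) = 0" "poly al2 (-1) = 0" unfolding al1_def al2_def poly_smult poly_mult by simp_all
 ultimately have "poly be (-1) = 0" by simp
 moreover have "1 + p~=0" using p(2) by (metis add.commute eq_neg_iff_add_eq_0)
 ultimately show False using c by (simp add: be_def)
qed

text \<open>A gauge makes the multiplier -1. The inhomogeneous term then has poles at -q, -1, -1,
  -1/q, all on one orbit, but only -1 is double.\<close>

lemma S1_T01_not_Dalg:
 assumes c: "c~=0" and g: "curve_eq (-q) (-1) q (-1) c g"
 shows "~ Dalg g"
proof
 assume Dg: "Dalg g"
 have q1: "q~=1" "q~=-1" using q_gt1 by auto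
 have "norm (q*q) > 1" using q_gt1 by (simp add: norm_mult less_1_mult)
 hence qq: "q*q~=1" by auto
 define a U b d e f where "a = toR [:q,1:]" and "U = toR [:1,1:]" and "b = toR [:1,-q:]" and "d = toR [:1,q:]"
  and "e = toR [:-q,1:]" and "f = toR [:-1,1:]"
 have nz: "U~=0" "f~=0" "e~=0" "a~=0" "b~=0" "d~=0"
  by (auto simp: U_def f_def e_def a_def b_def d_def)
 have e1: "dil e = fls_const q*f" "dil f = - b" "dil a = fls_const q*U" "dil U = d"
  unfolding e_def f_def b_def a_def U_def d_def dil_toR toR_smult[symmetric] toR_uminus[symmetric]
  by (simp_all add: pcompose_pCons)
 have da: "d - a = fls_const (q - 1)*f"
  unfolding d_def a_def f_def toR_smult[symmetric] toR_diff[symmetric] by simp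
 have "a*U*b*U*dil g = d*U*e*U*g + fls_const c*fls_X*((d - a)*U)"
  using g unfolding curve_eq_def toR_mult toR_diff a_def U_def b_def d_def e_def by (simp add: algebra_simps)
 hence "U*(a*U*b*dil g) = U*(d*U*e*g + fls_const c*fls_X*(d - a))" by (simp only: algebra_simps)
 hence E: "a*U*b*dil g = d*U*e*g + fls_const c*fls_X*(fls_const (q - 1)*f)"
  using nz unfolding da by (simp only: mult_cancel_left simp_thms)
 define C where "C = fls_const c*fls_const (q - 1)"
 define m where "m = g*e*f/(a*U)"
 have qz: "fls_const q~=0" by simp
 have "dil m = - (f*(b*dil g)/(U*d))"
  unfolding m_def using nz qz by (simp add: sig_mult sig_divide e1 field_simps)
 also have "b*dil g = (d*U*e*g + fls_const c*fls_X*(fls_const (q - 1)*f))/(a*U)"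
  using E nz by (simp add: field_simps)
 finally have dm: "dil m = - m + - (C*fls_X*f*f)/(a*U*U*d)"
  unfolding m_def C_def using nz by (simp add: divide_simps) (simp add: algebra_simps)
 define de where "de = - (C*fls_X*f*f)/(a*U*U*d)"
 define zs where "zs = [-q, - 1, - 1, - (1/q)]"
 have L: "a*U*U*d = fls_const q*toR (linprod zs)"
 proof -
  have "[:1,q:] = smult q [:1/q,1:]" by simp
  hence "d = fls_const q*toR [:1/q,1:]" unfolding d_def by (simp only: toR_smult)
  thus ?thesis unfolding a_def U_def linprod_def zs_def
   by (simp only: list.map prod_list.Cons prod_list.Nil mult_1_right mult_1_left toR_1 toR_mult minus_minus mult_ac)
 qed
 have de: "de*toR (linprod zs) = toR (smult (-(c*(q - 1)/q)) ([:0,1:]*[:-1,1:]*[:-1,1:]))"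
 proof -
  have "C = fls_const q*fls_const (c*(q - 1)/q)" by (simp add: C_def)
  hence "de*toR (linprod zs) = - (fls_const (c*(q - 1)/q)*(fls_X*f*f))"
   unfolding de_def L using linprod_nz[of zs] by (simp add: divide_simps)
  thus ?thesis unfolding toR_smult toR_mult f_def by (simp add: toR_pCons fls_const_uminus)
 qed
 have "isolated_pole (-1) (count_list zs (-1)) de"
 proof (rule isolated_poleI[OF de])
  show "poly (smult (-(c*(q - 1)/q)) ([:0,1:]*[:-1,1:]*[:-1,1:])) (-1)~=0" using c q1 by simp
  show "count_list zs (-1*q powi n) < count_list zs (-1)" if "n~=0" for n
   using orbit_neq[of "- 1" n] that q1 qq by (auto simp: zs_def field_simps)
 qed (auto simp: zs_def)
 moreover have "de : ratfun" by (rule ratfunI[OF linprod_nz de])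
 moreover have "dil m = fls_const (-1)*m + de" using dm by (simp add: fls_const_minus_1 de_def)
 ultimately have "~ Dalg m" using isolated_pole_not_Dalg[of m "- 1" de] by simp
 moreover have "Dalg m"
 proof (rule Dalg_affine[OF Dg])
  show "g = (a*U/(e*f))*m + 0" unfolding m_def using nz by (simp add: field_simps)
 qed (use nz in "auto intro!: rat.divide_in rat.mult_in ratfun_toR rat.zero_in simp: a_def U_def e_def f_def")
 ultimately show False by blast
qed

text \<open>The common root -1 has modulus 1 instead of about sqrt h, so \<open>regime_zeta\<close>
  does not apply. The other roots are \<open>- mob A\<close> and \<open>- (q/mob B)\<close>.\<close>

theorem S1_not_Dalg:
 assumes q: "q = h^2" and R: "R>=1" "norm q > R^4"
  and s: "separated A B R"
  and g: "kernel_eq A B 2 (h + 1/h) h k g" "g~=0" and k: "k~=0"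
 shows "~ Dalg g"
proof -
 define Q where "Q = norm q"
 have "R^2<=R^4" "R^1<=R^4" using R(1) by (intro power_increasing; simp)+
 hence Q: "R*R < Q" "R < Q" "1 < Q" "R > 0" using R by (auto simp: Q_def power2_eq_square)
 have QRQ: "Q*R < Q*Q" using Q by (intro mult_strict_left_mono) auto
 have RQR: "R < Q/R" using Q by (simp add: field_simps)
 have h: "h~=0" using q q_nz by auto
 have q1: "q~=1" "q~=-1" using q_gt1 by auto
 have "norm (q*q) > 1" using q_gt1 by (simp add: norm_mult less_1_mult)
 hence qq: "q*q~=1" by auto
 note mo = separated_mob[OF s R(1)]
 have az: "A*q - 1~=0" "B - q~=0" and AB: "A*B~=1" using s by (auto simp: separated_def)
 have az': "A*h^2 - 1~=0" "B - h\<^sup>2~=0" using az unfolding q by auto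
 define p r where "p = - mob A" and "r = - (q/mob B)"
 have pm: "(A*q - 1)*p = q - A" "(B - q)*r = - (q*(B*q - 1))" using az by (simp_all add: p_def r_def mob_def)
 have hh: "h*(h + 1/h) = q + 1" using h by (simp add: q power2_eq_square algebra_simps)
 have p2: "(A*h^2 - 1)*(p*- 1) = A - h\<^sup>2" using pm(1) by (simp add: q)
 have r2: "(B - h\<^sup>2)*(r*- 1) = h^2*(B*h^2 - 1)" using pm(2) by (simp add: q)
 have p1: "(A*h^2 - 1)*(p + - 1) = - ((h^2 + 1)*A*2 - (A + 1)*h*(h + 1/h))"
 proof -
  have "(A*q - 1)*(p + - 1) = (A*q - 1)*p - (A*q - 1)" by (simp add: algebra_simps)
  also have "... = - ((q + 1)*A*2 - (A + 1)*(q + 1))" unfolding pm by (simp add: algebra_simps)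
  also have "(A + 1)*(q + 1) = (A + 1)*h*(h + 1/h)" by (simp only: hh mult.assoc)
  finally show ?thesis unfolding q .
 qed
 have r1: "(B - h\<^sup>2)*(r + - 1) = - (h*((h^2 + 1)*B*(h + 1/h) - (B + 1)*h*2))"
 proof -
  have "(B - q)*(r + - 1) = (B - q)*r - (B - q)" by (simp add: algebra_simps)
  also have "... = - ((q + 1)*B*(q + 1) - (B + 1)*q*2)" unfolding pm by (simp add: algebra_simps)
  also have "... = - (h*((q + 1)*B*(h + 1/h) - (B + 1)*h*2))"
   unfolding hh[symmetric] using h by (simp add: q power2_eq_square algebra_simps)
  finally show ?thesis unfolding q .
 qed
 define c where "c = k/(B - h\<^sup>2)"
 have c: "c~=0" using k az' by (simp add: c_def)
 have ce: "curve_eq p (-1) r (-1) c g" unfolding c_def by (rule kernel_eq_curve_eq[OF az'(1) p1 p2 az'(2) r1 r2 g(1)])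
 have pA0: "p = - q" if "A = 0" using that by (simp add: p_def)
 have rB0: "r = -1" if "B = 0" using that by (simp add: r_def)
 have pb: "1/R<=norm p" "norm p<=R" if "A~=0" using mo(8)[OF that] by (simp_all add: p_def)
 have rb: "Q/R<=norm r" "norm r<=Q*R" if "B~=0" using mo(9)[OF that] by (simp_all add: r_def Q_def)
 have pn: "1/R<=norm p"
 proof (cases "A = 0")
  case True
  have "1/R<=1" using R by simp
  moreover have "norm p = Q" by (simp add: pA0[OF True] Q_def)
  ultimately show ?thesis using Q by linarith
 qed (rule pb)
 have pz: "p~=0" using pn Q by auto
 have rn: "1<=norm r" using rb rB0 RQR R(1) by (cases "B = 0") auto
 have rz: "r~=0" using rn by auto
 have rmax: "norm r<=Q*R" using rb rB0 Q R(1) mult_mono[of 1 Q 1 R] by (cases "B = 0") auto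
 have nzz: "(-1 :: complex)~=0" by simp
 have p1A: "p = 1 \<longleftrightarrow> A = 1" and pm1: "p~=-1" using mo(1,2) by (auto simp: p_def minus_equation_iff[of "mob A"])
 have rqz: "r = q*z \<longleftrightarrow> z*mob B = -1" for z
 proof -
  have "r = q*z \<longleftrightarrow> q*(z*mob B) = q*- 1" using mo(7) by (auto simp: r_def field_simps)
  thus ?thesis by (simp only: mult_cancel_left q_nz simp_thms)
 qed
 have rq1: "r = q \<longleftrightarrow> B = 1" and rqm: "r~=- q" and rpq: "r~=q*p"
  using mo(3,4,5) rqz[of 1] rqz[of "- 1"] rqz[of p] by (auto simp: p_def)
 have o_p: "~ in_orbit p (1/p)" if "A~=0" "A~=1"
 proof
  assume o: "in_orbit p (1/p)"
  have "norm p*norm p<=R*R" using pb[OF that(1)] Q by (intro mult_mono) auto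
  moreover have "(1/R)*(1/R)<=norm p*norm p" using pn Q by (intro mult_mono) auto
  moreover have "1/Q < (1/R)*(1/R)" using Q by (simp add: field_simps)
  ultimately have "p*p = q powi 0" using Q pz
   by (intro in_orbit_inverse[OF o]) (auto simp: norm_mult power_int_minus Q_def[symmetric] inverse_eq_divide)
  hence "p^2 = 1" by (simp add: power2_eq_square)
  thus False using p1A pm1 that(2) by (simp add: power2_eq_1_iff)
 qed
 have o_r: "~ in_orbit r (1/r)" if "B~=0" "B~=1"
 proof
  assume o: "in_orbit r (1/r)"
  have "norm r*norm r<=(Q*R)*(Q*R)" using rb[OF that(1)] Q by (intro mult_mono) auto
  also have "... = (Q*Q)*(R*R)" by simp
  also have "... < (Q*Q)*Q" using Q by (intro mult_strict_left_mono) auto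
  finally have b1: "norm r*norm r < Q*Q*Q" .
  have "Q < (Q/R)*(Q/R)" using Q by (simp add: field_simps)
  also have "...<=norm r*norm r" using rb[OF that(1)] Q by (intro mult_mono) auto
  finally have b2: "Q < norm r*norm r" .
  have "r*r = q powi 2"
   by (rule in_orbit_inverse[OF o rz]) (use b1 b2 in "auto simp: norm_mult power_int_def Q_def[symmetric] power3_eq_cube")
  hence "r^2 = q^2" by (simp add: power2_eq_square power_int_def)
  thus False using rq1 rqm that(2) by (simp add: power2_eq_iff)
 qed
 show ?thesis
 \<comment> \<open>In these cases a gauge makes the multiplier constant. The pair
   \<open>A = B = 1\<close> cannot occur, as \<open>A*B~=1\<close>.\<close>
 proof (cases "A = 0 & B = 0 | A = 1 & B = 0 | A = 0 & B = 1")
  case True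
  then consider "A = 0" "B = 0" | "A = 1" "B = 0" | "A = 0" "B = 1" by blast
  thus ?thesis
  proof cases
   case 1
   define zs where "zs = [-q, - 1, 1/(-q), 1/(-1), - 1 :: complex]"
   have iso: "isolated_pole (-1) (count_list zs (-1)) de"
    if K: "K~=0" and de': "de*toR (linprod (zs @ [-1])) = toR (smult K ([:0,1:]*[:1,0,-1:]))" for K de
   proof (rule isolated_poleI[OF linprod_cancel[OF de']])
    show "poly (smult K ([:0,1:]*[:-(-1),-1:])) (-1)~=0" using K by simp
    show "count_list zs (-1*q powi n) < count_list zs (-1)" if "n~=0" for n
     using orbit_neq[of "- 1" n] that q1 qq by (auto simp: zs_def field_simps)
   qed (auto simp: zs_def)
   have e: "EX z0 m. isolated_pole z0 m de" if "K~=0" "de*toR (linprod [-q, - 1, 1/(-q), 1/(-1), - 1, - 1]) = toR (smult K ([:0,1:]*[:1,0,-1:]))" for K de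
    using iso[of K de] that unfolding zs_def by auto
   show ?thesis
    by (rule T00_not_Dalg[of h 2 "h + 1/h" k g "- q" "- 1" "- 1" "- 1", OF q g(1)[unfolded 1] k _ _ _ _ e]) (use hh in auto)
  next
   case 2
   show ?thesis
   proof (rule T10_not_Dalg[OF q, where R = 1])
    show "(h^2 + 1)*2 = 2*h*(h + 1/h)" using hh by (simp add: q mult.assoc)
    show "kernel_eq 1 0 2 (h + 1/h) h k g" using g(1) 2 by simp
    fix z assume "poly (nB 0 2 (h + 1/h) h) z = 0"
    moreover have "poly (nB 0 2 (h + 1/h) h) z = - q*((z + 1)*(z + 1))" by (simp add: nB_def q power2_eq_square algebra_simps)
    ultimately have "- q*((z + 1)*(z + 1)) = 0" by simp
    hence "z = -1" by (simp add: eq_neg_iff_add_eq_0)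
    thus "1/1<=norm z & norm z<=1" by simp
   qed (use k q_gt1 in auto)
  next
   case 3
   have "p = - q" "r = q" using 3 pA0 rq1 by auto
   thus ?thesis using S1_T01_not_Dalg[OF c] ce by simp
  qed
 next
  case ncase: False
  have nt: "nontele (theta (gam p (-1) r (-1))/gam p (-1) r (-1))"
  \<comment> \<open>If \<open>A\<close> is 0 or 1, then \<open>p\<close> and \<open>1/p\<close>
    share an orbit and cancel, so \<open>r\<close> serves as base point; otherwise \<open>p\<close>
    does.\<close>
  proof (cases "A = 0 | A = 1")
   case False
   show ?thesis
   proof (rule nontele_common[OF pz nzz rz pz])
    have "~ in_orbit p r" if "B~=0"
    proof
     assume o: "in_orbit p r"
     have "norm p < norm r" using pb rb[OF that] RQR False by force
     moreover have "norm r < norm p*Q*Q"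
     proof -
      have "Q*(R*R) < Q*Q" using Q by (intro mult_strict_left_mono) auto
      hence "Q*R < (1/R)*(Q*Q)" using Q by (simp add: field_simps)
      also have "...<=norm p*(Q*Q)" using pn Q by (intro mult_right_mono) auto
      finally show ?thesis using rmax by (simp add: mult.assoc)
     qed
     ultimately have "r = p*q powi 1"
      by (intro in_orbit_exact[OF o]) (auto simp: Q_def[symmetric] power2_eq_square)
     thus False using rpq by (simp add: mult.commute)
    qed
    thus "(if in_orbit p (1/p) then 1 else 0) + (if in_orbit p r then 1 else 0)
     - (if in_orbit p p then 1 else 0) - (if in_orbit p (1/r) then 1 else 0)~=(0 :: int)"
     using o_p False rB0 by (cases "B = 0") auto
   qed
  next
   case True
   hence B: "B~=0" "B~=1" using ncase AB by auto
   show ?thesis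
   proof (rule nontele_common[OF pz nzz rz rz])
    have "in_orbit r (1/p) = in_orbit r p"
    proof (cases "A = 1")
     case True thus ?thesis using p1A by simp
    next
     case False
     hence "p = - q" using True pA0 by simp
     hence "p = (1/p)*q powi 2" by (simp add: power_int_def power2_eq_square)
     thus ?thesis using in_orbit_shift[of r "1/p" 2] by simp
    qed
    thus "(if in_orbit r (1/p) then 1 else 0) + (if in_orbit r r then 1 else 0)
     - (if in_orbit r p then 1 else 0) - (if in_orbit r (1/r) then 1 else 0)~=(0 :: int)"
     using o_r B by simp
   qed
  qed
  have pq1: "1 < norm p*Q"
  proof -
   have "1 < (1/R)*Q" using Q by (simp add: field_simps)
   also have "...<=norm p*Q" using pn Q by (intro mult_right_mono) auto
   finally show ?thesis .
  qed
  have pq2: "1 < norm p*norm p*Q"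
  proof -
   have "1 < (1/R)*(1/R)*Q" using Q by (simp add: field_simps)
   also have "...<=norm p*norm p*Q" using pn Q by (intro mult_right_mono mult_mono) auto
   finally show ?thesis .
  qed
  show ?thesis
  proof (rule nontele_not_Dalg[OF pz nzz rz nzz nt _ ce g(2)])
   fix P assume P: "P : ratfun" "curve_eq p (-1) r (-1) c P"
   show False
   proof (cases "B = 1")
    case True
    hence "r = q" using rq1 by simp
    thus False using S1_no_rational_solution[OF c pz pm1 _ _ P(1)] P(2) pq1 pq2 by (simp add: Q_def)
   next
    case B1: False
    show False
    proof (rule no_rational_solution_norm[OF pz nzz rz nzz c _ _ _ _ _ _ P])
     show "1 < norm x*norm y*norm q" if "x : {p, - 1}" "y : {p, - 1}" for x y
      using that pq1 pq2 Q by (auto simp: Q_def)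
     show "y~=q^m*x" if xy: "x : {p, - 1}" "y : {r, - 1}" "m>=1" for x y m
     proof -
      have 1: "r~=q^m*x" if "x = p | x = -1" for x
      proof (cases "m = 1")
       case True thus ?thesis using rpq rqm that by auto
      next
       case False
       hence m2: "m>=2" using xy(3) by simp
       have "1/R<=norm x" using that pn R by auto
       have "Q*(R*R) < Q*Q" using Q by (intro mult_strict_left_mono) auto
       hence "Q*R < Q^2*(1/R)" using Q by (simp add: field_simps power2_eq_square)
       also have "...<=Q^2*norm x" using `1/R<=norm x` by (intro mult_left_mono) auto
       finally show ?thesis using rmax by (intro ne_q_power[OF _ m2]) (simp add: Q_def)
      qed
      have 2: "- 1~=q^m*x" if "x = p | x = -1" for x
       by (rule ne_q_power[OF _ xy(3)]) (use that pq1 Q in "auto simp: Q_def mult.commute")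
      show ?thesis using xy(1,2) 1[of x] 2[of x] by (metis insertE singletonD)
     qed
     show "x*y~=q^m" if xy: "x : {r, - 1}" "y : {r, - 1}" "m>=2" for x y m
     proof -
      have Q2: "Q*R < Q^2" using QRQ by (simp add: power2_eq_square)
      have 1: "r*r~=q^m"
      proof (cases "m = 2")
       case True thus ?thesis using rq1 rqm B1 power2_eq_iff[of r q] by (simp add: power2_eq_square)
      next
       case False
       hence m3: "m>=3" using xy(3) by simp
       have "norm r*norm r<=(Q*R)*(Q*R)" using rmax Q by (intro mult_mono) auto
       also have "... = (Q*Q)*(R*R)" by simp
       also have "... < (Q*Q)*Q" using Q by (intro mult_strict_left_mono) auto
       finally show ?thesis using ne_q_power[of "r*r" 3 1 m] m3 by (simp add: Q_def norm_mult power3_eq_cube)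
      qed
      have 2: "r*- 1~=q^m" "- 1*r~=q^m" "- 1*- 1~=q^m"
       using ne_q_power[of "r*- 1" 2 1 m] ne_q_power[of "- 1*r" 2 1 m] ne_q_power[of "- 1*- 1" 2 1 m] xy(3) rmax Q2 Q
        one_less_power[OF Q(3), of 2]
       by (auto simp: Q_def norm_mult)
      show ?thesis using xy(1,2) 1 2 by auto
     qed
     show "r*- 1*q^m~=p*- 1" for m
     proof
      assume "r*- 1*q^m = p*- 1"
      hence e: "r*q^m = p" by simp
      hence n: "norm r*Q^m = norm p" by (metis Q_def norm_mult norm_power)
      show False
      proof (cases "m = 0")
       case True
       hence rp: "r = p" using e by simp
       show False
       proof (cases "A = 0")
        case True thus False using rp rqm pA0 by simp
       next
        case A: False
        show False using rp rB0 pm1 rb pb[OF A] RQR by (cases "B = 0") auto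
       qed
      next
       case False
       have "Q^1<=Q^m" using False Q by (intro power_increasing) auto
       hence "norm r*Q<=norm p" using n mult_left_mono[of "Q^1" "Q^m" "norm r"] by simp
       moreover have "norm p<=Q" using pb pA0 Q by (cases "A = 0") (auto simp: Q_def)
       ultimately have "norm r*Q<=1*Q" and pQ: "norm r*Q<=norm p" by auto
       hence r1: "norm r<=1" using Q by (intro mult_right_le_imp_le[of "norm r" Q 1]) auto
       have B: "B = 0" using r1 rb(1) RQR R(1) by force
       hence "A~=0" using ncase by simp
       hence "norm p<=R" using pb by simp
       thus False using pQ rB0[OF B] Q by simp
      qed
     qed
     show "r*- 1~=q" using rqm by (metis minus_mult_minus mult.right_neutral minus_minus mult_minus_right)
     show "p*- 1~=1" using pm1 by (metis minus_minus mult_minus_right mult.right_neutral)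
    qed
   qed
  qed
 qed
qed

end

subsection \<open>Walks and the functional equation\<close>

lemma px_append: "k<=length w ==> px (w @ [v]) k = px w k" "px (w @ [v]) (Suc (length w)) = px w (length w) + fst v"
 and py_append: "k<=length w ==> py (w @ [v]) k = py w k" "py (w @ [v]) (Suc (length w)) = py w (length w) + snd v"
 by (simp_all add: px_def py_def)

lemma card_atMost_Suc_filter:
 "card {k : {1..Suc n}. P k} = card {k : {1..n}. P k} + (if P (Suc n) then 1 else 0)"
proof -
 have "{k : {1..Suc n}. P k} = {k : {1..n}. P k} Un (if P (Suc n) then {Suc n} else {})"
  by (auto simp: le_Suc_eq One_nat_def)
 thus ?thesis by (auto simp: card_insert_if One_nat_def)
qed

lemma nx_append: "nx (w @ [v]) = nx w + (if py w (length w) + snd v = 0 then 1 else 0)"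
proof -
 have "{k : {1..length w}. py (w @ [v]) k = 0} = {k : {1..length w}. py w k = 0}"
  by (auto simp: py_append)
 moreover have "nx (w @ [v]) = card {k : {1..Suc (length w)}. py (w @ [v]) k = 0}" by (simp add: nx_def)
 ultimately show ?thesis unfolding card_atMost_Suc_filter py_append(2) nx_def by (simp only:)
qed

lemma ny_append: "ny (w @ [v]) = ny w + (if px w (length w) + fst v = 0 then 1 else 0)"
proof -
 have "{k : {1..length w}. px (w @ [v]) k = 0} = {k : {1..length w}. px w k = 0}"
  by (auto simp: px_append)
 moreover have "ny (w @ [v]) = card {k : {1..Suc (length w)}. px (w @ [v]) k = 0}" by (simp add: ny_def)
 ultimately show ?thesis unfolding card_atMost_Suc_filter px_append(2) ny_def by (simp only:)
qed

lemma weight_append: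
 assumes "finite S" "v : S"
 shows "weight S d a b (w @ [v]) = weight S d a b w *
  (d v * (if py w (length w) + snd v = 0 then a else 1)*(if px w (length w) + fst v = 0 then b else 1))"
proof -
 have "(PROD u:S. d u ^ count_list (w @ [v]) u) = (PROD u:S. d u ^ count_list w u*(if v = u then d u else 1))"
  by (intro prod.cong) (auto simp: power_add)
 also have "... = (PROD u:S. d u ^ count_list w u)*d v"
  using assms by (simp add: prod.distrib prod.delta)
 finally have e: "(PROD u:S. d u ^ count_list (w @ [v]) u) = (PROD u:S. d u ^ count_list w u)*d v" .
 show ?thesis unfolding weight_def e nx_append ny_append by (auto simp: power_add)
qed

lemma finite_walks: "finite S ==> finite (walks S n)"
 using finite_lists_length_eq[of S n] by (rule finite_subset[rotated]) (auto simp: walks_def)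

lemma walks_0: "walks S 0 = {[]}"
 by (auto simp: walks_def)

lemma walks_Suc: "walks S (Suc n) =
 (%(w, v). w @ [v]) ` (SIGMA w:walks S n. {v : S. 0<=px w n + fst v & 0<=py w n + snd v})"
proof (intro equalityI subsetI)
 fix u assume u: "u : walks S (Suc n)"
 hence l: "length u = Suc n" by (simp add: walks_def)
 then obtain w v where wv: "u = w @ [v]" by (metis length_Suc_conv_rev)
 have lw: "length w = n" using l wv by simp
 have pos: "0<=px u k & 0<=py u k" if "k : {1..Suc n}" for k using u that by (auto simp: walks_def)
 have "w : walks S n"
  unfolding walks_def
 proof (intro CollectI conjI ballI)
  show "set w<=S" using u by (auto simp: walks_def wv)
  fix k assume k: "k : {1..n}"
  hence "0<=px u k & 0<=py u k" by (intro pos) auto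
  thus "0<=px w k" "0<=py w k" using k px_append(1)[of k w v] py_append(1)[of k w v] lw by (auto simp: wv)
 qed (rule lw)
 moreover have "v : S" using u by (auto simp: walks_def wv)
 moreover have "0<=px w n + fst v & 0<=py w n + snd v"
  using pos[of "Suc n"] px_append(2)[of w v] py_append(2)[of w v] lw by (simp add: wv)
 ultimately show "u : (%(w, v). w @ [v]) ` (SIGMA w:walks S n. {v : S. 0<=px w n + fst v & 0<=py w n + snd v})"
  using wv by force
next
 fix u assume "u : (%(w, v). w @ [v]) ` (SIGMA w:walks S n. {v : S. 0<=px w n + fst v & 0<=py w n + snd v})"
 then obtain w v where wv: "u = w @ [v]" "w : walks S n" "v : S" "0<=px w n + fst v" "0<=py w n + snd v" by auto
 have lw: "length w = n" using wv(2) by (simp add: walks_def)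
 have "0<=px u k & 0<=py u k" if k: "k : {1..Suc n}" for k
 proof (cases "k = Suc n")
  case True thus ?thesis using wv px_append(2)[of w v] py_append(2)[of w v] lw by simp
 next
  case False
  hence "k : {1..n}" using k by auto
  thus ?thesis using wv(2) px_append(1)[of k w v] py_append(1)[of k w v] lw by (auto simp: walks_def wv(1))
 qed
 thus "u : walks S (Suc n)" using wv lw by (auto simp: walks_def)
qed

definition walk_sum :: "(int \<times> int) set => (int \<times> int => real) => real => real => nat => (int => int => complex) => complex" where
 "walk_sum S d a b n F = (SUM w:walks S n. cr (weight S d a b w)*F (px w n) (py w n))"

lemma walk_sum_Suc:
 assumes "finite S"
 shows "walk_sum S d a b (Suc n) F = walk_sum S d a b n (%i j. SUM v:S.
  if 0<=i + fst v & 0<=j + snd v then cr (d v * (if j + snd v = 0 then a else 1)*(if i + fst v = 0 then b else 1)) *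
   F (i + fst v) (j + snd v) else 0)"
proof -
 let ?ok = "%w. {v : S. 0<=px w n + fst v & 0<=py w n + snd v}"
 have inj: "inj_on (%(w, v). w @ [v]) (SIGMA w:walks S n. ?ok w)" by (auto simp: inj_on_def)
 have "walk_sum S d a b (Suc n) F = (SUM (w, v):(SIGMA w:walks S n. ?ok w).
   cr (weight S d a b (w @ [v]))*F (px (w @ [v]) (Suc n)) (py (w @ [v]) (Suc n)))"
  unfolding walk_sum_def walks_Suc by (subst sum.reindex[OF inj]) (simp add: case_prod_unfold)
 also have "... = (SUM w:walks S n. SUM v:?ok w.
   cr (weight S d a b (w @ [v]))*F (px (w @ [v]) (Suc n)) (py (w @ [v]) (Suc n)))"
  using assms by (subst sum.Sigma) (auto intro: finite_walks)
 also have "... = (SUM w:walks S n. cr (weight S d a b w)*(SUM v:S.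
  if 0<=px w n + fst v & 0<=py w n + snd v then cr (d v * (if py w n + snd v = 0 then a else 1)*(if px w n + fst v = 0 then b else 1)) *
   F (px w n + fst v) (py w n + snd v) else 0))"
 proof (rule sum.cong[OF refl])
  fix w assume w: "w : walks S n"
  hence lw: "length w = n" by (simp add: walks_def)
  have "(SUM v:?ok w. cr (weight S d a b (w @ [v]))*F (px (w @ [v]) (Suc n)) (py (w @ [v]) (Suc n))) =
   (SUM v:?ok w. cr (weight S d a b w)*(cr (d v * (if py w n + snd v = 0 then a else 1)*(if px w n + fst v = 0 then b else 1)) *
   F (px w n + fst v) (py w n + snd v)))"
  proof (rule sum.cong[OF refl])
   fix v assume "v : ?ok w"
   hence "v : S" by simp
   show "cr (weight S d a b (w @ [v]))*F (px (w @ [v]) (Suc n)) (py (w @ [v]) (Suc n)) =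
    cr (weight S d a b w)*(cr (d v * (if py w n + snd v = 0 then a else 1)*(if px w n + fst v = 0 then b else 1)) *
    F (px w n + fst v) (py w n + snd v))"
    unfolding weight_append[OF assms `v : S`] lw
    using px_append(2)[of w v] py_append(2)[of w v] lw by (simp only: of_real_mult mult.assoc)
  qed
  thus "(SUM v:?ok w. cr (weight S d a b (w @ [v]))*F (px (w @ [v]) (Suc n)) (py (w @ [v]) (Suc n))) =
   cr (weight S d a b w)*(SUM v:S.
  if 0<=px w n + fst v & 0<=py w n + snd v then cr (d v * (if py w n + snd v = 0 then a else 1)*(if px w n + fst v = 0 then b else 1)) *
   F (px w n + fst v) (py w n + snd v) else 0)"
   by (simp only: sum.inter_filter[OF assms, symmetric] sum_distrib_left)
 qed
 finally show ?thesis unfolding walk_sum_def .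
qed

lemma walk_sum_cong:
 "(!!w. w : walks S n ==> F (px w n) (py w n) = G (px w n) (py w n)) ==> walk_sum S d a b n F = walk_sum S d a b n G"
 unfolding walk_sum_def by (intro sum.cong) auto

lemma walk_sum_linear:
 "walk_sum S d a b n (%i j. F i j + G i j) = walk_sum S d a b n F + walk_sum S d a b n G"
 "walk_sum S d a b n (%i j. F i j - G i j) = walk_sum S d a b n F - walk_sum S d a b n G"
 "walk_sum S d a b n (%i j. c*F i j) = c*walk_sum S d a b n F"
 by (simp_all add: walk_sum_def algebra_simps sum.distrib sum_subtractf sum_distrib_left)

lemma finite_S5: "finite S5" by (simp add: S5_def)

lemma walks_nonneg: "w : walks S n ==> 0<=px w n" "w : walks S n ==> 0<=py w n"
proof -
 have "0<=px w n & 0<=py w n" if "w : walks S n"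
 proof (cases "n = 0")
  case True thus ?thesis by (simp add: px_def py_def)
 next
  case False
  hence "n : {1..n}" by auto
  thus ?thesis using that unfolding walks_def by blast
 qed
 thus "w : walks S n ==> 0<=px w n" "w : walks S n ==> 0<=py w n" by auto
qed

text \<open>No step lowers the sum of the coordinates, and the first step must raise it to stay in
  the quadrant; a nonempty walk therefore never ends at the origin.\<close>

lemma walks_S5_pos: "w : walks S5 (Suc n) ==> px w (Suc n) + py w (Suc n)>=1"
proof (induction n arbitrary: w)
 case (0 w)
 then obtain v where v: "w = [v]" "v : S5" "0<=fst v" "0<=snd v"
  unfolding walks_Suc walks_0 by (auto simp: px_def py_def)
 thus ?case by (auto simp: S5_def px_def py_def)
next
 case (Suc n w)
 then obtain u v where uv: "w = u @ [v]" "u : walks S5 (Suc n)" "v : S5" unfolding walks_Suc[of S5 "Suc n"] by auto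
 have lu: "length u = Suc n" using uv by (simp add: walks_def)
 have "fst v + snd v>=0" using uv(3) by (auto simp: S5_def)
 thus ?case using Suc.IH[OF uv(2)] px_append(2)[of u v] py_append(2)[of u v] lu uv(1) by simp
qed

lemma Qgf_walk_sum: "Qgf S d a b t x y = suminf (%n. cr (t^n)*walk_sum S d a b n (%i j. x^nat i*y^nat j))"
 by (simp add: Qgf_def walk_sum_def mult.assoc)

text \<open>Absent steps have weight 0, so all five models can be treated inside the largest step
  set.\<close>

lemma Qgf_S5:
 assumes "S<=S5" "ALL v. v ~: S --> d v = 0"
 shows "Qgf S d a b t = Qgf S5 d a b t"
proof -
 have fin: "finite S" using assms(1) finite_S5 by (rule finite_subset)
 have "walk_sum S d a b n F = walk_sum S5 d a b n F" for n F
  unfolding walk_sum_def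
 proof (rule sum.mono_neutral_cong_left)
  show "finite (walks S5 n)" by (rule finite_walks[OF finite_S5])
  show "walks S n<=walks S5 n" using assms(1) by (auto simp: walks_def)
  show "ALL w:walks S5 n - walks S n. cr (weight S5 d a b w)*F (px w n) (py w n) = 0"
  proof
   fix w assume w: "w : walks S5 n - walks S n"
   then obtain v where v: "v : set w" "v ~: S" "v : S5" by (auto simp: walks_def)
   have "d v = 0" using assms(2) v(2) by blast
   hence "d v ^ count_list w v = 0" using v(1) count_list_0_iff[of w v] by simp
   hence "(PROD v:S5. d v ^ count_list w v) = 0" using v(3) by (intro prod_zero finite_S5 bexI[of _ v])
   thus "cr (weight S5 d a b w)*F (px w n) (py w n) = 0" by (simp add: weight_def)
  qed
  fix w assume w: "w : walks S n"
  have "(PROD v:S. d v ^ count_list w v) = (PROD v:S5. d v ^ count_list w v)"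
  proof (rule prod.mono_neutral_left[OF finite_S5 assms(1)])
   show "ALL v:S5 - S. d v ^ count_list w v = 1"
   proof
    fix v assume "v : S5 - S"
    hence "v ~: set w" using w by (auto simp: walks_def)
    thus "d v ^ count_list w v = 1" by (simp add: count_list_0_iff)
   qed
  qed
  thus "cr (weight S d a b w)*F (px w n) (py w n) = cr (weight S5 d a b w)*F (px w n) (py w n)"
   by (simp add: weight_def)
 qed
 thus ?thesis by (intro ext) (simp add: Qgf_walk_sum)
qed

text \<open>The factor \<open>(1 + a)*(1 + b)\<close> bounds the boundary weights of a single step;
  with this \<open>t\<close> the walks of length n contribute at most (1/2)^n on the closed unit
  bidisc.\<close>

locale quadrant =
 fixes d :: "int \<times> int => real" and a b t :: real
 assumes d_nonneg: "!!v. 0<=d v" and ab_pos: "a > 0" "b > 0" and t_pos: "t > 0"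
  and t_small: "t*((SUM v:S5. d v)*((1 + a)*(1 + b)))<=1/2"
begin

definition C where "C = (SUM v:S5. d v)*((1 + a)*(1 + b))"

abbreviation "WW n == walk_sum S5 d a b n"
abbreviation "Q == Qgf S5 d a b t"

lemma weight_nonneg: "0<=weight S5 d a b w"
 unfolding weight_def using d_nonneg ab_pos by (intro mult_nonneg_nonneg prod_nonneg) auto

lemma walk_sum_norm:
 assumes "!!w. w : walks S5 n ==> norm (F (px w n) (py w n))<=M"
 shows "norm (WW n F)<=(SUM w:walks S5 n. weight S5 d a b w)*M"
 unfolding walk_sum_def sum_distrib_right
 by (rule sum_norm_le) (use assms weight_nonneg in "auto simp: norm_mult abs_of_nonneg intro!: mult_left_mono")

lemma total_weight: "(SUM w:walks S5 n. weight S5 d a b w)<=C^n"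
proof (induction n)
 case 0
 show ?case by (simp add: walks_0 weight_def nx_def ny_def One_nat_def)
next
 case (Suc n)
 have C0: "C>=0" unfolding C_def using d_nonneg ab_pos by (intro mult_nonneg_nonneg sum_nonneg) auto
 let ?f = "%i j. SUM v:S5. if 0<=i + fst v & 0<=j + snd v
   then cr (d v * (if j + snd v = 0 then a else 1)*(if i + fst v = 0 then b else 1))*1 else 0"
 have f: "norm (?f i j)<=C" for i j :: int
 proof -
  have "norm (?f i j)<=(SUM v:S5. d v * ((1 + a)*(1 + b)))"
  proof (rule sum_norm_le)
   fix v
   have "d v * ((if j + snd v = 0 then a else 1)*(if i + fst v = 0 then b else 1))<=d v * ((1 + a)*(1 + b))"
    using ab_pos d_nonneg[of v] by (intro mult_left_mono mult_mono) auto
   moreover have "0<=d v * ((if j + snd v = 0 then a else 1)*(if i + fst v = 0 then b else 1))"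
    using ab_pos d_nonneg[of v] by (intro mult_nonneg_nonneg) auto
   ultimately show "norm (if 0<=i + fst v & 0<=j + snd v
    then cr (d v * (if j + snd v = 0 then a else 1)*(if i + fst v = 0 then b else 1))*1 else 0)<=d v * ((1 + a)*(1 + b))"
    by (simp add: mult.assoc del: of_real_mult)
  qed
  thus ?thesis by (simp add: C_def sum_distrib_right)
 qed
 have "cr (SUM w:walks S5 (Suc n). weight S5 d a b w) = WW (Suc n) (%_ _. 1)" by (simp add: walk_sum_def)
 also have "... = WW n ?f" by (rule walk_sum_Suc[OF finite_S5])
 finally have "norm (cr (SUM w:walks S5 (Suc n). weight S5 d a b w))<=(SUM w:walks S5 n. weight S5 d a b w)*C"
  using walk_sum_norm[of n ?f C] f by simp
 moreover have "0<=(SUM w:walks S5 (Suc n). weight S5 d a b w)" using weight_nonneg by (intro sum_nonneg) auto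
 ultimately have "(SUM w:walks S5 (Suc n). weight S5 d a b w)<=(SUM w:walks S5 n. weight S5 d a b w)*C"
  by (simp only: norm_of_real abs_of_nonneg)
 also have "...<=C^n*C" using Suc C0 by (intro mult_right_mono) auto
 finally show ?case by (simp add: mult.commute)
qed

lemma C_nonneg: "C>=0" unfolding C_def using d_nonneg ab_pos by (intro mult_nonneg_nonneg sum_nonneg) auto

lemma term_bound:
 assumes "!!w. w : walks S5 n ==> norm (F (px w n) (py w n))<=M" "M>=0"
 shows "norm (cr (t^n) * WW n F)<=(1/2)^n*M"
proof -
 have "norm (cr (t^n) * WW n F) = t^n*norm (WW n F)" using t_pos by (simp add: norm_mult norm_power)
 also have "...<=t^n*(C^n*M)"
 proof (rule mult_left_mono)
  have "norm (WW n F)<=(SUM w:walks S5 n. weight S5 d a b w)*M" by (rule walk_sum_norm) (rule assms(1))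
  also have "...<=C^n*M" by (rule mult_right_mono[OF total_weight assms(2)])
  finally show "norm (WW n F)<=C^n*M" .
 qed (use t_pos in simp)
 also have "... = (t*C)^n*M" by (simp add: power_mult_distrib)
 also have "...<=(1/2)^n*M"
  using t_small t_pos C_nonneg assms(2) by (intro mult_right_mono power_mono) (auto simp: C_def)
 finally show ?thesis .
qed

lemma norm_monomial: "norm x<=1 ==> norm y<=1 ==> norm (x^i*y^j)<=1" for x y :: complex
 by (simp add: norm_mult norm_power mult_le_one power_le_one)

definition qterm where "qterm n x y = cr (t^n) * WW n (%i j. x^nat i*y^nat j)"

lemma qterm_bound: "norm x<=1 ==> norm y<=1 ==> norm (qterm n x y)<=(1/2)^n"
 unfolding qterm_def using term_bound[of n "%i j. x^nat i*y^nat j" 1] norm_monomial[of x y] by simp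

lemma Q_qterm: "Q x y = suminf (%n. qterm n x y)"
 by (simp add: Qgf_walk_sum qterm_def)

lemma qterm_summable: "norm x<=1 ==> norm y<=1 ==> summable (%n. qterm n x y)"
 by (rule summable_comparison_test'[OF complete_algebra_summable_geometric[of "1/2 :: real"]])
  (auto intro: qterm_bound)

lemma qterm_sums: "norm x<=1 ==> norm y<=1 ==> (%n. qterm n x y) sums Q x y"
 unfolding Q_qterm by (intro summable_sums qterm_summable)

lemma qterm_holomorphic: "(%x. qterm n x y) holomorphic_on A" "(%y. qterm n x y) holomorphic_on A"
 unfolding qterm_def walk_sum_def by (intro holomorphic_intros)+

lemma Q_holomorphic_x:
 assumes "norm y<=1" shows "(%x. Q x y) holomorphic_on ball 0 1"
proof (rule holomorphic_uniform_sequence)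
 show "(%x. SUM i<n. qterm i x y) holomorphic_on ball 0 1" for n by (intro holomorphic_on_sum qterm_holomorphic)
 fix x :: complex assume "x : ball 0 1"
 then obtain e where e: "e > 0" "cball x e<=ball 0 1" using open_contains_cball[of "ball (0::complex) 1"] open_ball by blast
 have "uniform_limit (cball x e) (%n x. SUM i<n. qterm i x y) (%x. suminf (%i. qterm i x y)) sequentially"
  by (rule Weierstrass_m_test[where M = "%n. (1/2)^n"]) (use e assms in "auto intro!: qterm_bound dest!: subsetD")
 thus "EX d>0. cball x d<=ball 0 1 & uniform_limit (cball x d) (%n x. SUM i<n. qterm i x y) (%x. Q x y) sequentially"
  using e by (auto simp: Q_qterm)
qed auto

lemma Q_holomorphic_y:
 assumes "norm x<=1" shows "(%y. Q x y) holomorphic_on ball 0 1"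
proof (rule holomorphic_uniform_sequence)
 show "(%y. SUM i<n. qterm i x y) holomorphic_on ball 0 1" for n by (intro holomorphic_on_sum qterm_holomorphic)
 fix y :: complex assume "y : ball 0 1"
 then obtain e where e: "e > 0" "cball y e<=ball 0 1" using open_contains_cball[of "ball (0::complex) 1"] open_ball by blast
 have "uniform_limit (cball y e) (%n y. SUM i<n. qterm i x y) (%y. suminf (%i. qterm i x y)) sequentially"
  by (rule Weierstrass_m_test[where M = "%n. (1/2)^n"]) (use e assms in "auto intro!: qterm_bound dest!: subsetD")
 thus "EX d>0. cball y d<=ball 0 1 & uniform_limit (cball y d) (%n y. SUM i<n. qterm i x y) (%y. Q x y) sequentially"
  using e by (auto simp: Q_qterm)
qed auto

text \<open>This gives uniform convergence to the boundary series, and with it convergence of all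
  derivatives, when one variable tends to 0.\<close>

lemma Q_lipschitz:
 assumes "norm x<=1" "norm y<=1"
 shows "norm (Q x y - Q x 0)<=2*norm y" "norm (Q x y - Q 0 y)<=2*norm x"
proof -
 have pw: "norm (z^n - 0^n)<=norm z" if "norm z<=1" for z :: complex and n
  using that power_decreasing[of 1 n "norm z"] by (cases "n = 0") (auto simp: norm_power power_0_left)
 have geo: "(%n. (1/2)^n*M) sums (2*M)" for M :: real
  using sums_mult2[OF geometric_sums[of "1/2 :: real"], of M] by simp
 have lip: "norm (Q x y - Q x' y')<=2*M" if b: "!!i j. norm (x^i*y^j - x'^i*y'^j)<=M" and n: "norm x'<=1" "norm y'<=1" for x' y' M
 proof -
  have 1: "norm (qterm n x y - qterm n x' y')<=(1/2)^n*M" for n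
  proof -
   have "qterm n x y - qterm n x' y' = cr (t^n) * WW n (%i j. x^nat i*y^nat j - x'^nat i*y'^nat j)"
    unfolding qterm_def walk_sum_linear by (simp add: algebra_simps)
   thus ?thesis using term_bound[of n "%i j. x^nat i*y^nat j - x'^nat i*y'^nat j" M] b order_trans[OF norm_ge_zero b[of 0 0]] by simp
  qed
  have "(%n. qterm n x y - qterm n x' y') sums (Q x y - Q x' y')" by (intro sums_diff qterm_sums) (use assms n in auto)
  thus ?thesis using norm_suminf_le[OF 1 sums_summable[OF geo]] geo[of M] by (simp add: sums_iff)
 qed
 show "norm (Q x y - Q x 0)<=2*norm y"
 proof (rule lip)
  fix i j
  have "norm (x^i*y^j - x^i*0^j) = norm x^i*norm (y^j - 0^j)"
   by (simp add: norm_mult norm_power flip: right_diff_distrib)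
  also have "...<=1*norm y" using assms by (intro mult_mono pw power_le_one) auto
  finally show "norm (x^i*y^j - x^i*0^j)<=norm y" by simp
 qed (use assms in auto)
 show "norm (Q x y - Q 0 y)<=2*norm x"
 proof (rule lip)
  fix i j
  have "norm (x^i*y^j - 0^i*y^j) = norm (x^i - 0^i)*norm y^j"
   by (simp add: norm_mult norm_power flip: left_diff_distrib)
  also have "...<=norm x*1" using assms by (intro mult_mono pw power_le_one) auto
  finally show "norm (x^i*y^j - 0^i*y^j)<=norm x" by simp
 qed (use assms in auto)
qed

lemma qterm_0: "qterm 0 x y = 1"
 by (simp add: qterm_def walk_sum_def walks_0 weight_def nx_def ny_def px_def py_def One_nat_def)

lemma Q_0_0: "Q 0 0 = 1"
proof -
 have "qterm (Suc n) 0 0 = 0" for n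
 proof -
  have "WW (Suc n) (%i j. 0^nat i*0^nat j) = WW (Suc n) (%i j. 0*1)"
  proof (rule walk_sum_cong)
   fix w assume "w : walks S5 (Suc n)"
   hence "nat (px w (Suc n))~=0 | nat (py w (Suc n))~=0" using walks_S5_pos[of w n] by linarith
   thus "0^nat (px w (Suc n))*0^nat (py w (Suc n)) = (0*1 :: complex)" by (auto simp: power_0_left)
  qed
  thus ?thesis by (simp add: qterm_def walk_sum_def)
 qed
 hence "(%n. qterm n 0 0) = (%n. if n = 0 then 1 else 0)" by (auto simp: qterm_0 fun_eq_iff gr0_conv_Suc)
 moreover have "(%n. if n = 0 then 1 else 0 :: complex) sums 1" using sums_single[of 0 "%_. 1 :: complex"] by simp
 ultimately have "(%n. qterm n 0 0) sums 1" by simp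
 thus ?thesis using qterm_sums[of 0 0] sums_unique2 by fastforce
qed

definition step_poly :: "complex => complex => complex" where
 "step_poly x y = of_real (d (1, -1))*x^2 + of_real (d (-1, 1))*y^2 + of_real (d (1, 0))*x^2*y
   + of_real (d (0, 1))*x*y^2 + of_real (d (1, 1))*x^2*y^2"

lemma one_step:
 assumes "0<=i" "0<=j"
 shows "(SUM v:S5. if 0<=i + fst v & 0<=j + snd v then cr (d v)*(x*y*(x^nat (i + fst v)*y^nat (j + snd v))) else 0)
  = step_poly x y*(x^nat i*y^nat j) - of_real (d (1, -1))*x^2*(x^nat i*0^nat j) - of_real (d (-1, 1))*y^2*(0^nat i*y^nat j)"
proof -
 obtain m n where mn: "i = int m" "j = int n" using assms by (metis nonneg_int_cases)
 have e: "nat (int k + 1) = Suc k" for k by simp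
 show ?thesis unfolding mn S5_def
  by (cases m; cases n) (simp_all add: e nat_add_distrib step_poly_def power2_eq_square algebra_simps)
qed

text \<open>The endpoint is not the origin, so at most one axis is met and no product of the two
  corrections appears.\<close>

lemma boundary_factor:
 assumes "0<=i" "0<=j" "i + j>=1"
 shows "(if j = 0 then 1 / of_real a else 1)*(if i = 0 then 1 / of_real b else 1)*(x^nat i*y^nat j)
  = x^nat i*y^nat j + (1 / of_real a - 1)*(x^nat i*0^nat j) + (1 / of_real b - 1)*(0^nat i*y^nat j :: complex)"
 using assms by (auto simp: algebra_simps power_0_left)

text \<open>The test function \<open>F\<close> divides out the boundary weights of the last step.
  The sum over last steps then becomes multiplication by the step polynomial, minus the steps that
  would leave the quadrant.\<close>

lemma qterm_recurrence:
 "x*y*(qterm (Suc n) x y + (1 / of_real a - 1)*qterm (Suc n) x 0 + (1 / of_real b - 1)*qterm (Suc n) 0 y) =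
   of_real t*(step_poly x y*qterm n x y - of_real (d (1, -1))*x^2*qterm n x 0 - of_real (d (-1, 1))*y^2*qterm n 0 y)"
proof -
 define F where "F i j = x*y*((if j = 0 then 1 / of_real a else 1)*(if i = 0 then 1 / of_real b else 1)*(x^nat i*y^nat j))" for i j :: int
 have "WW (Suc n) F = WW (Suc n) (%i j. x*y*(x^nat i*y^nat j + (1 / of_real a - 1)*(x^nat i*0^nat j) + (1 / of_real b - 1)*(0^nat i*y^nat j)))"
 proof (rule walk_sum_cong)
  fix w assume "w : walks S5 (Suc n)"
  thus "F (px w (Suc n)) (py w (Suc n)) = x*y*(x^nat (px w (Suc n))*y^nat (py w (Suc n)) +
   (1 / of_real a - 1)*(x^nat (px w (Suc n))*0^nat (py w (Suc n))) + (1 / of_real b - 1)*(0^nat (px w (Suc n))*y^nat (py w (Suc n))))"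
   unfolding F_def by (subst boundary_factor) (auto intro: walks_nonneg walks_S5_pos)
 qed
 hence e: "WW (Suc n) F = x*y*(WW (Suc n) (%i j. x^nat i*y^nat j) + (1 / of_real a - 1) * WW (Suc n) (%i j. x^nat i*0^nat j) +
   (1 / of_real b - 1) * WW (Suc n) (%i j. 0^nat i*y^nat j))"
  unfolding walk_sum_linear .
 have 1: "of_real (t^Suc n) * WW (Suc n) F = x*y*(qterm (Suc n) x y + (1 / of_real a - 1)*qterm (Suc n) x 0 + (1 / of_real b - 1)*qterm (Suc n) 0 y)"
  unfolding e qterm_def by (simp add: algebra_simps)
 have "WW (Suc n) F = WW n (%i j. step_poly x y*(x^nat i*y^nat j) - of_real (d (1, -1))*x^2*(x^nat i*0^nat j) - of_real (d (-1, 1))*y^2*(0^nat i*y^nat j))"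
  unfolding walk_sum_Suc[OF finite_S5]
 proof (rule walk_sum_cong)
  fix w assume w: "w : walks S5 n"
  let ?i = "px w n" and ?j = "py w n"
  have "(SUM v:S5. if 0<=?i + fst v & 0<=?j + snd v then cr (d v * (if ?j + snd v = 0 then a else 1)*(if ?i + fst v = 0 then b else 1))*F (?i + fst v) (?j + snd v) else 0)
   = (SUM v:S5. if 0<=?i + fst v & 0<=?j + snd v then cr (d v)*(x*y*(x^nat (?i + fst v)*y^nat (?j + snd v))) else 0)"
   by (intro sum.cong refl) (use ab_pos in "auto simp: F_def")
  also have "... = step_poly x y*(x^nat ?i*y^nat ?j) - of_real (d (1, -1))*x^2*(x^nat ?i*0^nat ?j) - of_real (d (-1, 1))*y^2*(0^nat ?i*y^nat ?j)"
   by (rule one_step) (use walks_nonneg w in auto)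
  finally show "(SUM v:S5. if 0<=?i + fst v & 0<=?j + snd v then cr (d v * (if ?j + snd v = 0 then a else 1)*(if ?i + fst v = 0 then b else 1))*F (?i + fst v) (?j + snd v) else 0)
   = step_poly x y*(x^nat ?i*y^nat ?j) - of_real (d (1, -1))*x^2*(x^nat ?i*0^nat ?j) - of_real (d (-1, 1))*y^2*(0^nat ?i*y^nat ?j)" .
 qed
 hence "of_real (t^Suc n) * WW (Suc n) F =
   of_real t*(step_poly x y*qterm n x y - of_real (d (1, -1))*x^2*qterm n x 0 - of_real (d (-1, 1))*y^2*qterm n 0 y)"
  unfolding qterm_def by (simp only: walk_sum_linear) (simp add: algebra_simps)
 thus ?thesis unfolding 1 .
qed

theorem functional_equation:
 assumes "norm x<=1" "norm y<=1"
 shows "(x*y - of_real t * step_poly x y)*Q x y = of_real (1/a + 1/b - 1)*(x*y)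
   + (of_real (1 - 1/a)*(x*y) - of_real (t*d (1, -1))*x^2)*Q x 0
   + (of_real (1 - 1/b)*(x*y) - of_real (t*d (-1, 1))*y^2)*Q 0 y"
proof -
 have s: "(%n. qterm n x y) sums Q x y" "(%n. qterm n x 0) sums Q x 0" "(%n. qterm n 0 y) sums Q 0 y"
  using assms by (auto intro!: qterm_sums)
 have s': "(%n. qterm (Suc n) x y) sums (Q x y - 1)" "(%n. qterm (Suc n) x 0) sums (Q x 0 - 1)" "(%n. qterm (Suc n) 0 y) sums (Q 0 y - 1)"
  using s by (subst sums_Suc_iff; simp add: qterm_0)+
 have "(%n. x*y*(qterm (Suc n) x y + (1 / of_real a - 1)*qterm (Suc n) x 0 + (1 / of_real b - 1)*qterm (Suc n) 0 y)) sums
  (x*y*((Q x y - 1) + (1 / of_real a - 1)*(Q x 0 - 1) + (1 / of_real b - 1)*(Q 0 y - 1)))"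
  by (intro sums_mult sums_add s')
 moreover have "(%n. x*y*(qterm (Suc n) x y + (1 / of_real a - 1)*qterm (Suc n) x 0 + (1 / of_real b - 1)*qterm (Suc n) 0 y)) sums
  (of_real t*(step_poly x y*Q x y - of_real (d (1, -1))*x^2*Q x 0 - of_real (d (-1, 1))*y^2*Q 0 y))"
  unfolding qterm_recurrence by (intro sums_mult sums_diff s)
 ultimately have "x*y*((Q x y - 1) + (1 / of_real a - 1)*(Q x 0 - 1) + (1 / of_real b - 1)*(Q 0 y - 1)) =
  of_real t*(step_poly x y*Q x y - of_real (d (1, -1))*x^2*Q x 0 - of_real (d (-1, 1))*y^2*Q 0 y)"
  by (rule sums_unique2)
 thus ?thesis by (simp add: algebra_simps)
qed

end

subsection \<open>From differential equations for functions to formal ones\<close>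

lemma moneval_split: "moneval m v = v i^lookup m i*moneval m (v(i := 1))"
proof -
 let ?A = "insert i (keys m)"
 have "moneval m v = (PROD j:?A. v j^lookup m j)" by (rule moneval_superset) auto
 also have "... = v i^lookup m i*(PROD j:?A - {i}. v j^lookup m j)"
  by (subst prod.remove[of ?A i]) auto
 also have "(PROD j:?A - {i}. v j^lookup m j) = (PROD j:?A - {i}. (v(i := 1)) j^lookup m j)"
  by (intro prod.cong) auto
 also have "... = (PROD j:?A. (v(i := 1)) j^lookup m j)"
  by (subst prod.remove[of ?A i]) auto
 also have "... = moneval m (v(i := 1))" by (rule moneval_superset[symmetric]) auto
 finally show ?thesis .
qed

text \<open>Dividing by the largest power of \<open>y\<close> and letting \<open>y\<close> tend to \<open>0\<close> keeps the monomials of least degree in \<open>y\<close>.\<close>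

lemma specialize_ADE:
 fixes P :: "complex mp"
 assumes P: "P~=0" and i: "i0~=i1" and r: "r > 0"
  and rel: "!!x y. norm x < r ==> norm y < r ==>
   mpeval P (%i. if i = i0 then x else if i = i1 then y else (deriv ^^ (i - 2)) (%u. F u y) x) = 0"
  and holo: "!!y. norm y<=1 ==> (%x. F x y) holomorphic_on ball 0 1"
  and lip: "!!x y. norm x<=1 ==> norm y<=1 ==> norm (F x y - F x 0)<=2*norm y"
 shows "EX k. {m : keys P. lookup m i1 = k}~={} &
  (ALL x. norm x < min r 1 --> (SUM m:{m : keys P. lookup m i1 = k}. lookup P m *
    moneval m (%i. if i = i0 then x else if i = i1 then 1 else (deriv ^^ (i - 2)) (%u. F u 0) x)) = 0)"
proof -
 define k where "k = Min ((%m. lookup m i1) ` keys P)"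
 have ne: "keys P~={}" using P by simp
 have kle: "k<=lookup m i1" if "m : keys P" for m using that by (simp add: k_def)
 have "k : (%m. lookup m i1) ` keys P" unfolding k_def using ne by (intro Min_in) auto
 hence 1: "{m : keys P. lookup m i1 = k}~={}" by auto
 define v where "v x y i = (if i = i0 then x else if i = i1 then 1 else (deriv ^^ (i - 2)) (%u. F u y) x)" for x y i
 have lim: "((%y. v x y i) \<longlongrightarrow> v x 0 i) (at 0)" if x: "norm x < 1" for x i
 proof -
  have "uniform_limit (ball 0 1) (%y x. F x y) (%x. F x 0) (at 0)"
  proof (rule uniform_limitI)
   fix e :: real assume e: "e > 0"
   have "eventually (%y::complex. norm y < min 1 (e/2)) (at 0)"
    using e eventually_at[of "%y::complex. norm y < min 1 (e/2)" 0 UNIV] by (auto intro!: exI[of _ "min 1 (e/2)"])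
   thus "\<forall>\<^sub>F y in at 0. ALL x:ball 0 1. dist (F x y) (F x 0) < e"
   proof eventually_elim
    case (elim y)
    show ?case
    proof
     fix x :: complex assume "x : ball 0 1"
     thus "dist (F x y) (F x 0) < e" using lip[of x y] elim by (auto simp: dist_norm)
    qed
   qed
  qed
  moreover have "eventually (%y. (%x. F x y) holomorphic_on ball 0 1) (at (0::complex))"
  proof -
   have "eventually (%y::complex. norm y < 1) (at 0)"
    using eventually_at[of "%y::complex. norm y < 1" 0 UNIV] by (auto intro!: exI[of _ 1])
   thus ?thesis by eventually_elim (auto intro: holo)
  qed
  ultimately have "((%y. (deriv ^^ n) (%u. F u y) x) \<longlongrightarrow> (deriv ^^ n) (%u. F u 0) x) (at 0)" for n
   by (rule higher_deriv_complex_uniform_limit) (use x in auto)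
  thus ?thesis unfolding v_def by auto
 qed
 have 2: "(SUM m:{m : keys P. lookup m i1 = k}. lookup P m*moneval m (v x 0)) = 0"
  if x: "norm x < min r 1" for x
 proof -
  define T where "T y = (SUM m:keys P. lookup P m*(y^(lookup m i1 - k)*moneval m (v x y)))" for y
  have "T y = 0" if y: "y~=0" "norm y < r" for y
  proof -
   have "0 = mpeval P (%i. if i = i0 then x else if i = i1 then y else (deriv ^^ (i - 2)) (%u. F u y) x)"
    using rel[of x y] x y by simp
   also have "... = (SUM m:keys P. lookup P m*(y^lookup m i1*moneval m (v x y)))"
    unfolding mpeval_def
   proof (intro sum.cong refl)
    fix m
    have "(%i. if i = i0 then x else if i = i1 then y else (deriv ^^ (i - 2)) (%u. F u y) x)(i1 := 1) = v x y"
     using i by (auto simp: v_def fun_eq_iff)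
    thus "lookup P m*moneval m (%i. if i = i0 then x else if i = i1 then y else (deriv ^^ (i - 2)) (%u. F u y) x)
     = lookup P m*(y^lookup m i1*moneval m (v x y))"
     using i by (subst moneval_split[of _ _ i1]) simp
   qed
   also have "... = y^k*T y" unfolding T_def sum_distrib_left
   proof (intro sum.cong refl)
    fix m assume "m : keys P"
    hence "y^lookup m i1 = y^k*y^(lookup m i1 - k)"
     using kle by (simp flip: power_add)
    thus "lookup P m*(y^lookup m i1*moneval m (v x y)) =
     y^k*(lookup P m*(y^(lookup m i1 - k)*moneval m (v x y)))" by (simp only: mult_ac)
   qed
   finally show ?thesis using y by simp
  qed
  moreover have "eventually (%y::complex. y~=0 & norm y < r) (at 0)"
   using r eventually_at[of "%y::complex. y~=0 & norm y < r" 0 UNIV] by (auto intro!: exI[of _ r])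
  ultimately have "eventually (%y. T y = 0) (at 0)" by (auto elim: eventually_mono)
  hence t1: "(T \<longlongrightarrow> 0) (at 0)" by (rule tendsto_eventually)
  have t2: "(T \<longlongrightarrow> (SUM m:keys P. lookup P m*(0^(lookup m i1 - k)*moneval m (v x 0)))) (at 0)"
   unfolding T_def moneval_def using x by (intro tendsto_intros lim) auto
  have "(SUM m:keys P. lookup P m*(0^(lookup m i1 - k)*moneval m (v x 0))) = 0"
   by (rule tendsto_unique[OF at_neq_bot t2 t1])
  also have "(SUM m:keys P. lookup P m*(0^(lookup m i1 - k)*moneval m (v x 0))) =
   (SUM m:{m : keys P. lookup m i1 = k}. lookup P m*moneval m (v x 0))"
  proof (rule sum.mono_neutral_cong_right)
   show "ALL m:keys P - {m : keys P. lookup m i1 = k}.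
    lookup P m*(0^(lookup m i1 - k)*moneval m (v x 0)) = 0"
   proof
    fix m assume m: "m : keys P - {m : keys P. lookup m i1 = k}"
    hence "lookup m i1 - k~=0" using kle[of m] by auto
    thus "lookup P m*(0^(lookup m i1 - k)*moneval m (v x 0)) = 0" by (simp add: power_0_left)
   qed
  qed auto
  finally show ?thesis .
 qed
 have "v x 0 = (%i. if i = i0 then x else if i = i1 then 1 else (deriv ^^ (i - 2)) (%u. F u 0) x)" for x
  by (simp add: v_def fun_eq_iff)
 thus ?thesis using 1 2 by (intro exI[of _ k]) simp
qed

lemma moneval_hom:
 assumes "!!x y. h (x*y) = h x*h y" "h 1 = 1"
 shows "h (moneval m v) = moneval m (%i. h (v i))"
proof -
 have p: "h (x^n) = h x^n" for x n by (induction n) (auto simp: assms)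
 have "h (PROD i:A. f i) = (PROD i:A. h (f i))" for A :: "nat set" and f
  by (induction A rule: infinite_finite_induct) (auto simp: assms)
 thus ?thesis by (simp add: moneval_def p)
qed

text \<open>Variables 0 and 1 hold the arguments x and y; the remaining ones hold the derivatives,
  renumbered from 0.\<close>

definition drop2 :: "(nat \<Rightarrow>\<^sub>0 nat) => (nat \<Rightarrow>\<^sub>0 nat)" where
 "drop2 m = Poly_Mapping.map_key (%j. j + 2) m"

lemma lookup_drop2: "lookup (drop2 m) j = lookup m (j + 2)"
 unfolding drop2_def by (subst Poly_Mapping.map_key.rep_eq) (auto simp: inj_def)

lemma moneval_drop2: "moneval m v = v 0^lookup m 0 * v 1^lookup m 1*moneval (drop2 m) (%j. v (j + 2))"
proof -
 obtain N where N: "keys m<={..<N}" using finite_nat_iff_bounded[of "keys m"] by auto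
 have N2: "keys (drop2 m)<={..<N}"
 proof
  fix j assume "j : keys (drop2 m)"
  hence "j + 2 : keys m" by (simp add: in_keys_iff lookup_drop2)
  thus "j : {..<N}" using N by auto
 qed
 have "moneval m v = (PROD i<Suc (Suc N). v i^lookup m i)" by (rule moneval_superset) (use N in auto)
 also have "... = v 0^lookup m 0*(v 1^lookup m 1*(PROD j<N. v (j + 2)^lookup m (j + 2)))"
  unfolding prod.lessThan_Suc_shift by (simp add: One_nat_def)
 also have "(PROD j<N. v (j + 2)^lookup m (j + 2)) = moneval (drop2 m) (%j. v (j + 2))"
  by (subst moneval_superset[OF _ N2]) (auto simp: lookup_drop2)
 finally show ?thesis by (simp add: mult.assoc)
qed

text \<open>The variables x and y turn into the coefficients \<open>Xi\<close> and 1, so monomials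
  that differ only there merge. Their exponents of y agree by assumption, and different powers of a
  series of order exactly 1 cannot cancel.\<close>

lemma alg_dep_of_relation:
 fixes Xi :: "complex fps" and P :: "complex mp" and f :: "nat => complex fls"
 assumes Xi: "fps_nth Xi 0 = 0" "fps_nth Xi 1~=0" "fps_to_fls Xi : ratfun"
  and i: "i0~=i1" "i0 < 2" "i1 < 2"
  and K: "K<=keys P" "K~={}" "!!m. m : K ==> lookup m i1 = k"
  and rel: "(SUM m:K. fls_const (lookup P m) *
    moneval m (%i. if i = i0 then fps_to_fls Xi else if i = i1 then 1 else f (i - 2))) = 0"
 shows "rat.alg_dep f"
proof -
 have fin: "finite K" using K(1) finite_keys finite_subset by blast
 define P' where "P' = (SUM m:K. single (drop2 m) (fls_const (lookup P m)*fps_to_fls Xi^lookup m i0))"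
 have "mpeval P' f = (SUM m:K. fls_const (lookup P m) *
    moneval m (%i. if i = i0 then fps_to_fls Xi else if i = i1 then 1 else f (i - 2)))"
  unfolding P'_def mpeval_sum mpeval_single
 proof (intro sum.cong refl)
  fix m
  have "i0 = 0 & i1 = 1 | i0 = 1 & i1 = 0" using i by linarith
  moreover have "(%j. if j + 2 = i0 then fps_to_fls Xi else if j + 2 = i1 then 1 else f (j + 2 - 2)) = f" using i by auto
  ultimately have "moneval m (%i. if i = i0 then fps_to_fls Xi else if i = i1 then 1 else f (i - 2)) =
   fps_to_fls Xi^lookup m i0*moneval (drop2 m) f" by (subst moneval_drop2) auto
  thus "fls_const (lookup P m)*fps_to_fls Xi^lookup m i0*moneval (drop2 m) f =
   fls_const (lookup P m)*moneval m (%i. if i = i0 then fps_to_fls Xi else if i = i1 then 1 else f (i - 2))"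
   by (simp add: mult.assoc)
 qed
 hence ev: "mpeval P' f = 0" using rel by simp
 have co: "coeffs_in ratfun P'" unfolding P'_def
  by (intro rat.coeffs_in_sum rat.coeffs_in_single rat.mult_in rat.power_in ratfun_const Xi)
 have "P'~=0"
 proof
  assume P0: "P' = 0"
  obtain m0 where m0: "m0 : K" using K(2) by blast
  define K1 where "K1 = {m : K. drop2 m = drop2 m0}"
  have K1: "finite K1" "K1~={}" using fin m0 by (auto simp: K1_def)
  define e where "e = Min ((%m. lookup m i0) ` K1)"
  have "e : (%m. lookup m i0) ` K1" unfolding e_def using K1 by (intro Min_in) auto
  then obtain m1 where m1: "m1 : K1" "lookup m1 i0 = e" by auto
  have ele: "e<=lookup m i0" if "m : K1" for m using that K1 by (simp add: e_def)
  have uniq: "m = m1" if m: "m : K1" "lookup m i0 = e" for m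
  proof (rule poly_mapping_eqI)
   fix j
   consider "j = i0" | "j = i1" | "j>=2" using i by linarith
   thus "lookup m j = lookup m1 j"
   proof cases
    case 1 thus ?thesis using m m1 by simp
   next
    case 2 thus ?thesis using m m1 K(3) by (simp add: K1_def)
   next
    case 3
    have "drop2 m = drop2 m1" using m m1 by (simp add: K1_def)
    hence "lookup (drop2 m) (j - 2) = lookup (drop2 m1) (j - 2)" by simp
    thus ?thesis unfolding lookup_drop2 le_add_diff_inverse2[OF 3] .
   qed
  qed
  have "0 = lookup P' (drop2 m0)" by (simp add: P0)
  also have "... = (SUM m:K. if drop2 m = drop2 m0 then fls_const (lookup P m)*fps_to_fls Xi^lookup m i0 else 0)"
   unfolding P'_def lookup_sum by (intro sum.cong) (auto simp: lookup_single when_def)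
  also have "... = (SUM m:K1. fls_const (lookup P m)*fps_to_fls Xi^lookup m i0)"
   unfolding K1_def by (rule sum.inter_filter[symmetric, OF fin])
  also have "... = fps_to_fls (SUM m:K1. fps_const (lookup P m) * Xi^lookup m i0)"
   using K1(1) by (induction K1 rule: finite_induct) (auto simp: fls_times_fps_to_fls fps_to_fls_power)
  finally have "(SUM m:K1. fps_const (lookup P m) * Xi^lookup m i0) = 0" by (metis fps_to_fls_eq_0_iff)
  \<comment> \<open>Comparison at the smallest exponent \<open>e\<close> of \<open>Xi\<close>, which
    only \<open>m1\<close> attains.\<close>
  hence "0 = (SUM m:K1. lookup P m*fps_nth (Xi^lookup m i0) e)"
   by (metis (no_types, lifting) fps_mult_left_const_nth fps_sum_nth fps_zero_nth sum.cong)
  also have "... = (SUM m:K1. if m = m1 then lookup P m1*fps_nth Xi 1^e else 0)"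
  proof (intro sum.cong refl)
   fix m assume m: "m : K1"
   show "lookup P m*fps_nth (Xi^lookup m i0) e = (if m = m1 then lookup P m1*fps_nth Xi 1^e else 0)"
   proof (cases "m = m1")
    case True
    thus ?thesis using startsby_zero_power_nth_same[OF Xi(1), of e] m1 by simp
   next
    case False
    hence "e < lookup m i0" using ele[OF m] uniq[OF m] by linarith
    thus ?thesis using startsby_zero_power_prefix[OF Xi(1)] False by auto
   qed
  qed
  also have "... = lookup P m1*fps_nth Xi 1^e" using K1 m1 by (simp add: sum.delta)
  finally have "lookup P m1 = 0" using Xi(2) by simp
  moreover have "m1 : keys P" using m1 K(1) by (auto simp: K1_def)
  ultimately show False by (simp add: in_keys_iff)
 qed
 thus ?thesis using ev co unfolding rat.alg_dep_def by blast
qed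

text \<open>\<open>f i\<close> will be the i-th derivative in x composed with the parametrization
  and \<open>ka\<close> the inverse of \<open>theta\<close> applied to the latter. Passing from one
  derivation to the other is triangular.\<close>

lemma chain_rule_Dalg:
 assumes dep: "rat.alg_dep f" and ka: "ka : ratfun" "ka~=0" and f: "!!i. f (Suc i) = ka*theta (f i)"
 shows "Dalg (f 0)"
proof -
 define D where "D i = (theta ^^ i) (f 0)" for i
 have D: "theta (D i) = D (Suc i)" for i by (simp add: D_def)
 have "EX c a. c : ratfun & c~=0 & (ALL j. a j : ratfun) & f i = c*D i + (SUM j<i. a j*D j)" for i
 proof (induction i)
  case 0
  show ?case by (rule exI[of _ 1], rule exI[of _ "%_. 0"]) (simp add: D_def)
 next
  case (Suc i)
  then obtain c a where IH: "c : ratfun" "c~=0" "!!j. a j : ratfun" "f i = c*D i + (SUM j<i. a j*D j)" by blast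
  define a' where "a' j = ka*((if j < i then theta (a j) else theta c) + (if j = 0 then 0 else a (j - 1)))" for j
  have s1: "(SUM j<Suc i. (if j < i then theta (a j) else theta c)*D j) = (SUM j<i. theta (a j)*D j) + theta c*D i" by simp
  have s2: "(SUM j<Suc i. (if j = 0 then 0 else a (j - 1))*D j) = (SUM j<i. a j*D (Suc j))"
   unfolding sum.lessThan_Suc_shift by simp
  have "f (Suc i) = ka*(theta c*D i + c*D (Suc i) + (SUM j<i. theta (a j)*D j + a j*D (Suc j)))"
   unfolding f IH(4) by (simp add: theta_add theta_mult theta_sum D)
  also have "... = ka * c*D (Suc i) + ka*((SUM j<Suc i. (if j < i then theta (a j) else theta c)*D j) + (SUM j<Suc i. (if j = 0 then 0 else a (j - 1))*D j))"
   unfolding s1 s2 sum.distrib by (simp add: algebra_simps)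
  also have "... = ka * c*D (Suc i) + (SUM j<Suc i. a' j*D j)"
   unfolding a'_def sum.distrib[symmetric] sum_distrib_left by (simp only: algebra_simps)
  finally show ?case using IH ka
   by (intro exI[of _ "ka * c"] exI[of _ a']) (auto simp: a'_def intro!: rat.mult_in rat.add_in theta_ratfun)
 qed
 then obtain c a where "!!i. c i : ratfun" "!!i. c i~=0" "!!i j. a i j : ratfun" "!!i. f i = c i*D i + (SUM j<i. a i j*D j)"
  by metis
 thus ?thesis unfolding Dalg_def D_def[symmetric]
  by (intro Dalg_linear[OF dep, where c = c and a = a and b = "%_. 0"]) auto
qed

text \<open>The indices \<open>i0\<close> and \<open>i1\<close> are kept abstract so that one
  statement serves both variables, with the arguments of \<open>F\<close> exchanged.\<close>

theorem ADE_imp_Dalg: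
 fixes P :: "complex mp" and Xi Ph :: "complex fps"
 assumes P: "P~=0" and i: "i0~=i1" "i0 < 2" "i1 < 2" and r: "r > 0"
  and rel: "!!x y. norm x < r ==> norm y < r ==>
   mpeval P (%i. if i = i0 then x else if i = i1 then y else (deriv ^^ (i - 2)) (%u. F u y) x) = 0"
  and holo: "!!y. norm y<=1 ==> (%x. F x y) holomorphic_on ball 0 1"
  and lip: "!!x y. norm x<=1 ==> norm y<=1 ==> norm (F x y - F x 0)<=2*norm y"
  and Ph: "(%x. F x 0) has_fps_expansion Ph"
  and Xi: "fps_nth Xi 0 = 0" "fps_nth Xi 1~=0" "fps_to_fls Xi : ratfun"
 shows "Dalg (fps_to_fls (fps_compose Ph Xi))"
proof -
 have "EX k. {m : keys P. lookup m i1 = k}~={} &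
  (ALL x. norm x < min r 1 --> (SUM m:{m : keys P. lookup m i1 = k}. lookup P m *
    moneval m (%i. if i = i0 then x else if i = i1 then 1 else (deriv ^^ (i - 2)) (%u. F u 0) x)) = 0)"
  by (rule specialize_ADE[OF P i(1) r rel holo lip])
 then obtain k where K: "{m : keys P. lookup m i1 = k}~={}"
  and R: "!!x. norm x < min r 1 ==> (SUM m:{m : keys P. lookup m i1 = k}. lookup P m *
    moneval m (%i. if i = i0 then x else if i = i1 then 1 else (deriv ^^ (i - 2)) (%u. F u 0) x)) = 0"
  by (elim exE conjE) blast
 define K0 where "K0 = {m : keys P. lookup m i1 = k}"
 define V where "V i = (if i = i0 then fps_X else if i = i1 then 1 else (fps_deriv ^^ (i - 2)) Ph)" for i
 have Dn: "(deriv ^^ n) (%u. F u 0) has_fps_expansion (fps_deriv ^^ n) Ph" for n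
  by (induction n) (auto intro: has_fps_expansion_deriv Ph)
 have V: "(%x. if i = i0 then x else if i = i1 then 1 else (deriv ^^ (i - 2)) (%u. F u 0) x) has_fps_expansion V i" for i
  unfolding V_def using Dn[of "i - 2"] by (auto intro: fps_expansion_intros)
 define G where "G = (SUM m:K0. fps_const (lookup P m)*moneval m V)"
 have "(%x. SUM m:K0. lookup P m *
    moneval m (%i. if i = i0 then x else if i = i1 then 1 else (deriv ^^ (i - 2)) (%u. F u 0) x)) has_fps_expansion G"
  unfolding G_def moneval_def by (intro has_fps_expansion_sum has_fps_expansion_mult has_fps_expansion_const has_fps_expansion_prod has_fps_expansion_power V)
 moreover have "(%x. SUM m:K0. lookup P m *
    moneval m (%i. if i = i0 then x else if i = i1 then 1 else (deriv ^^ (i - 2)) (%u. F u 0) x)) has_fps_expansion 0"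
  unfolding has_fps_expansion_0_iff
 proof -
  have "eventually (%x::complex. x : ball 0 (min r 1)) (nhds 0)" using r by (intro eventually_nhds_in_open) auto
  thus "\<forall>\<^sub>F x in nhds 0. (SUM m:K0. lookup P m *
    moneval m (%i. if i = i0 then x else if i = i1 then 1 else (deriv ^^ (i - 2)) (%u. F u 0) x)) = 0"
   by eventually_elim (use R in "simp add: K0_def")
 qed
 ultimately have G0: "G = 0" by (rule fps_expansion_unique_complex)
 define H where "H A = fps_to_fls (fps_compose A Xi)" for A :: "complex fps"
 have H: "H (x*y) = H x*H y" "H 1 = 1" "H 0 = 0" "H (x + y) = H x + H y" "H (fps_const c) = fls_const c" for x y c
  using Xi(1) by (simp_all add: H_def fps_compose_mult_distrib fls_times_fps_to_fls fps_compose_add_distrib)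
 define f where "f i = H ((fps_deriv ^^ i) Ph)" for i
 have Hs: "H (sum g A) = (SUM x:A. H (g x))" for g :: "(nat \<Rightarrow>\<^sub>0 nat) => complex fps" and A
  by (induction A rule: infinite_finite_induct) (auto simp: H)
 have HV: "H (V i) = (if i = i0 then fps_to_fls Xi else if i = i1 then 1 else f (i - 2))" for i
 proof -
  have "H fps_X = fps_to_fls Xi" using Xi(1) by (simp add: H_def)
  thus ?thesis by (simp add: V_def f_def H(2))
 qed
 have "0 = H G" by (simp add: G0 H)
 also have "... = (SUM m:K0. fls_const (lookup P m)*moneval m (%i. if i = i0 then fps_to_fls Xi else if i = i1 then 1 else f (i - 2)))"
  unfolding G_def Hs H(1) H(5) by (simp add: moneval_hom[of H, OF H(1,2)] HV)
 finally have rel': "(SUM m:K0. fls_const (lookup P m)*moneval m (%i. if i = i0 then fps_to_fls Xi else if i = i1 then 1 else f (i - 2))) = 0" ..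
 have dep: "rat.alg_dep f"
  by (rule alg_dep_of_relation[OF Xi i _ _ _ rel']) (use K in "auto simp: K0_def")
 define ka where "ka = inverse (theta (fps_to_fls Xi))"
 have "fls_nth (theta (fps_to_fls Xi)) 1~=0" using Xi(2) by (simp add: theta_nth One_nat_def)
 hence tz: "theta (fps_to_fls Xi)~=0" by auto
 have "f (Suc i) = ka*theta (f i)" for i
 proof -
  have "theta (f i) = f (Suc i)*theta (fps_to_fls Xi)"
   unfolding f_def H_def theta_def fls_deriv_fps_to_fls fps_compose_deriv[OF Xi(1)] by (simp add: fls_times_fps_to_fls mult_ac)
  thus ?thesis using tz by (simp add: ka_def field_simps)
 qed
 hence "Dalg (f 0)" by (intro chain_rule_Dalg[OF dep, of ka]) (use tz Xi in "auto simp: ka_def intro: rat.inverse_in theta_ratfun")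
 thus ?thesis by (simp add: f_def H_def)
qed

subsection \<open>The rational parametrization of the kernel curve\<close>

text \<open>The value of \<open>ta\<close> makes h and 1/h the slopes of the asymptotic directions,
  reached at s = 0 and s = infinity; \<open>(ex, ey)\<close> is the centre of the conic.\<close>

lemma conic_parametrization:
 fixes s h ex ey ta :: complex
 assumes "s~=0" "h~=0" "ta*(h^2 + 1) = h"
 defines "X == ex + s + 1/s" and "Y == ey + s/h + h/s"
 shows "ta*(X^2 + Y^2) - X*Y + (ex - 2 * ta*ey)*Y + (ey - 2 * ta*ex)*X
  + (h + 1/h - 4 * ta + ta*(ex^2 + ey^2) - ex*ey) = 0"
proof -
 define p r where "p = s + 1/s" and "r = s/h + h/s"
 have XY: "X = ex + p" "Y = ey + r" by (simp_all add: X_def Y_def p_def r_def)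
 have "ta*(X^2 + Y^2) - X*Y + (ex - 2 * ta*ey)*Y + (ey - 2 * ta*ex)*X
  + (h + 1/h - 4 * ta + ta*(ex^2 + ey^2) - ex*ey) = ta*(p^2 + r^2 - 4) - (p*r - (h + 1/h))"
  unfolding XY by (simp add: power2_eq_square algebra_simps)
 also have "p^2 + r^2 - 4 = (h^2 + 1)*(s^2/h^2 + 1/s^2)"
  using assms(1,2) by (simp add: p_def r_def power2_eq_square field_simps)
 also have "ta*((h^2 + 1)*(s^2/h^2 + 1/s^2)) = h*(s^2/h^2 + 1/s^2)"
  unfolding mult.assoc[symmetric] assms(3) ..
 also have "p*r - (h + 1/h) = h*(s^2/h^2 + 1/s^2)"
  using assms(1,2) by (simp add: p_def r_def power2_eq_square field_simps)
 finally show ?thesis by simp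
qed

text \<open>\<open>h\<close> is the root larger than 1 of a reciprocal quadratic whose coefficients
  depend on \<open>t\<close> times the geometric mean of the weights of the steps (1,-1) and (-1,1).
  The dilation factor will be \<open>h^2\<close>.\<close>

locale kernel_curve = quadrant +
 fixes h :: real
 assumes d_pos: "d (1, -1) > 0" "d (-1, 1) > 0" and d_nz: "d (1, 0) > 0 | d (0, 1) > 0 | d (1, 1) > 0"
  and h_gt1: "h > 1" and h_t: "t * sqrt (d (1, -1)*d (-1, 1)) = h/(h^2 + 1)"
begin

definition ta where "ta = h/(h^2 + 1)"
definition De where "De = 1 - 4 * ta\<^sup>2"
definition al where "al = sqrt (d (1, -1))"
definition be where "be = sqrt (d (-1, 1))"
definition u0 where "u0 = t*d (1, 0)/al"
definition v0 where "v0 = t*d (0, 1)/be"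
definition w0 where "w0 = t*d (1, 1)/(al * be)"
text \<open>\<open>L\<close> rescales both coordinates so that the conic takes the normal form of
  \<open>conic_parametrization\<close>; \<open>w_eq\<close> confirms the constant term.\<close>

definition L2 where "L2 = ta/De*(w0 + (u0 * v0 + ta*(u0^2 + v0^2))/De)"
definition L where "L = sqrt L2"
definition ex where "ex = (u0 + 2 * ta * v0)/(De*L)"
definition ey where "ey = (v0 + 2 * ta*u0)/(De*L)"

lemma ab_sqrt: "al > 0" "be > 0" "al\<^sup>2 = d (1, -1)" "be\<^sup>2 = d (-1, 1)" "t*(al * be) = ta"
 using d_pos h_t by (auto simp: al_def be_def ta_def real_sqrt_mult)

lemma h_nz [simp]: "h~=0" using h_gt1 by simp
lemma tau_pos: "ta > 0" using h_gt1 by (simp add: ta_def add_pos_pos)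
lemma tau_h: "ta*(h^2 + 1) = h" "1/ta = h + 1/h"
proof -
 have "h^2 + 1~=0" "h~=0" using h_gt1 by (auto simp: sum_power2_eq_zero_iff add_nonneg_eq_0_iff)
 thus "ta*(h^2 + 1) = h" "1/ta = h + 1/h" by (auto simp: ta_def field_simps power2_eq_square)
qed

lemma Delta: "De = ((h^2 - 1)/(h^2 + 1))\<^sup>2" "De > 0"
proof -
 have n: "h^2 + 1~=0" by (smt (verit) zero_le_power2)
 have "De = ((h\<^sup>2 + 1)^2 - 4*h^2)/(h\<^sup>2 + 1)^2"
  using n by (simp add: De_def ta_def power_divide diff_divide_distrib)
 also have "(h\<^sup>2 + 1)^2 - 4*h^2 = (h\<^sup>2 - 1)^2" by (simp add: power2_eq_square algebra_simps)
 finally show 1: "De = ((h^2 - 1)/(h^2 + 1))\<^sup>2" by (simp add: power_divide)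
 have "h^2 > 1" using h_gt1 by (simp add: one_less_power)
 hence "(h^2 - 1)/(h^2 + 1)~=0" using n by simp
 thus "De > 0" unfolding 1 by simp
qed

lemma uvw_nonneg: "u0>=0" "v0>=0" "w0>=0"
 using d_nonneg ab_sqrt t_pos by (auto simp: u0_def v0_def w0_def)

lemma L_pos: "L2 > 0" "L > 0" "L^2 = L2"
proof -
 have "u0 > 0 | v0 > 0 | w0 > 0" using d_nz ab_sqrt t_pos by (auto simp: u0_def v0_def w0_def)
 moreover have "0<=u0 * v0" "0<=ta*(u0^2 + v0^2)" using uvw_nonneg tau_pos by auto
 moreover have "0 < ta*(u0^2 + v0^2)" if "u0 > 0 | v0 > 0" using that tau_pos by (intro mult_pos_pos) (auto intro: add_pos_nonneg add_nonneg_pos)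
 ultimately have "0 < w0 + (u0 * v0 + ta*(u0^2 + v0^2))/De"
  using uvw_nonneg(3) Delta(2) by (smt (verit) divide_nonneg_pos divide_pos_pos)
 thus "L2 > 0" unfolding L2_def using tau_pos Delta(2) by simp
 thus "L > 0" "L^2 = L2" by (auto simp: L_def)
qed

lemma ex_ey: "ex - 2 * ta*ey = u0/L" "ey - 2 * ta*ex = v0/L" "ex>=0" "ey>=0"
proof -
 have "ex - 2 * ta*ey = (u0*(1 - 4 * ta\<^sup>2))/(De*L)" unfolding ex_def ey_def
  by (simp add: diff_divide_distrib[symmetric] power2_eq_square algebra_simps)
 thus "ex - 2 * ta*ey = u0/L" using Delta(2) by (simp add: De_def[symmetric])
 have "ey - 2 * ta*ex = (v0*(1 - 4 * ta\<^sup>2))/(De*L)" unfolding ex_def ey_def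
  by (simp add: diff_divide_distrib[symmetric] power2_eq_square algebra_simps)
 thus "ey - 2 * ta*ex = v0/L" using Delta(2) by (simp add: De_def[symmetric])
 show "ex>=0" "ey>=0" using uvw_nonneg tau_pos Delta(2) L_pos by (auto simp: ex_def ey_def)
qed

lemma w_eq: "w0/L2 = h + 1/h - 4 * ta + ta*(ex^2 + ey^2) - ex*ey"
proof -
 have Lz: "L~=0" "L2~=0" "De~=0" "ta~=0" using L_pos Delta tau_pos by auto
 define U V where "U = u0/L" and "V = v0/L"
 have eU: "ex = (U + 2 * ta*V)/De" "ey = (V + 2 * ta*U)/De"
  using Lz by (simp_all add: ex_def ey_def U_def V_def field_simps)
 have "ex*ey - ta*(ex^2 + ey^2) = ((U + 2 * ta*V)*(V + 2 * ta*U) - ta*((U + 2 * ta*V)^2 + (V + 2 * ta*U)^2))/De\<^sup>2"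
  unfolding eU by (simp add: power_divide power2_eq_square add_divide_distrib diff_divide_distrib algebra_simps)
 also have "(U + 2 * ta*V)*(V + 2 * ta*U) - ta*((U + 2 * ta*V)^2 + (V + 2 * ta*U)^2) = (U*V + ta*(U^2 + V^2)) * De"
  unfolding De_def by (simp add: power2_eq_square algebra_simps)
 finally have q: "ex*ey - ta*(ex^2 + ey^2) = (U*V + ta*(U^2 + V^2))/De" using Lz by (simp add: power2_eq_square)
 have "L2 * De/ta = w0 + (u0 * v0 + ta*(u0^2 + v0^2))/De" using Lz unfolding L2_def by simp
 hence "De/ta = (w0 + (u0 * v0 + ta*(u0^2 + v0^2))/De)/L2" using Lz by (simp add: field_simps)
 also have "... = w0/L2 + (U*V + ta*(U^2 + V^2))/De"
  unfolding U_def V_def L_pos(3)[symmetric] using Lz by (simp add: field_simps power2_eq_square)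
 finally have "w0/L2 = De/ta - (ex*ey - ta*(ex^2 + ey^2))" unfolding q by simp
 moreover have "De/ta = 1/ta - 4 * ta" using Lz by (simp add: De_def diff_divide_distrib power2_eq_square)
 ultimately show ?thesis using tau_h(2) by simp
qed

abbreviation "A == cr (a - 1)"
abbreviation "B == cr (b - 1)"
abbreviation "ch == cr h"
abbreviation "cx == cr ex"
abbreviation "cy == cr ey"
definition X1 where "X1 = cr (al*L)"
definition Y1 where "Y1 = cr (be*L)"

lemma X1_nz [simp]: "X1~=0" "Y1~=0" "ch~=0" using ab_sqrt L_pos h_gt1 by (auto simp: X1_def Y1_def)

lemma curve_relation:
 fixes X Y :: complex
 assumes nz: "X~=0" "Y~=0" and small: "norm (1/(X1*X))<=1" "norm (1/(Y1*Y))<=1"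
  and con: "of_real ta*(X^2 + Y^2) - X*Y + of_real (u0/L)*Y + of_real (v0/L)*X + of_real (w0/L2) = 0"
 shows "of_real (1/a + 1/b - 1)*(X*Y) + (of_real (1 - 1/a)*X - of_real ta*Y)*Y*Q (1/(X1*X)) 0
   + (of_real (1 - 1/b)*Y - of_real ta*X)*X*Q 0 (1/(Y1*Y)) = 0"
proof -
 define x y where "x = 1/(X1*X)" and "y = 1/(Y1*Y)"
 have xy: "x~=0" "y~=0" using nz by (auto simp: x_def y_def)
 define cal cbe cl ct where "cal = cr al" and "cbe = cr be" and "cl = cr L" and "ct = cr t"
 have cnz: "cal~=0" "cbe~=0" "cl~=0" "ct~=0" using ab_sqrt L_pos t_pos by (auto simp: cal_def cbe_def cl_def ct_def)
 have X1': "X1 = cal * cl" "Y1 = cbe * cl" by (simp_all add: X1_def Y1_def cal_def cbe_def cl_def)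
 have tau': "of_real ta = ct*(cal * cbe)" unfolding ab_sqrt(5)[symmetric] by (simp add: ct_def cal_def cbe_def)
 have dd: "cr (d (1, -1)) = cal^2" "cr (d (-1, 1)) = cbe^2" by (simp_all add: cal_def cbe_def ab_sqrt flip: of_real_power)
 define e10 e01 e11 where "e10 = cr (d (1, 0))" and "e01 = cr (d (0, 1))" and "e11 = cr (d (1, 1))"
 have uvw: "of_real (u0/L) = ct*e10/(cal * cl)" "of_real (v0/L) = ct*e01/(cbe * cl)" "of_real (w0/L2) = ct*e11/(cal * cbe * cl^2)"
  unfolding L_pos(3)[symmetric] by (simp_all add: u0_def v0_def w0_def ct_def e10_def e01_def e11_def cal_def cbe_def cl_def)
 have K: "x*y - ct * step_poly x y = 0"
 proof -
  have "x*y - ct * step_poly x y = - (x*y/(X*Y)) *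
   (ct*(cal * cbe)*(X^2 + Y^2) - X*Y + ct*e10/(cal * cl)*Y + ct*e01/(cbe * cl)*X + ct*e11/(cal * cbe * cl^2))"
   unfolding step_poly_def dd e10_def[symmetric] e01_def[symmetric] e11_def[symmetric] x_def y_def X1'
   using nz cnz by (simp add: field_simps power2_eq_square)
  thus ?thesis using con unfolding tau' uvw by simp
 qed
 have "0 = of_real (1/a + 1/b - 1)*(x*y)
   + (of_real (1 - 1/a)*(x*y) - of_real (t*d (1, -1))*x^2)*Q x 0
   + (of_real (1 - 1/b)*(x*y) - of_real (t*d (-1, 1))*y^2)*Q 0 y"
 proof -
  have "x*y - of_real t * step_poly x y = 0" using K by (simp only: ct_def)
  moreover have "norm x<=1" "norm y<=1" using small by (simp_all only: x_def y_def)
  ultimately show ?thesis using functional_equation[of x y] by (simp only: mult_zero_left)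
 qed
 also have "cr (t*d (1, -1)) = ct * cal^2" by (simp add: ct_def dd)
 also have "cr (t*d (-1, 1)) = ct * cbe^2" by (simp add: ct_def dd)
 finally have "0 = of_real (1/a + 1/b - 1)*(x*y) + (of_real (1 - 1/a)*(x*y) - ct * cal^2*x^2)*Q x 0
   + (of_real (1 - 1/b)*(x*y) - ct * cbe^2*y^2)*Q 0 y" .
 hence "0 = (X*Y)*(X*Y*(cal * cl)*(cbe * cl))*(of_real (1/a + 1/b - 1)*(x*y) + (of_real (1 - 1/a)*(x*y) - ct * cal^2*x^2)*Q x 0
   + (of_real (1 - 1/b)*(x*y) - ct * cbe^2*y^2)*Q 0 y)" by simp
 also have "... = (X*Y)*(of_real (1/a + 1/b - 1) + (of_real (1 - 1/a) - ct*(cal * cbe)*Y/X)*Q x 0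
   + (of_real (1 - 1/b) - ct*(cal * cbe)*X/Y)*Q 0 y)"
 proof -
  have s: "X*Y*(cal * cl)*(cbe * cl)*(x*y) = 1" "X*Y*(cal * cl)*(cbe * cl)*(ct * cal^2*x^2) = ct*(cal * cbe)*Y/X"
   "X*Y*(cal * cl)*(cbe * cl)*(ct * cbe^2*y^2) = ct*(cal * cbe)*X/Y"
   using nz cnz by (simp_all add: x_def y_def X1' power2_eq_square field_simps)
  define N where "N = X*Y*(cal * cl)*(cbe * cl)"
  have "N*(of_real (1/a + 1/b - 1)*(x*y) + (of_real (1 - 1/a)*(x*y) - ct * cal^2*x^2)*Q x 0
   + (of_real (1 - 1/b)*(x*y) - ct * cbe^2*y^2)*Q 0 y) = of_real (1/a + 1/b - 1)*(N*(x*y))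
   + (of_real (1 - 1/a)*(N*(x*y)) - N*(ct * cal^2*x^2))*Q x 0
   + (of_real (1 - 1/b)*(N*(x*y)) - N*(ct * cbe^2*y^2))*Q 0 y" by (simp only: algebra_simps)
  thus ?thesis unfolding mult.assoc[of "X*Y" _ "of_real (1/a + 1/b - 1)*(x*y) + _ + _"] N_def[symmetric] unfolding s[folded N_def] by simp
 qed
 also have "... = of_real (1/a + 1/b - 1)*(X*Y) + (of_real (1 - 1/a)*X - of_real ta*Y)*Y*Q x 0
   + (of_real (1 - 1/b)*Y - of_real ta*X)*X*Q 0 y"
  unfolding tau' using nz by (simp add: divide_simps) (simp add: algebra_simps)
 finally show ?thesis unfolding x_def y_def ..
qed

definition DX where "DX = [:1,cx,1:]"
definition DY where "DY = [:ch\<^sup>2,ch * cy,1:]"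
definition DY' where "DY' = [:1,ch * cy,ch\<^sup>2:]"
definition xi where "xi s = s/(X1*poly DX s)"
definition et where "et s = ch * s/(Y1*poly DY s)"

lemma nA_DX: "nA A cx cy ch = smult (A*(ch^2 + 1)) DX - smult (A + 1) DY"
 "nA' A cx cy ch = smult (A*(ch^2 + 1)) DX - smult (A + 1) DY'"
 "nB B cx cy ch = smult (B*(ch^2 + 1)) DY - smult ((B + 1) * ch^2) DX"
 "nB' B cx cy ch = smult (B*(ch^2 + 1)) DY' - smult ((B + 1) * ch^2) DX"
 by (simp_all add: nA_def nA'_def nB_def nB'_def DX_def DY_def DY'_def algebra_simps power2_eq_square)

text \<open>The two choices of \<open>z\<close> are the two points of the curve over the same x.
  \<open>E\<close> equals \<open>ch\<close> times s times Y, which lets one formula serve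
  both.\<close>

lemma relation_at:
 assumes s: "s~=0" and nz: "poly DX s~=0" "poly DY z~=0" and z: "z = s | z = ch^2 * s" and small: "norm (xi s)<=1" "norm (et z)<=1"
 defines "E == poly DY z * s/z"
 shows "(1 - A*B)*(ch^2 + 1)*(poly DX s*E) + of_real b*(A*(ch^2 + 1)*poly DX s - (A + 1)*E)*E*Q (xi s) 0
  + of_real a*(B*(ch^2 + 1)*E - (B + 1) * ch^2*poly DX s)*poly DX s*Q 0 (et z) = 0"
proof -
 have zz: "z~=0" using s z by auto
 define X Y where "X = cx + s + 1/s" and "Y = cy + z / ch + ch/z"
 have X: "X = poly DX s/s" using s by (simp add: X_def DX_def field_simps power2_eq_square)
 have Y: "Y = poly DY z/(ch*z)" using zz by (simp add: Y_def DY_def field_simps power2_eq_square)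
 have Y': "Y = E/(ch * s)" using zz s by (simp add: Y E_def)
 have xx: "1/(X1*X) = xi s" "1/(Y1*Y) = et z" using s zz nz by (simp_all add: X Y xi_def et_def)
 have XY: "X~=0" "Y~=0" using nz s zz by (simp_all add: X Y)
 have th: "cr ta*(ch^2 + 1) = ch" by (metis of_real_1 of_real_add of_real_mult of_real_power tau_h(1))
 have Ys: "Y = cy + s / ch + ch/s | Y = cy + (1/s) / ch + ch/(1/s)" using z s by (auto simp: Y_def field_simps power2_eq_square)
 have Xs: "X = cx + 1/s + 1/(1/s)" by (simp add: X_def)
 have "cr ta*(X^2 + Y^2) - X*Y + (cx - 2 * of_real ta * cy)*Y + (cy - 2 * of_real ta * cx)*X
  + (ch + 1 / ch - 4 * of_real ta + of_real ta*(cx^2 + cy^2) - cx * cy) = 0"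
  using Ys
 proof
  assume Y1: "Y = cy + s / ch + ch/s"
  show ?thesis unfolding Y1 X_def by (rule conic_parametrization[OF s _ th]) simp
 next
  assume Y2: "Y = cy + (1/s) / ch + ch/(1/s)"
  show ?thesis unfolding Y2 Xs by (rule conic_parametrization[OF _ _ th]) (use s in simp_all)
 qed
 moreover have "cx - 2 * of_real ta * cy = of_real (u0/L)" "cy - 2 * of_real ta * cx = of_real (v0/L)"
  "ch + 1 / ch - 4 * of_real ta + of_real ta*(cx^2 + cy^2) - cx * cy = of_real (w0/L2)"
  unfolding ex_ey(1,2)[symmetric] w_eq by simp_all
 ultimately have con: "of_real ta*(X^2 + Y^2) - X*Y + of_real (u0/L)*Y + of_real (v0/L)*X + of_real (w0/L2) = 0" by simp
 define F G where "F = Q (xi s) 0" and "G = Q 0 (et z)"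
 have R: "of_real (1/a + 1/b - 1)*(X*Y) + (of_real (1 - 1/a)*X - of_real ta*Y)*Y*F + (of_real (1 - 1/b)*Y - of_real ta*X)*X*G = 0"
  using curve_relation[OF XY _ _ con] small unfolding xx F_def G_def by simp
 define T where "T = cr ta"
 define P where "P = ch^2 + 1"
 have TP: "T*P = ch" using th by (simp add: T_def P_def)
 define ca cb where "ca = cr a" and "cb = cr b"
 have ab: "ca~=0" "cb~=0" using ab_pos by (auto simp: ca_def cb_def)
 have AB: "A = ca - 1" "B = cb - 1" by (simp_all add: ca_def cb_def)
 have c1: "ca * cb * of_real (1/a + 1/b - 1) = 1 - A*B" "ca * of_real (1 - 1/a) = A" "cb * of_real (1 - 1/b) = B"
  using ab unfolding AB by (simp_all add: ca_def cb_def field_simps)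
 define x where "x = poly DX s"
 have Xx: "X = x/s" and Yx: "Y = E/(ch * s)" by (simp_all add: X x_def Y')
 have "0 = (ca * cb*P*(ch * s * s))*(of_real (1/a + 1/b - 1)*(X*Y) + (of_real (1 - 1/a)*X - T*Y)*Y*F + (of_real (1 - 1/b)*Y - T*X)*X*G)"
  using R by (simp add: T_def)
 also have "... = (ca * cb * of_real (1/a + 1/b - 1))*P*(ch * s * s*(X*Y)) + cb*((ca * of_real (1 - 1/a))*P*(s*X) - ca*(T*P)*(s*Y))*(ch * s*Y)*F
   + ca*((cb * of_real (1 - 1/b))*P*(ch * s*Y) - cb*(T*P) * ch*(s*X))*(s*X)*G" by (simp add: algebra_simps)
 also have "... = (1 - A*B)*P*(x*E) + cb*(A*P*x - ca*E)*E*F + ca*(B*P*E - cb * ch^2*x)*x*G"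
 proof -
  have "s*X = x" "ch * s*Y = E" "ch * s * s*(X*Y) = x*E" "ch*(s*Y) = E" using s by (simp_all add: Xx Yx)
  thus ?thesis unfolding c1 TP by (simp add: power2_eq_square mult.assoc)
 qed
 finally show ?thesis unfolding x_def[symmetric] P_def[symmetric] F_def[symmetric] G_def[symmetric] ca_def[symmetric] cb_def[symmetric] AB by simp
qed

end

lemma has_fps_expansion_poly: "poly p has_fps_expansion fps_of_poly p" for p :: "complex poly"
proof (induction p)
 case 0
 have "poly (0 :: complex poly) = (%_. 0)" by auto
 thus ?case by (simp only: fps_of_poly_0) (intro fps_expansion_intros)
next
 case (pCons c p)
 have "(%x. c + x*poly p x) has_fps_expansion fps_const c + fps_X*fps_of_poly p"
  by (intro fps_expansion_intros pCons)
 moreover have "poly (pCons c p) = (%x. c + x*poly p x)" by auto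
 ultimately show ?case by (simp add: fps_of_poly_pCons mult.commute)
qed

lemma isCont_eventually:
 fixes f :: "complex => complex"
 assumes "isCont f 0" "open S" "f 0 : S" shows "eventually (%s. f s : S) (nhds 0)"
 using assms unfolding continuous_at_open eventually_nhds by blast

lemma cancel_fraction: "X~=0 ==> D~=0 ==> g = D/X*(X*g/D) + 0" for g :: "'a :: field"
 by simp

lemma solve_linear:
 fixes f :: "'a :: field"
 assumes "c + u*f + v * g = 0" "u~=0" shows "f = - (v/u)*g + - (c/u)"
proof -
 have "u*f = (c + u*f + v * g) - c - v * g" by simp
 also have "... = - (v * g) - c" unfolding assms(1) by simp
 finally have "f = (-(v * g) - c)/u" using assms(2) by (simp add: eq_divide_eq mult.commute)
 thus ?thesis by (simp add: diff_divide_distrib)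
qed

lemma toR_divide_X: "toR p/fls_X : ratfun" "toR p/fls_X = 0 \<longleftrightarrow> p = 0"
proof -
 show "toR p/fls_X : ratfun" by (intro rat.divide_in ratfun_toR ratfun_X)
 have "fls_X~=(0 :: complex fls)" by simp
 thus "toR p/fls_X = 0 \<longleftrightarrow> p = 0" by (simp only: divide_eq_0_iff toR_eq_0_iff) simp
qed

section \<open>The q-difference equation of the boundary series\<close>

context kernel_curve
begin

sublocale qd: qdil "ch^2"
proof
 have "1 < h\<^sup>2" using h_gt1 by (simp add: one_less_power)
 thus "norm (ch^2) > 1" by (simp add: norm_power)
qed

definition Ph where "Ph = fps_expansion (%x. Q x 0) 0"
definition Ps where "Ps = fps_expansion (%y. Q 0 y) 0"
definition Xi where "Xi = fps_X*inverse (fps_of_poly (smult X1 DX))"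
definition H where "H = fps_const ch*fps_X*inverse (fps_of_poly (smult Y1 DY))"
definition Fs where "Fs = fps_to_fls (fps_compose Ph Xi)"
definition Gs where "Gs = fps_to_fls (fps_compose Ps H)"

lemma Ph: "(%x. Q x 0) has_fps_expansion Ph" and Ps: "(%y. Q 0 y) has_fps_expansion Ps"
 unfolding Ph_def Ps_def
 by (rule has_fps_expansion_fps_expansion[of "ball 0 1"]; use Q_holomorphic_x Q_holomorphic_y in simp)+

lemma xi_expansion: "xi has_fps_expansion Xi" and et_expansion: "et has_fps_expansion H"
proof -
 have "(%s. s*inverse (poly (smult X1 DX) s)) has_fps_expansion Xi"
  unfolding Xi_def by (intro fps_expansion_intros has_fps_expansion_poly) (simp add: fps_of_poly_nth DX_def)
 thus "xi has_fps_expansion Xi" unfolding xi_def by (simp add: divide_inverse)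
 have "(%s. ch * s*inverse (poly (smult Y1 DY) s)) has_fps_expansion H"
  unfolding H_def by (intro fps_expansion_intros has_fps_expansion_poly) (simp add: fps_of_poly_nth DY_def)
 thus "et has_fps_expansion H" unfolding et_def by (simp add: divide_inverse)
qed

lemma Xi_props: "fps_nth Xi 0 = 0" "fps_nth Xi 1~=0" "fps_to_fls Xi*toR (smult X1 DX) = fls_X" "fps_to_fls Xi : ratfun"
proof -
 have nz: "fps_nth (fps_of_poly (smult X1 DX)) 0~=0" by (simp add: DX_def)
 show "fps_nth Xi 0 = 0" by (simp add: Xi_def)
 show "fps_nth Xi 1~=0" using nz by (simp add: Xi_def fps_X_mult_nth)
 have "Xi*fps_of_poly (smult X1 DX) = fps_X" unfolding Xi_def mult.assoc inverse_mult_eq_1[OF nz] by simp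
 hence "fps_to_fls (Xi*fps_of_poly (smult X1 DX)) = fls_X" by simp
 thus e: "fps_to_fls Xi*toR (smult X1 DX) = fls_X" by (simp only: fls_times_fps_to_fls toR_def)
 show "fps_to_fls Xi : ratfun" by (rule ratfunI[of "smult X1 DX" _ "[:0,1:]"]) (use e in "simp_all add: DX_def toR_pCons")
qed

lemma H_props: "fps_nth H 0 = 0" "fps_nth H 1~=0" "fps_to_fls H*toR (smult Y1 DY) = fls_const ch*fls_X" "fps_to_fls H : ratfun"
proof -
 have nz: "fps_nth (fps_of_poly (smult Y1 DY)) 0~=0" by (simp add: DY_def)
 show "fps_nth H 0 = 0" by (simp add: H_def)
 show "fps_nth H 1~=0" using nz by (simp add: H_def mult.assoc fps_X_mult_nth)
 have "H*fps_of_poly (smult Y1 DY) = fps_const ch*fps_X" unfolding H_def mult.assoc inverse_mult_eq_1[OF nz] by simp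
 hence "fps_to_fls (H*fps_of_poly (smult Y1 DY)) = fps_to_fls (fps_const ch*fps_X)" by simp
 thus e: "fps_to_fls H*toR (smult Y1 DY) = fls_const ch*fls_X" by (simp only: fls_times_fps_to_fls toR_def fps_const_to_fls fps_X_to_fls)
 show "fps_to_fls H : ratfun" by (rule ratfunI[of "smult Y1 DY" _ "[:0,ch:]"]) (use e in "simp_all add: DY_def toR_pCons mult.commute")
qed

lemma F_expansion: "(%s. Q (xi s) 0) has_fps_expansion fps_compose Ph Xi"
 and G_expansion: "(%s. Q 0 (et s)) has_fps_expansion fps_compose Ps H"
 using has_fps_expansion_compose[OF Ph xi_expansion Xi_props(1)] has_fps_expansion_compose[OF Ps et_expansion H_props(1)]
 by (simp_all add: o_def)

lemma xiet_0: "xi 0 = 0" "et 0 = 0" by (simp_all add: xi_def et_def)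

lemma DX_DY_0: "poly DX 0 = 1" "poly DY 0 = ch^2" by (simp_all add: DX_def DY_def)

lemma eventually_small:
 "eventually (%s. poly DX s~=0 & poly DY s~=0 & poly DY (ch^2 * s)~=0 &
   norm (xi s)<=1 & norm (et s)<=1 & norm (et (ch^2 * s))<=1) (nhds 0)"
proof -
 have c: "isCont (%s. ch\<^sup>2 * s) 0" by (intro continuous_intros)
 have cx: "isCont xi 0" unfolding xi_def using DX_DY_0 by (intro continuous_intros) auto
 have cy: "isCont et (ch^2*0)" "isCont et 0" unfolding et_def using DX_DY_0 by (auto intro!: continuous_intros)
 have 1: "eventually (%s. poly DX s : - {0}) (nhds 0)" by (rule isCont_eventually) (use DX_DY_0 in auto)
 have 2: "eventually (%s. poly DY s : - {0}) (nhds 0)" by (rule isCont_eventually) (use DX_DY_0 in auto)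
 have 3: "eventually (%s. poly DY (ch^2 * s) : - {0}) (nhds 0)"
  by (rule isCont_eventually) (use DX_DY_0 in "auto intro!: continuous_intros")
 have 4: "eventually (%s. xi s : ball 0 1) (nhds 0)" by (rule isCont_eventually) (use cx xiet_0 in auto)
 have 5: "eventually (%s. et s : ball 0 1) (nhds 0)" by (rule isCont_eventually) (use cy xiet_0 in auto)
 have 6: "eventually (%s. et (ch^2 * s) : ball 0 1) (nhds 0)"
  by (rule isCont_eventually) (use isCont_o2[OF c cy(1)] xiet_0 in auto)
 from 1 2 3 4 5 6 show ?thesis by eventually_elim auto
qed

definition Cst where "Cst = (1 - A*B)*(ch^2 + 1)"

lemma DY_dil: "poly DY (ch^2 * s) = ch^2*poly DY' s" "qd.dil (toR DY) = fls_const (ch^2)*toR DY'"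
proof -
 show "poly DY (ch^2 * s) = ch^2*poly DY' s" by (simp add: DY_def DY'_def algebra_simps power2_eq_square)
 show "qd.dil (toR DY) = fls_const (ch^2)*toR DY'"
  unfolding qd.dil_toR toR_smult[symmetric] by (simp add: DY_def DY'_def pcompose_pCons algebra_simps power2_eq_square)
qed

text \<open>After this normalisation of Q(x,0), and that of Q(0,y) in \<open>gh\<close>, only the
  quadratics remain as coefficients of the relations.\<close>

definition fh where "fh = fls_X*Fs/toR DX"
definition gh where "gh = fls_X*Gs/toR DY"

lemma D_nz: "toR DX~=0" "toR DY~=0" "toR DY'~=0"
 by (simp_all add: DX_def DY_def DY'_def)

lemma dil_gh: "qd.dil gh = fls_X*qd.dil Gs/toR DY'"
proof -
 have "fls_const (ch^2)~=0" by simp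
 thus ?thesis unfolding gh_def using D_nz by (simp add: qd.sig_divide qd.sig_mult DY_dil(2) del: fls_const_nonzero)
qed

text \<open>The identity is checked for convergent functions near 0, by \<open>relation_at\<close>
  away from 0 and by Q(0,0) = 1 at 0 itself, and then carried over to expansions.\<close>

lemma curve_expansion:
 assumes c: "c = 1 | c = ch^2" and D: "!!s. poly DY (c * s) = c*poly D s" "toR D~=0"
  and G: "(%s. Q 0 (et (c * s))) has_fps_expansion G"
  and n: "n = smult (A*(ch^2 + 1)) DX - smult (A + 1) D" "m = smult (B*(ch^2 + 1)) D - smult ((B + 1) * ch^2) DX"
 shows "fls_const Cst*fls_X + fls_const (of_real b)*toR n*fh + fls_const (of_real a)*toR m*(fls_X*fps_to_fls G/toR D) = 0"
proof -
 define T where "T s = Cst*(poly DX s*poly D s) + of_real b*poly n s*poly D s*Q (xi s) 0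
  + of_real a*poly m s*poly DX s*Q 0 (et (c * s))" for s
 define P where "P = fps_const Cst*(fps_of_poly DX*fps_of_poly D) + fps_const (of_real b)*fps_of_poly n*fps_of_poly D*fps_compose Ph Xi
  + fps_const (of_real a)*fps_of_poly m*fps_of_poly DX*G"
 have "T has_fps_expansion P" unfolding T_def P_def
  by (intro has_fps_expansion_add has_fps_expansion_mult has_fps_expansion_const has_fps_expansion_poly F_expansion G)
 moreover have "T has_fps_expansion 0" unfolding has_fps_expansion_0_iff
  using eventually_small
 proof eventually_elim
  case (elim s)
  show ?case
  proof (cases "s = 0")
   case False
   have E: "poly DY (c * s) * s/(c * s) = poly D s" using False c by (auto simp: D)
   show ?thesis unfolding T_def Cst_def n poly_diff poly_smult
    by (rule relation_at[of s "c * s", unfolded E]) (use elim False c in auto)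
  next
   case True
   have "poly D 0 = 1 | poly D 0 = ch^2" using D(1)[of 0] DX_DY_0 c by auto
   thus ?thesis unfolding True T_def Cst_def n poly_diff poly_smult mult_zero_right xiet_0 Q_0_0 DX_DY_0
    by (auto simp: algebra_simps power2_eq_square)
  qed
 qed
 ultimately have "P = 0" by (rule fps_expansion_unique_complex)
 hence "fps_to_fls P = 0" by simp
 hence "fls_const Cst*(toR DX*toR D) + fls_const (of_real b)*toR n*toR D*Fs + fls_const (of_real a)*toR m*toR DX*fps_to_fls G = 0"
  unfolding P_def Fs_def toR_def by (simp only: fps_to_fls_plus fls_times_fps_to_fls fps_const_to_fls)
 moreover have "fls_const Cst*fls_X + fls_const (of_real b)*toR n*fh + fls_const (of_real a)*toR m*(fls_X*fps_to_fls G/toR D)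
  = fls_X/(toR DX*toR D)*(fls_const Cst*(toR DX*toR D) + fls_const (of_real b)*toR n*toR D*Fs
  + fls_const (of_real a)*toR m*toR DX*fps_to_fls G)"
  unfolding fh_def using D_nz D(2) by (simp add: divide_simps) (simp add: algebra_simps)
 ultimately show ?thesis by simp
qed

lemma E1': "fls_const Cst*fls_X + fls_const (of_real b)*toR (nA A cx cy ch)*fh + fls_const (of_real a)*toR (nB B cx cy ch)*gh = 0"
 unfolding gh_def Gs_def by (rule curve_expansion[of 1, OF _ _ _ _ nA_DX(1,3)]) (use G_expansion D_nz in auto)

lemma E2': "fls_const Cst*fls_X + fls_const (of_real b)*toR (nA' A cx cy ch)*fh + fls_const (of_real a)*toR (nB' B cx cy ch)*qd.dil gh = 0"
proof -
 have "(%s. ch\<^sup>2 * s) has_fps_expansion (fps_const (ch^2)*fps_X)" by (intro fps_expansion_intros)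
 hence "(%s. Q 0 (et (ch^2 * s))) has_fps_expansion fps_compose (fps_compose Ps H) (fps_const (ch^2)*fps_X)"
  using has_fps_expansion_compose[OF G_expansion, of "%s. ch\<^sup>2 * s"] by (simp add: o_def)
 moreover have "qd.dil Gs = fps_to_fls (fps_compose (fps_compose Ps H) (fps_const (ch^2)*fps_X))" unfolding Gs_def qd.dil_def by simp
 ultimately show ?thesis unfolding dil_gh by (simp only:) (rule curve_expansion[of "ch^2", OF _ _ D_nz(3) _ nA_DX(2,4)], auto simp: DY_dil)
qed

theorem kernel_equation: "qd.kernel_eq A B cx cy ch (Cst / of_real a) gh"
proof -
 define p p' r r' where "p = toR (nA A cx cy ch)" and "p' = toR (nA' A cx cy ch)" and "r = toR (nB B cx cy ch)" and "r' = toR (nB' B cx cy ch)"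
 define ca cb k where "ca = fls_const (cr a)" and "cb = fls_const (cr b)" and "k = fls_const Cst"
 have ca: "ca~=0" using ab_pos by (simp add: ca_def)
 have k: "k = ca*fls_const (Cst / of_real a)" using ab_pos by (simp add: k_def ca_def)
 have e1: "k*fls_X + cb*p*fh + ca*r*gh = 0" using E1' by (simp only: k_def cb_def ca_def p_def r_def)
 have e2: "k*fls_X + cb*p'*fh + ca*r'*qd.dil gh = 0" using E2' by (simp only: k_def cb_def ca_def p'_def r'_def)
 \<comment> \<open>Elimination of \<open>fh\<close>, the series of Q(x,0), between the two
   relations.\<close>
 have "p'*(k*fls_X + cb*p*fh + ca*r*gh) - p*(k*fls_X + cb*p'*fh + ca*r'*qd.dil gh) = 0" unfolding e1 e2 by simp
 hence "ca*(p*r'*qd.dil gh) = ca*(p'*r*gh) + k*fls_X*(p' - p)" by (simp add: algebra_simps)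
 hence "ca*(p*r'*qd.dil gh) = ca*(p'*r*gh + fls_const (Cst / of_real a)*fls_X*(p' - p))" unfolding k by (simp only: algebra_simps)
 hence "p*r'*qd.dil gh = p'*r*gh + fls_const (Cst / of_real a)*fls_X*(p' - p)" using ca by (simp only: mult_cancel_left simp_thms)
 thus ?thesis unfolding qd.kernel_eq_def toR_mult toR_diff p_def p'_def r_def r'_def .
qed

lemma Fs_Gs_0: "fls_nth Fs 0 = 1" "fls_nth Gs 0 = 1"
proof -
 have "fps_nth Ph 0 = 1" "fps_nth Ps 0 = 1"
  using has_fps_expansion_imp_0_eq_fps_nth_0[OF Ph] has_fps_expansion_imp_0_eq_fps_nth_0[OF Ps] Q_0_0 by simp_all
 thus "fls_nth Fs 0 = 1" "fls_nth Gs 0 = 1" by (simp_all add: Fs_def Gs_def)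
qed

lemma gh_nz: "gh~=0"
proof -
 have "Gs~=0" using Fs_Gs_0 by auto
 thus ?thesis using D_nz by (simp add: gh_def)
qed

text \<open>Both extreme coefficients could vanish together only if \<open>ch^2\<close> had square
  1.\<close>

lemma n_nz: "nA A cx cy ch~=0" "nB B cx cy ch~=0" "nA' A cx cy ch~=0" "nB' B cx cy ch~=0"
proof -
 have q: "ch^2 * ch^2~=1"
 proof -
  have "1 < norm (ch^2)*norm (ch^2)" using qd.q_gt1 by (rule less_1_mult) (rule qd.q_gt1)
  thus ?thesis by (metis less_irrefl norm_mult norm_one)
 qed
 have z: "~ (z - ch\<^sup>2 = 0 & z * ch^2 - 1 = 0)" for z using q by auto
 show "nA A cx cy ch~=0" "nA' A cx cy ch~=0" using z[of A] unfolding nA_def nA'_def pCons_eq_0_iff by blast+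
 show "nB B cx cy ch~=0" "nB' B cx cy ch~=0" using z[of B] unfolding nB_def nB'_def pCons_eq_0_iff mult_eq_0_iff by auto
qed

lemma Gs_Dalg: "Dalg Gs ==> Dalg gh"
proof (rule Dalg_affine[of Gs "toR DY/fls_X" gh 0])
 show "Gs = toR DY/fls_X*gh + 0" unfolding gh_def by (rule cancel_fraction) (use D_nz in simp_all)
qed (use D_nz in "simp_all only: toR_divide_X rat.zero_in toR_eq_0_iff not_False_eq_True")

lemma Fs_Dalg: "Dalg Fs ==> Dalg gh"
proof -
 define p r where "p = toR (nA A cx cy ch)" and "r = toR (nB B cx cy ch)"
 define ca cb k w where "ca = fls_const (cr a)" and "cb = fls_const (cr b)" and "k = fls_const Cst"
  and "w = toR DX/fls_X"
 have nz: "ca~=0" "cb~=0" "p~=0" "r~=0" using ab_pos n_nz by (simp_all add: ca_def cb_def p_def r_def)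
 have w: "w : ratfun" "w~=0" unfolding w_def using D_nz by (simp_all only: toR_divide_X toR_eq_0_iff not_False_eq_True)
 have rt: "ca : ratfun" "cb : ratfun" "k : ratfun" "p : ratfun" "r : ratfun" "fls_X : ratfun"
  by (auto simp: ca_def cb_def k_def p_def r_def intro: ratfun_const ratfun_toR ratfun_X)
 have e1: "k*fls_X + cb*p*fh + ca*r*gh = 0" using E1' by (simp only: k_def cb_def ca_def p_def r_def)
 have F: "Fs = w*fh + 0" unfolding fh_def w_def by (rule cancel_fraction) (use D_nz in simp_all)
 have "fh = - (ca*r/(cb*p))*gh + - (k*fls_X/(cb*p))"
  by (rule solve_linear[OF e1]) (use nz in simp)
 hence e: "Fs = (w*- (ca*r/(cb*p)))*gh + w*- (k*fls_X/(cb*p))"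
  unfolding F by (simp only: distrib_left mult.assoc add_0_right)
 assume DF: "Dalg Fs"
 show "Dalg gh"
  by (rule Dalg_affine[OF DF e]) (use nz w rt in "auto intro!: rat.mult_in rat.divide_in rat.uminus_in")
qed

theorem D_algebraic_imp_Dalg:
 assumes "x_D_algebraic Q | y_D_algebraic Q" shows "Dalg gh"
 using assms
proof
 assume "x_D_algebraic Q"
 then obtain P :: "complex mp" and r where P: "P~=0" "r > 0" and rel: "!!x y. norm x < r ==> norm y < r ==>
   mpeval P (%i. if i = 0 then x else if i = 1 then y else (deriv ^^ (i - 2)) (%u. Q u y) x) = 0"
  unfolding x_D_algebraic_def by blast
 have "Dalg Fs" unfolding Fs_def
  by (rule ADE_imp_Dalg[OF P(1) _ _ _ P(2) rel _ _ Ph Xi_props(1,2,4)]) (use Q_holomorphic_x Q_lipschitz(1) in auto)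
 thus ?thesis by (rule Fs_Dalg)
next
 assume "y_D_algebraic Q"
 then obtain P :: "complex mp" and r where P: "P~=0" "r > 0" and rel: "!!x y. norm x < r ==> norm y < r ==>
   mpeval P (%i. if i = 0 then x else if i = 1 then y else (deriv ^^ (i - 2)) (%u. Q x u) y) = 0"
  unfolding y_D_algebraic_def by blast
 have rel': "mpeval P (%i. if i = 1 then x else if i = 0 then y else (deriv ^^ (i - 2)) (%u. Q y u) x) = 0"
  if "norm x < r" "norm y < r" for x y
 proof -
  have "(%i. if i = 1 then x else if i = 0 then y else (deriv ^^ (i - 2)) (%u. Q y u) x) =
   (%i. if i = 0 then y else if i = 1 then x else (deriv ^^ (i - 2)) (%u. Q y u) x)" by (auto simp: fun_eq_iff)
  thus ?thesis using rel[OF that(2,1)] by simp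
 qed
 have "Dalg Gs" unfolding Gs_def
  by (rule ADE_imp_Dalg[where F = "%u v. Q v u", OF P(1) _ _ _ P(2) rel' _ _ Ps H_props(1,2,4)]) (use Q_holomorphic_y Q_lipschitz(2) in auto)
 thus ?thesis by (rule Gs_Dalg)
qed

end

subsection \<open>Small \<open>t\<close>\<close>

lemma mobius_bounds:
 fixes A :: complex
 assumes "A~=0"
 shows "EX R>=1. EX H>0. ALL q. norm q > H --> 1/R<=norm ((A - q)/(A*q - 1)) & norm ((A - q)/(A*q - 1))<=R"
proof (rule ex_bound_threshold[of "max 1 (max (4*norm A) (4/norm A))" "2*norm A + 2/norm A + 1"]; (intro allI impI)?)
 have A: "norm A > 0" using assms by simp
 have "0<=2/norm A" by simp
 thus "0 < 2*norm A + 2/norm A + 1" using A by linarith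
 fix q :: complex assume q: "norm q > 2*norm A + 2/norm A + 1"
 have q1: "norm q > 2*norm A" "norm q > 2/norm A" using q A `0<=2/norm A` by linarith+
 have qp: "norm q > 0" using q1 A by linarith
 have a: "norm (A - q)<=2*norm q" "norm q<=2*norm (A - q)"
  using norm_triangle_ineq4[of A q] norm_triangle_ineq2[of q A] norm_minus_commute[of q A] q1 by linarith+
 have Aq: "norm (A*q) = norm A*norm q" by (rule norm_mult)
 have "2 < norm A*norm q" using q1(2) A by (simp add: pos_divide_less_eq mult.commute)
 hence b: "norm (A*q - 1)<=2*(norm A*norm q)" "norm A*norm q<=2*norm (A*q - 1)"
  using norm_triangle_ineq4[of "A*q" 1] norm_triangle_ineq2[of "A*q" 1] Aq norm_one[where 'a = complex] by linarith+
 have dp: "norm (A*q - 1) > 0" using b(2) A qp by (smt (verit) mult_pos_pos)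
 define R where "R = max 1 (max (4*norm A) (4/norm A))"
 have R: "R>=4*norm A" "R>=4/norm A" "R > 0" by (auto simp: R_def)
 have "norm (A - q)<=R*norm (A*q - 1)"
 proof -
  have "norm (A - q)<=2*norm q" by (rule a)
  also have "... = (4/norm A)*(norm A*norm q/2)" using A by (simp add: field_simps)
  also have "...<=R*norm (A*q - 1)" using R b(2) A qp less_imp_le[OF R(3)] by (intro mult_mono; force)
  finally show ?thesis .
 qed
 moreover have "norm (A*q - 1)<=R*norm (A - q)"
 proof -
  have "norm (A*q - 1)<=(4*norm A)*(norm q/2)" using b(1) by simp
  also have "...<=R*norm (A - q)" using R a(2) A qp less_imp_le[OF R(3)] by (intro mult_mono; force)
  finally show ?thesis .
 qed
 ultimately show "1/max 1 (max (4*norm A) (4/norm A))<=norm ((A - q)/(A*q - 1)) &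
  norm ((A - q)/(A*q - 1))<=max 1 (max (4*norm A) (4/norm A))"
  unfolding R_def[symmetric] norm_divide using dp R by (simp add: divide_simps mult.commute)
qed auto

lemma ex_kernel_curve:
 assumes "!!v. 0<=d v" "a > 0" "b > 0" "d (1, -1) > 0" "d (-1, 1) > 0" "d (1, 0) > 0 | d (0, 1) > 0 | d (1, 1) > 0"
 shows "EX ep>0. ALL t. 0 < t & t < ep --> (EX h>H0. kernel_curve d a b t h)"
proof -
 define C where "C = (SUM v:S5. d v)*((1 + a)*(1 + b))"
 define ka where "ka = sqrt (d (1, -1)*d (-1, 1))"
 have C: "C>=0" unfolding C_def using assms(1-3) by (intro mult_nonneg_nonneg sum_nonneg) auto
 have ka: "ka > 0" using assms by (simp add: ka_def)
 \<comment> \<open>The first bound ensures convergence; the second makes \<open>1/(2 * ta)\<close>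
   exceed the absolute value of \<open>H0\<close> by more than 2.\<close>
 define ep where "ep = min (1/(2*(C + 1))) (1/(2 * ka*(\<bar>H0\<bar> + 2)))"
 have "ep > 0" using C ka by (simp add: ep_def)
 moreover have "EX h>H0. kernel_curve d a b t h" if t: "0 < t" "t < ep" for t
 proof -
  define ta where "ta = t * ka"
  have ta: "ta > 0" using t ka by (simp add: ta_def)
  have "t < 1/(2 * ka*(\<bar>H0\<bar> + 2))" using t by (simp add: ep_def)
  hence "t*(2 * ka*(\<bar>H0\<bar> + 2)) < 1" using ka by (subst (asm) pos_less_divide_eq) auto
  hence h1: "2 * ta*(\<bar>H0\<bar> + 2) < 1" by (simp add: ta_def mult_ac)
  moreover have "2 * ta*2<=2 * ta*(\<bar>H0\<bar> + 2)" using ta by (intro mult_left_mono) auto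
  ultimately have ta2: "2 * ta*2 < 1" by linarith
  have D: "1 - 4 * ta\<^sup>2>=0" using ta2 ta power2_le_iff_abs_le[of "1/2" ta] by (simp add: power2_eq_square)
  define D where "D = sqrt (1 - 4 * ta\<^sup>2)"
  have DD: "D*D = 1 - 4 * ta\<^sup>2" "D>=0" using D by (auto simp: D_def)
  \<comment> \<open>The larger root of ta (h^2 + 1) = h, which is at least \<open>1/(2 * ta)\<close>
    and so exceeds any prescribed bound for small \<open>t\<close>.\<close>
  define h where "h = (1 + D)/(2 * ta)"
  have hb: "h>=1/(2 * ta)" unfolding h_def using DD ta by (intro divide_right_mono) auto
  have "\<bar>H0\<bar> + 2 < 1/(2 * ta)" using h1 ta by (simp add: field_simps)
  hence hH: "h > \<bar>H0\<bar> + 2" using hb by simp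
  have "(2 * ta*h) = 1 + D" using ta by (simp add: h_def)
  hence "(2 * ta*h - 1)*(2 * ta*h - 1) = 1 - 4 * ta\<^sup>2" using DD by simp
  hence "4 * ta*(ta*(h^2 + 1) - h) = 0" by (simp add: power2_eq_square algebra_simps)
  hence "ta*(h^2 + 1) = h" using ta by simp
  moreover have "h^2 + 1 > 0" by (smt (verit) zero_le_power2)
  ultimately have "ta = h/(h^2 + 1)" by (simp add: field_simps)
  moreover have "t*C<=1/2"
  proof -
   have "t<=1/(2*(C + 1))" using t by (simp add: ep_def)
   hence "t*C<=1/(2*(C + 1))*C" using C by (intro mult_right_mono)
   also have "...<=1/2" using C by (simp add: field_simps)
   finally show ?thesis .
  qed
  ultimately have "kernel_curve d a b t h" using assms t hH
   by unfold_locales (auto simp: C_def ta_def ka_def)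
  thus ?thesis using hH by (intro exI[of _ h]) auto
 qed
 ultimately show ?thesis by blast
qed

context kernel_curve
begin

lemma norm_ch: "norm ch = h" "norm (ch^2) = h^2" using h_gt1 by (auto simp: norm_power)

lemma Cst_nz: "A*B~=1 ==> Cst / cr a~=0"
proof -
 have "h^2 + 1 > 0" by (smt (verit) zero_le_power2)
 hence "cr (h^2 + 1)~=0" by (metis less_irrefl of_real_eq_0_iff)
 hence "ch^2 + 1~=0" by simp
 moreover assume "A*B~=1"
 ultimately show ?thesis using ab_pos unfolding Cst_def by auto
qed

lemma AB_nz:
 assumes "h > 1 + \<bar>b - 1\<bar> + 1/\<bar>a - 1\<bar>"
 shows "A~=-1" "B~=-1" "A * ch^2~=1" "B~=ch^2"
proof -
 show "A~=-1" "B~=-1" using ab_pos by (auto simp: complex_eq_iff)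
 have hh: "h < h\<^sup>2" using h_gt1 by (simp add: power2_eq_square)
 have "0<=1/\<bar>a - 1\<bar>" by simp
 hence "b - 1~=h^2" using assms hh by linarith
 hence "cr (b - 1)~=cr (h^2)" by (simp only: of_real_eq_iff not_False_eq_True)
 thus "B~=ch^2" by simp
 have "(a - 1)*h^2~=1"
 proof (cases "a = 1")
  case False
  hence "1/\<bar>a - 1\<bar> < h\<^sup>2" using assms hh by linarith
  hence "1 < \<bar>a - 1\<bar>*h^2" using False by (simp add: pos_divide_less_eq mult.commute)
  moreover have "\<bar>(a - 1)*h^2\<bar> = \<bar>a - 1\<bar>*h^2" by (simp add: abs_mult)
  ultimately show ?thesis by auto
 qed simp
 hence "cr ((a - 1)*h^2)~=cr 1" by (simp only: of_real_eq_iff not_False_eq_True)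
 thus "A * ch^2~=1" by simp
qed

text \<open>\<open>L\<close> is at least t times the square root of \<open>d (1, 1)\<close>, while
  \<open>u0\<close> and \<open>v0\<close> are of order t, so the centre of the conic stays bounded
  as t tends to 0. Without the step (1,1), \<open>L\<close> is of smaller order than t and the
  centre escapes.\<close>

lemma ex_ey_bounded:
 assumes "d (1, 1) > 0" "h>=2"
 defines "M == 3*(d (1, 0)/sqrt (d (1, -1)) + d (0, 1)/sqrt (d (-1, 1)))/sqrt (d (1, 1))"
 shows "norm cx<=M" "norm cy<=M"
proof -
 have "ta<=2/5"
 proof -
  have "0<=(h - 2)*(2*h - 1)" using assms(2) by (intro mult_nonneg_nonneg) auto
  hence "5*h<=2*(h^2 + 1)" by (simp add: power2_eq_square algebra_simps)
  moreover have "h^2 + 1 > 0" by (smt (verit) zero_le_power2)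
  ultimately show ?thesis unfolding ta_def by (simp add: divide_le_eq)
 qed
 hence "ta\<^sup>2<=(2/5)^2" using tau_pos by (intro power_mono) auto
 hence De: "De>=1/3" "De<=1" by (auto simp: De_def power2_eq_square)
 have "ta*w0<=L2"
 proof -
  have "0<=(u0 * v0 + ta*(u0^2 + v0^2))/De" using uvw_nonneg tau_pos Delta by auto
  hence "ta*w0<=ta*(w0 + (u0 * v0 + ta*(u0^2 + v0^2))/De)" using tau_pos by simp
  also have "...<=ta/De*(w0 + (u0 * v0 + ta*(u0^2 + v0^2))/De)"
  proof (rule mult_right_mono)
   have "ta*1<=ta*(1/De)" using tau_pos De Delta by (intro mult_left_mono) auto
   thus "ta<=ta/De" by simp
   show "0<=w0 + (u0 * v0 + ta*(u0^2 + v0^2))/De"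
    using `0<=(u0 * v0 + ta*(u0^2 + v0^2))/De` uvw_nonneg by simp
  qed
  finally show ?thesis unfolding L2_def .
 qed
 also have "ta*w0 = t^2*d (1, 1)" using ab_sqrt(1,2) unfolding ab_sqrt(5)[symmetric] w0_def by (simp add: power2_eq_square)
 finally have "(t * sqrt (d (1, 1)))\<^sup>2<=L^2" using assms(1) L_pos by (simp add: power_mult_distrib)
 hence L: "t * sqrt (d (1, 1))<=L" using L_pos by (intro power2_le_imp_le[of "t * sqrt (d (1, 1))" L]) auto
 have tp: "t * sqrt (d (1, 1)) > 0" using t_pos assms(1) by simp
 have den: "1/3*(t * sqrt (d (1, 1)))<=De*L" using De L tp by (intro mult_mono) auto
 have num: "u0 + 2 * ta * v0<=u0 + v0" "v0 + 2 * ta*u0<=u0 + v0"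
  using `ta<=2/5` uvw_nonneg mult_right_mono[of "2 * ta" 1 v0] mult_right_mono[of "2 * ta" 1 u0] by auto
 have fin: "(u0 + v0)/(1/3*(t * sqrt (d (1, 1)))) = M"
  unfolding M_def u0_def v0_def al_def be_def using t_pos assms(1) d_pos by (simp add: field_simps)
 have "z/(De*L)<=M" if "0<=z" "z<=u0 + v0" for z
 proof -
  have "z/(De*L)<=(u0 + v0)/(1/3*(t * sqrt (d (1, 1))))"
   by (rule frac_le) (use that den tp uvw_nonneg in auto)
  thus ?thesis unfolding fin .
 qed
 hence "ex<=M" "ey<=M" unfolding ex_def ey_def using num uvw_nonneg tau_pos by auto
 thus "norm cx<=M" "norm cy<=M" using ex_ey by simp_all
qed

text \<open>Without the step (1,1) the conic passes through X = Y = 0, so \<open>DX\<close> and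
  \<open>DY\<close> have a common root, shared by their combinations \<open>nA\<close> and
  \<open>nB\<close>. The last equation shows that its square is of order \<open>h\<close>.\<close>

lemma common_root:
 assumes "d (1, 1) = 0" "d (1, 0) > 0" "d (0, 1) > 0"
 obtains zt where "poly (nA A cx cy ch) (of_real zt) = 0" "poly (nB B cx cy ch) (of_real zt) = 0"
  "zt\<^sup>2*(h*(d (0, 1)/be) + d (1, 0)/al) = h*(h*(d (1, 0)/al) + d (0, 1)/be)"
proof -
 have w: "w0 = 0" using assms by (simp add: w0_def)
 have uv: "u0 > 0" "v0 > 0" using assms t_pos ab_sqrt by (auto simp: u0_def v0_def)
 define e where "e = h*ey - ex"
 have H: "h^2 + 1 > 0" "h^2 > 1" using h_gt1 by (auto simp: one_less_power intro: add_nonneg_pos)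
 have "e > 0"
 proof -
  have "e = ((h - 2 * ta) * v0 + (2 * ta*h - 1)*u0)/(De*L)"
   unfolding e_def ex_def ey_def by (simp add: diff_divide_distrib[symmetric] algebra_simps)
  moreover have "2 * ta*h > 1"
  proof -
   have "2 * ta*h = 2*h^2/(h^2 + 1)" by (simp add: ta_def power2_eq_square)
   thus ?thesis using H by (simp add: less_divide_eq)
  qed
  moreover have "2 * ta < h"
  proof -
   have "2*h < h*(h^2 + 1)" using H h_gt1 by (intro mult_strict_left_mono[of 2 "h^2 + 1" h, simplified mult.commute[of h 2]]) auto
   thus ?thesis using H by (simp add: ta_def divide_less_eq mult.commute)
  qed
  ultimately show ?thesis using uv Delta L_pos by (auto intro!: divide_pos_pos add_pos_pos mult_pos_pos)
 qed
 \<comment> \<open>The root of the difference of \<open>DY\<close> and \<open>DX\<close>, which is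
   linear.\<close>
 define zt where "zt = - (h^2 - 1)/e"
 have ze: "zt*e = - (h^2 - 1)" using `e > 0` by (simp add: zt_def)
 have zn: "zt~=0" using H `e > 0` by (simp add: zt_def)
 have Z1: "zt\<^sup>2 + ex * zt + 1 = 0"
 proof -
  have "0 = h + 1/h - 4 * ta + ta*(ex^2 + ey^2) - ex*ey" using w_eq w by simp
  hence "0 = h*(h^2 + 1)*(h + 1/h - 4 * ta + ta*(ex^2 + ey^2) - ex*ey)" by simp
  also have "... = (h^2 + 1)*(h*h + 1) - 4*h*(ta*(h^2 + 1)) + h*(ta*(h^2 + 1))*(ex^2 + ey^2) - h*(h^2 + 1)*(ex*ey)"
   by (simp add: field_simps)
  also have "... = (h\<^sup>2 - 1)^2 - ex*(h^2 - 1)*e + e^2"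
   unfolding tau_h e_def by (simp add: power2_eq_square algebra_simps)
  also have "(h\<^sup>2 - 1)^2 = (zt*e)^2" unfolding ze power2_minus ..
  also have "ex*(h^2 - 1)*e = - (ex*(zt*e)*e)" unfolding ze by (simp add: algebra_simps)
  also have "(zt*e)^2 - - (ex*(zt*e)*e) + e^2 = (zt\<^sup>2 + ex * zt + 1)*e^2" by (simp add: power2_eq_square algebra_simps)
  finally show ?thesis using `e > 0` by simp
 qed
 have Z2: "zt\<^sup>2 + h*ey * zt + h^2 = 0"
 proof -
  have "zt\<^sup>2 + h*ey * zt + h^2 = (zt\<^sup>2 + ex * zt + 1) + zt*e + (h^2 - 1)" unfolding e_def by (simp add: algebra_simps)
  thus ?thesis unfolding Z1 ze by simp
 qed
 have cZ: "poly DX (of_real zt) = 0" "poly DY (of_real zt) = 0"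
 proof -
  have "cr (zt\<^sup>2 + ex * zt + 1) = 0" "cr (zt\<^sup>2 + h*ey * zt + h^2) = 0" unfolding Z1 Z2 by simp_all
  thus "poly DX (of_real zt) = 0" "poly DY (of_real zt) = 0"
   by (simp_all add: DX_def DY_def power2_eq_square algebra_simps)
 qed
 have "zt\<^sup>2*(h * v0 + u0) = h*(h*u0 + v0)"
 proof -
  have a: "- (zt*(u0/L))*(h^2 + 1) = (h^2 - 1)*(zt\<^sup>2 - 1)"
  proof -
   have "- (zt*(u0/L))*(h^2 + 1) = - (ex * zt)*(h^2 + 1) + 2*(ta*(h^2 + 1))*(ey * zt)"
    unfolding ex_ey(1)[symmetric] by (simp add: algebra_simps)
   also have "... = - (ex * zt)*(h^2 + 1) + 2*(h*ey * zt)" unfolding tau_h by simp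
   also have "- (ex * zt) = zt\<^sup>2 + 1" using Z1 by simp
   also have "h*ey * zt = - (zt\<^sup>2 + h^2)" using Z2 by simp
   finally show ?thesis by (simp add: algebra_simps)
  qed
  have b: "- (zt*(v0/L))*(h*(h^2 + 1)) = (h^2 - 1)*(h^2 - zt\<^sup>2)"
  proof -
   have "- (zt*(v0/L))*(h*(h^2 + 1)) = - (h*ey * zt)*(h^2 + 1) + 2*h*(ta*(h^2 + 1))*(ex * zt)"
    unfolding ex_ey(2)[symmetric] by (simp add: algebra_simps)
   also have "... = - (h*ey * zt)*(h^2 + 1) + 2*h^2*(ex * zt)" unfolding tau_h by (simp add: power2_eq_square)
   also have "- (h*ey * zt) = zt\<^sup>2 + h^2" using Z2 by simp
   also have "ex * zt = - (zt\<^sup>2 + 1)" using Z1 by simp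
   finally show ?thesis by (simp add: algebra_simps power2_eq_square)
  qed
  define W where "W = - (zt/L)*(h^2 + 1)"
  have W: "W~=0" using zn L_pos H by (simp add: W_def)
  have a': "W*u0 = (h^2 - 1)*(zt\<^sup>2 - 1)" and b': "W*(h * v0) = (h^2 - 1)*(h^2 - zt\<^sup>2)"
   using a b by (simp_all add: W_def mult_ac)
  have "W*(u0*(h^2 - zt\<^sup>2)) = (h^2 - 1)*(zt\<^sup>2 - 1)*(h^2 - zt\<^sup>2)" unfolding a'[symmetric] by (simp only: mult.assoc)
  also have "... = W*(h * v0)*(zt\<^sup>2 - 1)" unfolding b' by (simp only: mult_ac)
  finally have "W*(u0*(h^2 - zt\<^sup>2)) = W*(h * v0*(zt\<^sup>2 - 1))" by (simp only: mult.assoc)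
  hence "u0*(h^2 - zt\<^sup>2) = h * v0*(zt\<^sup>2 - 1)" using W by simp
  thus ?thesis by (simp add: algebra_simps power2_eq_square)
 qed
 hence "t*(zt\<^sup>2*(h*(d (0, 1)/be) + d (1, 0)/al)) = t*(h*(h*(d (1, 0)/al) + d (0, 1)/be))"
  unfolding u0_def v0_def by (simp add: algebra_simps)
 hence "zt\<^sup>2*(h*(d (0, 1)/be) + d (1, 0)/al) = h*(h*(d (1, 0)/al) + d (0, 1)/be)" using t_pos by simp
 moreover have "poly (nA A cx cy ch) (of_real zt) = 0" "poly (nB B cx cy ch) (of_real zt) = 0"
  unfolding nA_DX poly_diff poly_smult cZ by simp_all
 ultimately show ?thesis using that by blast
qed

lemma S1_parameters:
 assumes "d (1, 1) = 0" "d (1, 0) = 0"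
 shows "cx = 2" "cy = ch + 1 / ch"
proof -
 have v: "v0 > 0" using d_nz assms t_pos ab_sqrt by (auto simp: v0_def)
 have "L2 = (ta * v0/De)^2" using assms by (simp add: L2_def w0_def u0_def power2_eq_square)
 hence "L = ta * v0/De" using v tau_pos Delta(2) by (simp add: L_def)
 hence ey: "ey = 1/ta" using v tau_pos Delta(2) assms by (simp add: ey_def u0_def)
 have "ex = 2 * ta*ey" using ex_ey(1) assms by (simp add: u0_def)
 hence "ex = 2" using ey tau_pos by simp
 thus "cx = 2" by simp
 show "cy = ch + 1 / ch" using ey tau_h(2) by simp
qed

end

theorem small_t_transcendental:
 fixes d :: "int \<times> int => real"
 assumes d: "!!v. 0<=d v" and ab: "a > 0" "b > 0" and pos: "d (1, -1) > 0" "d (-1, 1) > 0"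
  and cs: "d (1, 1) > 0 & ~ (a = 2 & b = 2 & d (1, 0) = 0 & d (0, 1) = 0) |
   d (1, 1) = 0 & d (0, 1) > 0 & a + b~=a*b"
 shows "EX ep>0. ALL t. 0 < t & t < ep --> ~ x_D_algebraic (Qgf S5 d a b t) & ~ y_D_algebraic (Qgf S5 d a b t)"
proof -
 define A B where "A = cr (a - 1)" and "B = cr (b - 1)"
 have AB: "A*B~=1" if "a + b~=a*b"
 proof -
  have "(a - 1)*(b - 1)~=1" using that by (simp add: algebra_simps)
  hence "cr ((a - 1)*(b - 1))~=cr 1" by (simp only: of_real_eq_iff not_False_eq_True)
  thus ?thesis by (simp add: A_def B_def)
 qed
 define N where "N = 1 + \<bar>b - 1\<bar> + 1/\<bar>a - 1\<bar>"
 have dnz: "d (1, 0) > 0 | d (0, 1) > 0 | d (1, 1) > 0" using cs by auto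
 \<comment> \<open>Every small \<open>t\<close> yields a large \<open>h\<close>, so a lower bound on
   \<open>h\<close> may be assumed freely.\<close>
 have red: ?thesis if main: "!!t h. h > H ==> kernel_curve d a b t h ==> ~ Dalg (kernel_curve.gh d a b t h)" for H
 proof -
  obtain ep where e: "ep > 0" "!!t. 0 < t ==> t < ep ==> EX h>H. kernel_curve d a b t h"
   using ex_kernel_curve[OF d ab pos dnz, of H] by blast
  have "~ x_D_algebraic (Qgf S5 d a b t) & ~ y_D_algebraic (Qgf S5 d a b t)" if t: "0 < t" "t < ep" for t
  proof -
   obtain h where h: "h > H" "kernel_curve d a b t h" using e(2)[OF t] by blast
   show ?thesis using kernel_curve.D_algebraic_imp_Dalg[OF h(2)] main[OF h] by blast
  qed
  thus ?thesis using e(1) by blast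
 qed
 have mb: "EX R>=1. EX H>0. ALL q. norm q > H --> C~=0 --> 1/R<=norm ((C - q)/(C*q - 1)) & norm ((C - q)/(C*q - 1))<=R" for C :: complex
 proof (cases "C = 0")
  case True thus ?thesis by (auto intro!: exI[of _ 1])
 next
  case False
  from mobius_bounds[OF this] show ?thesis by (elim exE conjE, intro exI conjI) auto
 qed
 obtain RA HA where RA: "RA>=1" "HA > 0" "!!q. norm q > HA ==> A~=0 ==> 1/RA<=norm ((A - q)/(A*q - 1)) & norm ((A - q)/(A*q - 1))<=RA"
  using mb[of A] by (elim exE conjE) blast
 obtain RB HB where RB: "RB>=1" "HB > 0" "!!q. norm q > HB ==> B~=0 ==> 1/RB<=norm ((B - q)/(B*q - 1)) & norm ((B - q)/(B*q - 1))<=RB"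
  using mb[of B] by (elim exE conjE) blast
 have sep: "qdil.separated ((cr h)^2) A B R" if "kernel_curve d a b t h" "R>=RA" "R>=RB" "h > HA" "h > HB" "h > N" "a + b~=a*b" for t h R
 proof -
  interpret kernel_curve d a b t h by (rule that)
  have "h < h\<^sup>2" using h_gt1 by (simp add: power2_eq_square)
  hence "norm (ch^2) > HA" "norm (ch^2) > HB" using that unfolding norm_ch by linarith+
  moreover have "1/R<=1/RA" "1/R<=1/RB" using that(2,3) RA(1) RB(1) by (auto intro!: divide_left_mono)
  ultimately have "ALL C:{A, B}. C~=0 --> 1/R<=norm (qd.mob C) & norm (qd.mob C)<=R"
   using RA(3)[of "ch^2"] RB(3)[of "ch^2"] that(2,3) unfolding qd.mob_def by fastforce
  thus ?thesis using AB[OF that(7)] AB_nz that(6) unfolding qd.separated_def A_def B_def N_def by blast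
 qed
 from cs show ?thesis
 proof (elim disjE conjE)
  assume d11: "d (1, 1) > 0" and ne: "~ (a = 2 & b = 2 & d (1, 0) = 0 & d (0, 1) = 0)"
  define M where "M = 3*(d (1, 0)/sqrt (d (1, -1)) + d (0, 1)/sqrt (d (-1, 1)))/sqrt (d (1, 1))"
  have M0: "M>=0" using d pos d11 by (auto simp: M_def intro!: divide_nonneg_nonneg add_nonneg_nonneg mult_nonneg_nonneg)
  obtain R H where R: "R>=1" "H > 0" "!!h ex ey. norm h > H ==> norm ex<=M ==> norm ey<=M ==> roots_bounded A B ex ey h R"
   using ex_roots_bounded[OF M0, of A B] by (elim exE conjE) blast
  show ?thesis
  proof (rule red[of "max (max H (R^4)) (max N 2)"])
   fix t h assume h: "h > max (max H (R^4)) (max N 2)" and kc: "kernel_curve d a b t h"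
   interpret kernel_curve d a b t h by (rule kc)
   have hh: "h > H" "h > R^4" "h > N" "h>=2" using h by auto
   have b: "norm cx<=M" "norm cy<=M" unfolding M_def by (rule ex_ey_bounded[OF d11 hh(4)])+
   show "~ Dalg gh"
   proof (rule qd.bounded_not_Dalg[OF refl R(1) _ _ _ _ _ _ kernel_equation gh_nz])
    show "norm ch > R^4" using hh(2) unfolding norm_ch .
    show "roots_bounded (cr (a - 1)) (cr (b - 1)) cx cy ch R"
     using R(3)[of ch cx cy] b hh(1) unfolding A_def B_def norm_ch by simp
    show "cr (a - 1)~=-1" "cr (b - 1)~=-1" "cr (a - 1) * ch^2~=1" "cr (b - 1)~=ch^2"
     using AB_nz hh(3) unfolding N_def by blast+
    show "Cst / cr a~=0" if "cr (a - 1) * cr (b - 1)~=1" by (rule Cst_nz[OF that])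
    show "~ (cr (a - 1) = 1 & cr (b - 1) = 1 & cx = 0 & cy = 0)"
    proof
     assume e: "cr (a - 1) = 1 & cr (b - 1) = 1 & cx = 0 & cy = 0"
     hence "ex = 0" "ey = 0" by simp_all
     hence "u0 = 0" "v0 = 0" using ex_ey(1,2) L_pos by simp_all
     hence "d (1, 0) = 0" "d (0, 1) = 0" using t_pos ab_sqrt by (auto simp: u0_def v0_def)
     moreover have "a = 2" "b = 2" using e by (auto simp: complex_eq_iff)
     ultimately show False using ne by blast
    qed
   qed
  qed
 next
  assume d11: "d (1, 1) = 0" and d01: "d (0, 1) > 0" and ne: "a + b~=a*b"
  note AB = AB[OF ne]
  show ?thesis
  proof (cases "d (1, 0) = 0")
   case d10: True
   define R where "R = max RA RB"
   have RR2: "R>=RA" "R>=RB" by (auto simp: R_def)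
   show ?thesis
   proof (rule red[of "max (max HA HB) (max N (R^4))"])
    fix t h assume h: "h > max (max HA HB) (max N (R^4))" and kc: "kernel_curve d a b t h"
    interpret kernel_curve d a b t h by (rule kc)
    have "h < h\<^sup>2" using h_gt1 by (simp add: power2_eq_square)
    hence hh: "norm (ch^2) > R^4" using h unfolding norm_ch by auto
    show "~ Dalg gh"
    proof (rule qd.S1_not_Dalg[OF refl _ hh sep[OF kc RR2, unfolded A_def B_def] _ gh_nz])
     show "R>=1" using RA(1) by (simp add: R_def)
     show "qd.kernel_eq (cr (a - 1)) (cr (b - 1)) 2 (ch + 1 / ch) ch (Cst / cr a) gh"
      using kernel_equation unfolding S1_parameters[OF d11 d10] .
     show "Cst / cr a~=0" by (rule Cst_nz) (use AB in "simp only: A_def B_def not_False_eq_True")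
    qed (use h ne in auto)
   qed
  next
   case False
   hence d10: "d (1, 0) > 0" using d[of "(1, 0)"] by simp
   define u1 v1 where "u1 = d (1, 0)/sqrt (d (1, -1))" and "v1 = d (0, 1)/sqrt (d (-1, 1))"
   have uv: "u1 > 0" "v1 > 0" using d10 d01 pos by (auto simp: u1_def v1_def)
   \<comment> \<open>The last two terms bound \<open>zt\<^sup>2/h\<close> and its inverse uniformly:
     this quotient equals (h u1 + v1) / (h v1 + u1).\<close>
   define R where "R = max (max RA RB) (max ((u1 + v1)/v1) ((u1 + v1)/u1))"
   have RR2: "R>=RA" "R>=RB" by (auto simp: R_def)
   have RR: "R>=1" "R>=(u1 + v1)/v1" "R>=(u1 + v1)/u1" using RA(1) by (auto simp: R_def)
   show ?thesis
   proof (rule red[of "max (max HA HB) (max N (R^4))"])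
    fix t h assume h: "h > max (max HA HB) (max N (R^4))" and kc: "kernel_curve d a b t h"
    interpret kernel_curve d a b t h by (rule kc)
    have hh: "norm ch > R^4" using h unfolding norm_ch by auto
    obtain zt where z: "poly (nA (cr (a - 1)) cx cy ch) (of_real zt) = 0" "poly (nB (cr (b - 1)) cx cy ch) (of_real zt) = 0"
     "zt\<^sup>2*(h*(d (0, 1)/be) + d (1, 0)/al) = h*(h*(d (1, 0)/al) + d (0, 1)/be)"
     using common_root[OF d11 d10 d01] by blast
    have ze: "zt\<^sup>2*(h * v1 + u1) = h*(h*u1 + v1)" using z(3) by (simp only: u1_def v1_def al_def be_def)
    have "R > 0" "h * v1 + u1 > 0" using RR uv h_gt1 by (auto intro: add_pos_pos)
    have zn: "norm (cr zt)^2 = zt\<^sup>2" by simp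
    show "~ Dalg gh"
    proof (rule qd.zeta_not_Dalg[OF refl RR(1) hh _ _ z(1,2) sep[OF kc RR2, unfolded A_def B_def] kernel_equation gh_nz])
     have sy: "h*(h*x + y)<=h*(R*(h*y + x))" if "R>=(x + y)/y" "x > 0" "y > 0" for x y
     proof (rule mult_left_mono)
      have "h*x + y<=h*(x + y)" using h_gt1 that mult_right_mono[of 1 h y] by (simp add: algebra_simps)
      also have "x + y<=R*y" using that by (simp add: divide_le_eq)
      finally have "h*x + y<=h*(R*y)" using h_gt1 by simp
      also have "...<=R*(h*y + x)" using `R > 0` that by (simp add: algebra_simps)
      finally show "h*x + y<=R*(h*y + x)" .
     qed (use h_gt1 in simp)
     have "h*(h*u1 + v1)<=h*(R*(h * v1 + u1))" by (rule sy[OF RR(2) uv])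
     hence "zt\<^sup>2*(h * v1 + u1)<=(h*R)*(h * v1 + u1)" unfolding ze by (simp add: mult.assoc)
     hence "zt\<^sup>2<=h*R" using `h * v1 + u1 > 0` by (rule mult_right_le_imp_le)
     thus "norm (cr zt)^2<=norm ch*R" unfolding norm_ch zn .
     have "h*(h * v1 + u1)<=h*(R*(h*u1 + v1))" by (rule sy) (use RR(3) uv in "auto simp: add.commute")
     hence "h*(h * v1 + u1)<=R*(zt\<^sup>2*(h * v1 + u1))" unfolding ze by (simp add: mult_ac)
     hence "h*(h * v1 + u1)<=(R * zt\<^sup>2)*(h * v1 + u1)" by (simp only: mult.assoc)
     hence "h<=R * zt\<^sup>2" using `h * v1 + u1 > 0` by (rule mult_right_le_imp_le)
     hence "h/R<=zt\<^sup>2" using `R > 0` by (simp add: divide_le_eq mult.commute)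
     thus "norm ch/R<=norm (cr zt)^2" unfolding norm_ch zn .
     show "Cst / cr a~=0" by (rule Cst_nz) (use AB in "simp only: A_def B_def not_False_eq_True")
    qed (use h ne in auto)
   qed
  qed
 qed
qed

subsection \<open>The rational and the algebraic case\<close>

text \<open>The quotient of two solutions is computed once from each pair of equations; the results
  differ by a dilation, so the quotient is invariant and hence constant.\<close>

lemma (in qdil) proportional_solutions:
 assumes 1: "M1*U = M2*V" "M1*U0 = M2*V0" and 2: "N1*U = N2*dil V" "N1*U0 = N2*dil V0"
  and nz: "M1~=0" "M2~=0" "N1~=0" "N2~=0" "U0~=0" "V0~=0"
 shows "EX c. U = fls_const c*U0 & V = fls_const c*V0"
proof -
 define rh where "rh = V/V0"
 have dz: "dil V0~=0" using nz(6) by (metis 2(2) mult_eq_0_iff nz(3,5))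
 have "M1*U0*V = M2*V*V0" unfolding 1(2) by (simp only: mult_ac)
 also have "... = M1*U*V0" unfolding 1(1)[symmetric] by (simp only: mult_ac)
 finally have "M1*(U0*V) = M1*(U*V0)" by (simp only: mult.assoc)
 hence "U0*V = U*V0" using nz(1) by (simp only: mult_cancel_left simp_thms)
 hence a: "U = rh*U0" using nz(5,6) by (simp add: rh_def field_simps)
 have "N1*U0*dil V = N2*dil V*dil V0" unfolding 2(2) by (simp only: mult_ac)
 also have "... = N1*U*dil V0" unfolding 2(1)[symmetric] by (simp only: mult_ac)
 finally have "N1*(U0*dil V) = N1*(U*dil V0)" by (simp only: mult.assoc)
 hence "U0*dil V = U*dil V0" using nz(3) by (simp only: mult_cancel_left simp_thms)
 hence b: "U = dil rh*U0" using nz(5,6) dz by (simp add: rh_def sig_divide field_simps)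
 have "dil rh = rh" using a b nz(5) by simp
 hence "rh = fls_const (fls_nth rh 0)" by (rule dil_fixed)
 moreover have "V = rh*V0" using nz(6) by (simp add: rh_def)
 ultimately show ?thesis using a by metis
qed

context kernel_curve
begin

definition u' where "u' = (ch^2 + 1) * cx - 2 * ch * cy"
definition v' where "v' = (ch^2 + 1) * ch * cy - 2 * ch^2 * cx"
definition w' where "w' = (ch\<^sup>2 - 1)^2 + ch^2*(cx^2 + cy^2) - (ch^2 + 1) * ch*(cx * cy)"

text \<open>The equation of the conic with denominators cleared, at the unshifted and the shifted
  point; \<open>uvw'\<close> identifies \<open>u'\<close>, \<open>v'\<close>, \<open>w'\<close> with
  scaled weights of the steps (1,0), (0,1), (1,1).\<close>

lemma conic_poly:
 "smult (ch^2 + 1) (DX*DY) = DY*DY + smult (ch^2) (DX*DX) + [:0,1:]*(smult u' DY + smult v' DX) + [:0,0,w':]"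
 "smult (ch^2 + 1) (DX*DY') = DY'*DY' + smult (ch^2) (DX*DX) + [:0,1:]*(smult u' DY' + smult v' DX) + [:0,0,w':]"
 unfolding DX_def DY_def DY'_def u'_def v'_def w'_def
 by (simp_all add: power2_eq_square algebra_simps)

lemma uvw':
 "u' = (ch^2 + 1) * of_real (u0/L)" "v' = (ch^2 + 1) * ch * of_real (v0/L)" "w' = (ch^2 + 1) * ch * of_real (w0/L2)"
proof -
 have th: "cr ta*(ch^2 + 1) = ch" by (metis of_real_1 of_real_add of_real_mult of_real_power tau_h(1))
 have "(ch^2 + 1) * of_real (u0/L) = (ch^2 + 1) * cx - 2*(cr ta*(ch^2 + 1)) * cy"
  unfolding ex_ey(1)[symmetric] by (simp add: algebra_simps)
 thus "u' = (ch^2 + 1) * of_real (u0/L)" unfolding th u'_def by simp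
 have "(ch^2 + 1) * ch * of_real (v0/L) = (ch^2 + 1) * ch * cy - 2 * ch*(cr ta*(ch^2 + 1)) * cx"
  unfolding ex_ey(2)[symmetric] by (simp add: algebra_simps)
 thus "v' = (ch^2 + 1) * ch * of_real (v0/L)" unfolding th v'_def by (simp add: power2_eq_square)
 have "(ch^2 + 1) * ch * of_real (w0/L2) = (ch^2 + 1)*(ch * ch + ch*(1 / ch)) - 4 * ch*(cr ta*(ch^2 + 1))
   + ch*(cr ta*(ch^2 + 1))*(cx^2 + cy^2) - (ch^2 + 1) * ch*(cx * cy)"
  unfolding w_eq by (simp add: algebra_simps)
 also have "ch*(1 / ch) = 1" by simp
 finally show "w' = (ch^2 + 1) * ch * of_real (w0/L2)" unfolding th w'_def by (simp add: power2_eq_square algebra_simps)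
qed

lemma ab_tau_small: "a*b * ta\<^sup>2 < 1" "(1 - a*b * ta\<^sup>2)~=0"
proof -
 have "al * be<=al\<^sup>2 + be\<^sup>2" using sum_squares_bound[of al be] ab_sqrt(1,2) mult_pos_pos[OF ab_sqrt(1,2)] by linarith
 also have "...<=(SUM v:S5. d v)"
 proof -
  have "(SUM v:{(1, -1), (-1, 1)}. d v)<=(SUM v:S5. d v)" by (rule sum_mono2) (auto simp: S5_def d_nonneg)
  thus ?thesis by (simp add: ab_sqrt)
 qed
 finally have "t*(al * be)*((1 + a)*(1 + b))<=t*((SUM v:S5. d v)*((1 + a)*(1 + b)))"
  using t_pos ab_pos by (simp add: mult.assoc mult_right_mono mult_left_mono)
 also have "...<=1/2" by (rule t_small)
 finally have "ta*((1 + a)*(1 + b))<=1/2" by (simp only: ab_sqrt(5))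
 hence "(ta*((1 + a)*(1 + b)))\<^sup>2<=(1/2)^2" using tau_pos ab_pos by (intro power_mono) auto
 moreover have "a*b * ta\<^sup>2<=(ta*((1 + a)*(1 + b)))\<^sup>2"
 proof -
  have "a<=(1 + a)^2" "b<=(1 + b)^2" using ab_pos by (auto simp: power2_eq_square algebra_simps)
  hence "a*b * ta\<^sup>2<=(1 + a)^2*(1 + b)^2 * ta\<^sup>2" using ab_pos by (intro mult_mono) auto
  thus ?thesis by (simp add: power_mult_distrib mult_ac)
 qed
 ultimately show "a*b * ta\<^sup>2 < 1" by (simp add: power2_eq_square)
 thus "(1 - a*b * ta\<^sup>2)~=0" by simp
qed

lemma tau_square: "ta\<^sup>2 = t^2*d (1, -1)*d (-1, 1)"
proof -
 have "ta\<^sup>2 = (t*(al * be))\<^sup>2" by (simp only: ab_sqrt(5))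
 also have "... = t^2 * al\<^sup>2 * be\<^sup>2" by (simp add: power_mult_distrib)
 finally show ?thesis unfolding ab_sqrt(3,4) .
qed

lemma expansion_eventually:
 fixes f :: "complex => complex"
 assumes "f has_fps_expansion F" "F = 1"
 shows "EX r>0. ALL x. norm x < r --> f x = 1"
proof -
 have "(%x. f x - 1) has_fps_expansion F - 1" by (intro fps_expansion_intros assms)
 hence "eventually (%x. f x - 1 = 0) (nhds 0)" using assms(2) by (simp add: has_fps_expansion_0_iff)
 thus ?thesis unfolding eventually_nhds_metric by (auto simp: dist_norm)
qed

lemma compose_cancel:
 fixes P Th :: "complex fps"
 assumes "fps_compose P Th = 1" "fps_nth Th 0 = 0" "fps_nth Th 1~=0"
 shows "P = 1"
proof -
 have "fps_compose (P - 1) Th = 0" by (simp add: fps_compose_sub_distrib assms(1))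
 hence "P - 1 = 0 | Th = 0" using fps_compose_eq_0_iff[OF assms(2)] by blast
 thus ?thesis using assms(3) by auto
qed

text \<open>The exponent \<open>n\<close> is 1 in the rational and 2 in the algebraic case. The
  substitution by \<open>G\<close> is undone because \<open>G\<close> has order 1, and the value at
  0 fixes the constant \<open>c\<close>.\<close>

lemma closed_form:
 fixes f :: "complex => complex"
 assumes f: "f has_fps_expansion P" "fps_nth P 0 = 1"
  and G: "fps_nth G 0 = 0" "fps_nth G 1~=0" "fps_to_fls G*toR (smult e D) = fls_const k*fls_X"
  and D: "poly D 0~=0" and n: "n > 0"
  and E: "fps_to_fls (fps_compose P G)^n*toR (D^n - smult (z*k^n) ([:0,1:]^n)) = fls_const c*toR D^n"
 shows "EX r>0. ALL x. norm x < r --> f x^n*(1 - z*e^n*x^n) = 1"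
proof -
 define F where "F = fps_compose P G"
 define M where "M = fps_of_poly D"
 have X: "fps_of_poly [:0,1:] = (fps_X :: complex fps)" by (simp add: fps_of_poly_pCons)
 have p: "fps_of_poly (D^n - smult (z*k^n) ([:0,1:]^n)) = M^n - fps_const (z*k^n)*fps_X^n"
  by (simp add: fps_of_poly_diff fps_of_poly_smult fps_of_poly_power X M_def)
 have "fps_to_fls (F^n*(M^n - fps_const (z*k^n)*fps_X^n)) = fps_to_fls (fps_const c*M^n)"
  using E unfolding F_def[symmetric] toR_def p M_def by (simp only: fls_times_fps_to_fls fps_to_fls_power fps_const_to_fls)
 hence E: "F^n*(M^n - fps_const (z*k^n)*fps_X^n) = fps_const c*M^n" by simp
 have M0: "fps_nth M 0~=0" using D by (simp add: M_def poly_0_coeff_0)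
 have F0: "fps_nth F 0 = 1" using f(2) by (simp add: F_def)
 have "fps_nth (F^n*(M^n - fps_const (z*k^n)*fps_X^n)) 0 = fps_nth M 0^n"
  using n F0 by (simp add: fps_power_zeroth)
 hence c: "c = 1" unfolding E using M0 by (simp add: fps_power_zeroth)
 have "fps_to_fls (G*fps_of_poly (smult e D)) = fps_to_fls (fps_const k*fps_X)"
  using G(3) by (simp add: toR_def fls_times_fps_to_fls)
 hence XX: "fps_const k*fps_X = fps_const e*G*M" by (simp add: fps_of_poly_smult M_def mult_ac)
 have "M^n*(F^n*(1 - fps_const (z*e^n)*G^n)) = F^n*(M^n - fps_const z*(fps_const e*G*M)^n)"
  by (simp add: power_mult_distrib algebra_simps fps_const_power flip: fps_const_mult)
 also have "... = F^n*(M^n - fps_const (z*k^n)*fps_X^n)" unfolding XX[symmetric]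
  by (simp add: power_mult_distrib fps_const_power mult.assoc flip: fps_const_mult)
 also have "... = M^n*1" unfolding E c by simp
 finally have "F^n*(1 - fps_const (z*e^n)*G^n) = 1"
  using M0 by (metis mult_cancel_left power_not_zero fps_zero_nth)
 moreover have "fps_compose (P^n*(1 - fps_const (z*e^n)*fps_X^n)) G = F^n*(1 - fps_const (z*e^n)*G^n)"
  using G(1) by (simp add: fps_compose_mult_distrib fps_compose_sub_distrib fps_compose_power[symmetric] F_def)
 ultimately have "P^n*(1 - fps_const (z*e^n)*fps_X^n) = 1" using compose_cancel[OF _ G(1,2)] by metis
 moreover have "(%x. f x^n*(1 - z*e^n*x^n)) has_fps_expansion P^n*(1 - fps_const (z*e^n)*fps_X^n)"
  by (intro fps_expansion_intros f)
 ultimately show ?thesis by (rule expansion_eventually[rotated])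
qed

text \<open>The quotients of the n-th power of \<open>fls_X\<close> by \<open>PX\<close> and by
  \<open>PY\<close> are what \<open>fh^n\<close> and \<open>gh^n\<close> must be for the expected
  formulas. They satisfy the same homogeneous relations, so uniqueness up to a constant
  applies.\<close>

lemma closed_forms:
 assumes n: "n > 0" and PX: "PX = DX^n - smult z ([:0,1:]^n)" and PY: "PY = DY^n - smult (z' * ch^n) ([:0,1:]^n)"
  and PY': "PY' = DY'^n - smult (z' * ch^n) ([:0,1:]^n)"
  and M: "M1*fh^n = M2*gh^n" "M1*toR PY = M2*toR PX"
  and N: "N1*fh^n = N2*qd.dil gh^n" "N1*toR PY' = N2*toR PX"
  and nz: "M1~=0" "M2~=0" "N1~=0" "N2~=0"
 shows "EX r>0. ALL x. norm x < r --> Q x 0^n*(1 - z*X1^n*x^n) = 1"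
  "EX r>0. ALL y. norm y < r --> Q 0 y^n*(1 - z'*Y1^n*y^n) = 1"
proof -
 have "poly PX 0~=0" "poly PY 0~=0" "poly PY' 0~=0" using n by (simp_all add: PX PY PY' DX_def DY_def DY'_def power_0_left)
 hence Pnz: "toR PX~=0" "toR PY~=0" "toR PY'~=0" by auto
 have X: "toR ([:0,1:]^n) = fls_X^n" by (simp add: toR_power toR_pCons)
 have dPY: "qd.dil (toR PY) = fls_const (ch^2)^n*toR PY'"
  unfolding PY PY' toR_diff toR_smult toR_power[of DY] toR_power[of DY'] X
  by (simp add: qd.sig_diff qd.sig_power qd.sig_mult DY_dil power_mult_distrib algebra_simps)
 have "qd.dil (fls_X^n/toR PY) = (fls_const (ch^2)^n*fls_X^n)/(fls_const (ch^2)^n*toR PY')"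
  by (simp only: qd.sig_divide qd.sig_power dPY qd.dil_X power_mult_distrib)
 also have "... = fls_X^n/toR PY'" by (rule nonzero_mult_divide_mult_cancel_left) simp
 finally have dl: "qd.dil (fls_X^n/toR PY) = fls_X^n/toR PY'" .
 have "EX c. fh^n = fls_const c*(fls_X^n/toR PX) & gh^n = fls_const c*(fls_X^n/toR PY)"
 proof (rule qd.proportional_solutions[OF M(1) _ _ _ nz])
  show "M1*(fls_X^n/toR PX) = M2*(fls_X^n/toR PY)" using M(2) Pnz by (simp add: frac_eq_eq mult_ac)
  show "N1*fh^n = N2*qd.dil (gh^n)" using N(1) by (simp add: qd.sig_power)
  show "N1*(fls_X^n/toR PX) = N2*qd.dil (fls_X^n/toR PY)" unfolding dl using N(2) Pnz by (simp add: frac_eq_eq mult_ac)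
 qed (use Pnz in simp_all)
 then obtain c where c: "fh^n = fls_const c*(fls_X^n/toR PX)" "gh^n = fls_const c*(fls_X^n/toR PY)" by blast
 have cross: "g^n*P = k*D^n" if "(X*g/D)^n = k*(X^n/P)" "X~=0" "D~=0" "P~=0" for g P k D X :: "complex fls"
  using that by (simp add: frac_eq_eq power_divide power_mult_distrib)
 have 0: "fps_nth Ph 0 = 1" "fps_nth Ps 0 = 1" using Fs_Gs_0 by (simp_all add: Fs_def Gs_def)
 have "Fs^n*toR PX = fls_const c*toR DX^n" by (rule cross[OF c(1)[unfolded fh_def]]) (use Pnz D_nz in simp_all)
 thus "EX r>0. ALL x. norm x < r --> Q x 0^n*(1 - z*X1^n*x^n) = 1" unfolding Fs_def PX
  by (intro closed_form[OF Ph 0(1) Xi_props(1,2), of X1 DX 1 n z c]) (use Xi_props(3) n in "simp_all add: DX_def")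
 have "Gs^n*toR PY = fls_const c*toR DY^n" by (rule cross[OF c(2)[unfolded gh_def]]) (use Pnz D_nz in simp_all)
 thus "EX r>0. ALL y. norm y < r --> Q 0 y^n*(1 - z'*Y1^n*y^n) = 1" unfolding Gs_def PY
  by (intro closed_form[OF Ps 0(2) H_props(1,2,3) _ n]) (simp_all add: DY_def)
qed

theorem rational_closed_form:
 assumes ab: "a + b = a*b" and d11: "d (1, 1) = 0"
 defines "rh == (a*d (1, 0)*t + a*b*d (1, -1)*d (0, 1)*t^2)/(1 - a*b*d (1, -1)*d (-1, 1)*t^2)"
  and "rh' == (b*d (0, 1)*t + a*b*d (-1, 1)*d (1, 0)*t^2)/(1 - a*b*d (1, -1)*d (-1, 1)*t^2)"
 shows "EX r>0. ALL x. norm x < r --> Q x 0*(1 - of_real rh*x) = 1"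
  "EX r>0. ALL y. norm y < r --> Q 0 y*(1 - of_real rh'*y) = 1"
proof -
 define U V N where "U = u0/L" and "V = v0/L" and "N = 1 - a*b * ta\<^sup>2"
 have N: "N~=0" using ab_tau_small by (simp add: N_def)
 \<comment> \<open>The solution of the linear system rx = a (U + ta ry), ry = b (V + ta rx), whose
   determinant is \<open>N\<close>.\<close>
 define rx ry where "rx = (a*U + a*b * ta*V)/N" and "ry = (b*V + a*b * ta*U)/N"
 have Lz: "L~=0" "al~=0" "be~=0" using L_pos ab_sqrt by auto
 have Nd: "N = 1 - a*b*d (1, -1)*d (-1, 1)*t^2" by (simp add: N_def tau_square mult_ac)
 have rh: "rh = rx*(al*L)"
 proof -
  have "rx*(al*L) = (a*(al*(U*L)) + a*b*(ta * al*(V*L)))/N" by (simp add: rx_def algebra_simps)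
  also have "U*L = u0" using Lz by (simp add: U_def)
  also have "V*L = v0" using Lz by (simp add: V_def)
  also have "al*u0 = t*d (1, 0)" using Lz by (simp add: u0_def)
  also have "ta * al * v0 = t^2 * al\<^sup>2*d (0, 1)" using Lz unfolding ab_sqrt(5)[symmetric] v0_def by (simp add: power2_eq_square)
  finally show ?thesis unfolding rh_def Nd ab_sqrt by (simp add: mult_ac)
 qed
 have rh': "rh' = ry*(be*L)"
 proof -
  have "ry*(be*L) = (b*(be*(V*L)) + a*b*(ta * be*(U*L)))/N" by (simp add: ry_def algebra_simps)
  also have "U*L = u0" using Lz by (simp add: U_def)
  also have "V*L = v0" using Lz by (simp add: V_def)
  also have "be * v0 = t*d (0, 1)" using Lz by (simp add: v0_def)
  also have "ta * be*u0 = t^2 * be\<^sup>2*d (1, 0)" using Lz unfolding ab_sqrt(5)[symmetric] u0_def by (simp add: power2_eq_square)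
  finally show ?thesis unfolding rh'_def Nd ab_sqrt by (simp add: mult_ac)
 qed
 have r1: "rx = a*(U + ta*ry)" "ry = b*(V + ta*rx)"
 proof -
  have e: "rx*N = a*U + a*b * ta*V" "ry*N = b*V + a*b * ta*U" using N by (simp_all add: rx_def ry_def)
  have "a*(U + ta*ry)*N = a*U*N + a * ta*(ry*N)" by (simp add: algebra_simps)
  also have "... = rx*N" unfolding e by (simp add: N_def algebra_simps power2_eq_square)
  finally have 1: "rx*N = a*(U + ta*ry)*N" ..
  have "b*(V + ta*rx)*N = b*V*N + b * ta*(rx*N)" by (simp add: algebra_simps)
  also have "... = ry*N" unfolding e by (simp add: N_def algebra_simps power2_eq_square)
  finally have "ry*N = b*(V + ta*rx)*N" ..
  with 1 show "rx = a*(U + ta*ry)" "ry = b*(V + ta*rx)" using N by simp_all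
 qed
 define ca cb px py where "ca = cr a" and "cb = cr b" and "px = cr rx" and "py = ch * cr ry"
 have cab: "ca + cb = ca * cb" unfolding ca_def cb_def using ab by (metis of_real_add of_real_mult)
 have AB: "A = ca - 1" "B = cb - 1" by (simp_all add: ca_def cb_def)
 have AB1: "A*B = 1" unfolding AB using cab by (simp add: algebra_simps)
 have C0: "Cst = 0" unfolding Cst_def AB1 by simp
 have w: "w' = 0" unfolding uvw' w0_def d11 by simp
 have th: "cr ta*(ch^2 + 1) = ch" by (metis of_real_1 of_real_add of_real_mult of_real_power tau_h(1))
 have c1: "px*(ch^2 + 1) = ca*(u' + py)"
 proof -
  have "px = cr (a*(U + ta*ry))" by (simp only: px_def r1(1)[symmetric])
  hence "px = ca*(of_real U + of_real ta * of_real ry)" by (simp add: ca_def)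
  hence "px*(ch^2 + 1) = ca*((ch^2 + 1) * of_real U + (cr ta*(ch^2 + 1)) * of_real ry)" by (simp add: algebra_simps)
  thus ?thesis unfolding th uvw' U_def py_def .
 qed
 have c2: "py*(ch^2 + 1) = cb*(v' + ch^2*px)"
 proof -
  have "cr ry = cr (b*(V + ta*rx))" by (simp only: r1(2)[symmetric])
  hence "cr ry = cb*(of_real V + of_real ta*px)" by (simp add: cb_def px_def)
  hence "py*(ch^2 + 1) = cb*((ch^2 + 1) * ch * of_real V + ch*(cr ta*(ch^2 + 1))*px)" unfolding py_def by (simp add: algebra_simps)
  thus ?thesis unfolding th uvw' V_def by (simp add: power2_eq_square)
 qed
 define PX PY PY' where "PX = DX - [:0,px:]" and "PY = DY - [:0,py:]" and "PY' = DY' - [:0,py:]"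
 \<comment> \<open>\<open>D\<close> stands for \<open>DY\<close> or \<open>DY'\<close>; both satisfy
   the conic equation, so one computation gives both relations.\<close>
 have id: "smult cb (smult (A*(ch^2 + 1)) DX - smult (A + 1) D)*(D - [:0,py:]) + smult ca (smult (B*(ch^2 + 1)) D - smult ((B + 1) * ch^2) DX)*(DX - [:0,px:]) = 0"
  if D: "smult (ch^2 + 1) (DX*D) = D*D + smult (ch^2) (DX*DX) + [:0,1:]*(smult u' D + smult v' DX) + [:0,0,w':]" for D
 proof -
  have "poly (smult cb (smult (A*(ch^2 + 1)) DX - smult (A + 1) D)*(D - [:0,py:]) + smult ca (smult (B*(ch^2 + 1)) D - smult ((B + 1) * ch^2) DX)*(DX - [:0,px:])) s = 0" for s
  proof -
   define x y where "x = poly DX s" and "y = poly D s"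
   have con: "(ch^2 + 1)*(x*y) = y*y + ch^2*(x*x) + s*(u'*y + v'*x)"
    using arg_cong[OF D, of "%p. poly p s"] by (simp add: x_def y_def w algebra_simps)
   have bA: "cb*A = ca" "ca*B = cb" unfolding AB using cab by (simp_all add: algebra_simps)
   have "cb*(A*(ch^2 + 1)*x - ca*y)*(y - s*py) + ca*(B*(ch^2 + 1)*y - cb * ch^2*x)*(x - s*px)
    = (cb*A)*(ch^2 + 1)*(x*y) + (ca*B)*(ch^2 + 1)*(x*y) - ca * cb*(y*y) - ca * cb * ch^2*(x*x)
     - s*x*(cb*A)*(py*(ch^2 + 1)) + ca * cb * s*y*py - s*y*(ca*B)*(px*(ch^2 + 1)) + ca * cb * ch^2 * s*x*px"
    by (simp add: algebra_simps)
   also have "... = (ca + cb)*((ch^2 + 1)*(x*y)) - ca * cb*(y*y) - ca * cb * ch^2*(x*x)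
     - s*x * ca*(cb*(v' + ch^2*px)) + ca * cb * s*y*py - s*y * cb*(ca*(u' + py)) + ca * cb * ch^2 * s*x*px"
    unfolding bA c1 c2 by (simp add: algebra_simps)
   also have "... = 0" unfolding cab con by (simp add: algebra_simps)
   moreover have "A + 1 = ca" "B + 1 = cb" "poly [:0,py:] s = s*py" "poly [:0,px:] s = s*px" by (simp_all add: ca_def cb_def)
   ultimately show ?thesis unfolding poly_add poly_mult poly_smult poly_diff x_def[symmetric] y_def[symmetric] by (simp only:)
  qed
  thus ?thesis by (intro poly_eq_poly_eq_iff[THEN iffD1] ext) (simp only: poly_0)
 qed
 have I1: "smult cb (nA A cx cy ch)*PY = - (smult ca (nB B cx cy ch)*PX)"
  using id[OF conic_poly(1)] unfolding PX_def PY_def nA_DX by (simp only: eq_neg_iff_add_eq_0)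
 have I2: "smult cb (nA' A cx cy ch)*PY' = - (smult ca (nB' B cx cy ch)*PX)"
  using id[OF conic_poly(2)] unfolding PX_def PY'_def nA_DX by (simp only: eq_neg_iff_add_eq_0)
 define M1 M2 N1 N2 where "M1 = toR (smult cb (nA A cx cy ch))" and "M2 = - toR (smult ca (nB B cx cy ch))"
  and "N1 = toR (smult cb (nA' A cx cy ch))" and "N2 = - toR (smult ca (nB' B cx cy ch))"
 have Mnz: "M1~=0" "M2~=0" "N1~=0" "N2~=0" using n_nz ab_pos by (simp_all add: M1_def M2_def N1_def N2_def ca_def cb_def)
 have PXY: "PX = DX^1 - smult px ([:0,1:]^1)" "PY = DY^1 - smult (of_real ry * ch^1) ([:0,1:]^1)"
  "PY' = DY'^1 - smult (of_real ry * ch^1) ([:0,1:]^1)"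
  by (simp_all add: PX_def PY_def PY'_def py_def mult.commute)
 have 1: "M1*fh^1 = M2*gh^1" "N1*fh^1 = N2*qd.dil gh^1"
  using E1' E2' unfolding C0 M1_def M2_def N1_def N2_def toR_smult ca_def cb_def by (simp_all add: eq_neg_iff_add_eq_0)
 have 2: "M1*toR PY = M2*toR PX" "N1*toR PY' = N2*toR PX"
  using I1 I2 unfolding M1_def M2_def N1_def N2_def by (metis mult_minus_left toR_mult toR_uminus)+
 have "EX r>0. ALL x. norm x < r --> Q x 0^1*(1 - px*X1^1*x^1) = 1"
   "EX r>0. ALL y. norm y < r --> Q 0 y^1*(1 - of_real ry*Y1^1*y^1) = 1"
  by (rule closed_forms[OF zero_less_one PXY 1(1) 2(1) 1(2) 2(2) Mnz])+
 thus "EX r>0. ALL x. norm x < r --> Q x 0*(1 - of_real rh*x) = 1" "EX r>0. ALL y. norm y < r --> Q 0 y*(1 - of_real rh'*y) = 1"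
  unfolding rh rh' by (simp_all add: px_def X1_def Y1_def)
qed

theorem algebraic_closed_form:
 assumes ab: "a = 2" "b = 2" and d0: "d (1, 0) = 0" "d (0, 1) = 0"
 defines "p == 4*d (1, 1)*d (1, -1)*t^2/(1 - 4*d (1, -1)*d (-1, 1)*t^2)"
  and "p' == 4*d (1, 1)*d (-1, 1)*t^2/(1 - 4*d (1, -1)*d (-1, 1)*t^2)"
 shows "EX r>0. ALL x. norm x < r --> Q x 0^2*(1 - of_real p*x^2) = 1"
  "EX r>0. ALL y. norm y < r --> Q 0 y^2*(1 - of_real p'*y^2) = 1"
  "1 - 4*d (1, -1)*d (-1, 1)*t^2 > 0"
proof -
 have De: "De = 1 - 4*d (1, -1)*d (-1, 1)*t^2" by (simp add: De_def tau_square mult_ac)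
 thus "1 - 4*d (1, -1)*d (-1, 1)*t^2 > 0" using Delta(2) by simp
 have uv: "u' = 0" "v' = 0" unfolding uvw' u0_def v0_def d0 by simp_all
 have A1: "A = 1" "B = 1" using ab by simp_all
 have C0: "Cst = 0" unfolding Cst_def A1 by simp
 \<comment> \<open>Chosen to satisfy P (ch^2 - 1)^2 = 4 w'. Modulo the conic, the squares of
   \<open>nA\<close> and \<open>nB\<close> are then the same constant multiple of \<open>PX\<close>
   and \<open>PY\<close>.\<close>
 define s where "s = 4*(w0/L2) * ta/De"
 have Lz: "L~=0" "al~=0" "be~=0" "De~=0" "L2~=0" using L_pos ab_sqrt Delta by auto
 have wt: "w0 * ta = t^2*d (1, 1)" using Lz unfolding ab_sqrt(5)[symmetric] w0_def by (simp add: power2_eq_square)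
 have "s*(x*L)^2 = 4*(w0 * ta)*x^2/De" for x
  unfolding s_def power_mult_distrib L_pos(3) using Lz by (simp add: field_simps)
 hence pp: "p = s*(al*L)^2" "p' = s*(be*L)^2"
  unfolding p_def p'_def De[symmetric] wt by (simp_all add: ab_sqrt(3,4) mult_ac)
 define P where "P = cr s"
 have q1: "ch^2 - 1~=0" using qd.q_gt1 by auto
 have Pw: "P*(ch\<^sup>2 - 1)^2 = 4*w'"
 proof -
  have "s*(h\<^sup>2 - 1)^2 = 4*((h^2 + 1)*h*(w0/L2))"
  proof -
   define m n where "m = h^2 - 1" and "n = h^2 + 1"
   have "h^2 > 1" using h_gt1 by (simp add: one_less_power)
   hence H: "m~=0" "n~=0" by (simp_all add: m_def n_def)
   have "ta/De*m^2 = n*h" unfolding Delta(1) ta_def m_def[symmetric] n_def[symmetric] using H by (simp add: field_simps power2_eq_square)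
   hence "ta/De*(h\<^sup>2 - 1)^2 = (h^2 + 1)*h" by (simp only: m_def n_def)
   hence "4*(w0/L2)*(ta/De*(h\<^sup>2 - 1)^2) = 4*(w0/L2)*((h^2 + 1)*h)" by simp
   thus ?thesis unfolding s_def by (simp add: mult_ac)
  qed
  hence "cr (s*(h\<^sup>2 - 1)^2) = cr (4*((h^2 + 1)*h*(w0/L2)))" by simp
  thus ?thesis unfolding uvw' P_def by simp
 qed
 define PX PY PY' where "PX = DX^2 - smult P ([:0,1:]^2)" and "PY = DY^2 - smult (P * ch^2) ([:0,1:]^2)"
  and "PY' = DY'^2 - smult (P * ch^2) ([:0,1:]^2)"
 have id: "(smult (A*(ch^2 + 1)) DX - smult (A + 1) D)^2*(D^2 - smult (P * ch^2) ([:0,1:]^2)) =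
   (smult (B*(ch^2 + 1)) D - smult ((B + 1) * ch^2) DX)^2*(DX^2 - smult P ([:0,1:]^2))"
  if D: "smult (ch^2 + 1) (DX*D) = D*D + smult (ch^2) (DX*DX) + [:0,1:]*(smult u' D + smult v' DX) + [:0,0,w':]" for D
 proof -
  have "poly ((smult (A*(ch^2 + 1)) DX - smult (A + 1) D)^2*(D^2 - smult (P * ch^2) ([:0,1:]^2))) s =
   poly ((smult (B*(ch^2 + 1)) D - smult ((B + 1) * ch^2) DX)^2*(DX^2 - smult P ([:0,1:]^2))) s" for s
  proof -
   define x y k where "x = poly DX s" and "y = poly D s" and "k = ch^2"
   have con: "(k + 1)*(x*y) = y*y + k*(x*x) + s * s*w'"
    using arg_cong[OF D, of "%p. poly p s"] by (simp add: x_def y_def k_def uv algebra_simps)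
   have "((k + 1)*x - 2*y)^2 = (k + 1)^2*(x*x) - 4*((k + 1)*(x*y)) + 4*(y*y)" by (simp add: power2_eq_square algebra_simps)
   also have "... = (k - 1)^2*(x*x) - 4*w'*(s * s)" unfolding con by (simp add: power2_eq_square algebra_simps)
   finally have a: "((k + 1)*x - 2*y)^2 = (k - 1)^2*(x*x) - P*(k - 1)^2*(s * s)" using Pw by (simp add: k_def)
   have "((k + 1)*y - 2*k*x)^2 = (k + 1)^2*(y*y) - 4*k*((k + 1)*(x*y)) + 4*k*k*(x*x)" by (simp add: power2_eq_square algebra_simps)
   also have "... = (k - 1)^2*(y*y) - k*(4*w')*(s * s)" unfolding con by (simp add: power2_eq_square algebra_simps)
   finally have b: "((k + 1)*y - 2*k*x)^2 = (k - 1)^2*(y*y) - k*(P*(k - 1)^2)*(s * s)" using Pw by (simp add: k_def)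
   have "((k + 1)*x - 2*y)^2*(y^2 - P*k*(s * s)) = ((k + 1)*y - 2*k*x)^2*(x^2 - P*(s * s))"
    unfolding a b by (simp add: power2_eq_square algebra_simps)
   thus ?thesis unfolding poly_add poly_mult poly_smult poly_diff poly_power x_def[symmetric] y_def[symmetric] A1
    by (simp add: k_def power2_eq_square mult_ac)
  qed
  thus ?thesis by (metis poly_eq_poly_eq_iff ext)
 qed
 have I1: "nA A cx cy ch^2*PY = nB B cx cy ch^2*PX" unfolding PX_def PY_def nA_DX by (rule id[OF conic_poly(1)])
 have I2: "nA' A cx cy ch^2*PY' = nB' B cx cy ch^2*PX" unfolding PX_def PY'_def nA_DX by (rule id[OF conic_poly(2)])
 define M1 M2 N1 N2 where "M1 = toR (nA A cx cy ch^2)" and "M2 = toR (nB B cx cy ch^2)"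
  and "N1 = toR (nA' A cx cy ch^2)" and "N2 = toR (nB' B cx cy ch^2)"
 have Mnz: "M1~=0" "M2~=0" "N1~=0" "N2~=0" using n_nz by (simp_all add: M1_def M2_def N1_def N2_def)
 have two: "fls_const (cr a)~=0" using ab_pos by simp
 have sq: "x^2*f^2 = y^2*g^2" if "fls_const (cr a)*x*f + fls_const (cr a)*y*g = 0" for x y f g
 proof -
  have "fls_const (cr a)*(x*f + y*g) = 0" using that by (simp only: algebra_simps)
  hence "x*f = - (y*g)" using two by (simp add: eq_neg_iff_add_eq_0)
  hence "(x*f)^2 = (y*g)^2" by simp
  thus ?thesis by (simp only: power_mult_distrib)
 qed
 have ba: "cr b = cr a" using ab by simp
 have 1: "M1*fh^2 = M2*gh^2" unfolding M1_def M2_def toR_power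
  by (rule sq) (use E1'[unfolded C0 ba] in "simp only: fls_const_0 mult_zero_left add_0_left")
 have 2: "N1*fh^2 = N2*qd.dil gh^2" unfolding N1_def N2_def toR_power
  by (rule sq) (use E2'[unfolded C0 ba] in "simp only: fls_const_0 mult_zero_left add_0_left")
 have 3: "M1*toR PY = M2*toR PX" "N1*toR PY' = N2*toR PX"
  using I1 I2 unfolding M1_def M2_def N1_def N2_def by (metis toR_mult)+
 have "EX r>0. ALL x. norm x < r --> Q x 0^2*(1 - P*X1^2*x^2) = 1"
   "EX r>0. ALL y. norm y < r --> Q 0 y^2*(1 - P*Y1^2*y^2) = 1"
  by (rule closed_forms[OF zero_less_numeral PX_def PY_def PY'_def 1 3(1) 2 3(2) Mnz])+
 thus "EX r>0. ALL x. norm x < r --> Q x 0^2*(1 - of_real p*x^2) = 1" "EX r>0. ALL y. norm y < r --> Q 0 y^2*(1 - of_real p'*y^2) = 1"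
  unfolding pp by (simp_all add: P_def X1_def Y1_def)
qed

end

subsection \<open>Rationality and algebraic degree\<close>

lemma deg_in_le_iff: "deg_in i p<=n \<longleftrightarrow> (ALL m:keys p. lookup m i<=n)"
 unfolding deg_in_def by (subst Max_le_iff) auto

text \<open>Polynomials of the required shape can then be given by a formula for their values; the
  degree is counted in variable 2, which holds the value of the function.\<close>

definition poly_fun :: "nat set => nat => ((nat => complex) => complex) => bool" where
 "poly_fun V n f \<longleftrightarrow> (EX P. vars_in V P & deg_in 2 P<=n & (ALL v. mpeval P v = f v))"

lemma poly_fun_const: "poly_fun V n (%v. c)"
 unfolding poly_fun_def
 by (rule exI[of _ "single 0 c"]) (auto simp: vars_in_def deg_in_le_iff split: if_splits)

lemma poly_fun_var: "i : V ==> (if i = 2 then 1 else 0)<=n ==> poly_fun V n (%v. v i)"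
 unfolding poly_fun_def
 by (rule exI[of _ "single (single i 1) 1"])
  (auto simp: vars_in_def deg_in_le_iff lookup_single when_def split: if_splits)

lemma poly_fun_add: "poly_fun V n f ==> poly_fun V n g ==> poly_fun V n (%v. f v + g v)"
proof -
 assume "poly_fun V n f" "poly_fun V n g"
 then obtain P R where P: "vars_in V P" "deg_in 2 P<=n" "!!v. mpeval P v = f v"
  and R: "vars_in V R" "deg_in 2 R<=n" "!!v. mpeval R v = g v" unfolding poly_fun_def by blast
 have "vars_in V (P + R)" "deg_in 2 (P + R)<=n"
  using P(1,2) R(1,2) Poly_Mapping.keys_add[of P R] unfolding vars_in_def deg_in_le_iff by blast+
 thus ?thesis unfolding poly_fun_def using P(3) R(3) by (auto simp: mpeval_add)
qed

lemma poly_fun_mult: "poly_fun V n f ==> poly_fun V m g ==> n + m<=k ==> poly_fun V k (%v. f v * g v)"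
proof -
 assume "poly_fun V n f" "poly_fun V m g" and k: "n + m<=k"
 then obtain P R where P: "vars_in V P" "deg_in 2 P<=n" "!!v. mpeval P v = f v"
  and R: "vars_in V R" "deg_in 2 R<=m" "!!v. mpeval R v = g v" unfolding poly_fun_def by blast
 have K: "EX a:keys P. EX b:keys R. u = a + b" if "u : keys (P*R)" for u
  using that Poly_Mapping.keys_mult[of P R] by blast
 have "vars_in V (P*R)" unfolding vars_in_def
 proof
  fix u assume "u : keys (P*R)"
  then obtain a b where ab: "a : keys P" "b : keys R" "u = a + b" using K by blast
  thus "keys u<=V" using P(1) R(1) Poly_Mapping.keys_add[of a b] unfolding vars_in_def by blast
 qed
 moreover have "deg_in 2 (P*R)<=k" unfolding deg_in_le_iff
 proof
  fix u assume "u : keys (P*R)"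
  then obtain a b where ab: "a : keys P" "b : keys R" "u = a + b" using K by blast
  hence "lookup a 2<=n" "lookup b 2<=m" using P(2) R(2) unfolding deg_in_le_iff by blast+
  thus "lookup u 2<=k" using k by (simp add: ab(3) lookup_add)
 qed
 ultimately show ?thesis unfolding poly_fun_def using P(3) R(3) by (auto simp: mpeval_mult)
qed

lemma poly_fun_mult0: "poly_fun V 0 f ==> poly_fun V n g ==> poly_fun V n (%v. f v * g v)"
 by (rule poly_fun_mult) auto

lemma poly_fun_diff: "poly_fun V n f ==> poly_fun V n g ==> poly_fun V n (%v. f v - g v)"
 using poly_fun_add[of V n f "%v. - 1*g v"] poly_fun_mult0[OF poly_fun_const[of V 0 "- 1"], of n g] by simp

lemma poly_fun_power0: "poly_fun V 0 f ==> poly_fun V 0 (%v. f v^k)"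
 by (induction k) (auto intro: poly_fun_const poly_fun_mult0)

lemmas poly_fun_intros = poly_fun_const poly_fun_add poly_fun_diff poly_fun_mult0 poly_fun_power0

lemma infinite_punctured_ball: "r > 0 ==> infinite (ball (0::complex) r - {0})"
 using uncountable_ball[of r "0::complex"] countable_finite by (metis finite_Diff_insert Diff_empty)

lemma poly_zero_on_ball:
 assumes "r > 0" "!!x. norm x < r ==> x~=0 ==> poly p x = 0"
 shows "p = (0 :: complex poly)"
proof (rule ccontr)
 assume "p~=0"
 hence "finite {x. poly p x = 0}" by (rule poly_roots_finite)
 moreover have "ball 0 r - {0}<={x. poly p x = 0}" using assms(2) by auto
 ultimately show False using infinite_punctured_ball[OF assms(1)] finite_subset by blast
qed

text \<open>\<open>T\<close> stands for an inverse square root of \<open>D\<close>: up to powers of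
  \<open>D\<close> the function becomes linear in \<open>T\<close>, which is what makes a change of
  sign of \<open>T\<close> tractable.\<close>

definition reducible :: "complex poly => (complex => complex => complex) => bool" where
 "reducible D f \<longleftrightarrow> (EX e0 e1 N. ALL x T. poly D x*T^2 = 1 --> poly D x^N*f x T = poly e0 x + poly e1 x*T)"

lemma reducible_poly: "(!!x. f x = poly p x) ==> reducible D (%x T. f x)"
 unfolding reducible_def by (rule exI[of _ p], rule exI[of _ 0], rule exI[of _ 0]) simp

lemma reducible_T: "reducible D (%x T. T)"
 unfolding reducible_def by (rule exI[of _ 0], rule exI[of _ 1], rule exI[of _ 0]) simp

lemma reducible_add: "reducible D f ==> reducible D g ==> reducible D (%x T. f x T + g x T)"
proof -
 assume "reducible D f" "reducible D g"
 then obtain e0 e1 N g0 g1 M where e: "!!x T. poly D x*T^2 = 1 ==> poly D x^N*f x T = poly e0 x + poly e1 x*T"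
  and g: "!!x T. poly D x*T^2 = 1 ==> poly D x^M*g x T = poly g0 x + poly g1 x*T" unfolding reducible_def by metis
 have "poly D x^(N + M)*(f x T + g x T) = poly (D^M*e0 + D^N*g0) x + poly (D^M*e1 + D^N*g1) x*T"
  if "poly D x*T^2 = 1" for x T
 proof -
  have "poly D x^(N + M)*(f x T + g x T) = poly D x^M*(poly D x^N*f x T) + poly D x^N*(poly D x^M*g x T)"
   by (simp add: power_add algebra_simps)
  also have "... = poly D x^M*(poly e0 x + poly e1 x*T) + poly D x^N*(poly g0 x + poly g1 x*T)" by (simp only: e[OF that] g[OF that])
  finally show ?thesis by (simp add: algebra_simps)
 qed
 thus ?thesis unfolding reducible_def by blast
qed

lemma reducible_mult: "reducible D f ==> reducible D g ==> reducible D (%x T. f x T*g x T)"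
proof -
 assume "reducible D f" "reducible D g"
 then obtain e0 e1 N g0 g1 M where e: "!!x T. poly D x*T^2 = 1 ==> poly D x^N*f x T = poly e0 x + poly e1 x*T"
  and g: "!!x T. poly D x*T^2 = 1 ==> poly D x^M*g x T = poly g0 x + poly g1 x*T" unfolding reducible_def by metis
 have "poly D x^(N + M + 1)*(f x T*g x T) = poly (D*e0*g0 + e1*g1) x + poly (D*(e0*g1 + e1*g0)) x*T"
  if T: "poly D x*T^2 = 1" for x T
 proof -
  have "poly D x^(N + M + 1)*(f x T*g x T) = poly D x*((poly D x^N*f x T)*(poly D x^M*g x T))"
   by (simp add: power_add algebra_simps)
  also have "... = poly D x*((poly e0 x + poly e1 x*T)*(poly g0 x + poly g1 x*T))" by (simp only: e[OF T] g[OF T])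
  also have "... = poly D x*poly e0 x*poly g0 x + poly e1 x*poly g1 x*(poly D x*T^2) + poly D x*(poly e0 x*poly g1 x + poly e1 x*poly g0 x)*T"
   by (simp add: algebra_simps power2_eq_square)
  finally show ?thesis unfolding T by simp
 qed
 thus ?thesis unfolding reducible_def by blast
qed

lemma reducible_power: "reducible D f ==> reducible D (%x T. f x T^k)"
proof (induction k)
 case 0
 show ?case using reducible_poly[of "%_. 1" 1 D] by simp
next
 case (Suc k)
 thus ?case using reducible_mult[of D f "%x T. f x T^k"] by simp
qed

lemma reducible_sum: "finite I ==> (!!i. i : I ==> reducible D (f i)) ==> reducible D (%x T. SUM i:I. f i x T)"
proof (induction I rule: finite_induct)
 case empty
 show ?case using reducible_poly[of "%_. 0" 0 D] by simp
next
 case (insert i I)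
 thus ?case using reducible_add[of D "f i" "%x T. SUM i:I. f i x T"] by simp
qed

text \<open>\<open>e\<^sub>0\<^sup>2 D = e\<^sub>1\<^sup>2\<close> is impossible for polynomials, since the roots of \<open>D\<close> are simple.\<close>

lemma conjugate_root:
 assumes f: "reducible [:1,0,-p:] f" and p: "p~=0" and r: "r > 0"
  and ph: "!!x. norm x < r ==> ph x^2*(1 - p*x^2) = 1" and z: "!!x. norm x < r ==> f x (ph x) = 0"
  and x: "norm x < r"
 shows "f x (- ph x) = 0"
proof -
 define D where "D = [:1,0,-p:]"
 have Dx: "poly D x = 1 - p*x^2" for x by (simp add: D_def power2_eq_square algebra_simps)
 obtain e0 e1 N where e: "!!x T. poly D x*T^2 = 1 ==> poly D x^N*f x T = poly e0 x + poly e1 x*T"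
  using f unfolding reducible_def D_def by blast
 have D1: "poly D x * ph x^2 = 1" if "norm x < r" for x using ph[OF that] by (simp add: Dx mult.commute)
 have "D*(e0*e0) - e1*e1 = 0"
 proof (rule poly_zero_on_ball[OF r])
  fix x :: complex assume x: "norm x < r"
  have "poly e0 x = - (poly e1 x * ph x)" using e[OF D1[OF x]] z[OF x] by (simp add: eq_neg_iff_add_eq_0)
  hence "poly D x*(poly e0 x*poly e0 x) = poly e1 x*poly e1 x*(poly D x * ph x^2)" by (simp add: power2_eq_square mult_ac)
  thus "poly (D*(e0*e0) - e1*e1) x = 0" unfolding D1[OF x] by simp
 qed
 hence eq: "D*(e0*e0) = e1*e1" by simp
 have "e0 = 0"
 proof (rule ccontr)
  assume e0: "e0~=0"
  define w where "w = csqrt (1/p)"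
  have w2: "w*w = 1/p" by (simp add: w_def power2_eq_square[symmetric])
  have wz: "w~=0" using w2 p by auto
  have DD: "D = smult (-p) ([:-w,1:]*[:-(-w),1:])" using w2 p by (simp add: D_def)
  have "D~=0" by (simp add: D_def)
  moreover have "e0*e0~=0" using e0 by simp
  ultimately have nz: "D~=0" "D*(e0*e0)~=0" "e0*e0~=0" by (metis mult_eq_0_iff)+
  have "[:-w,1:]*[:-(-w),1:]~=0" by (metis DD nz(1) smult_0_right)
  hence "order w D = order w [:-w,1:] + order w [:-(-w),1:]"
   unfolding DD using p by (subst order_smult) (simp_all only: order_mult neg_equal_0_iff_equal not_False_eq_True)
  moreover have "w~=- w" using wz by simp
  ultimately have o1: "order w D = 1" unfolding order_lin by simp
  \<comment> \<open>The order is odd on one side and even on the other.\<close>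
  have "order w (D*(e0*e0)) = 1 + (order w e0 + order w e0)" using order_mult[OF nz(2), of w] order_mult[OF nz(3), of w] o1 by simp
  moreover have "order w (e1*e1) = order w e1 + order w e1" by (rule order_mult) (use nz(2) eq in simp)
  ultimately have "1 + (order w e0 + order w e0) = order w e1 + order w e1" using eq by simp
  thus False by presburger
 qed
 moreover from this have "e1 = 0" using eq by simp
 ultimately have "poly D x^N*f x (- ph x) = 0" using e[of x "- ph x"] D1[OF x] by simp
 moreover have "poly D x~=0" using D1[OF x] by auto
 ultimately show ?thesis by simp
qed

lemma moneval_3:
 assumes "keys m<={0, 1, 2}"
 shows "moneval m (%i. if i = 0 then x else if i = 1 then y else z) =
  x^lookup m 0*y^lookup m 1*z^lookup m 2"
 by (subst moneval_superset[OF _ assms]) (auto simp: mult.assoc)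

text \<open>The square roots behind \<open>ph\<close> and \<open>ps\<close> are independent, so
  \<open>F\<close> has four conjugates obtained by changing their signs. They are generically
  distinct, which excludes degree at most 3; eliminating both signs gives a biquadratic
  equation.\<close>

theorem algebraic_degree_4:
 fixes al be de p p' :: complex
 assumes nz: "al~=0" "be~=0" "p~=0" "p'~=0" and r: "r > 0"
  and ph: "!!x. norm x < r ==> ph x^2*(1 - p*x^2) = 1" and ps: "!!y. norm y < r ==> ps y^2*(1 - p'*y^2) = 1"
  and rel: "!!x y. norm x < r ==> norm y < r ==>
   (x*y - (al*x^2 + be*y^2 + de*x^2*y^2))*F x y = (x*y/2 - al*x^2) * ph x + (x*y/2 - be*y^2) * ps y"
 shows "algebraic_deg2 F 4"
proof -
 define K A B D1 D2 where "K x y = x*y - (al*x^2 + be*y^2 + de*x^2*y^2)" and "A x y = x*y/2 - al*x^2"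
  and "B x y = x*y/2 - be*y^2" and "D1 x = 1 - p*x^2" and "D2 y = 1 - p'*y^2" for x y
 have rel': "K x y*F x y = A x y * ph x + B x y * ps y" if "norm x < r" "norm y < r" for x y
  using rel[OF that] by (simp add: K_def A_def B_def)
 have D1: "D1 x * ph x^2 = 1" if "norm x < r" for x using ph[OF that] by (simp add: D1_def mult.commute)
 have D2: "D2 y * ps y^2 = 1" if "norm y < r" for y using ps[OF that] by (simp add: D2_def mult.commute)
 have low: "4<=deg_in 2 P" if P: "alg_annihilates F P" for P
 proof (rule ccontr)
  assume "~ 4<=deg_in 2 P"
  hence deg: "deg_in 2 P<=3" by simp
  from P obtain r0 where P0: "P~=0" "vars_in {0, 1, 2} P" "r0 > 0"
   and ann: "!!x y. norm x < r0 ==> norm y < r0 ==> mpeval P (%i. if i = 0 then x else if i = 1 then y else F x y) = 0"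
   unfolding alg_annihilates_def by blast
  define rh where "rh = min r r0"
  have rh: "rh > 0" using r P0 by (simp add: rh_def)
  define KS where "KS = keys P"
  have fin: "finite KS" by (simp add: KS_def)
  have m3: "lookup m 2<=3" if "m : KS" for m using deg that unfolding deg_in_le_iff KS_def by blast
  have mk: "keys m<={0, 1, 2}" if "m : KS" for m using P0(2) that unfolding vars_in_def KS_def by blast
  define c where "c m = lookup P m" for m
  define l0 l1 l2 :: "(nat \<Rightarrow>\<^sub>0 nat) => nat" where "l0 m = lookup m 0" and "l1 m = lookup m 1" and "l2 m = lookup m 2" for m
  have ev: "mpeval P (%i. if i = 0 then x else if i = 1 then y else z) = (SUM m:KS. c m*(x^l0 m*y^l1 m*z^l2 m))" for x y z
   unfolding mpeval_def KS_def[symmetric] c_def l0_def l1_def l2_def by (intro sum.cong refl) (simp add: moneval_3[OF mk])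
  \<comment> \<open>The annihilating polynomial at \<open>(A x y*T + B x y*V)/K x y\<close>,
    multiplied by the cube of \<open>K x y\<close> so as to be polynomial in \<open>T\<close> and
    \<open>V\<close>.\<close>
  define G where "G x y T V = (SUM m:KS. c m*(x^l0 m*y^l1 m*((A x y*T + B x y*V)^l2 m*K x y^(3 - l2 m))))" for x y T V
  have GP: "G x y T V = K x y^3*mpeval P (%i. if i = 0 then x else if i = 1 then y else z)" if "K x y*z = A x y*T + B x y*V" for x y z T V
   unfolding ev G_def sum_distrib_left
  proof (intro sum.cong refl)
   fix m assume "m : KS"
   hence "K x y^3 = K x y^l2 m*K x y^(3 - l2 m)" using m3 by (simp add: l2_def flip: power_add)
   hence "(A x y*T + B x y*V)^l2 m*K x y^(3 - l2 m) = K x y^3*z^l2 m" unfolding that[symmetric] by (simp add: power_mult_distrib mult_ac)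
   thus "c m*(x^l0 m*y^l1 m*((A x y*T + B x y*V)^l2 m*K x y^(3 - l2 m))) = K x y^3*(c m*(x^l0 m*y^l1 m*z^l2 m))"
    by (simp only:) (simp only: mult_ac)
  qed
  have G1: "G x y (ph x) (ps y) = 0" if "norm x < rh" "norm y < rh" for x y
   using GP[OF rel'[of x y]] ann[of x y] that by (simp add: rh_def)
  have red: "reducible D (%x T. SUM m:KS. c' m*(x^e m*((A' x*T + B' x)^l2 m*K' x^(3 - l2 m))))"
   if "reducible D (%x T. A' x)" "reducible D (%x T. B' x)" "reducible D (%x T. K' x)" for D c' e A' B' K'
   by (intro reducible_sum fin reducible_mult reducible_power reducible_add reducible_T that
    reducible_poly[of "%_. z" "[:z:]" for z] reducible_poly[of "%x. x" "[:0,1:]"]) simp_all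
  have redx: "reducible [:1,0,-p:] (%x T. G x y T V)" for y V
   using red[of "[:1,0,-p:]" "%x. A x y" "%x. B x y*V" "%x. K x y" "%m. c m*y^l1 m" l0]
    reducible_poly[of "%x. A x y" "[:0,y/2,- al:]"] reducible_poly[of "%x. B x y*V" "[:- be*y^2*V,y/2*V:]"]
    reducible_poly[of "%x. K x y" "[:- be*y^2,y,-(al + de*y^2):]"]
   unfolding G_def by (simp add: A_def B_def K_def power2_eq_square algebra_simps)
  have redy: "reducible [:1,0,-p':] (%y V. G x y T V)" for x T
   using red[of "[:1,0,-p':]" "%y. B x y" "%y. A x y*T" "%y. K x y" "%m. c m*x^l0 m" l1]
    reducible_poly[of "%y. A x y*T" "[:- al*x^2*T,x/2*T:]"] reducible_poly[of "%y. B x y" "[:0,x/2,- be:]"]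
    reducible_poly[of "%y. K x y" "[:- al*x^2,x,-(be + de*x^2):]"]
   unfolding G_def by (simp add: A_def B_def K_def power2_eq_square algebra_simps)
  have phrh: "ph x^2*(1 - p*x^2) = 1" "ps x^2*(1 - p'*x^2) = 1" if "norm x < rh" for x using ph ps that by (simp_all add: rh_def)
  have G2: "G x y (- ph x) (ps y) = 0" if "norm x < rh" "norm y < rh" for x y
   by (rule conjugate_root[OF redx nz(3) rh phrh(1) G1 that(1)]) (use that in auto)
  have G3: "G x y (ph x) (- ps y) = 0" if "norm x < rh" "norm y < rh" for x y
   by (rule conjugate_root[where f = "%y V. G x y (ph x) V", OF redy nz(4) rh phrh(2) G1 that(2)]) (use that in auto)
  have G4: "G x y (- ph x) (- ps y) = 0" if "norm x < rh" "norm y < rh" for x y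
   by (rule conjugate_root[where f = "%y V. G x y (- ph x) V", OF redy nz(4) rh phrh(2) G2 that(2)]) (use that in auto)
  \<comment> \<open>The conditions \<open>gen\<close> make the four conjugates distinct, more than a
    nonzero polynomial of degree at most 3 has roots.\<close>
  have coef: "(SUM m:KS. if l2 m = k then c m*x^l0 m*y^l1 m else 0) = 0"
   if xy: "norm x < rh" "norm y < rh" and gen: "K x y~=0" "A x y~=0" "B x y~=0" "A x y^2*D2 y~=B x y^2*D1 x" for x y k
  proof -
   define U W where "U = A x y * ph x/K x y" and "W = B x y * ps y/K x y"
   have d1: "D1 x * ph x^2 = 1" and d2: "D2 y * ps y^2 = 1" using D1 D2 xy by (simp_all add: rh_def)
   have "ph x~=0" "ps y~=0" using d1 d2 by auto
   hence UW: "U~=0" "W~=0" using gen by (simp_all add: U_def W_def)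
   have "U^2~=W^2"
   proof
    assume "U^2 = W^2"
    hence "A x y^2 * ph x^2 = B x y^2 * ps y^2" using gen(1) by (simp add: U_def W_def power_divide power_mult_distrib)
    hence "A x y^2*D2 y*(D1 x * ph x^2) = B x y^2*D1 x*(D2 y * ps y^2)" by (simp add: mult_ac)
    thus False using gen(4) unfolding d1 d2 by simp
   qed
   hence UWn: "U~=W" "U~=- W" by auto
   define R where "R = (SUM m:KS. monom (c m*x^l0 m*y^l1 m) (l2 m))"
   have Rz: "poly R z = mpeval P (%i. if i = 0 then x else if i = 1 then y else z)" for z
    unfolding ev R_def poly_sum poly_monom by (simp add: mult.assoc)
   have Gz: "poly R ((A x y*T + B x y*V)/K x y) = 0" if "G x y T V = 0" for T V
    unfolding Rz using GP[of x y "(A x y*T + B x y*V)/K x y" T V] that gen(1) by simp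
   have "poly R (U + W) = 0" "poly R (-U + W) = 0" "poly R (U + - W) = 0" "poly R (-U + - W) = 0"
    using Gz[OF G1[OF xy]] Gz[OF G2[OF xy]] Gz[OF G3[OF xy]] Gz[OF G4[OF xy]]
    by (simp_all add: U_def W_def add_divide_distrib diff_divide_distrib)
   hence sub: "{U + W, - U + W, U + - W, - U + - W}<={z. poly R z = 0}" by auto
   have card4: "card {U + W, - U + W, U + - W, - U + - W} = 4"
   proof -
    have "U + W~=- U + W" "U + - W~=- U + - W" using UW(1) by (auto simp: eq_neg_iff_add_eq_0)
    moreover have "U + W~=U + - W" "- U + W~=- U + - W" using UW(2) by (auto simp: eq_neg_iff_add_eq_0)
    moreover have "U + W~=- U + - W"
    proof -
     have "U + W~=0" using UWn(2) by (simp only: eq_neg_iff_add_eq_0 not_False_eq_True)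
     moreover have "z~=- z" if "z~=0" for z :: complex using that by simp
     ultimately have "U + W~=- (U + W)" by blast
     thus ?thesis by (simp only: minus_add_distrib not_False_eq_True)
    qed
    moreover have "- U + W~=U + - W" using UWn(1) by (auto simp: algebra_simps simp flip: mult_2)
    ultimately show ?thesis by simp
   qed
   have "R = 0"
   proof (rule ccontr)
    assume R: "R~=0"
    have "degree R<=3" unfolding R_def
     by (intro degree_sum_le fin order_trans[OF degree_monom_le]) (use m3 in "simp add: l2_def")
    moreover have "card {z. poly R z = 0}<=degree R" by (rule card_poly_roots_bound[OF R])
    moreover have "4<=card {z. poly R z = 0}" unfolding card4[symmetric] by (rule card_mono[OF poly_roots_finite[OF R] sub])
    ultimately show False by simp
   qed
   hence "0 = coeff R k" by simp
   thus ?thesis unfolding R_def coeff_sum by (simp add: if_distrib cong: if_cong)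
  qed
  obtain m where m: "m : KS" using P0(1) unfolding KS_def by (metis all_not_in_conv keys_eq_empty)
  define k i j where "k = l2 m" and "i = l0 m" and "j = l1 m"
  have stepy: "(SUM m:KS. if l2 m = k & l0 m = i then c m*y^l1 m else 0) = 0" if y: "norm y < rh" "y~=0" for y
  proof -
   \<comment> \<open>\<open>A x y\<close> vanishes at x = 0; with its factor x removed,
     \<open>g\<close> is nonzero at 0 and hence near 0, so points close to x = 0 are
     generic.\<close>
   define g where "g x = K x y*B x y*(A x y^2*D2 y - B x y^2*D1 x)*(y/2 - al*x)" for x
   have "isCont g 0" unfolding g_def[abs_def] K_def B_def A_def D1_def D2_def by (intro continuous_intros; simp)
   moreover have "g 0~=0" using nz y by (simp add: g_def K_def B_def A_def D1_def)
   ultimately have "eventually (%x. g x : - {0}) (nhds 0)" by (intro isCont_eventually) auto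
   then obtain e where e: "e > 0" "!!x. norm x < e ==> g x~=0" unfolding eventually_nhds_metric by (auto simp: dist_norm)
   define R where "R = (SUM m:KS. if l2 m = k then monom (c m*y^l1 m) (l0 m) else 0)"
   have "R = 0"
   proof (rule poly_zero_on_ball[of "min e rh"])
    fix x :: complex assume x: "norm x < min e rh" "x~=0"
    have gx: "g x~=0" using e(2) x by simp
    have Ax: "A x y = x*(y/2 - al*x)" by (simp add: A_def power2_eq_square algebra_simps)
    have "poly R x = (SUM m:KS. if l2 m = k then c m*x^l0 m*y^l1 m else 0)"
     unfolding R_def poly_sum by (intro sum.cong refl) (simp add: poly_monom)
    also have "... = 0" by (rule coef) (use gx x y in "auto simp: g_def Ax")
    finally show "poly R x = 0" .
   qed (use e rh in simp)
   hence "0 = coeff R i" by simp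
   also have "... = (SUM m:KS. if l2 m = k & l0 m = i then c m*y^l1 m else 0)"
    unfolding R_def coeff_sum by (intro sum.cong refl) auto
   finally show ?thesis ..
  qed
  define R where "R = (SUM m:KS. if l2 m = k & l0 m = i then monom (c m) (l1 m) else 0)"
  have "R = 0"
  proof (rule poly_zero_on_ball[OF rh])
   fix y :: complex assume y: "norm y < rh" "y~=0"
   have "poly R y = (SUM m:KS. if l2 m = k & l0 m = i then c m*y^l1 m else 0)"
    unfolding R_def poly_sum by (intro sum.cong refl) (simp add: poly_monom)
   thus "poly R y = 0" using stepy[OF y] by simp
  qed
  hence "0 = coeff R j" by simp
  also have "... = (SUM n:KS. if n = m then c m else 0)"
   unfolding R_def coeff_sum
  proof (intro sum.cong refl)
   fix n assume n: "n : KS"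
   have "n = m" if "l2 n = k" "l0 n = i" "l1 n = j"
   proof (rule poly_mapping_eqI)
    fix u
    show "lookup n u = lookup m u"
    proof (cases "u : {0, 1, 2}")
     case True thus ?thesis using that by (auto simp: k_def i_def j_def l0_def l1_def l2_def)
    next
     case False
     hence "u ~: keys n" "u ~: keys m" using mk n m by blast+
     thus ?thesis by (simp add: in_keys_iff)
    qed
   qed
   thus "coeff (if l2 n = k & l0 n = i then monom (c n) (l1 n) else 0) j = (if n = m then c m else 0)"
    by (auto simp: k_def i_def j_def)
  qed
  also have "... = c m" using fin m by (simp add: sum.delta)
  finally show False using m by (simp add: c_def KS_def in_keys_iff)
 qed
 have "EX P. alg_annihilates F P & deg_in 2 P<=4"
 proof -
  \<comment> \<open>With F = U + W the equation is (F^2 - U^2 - W^2)^2 = 4 U^2 W^2, here with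
    denominators cleared.\<close>
  define f where "f v = (D1 (v 0)*D2 (v 1)*K (v 0) (v 1)^2*(v 2 * v 2) - (A (v 0) (v 1)^2*D2 (v 1) + B (v 0) (v 1)^2*D1 (v 0)))
    * (D1 (v 0)*D2 (v 1)*K (v 0) (v 1)^2*(v 2 * v 2) - (A (v 0) (v 1)^2*D2 (v 1) + B (v 0) (v 1)^2*D1 (v 0)))
    - 4*A (v 0) (v 1)^2*B (v 0) (v 1)^2*D1 (v 0)*D2 (v 1)" for v :: "nat => complex"
  have v: "poly_fun {0, 1, 2} n (%v. v 0)" "poly_fun {0, 1, 2} n (%v. v 1)" "poly_fun {0, 1, 2} 1 (%v. v 2)" for n
   by (intro poly_fun_var; simp)+
  have pk: "poly_fun {0, 1, 2} 0 (%v. K (v 0) (v 1))" "poly_fun {0, 1, 2} 0 (%v. A (v 0) (v 1))" "poly_fun {0, 1, 2} 0 (%v. B (v 0) (v 1))"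
   "poly_fun {0, 1, 2} 0 (%v. D1 (v 0))" "poly_fun {0, 1, 2} 0 (%v. D2 (v 1))"
   unfolding K_def A_def B_def D1_def D2_def divide_inverse by (intro poly_fun_intros v)+
  have up: "poly_fun {0, 1, 2} n f" if "poly_fun {0, 1, 2} 0 f" for n f
   using poly_fun_mult0[OF that poly_fun_const[of _ n 1]] by simp
  have zz: "poly_fun {0, 1, 2} 2 (%v. v 2 * v 2)" by (rule poly_fun_mult[OF v(3) v(3)]) simp
  have lin: "poly_fun {0, 1, 2} 2 (%v. D1 (v 0)*D2 (v 1)*K (v 0) (v 1)^2*(v 2 * v 2) - (A (v 0) (v 1)^2*D2 (v 1) + B (v 0) (v 1)^2*D1 (v 0)))"
  proof (rule poly_fun_diff)
   show "poly_fun {0, 1, 2} 2 (%v. D1 (v 0)*D2 (v 1)*K (v 0) (v 1)^2*(v 2 * v 2))"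
    by (rule poly_fun_mult0[OF _ zz]) (intro poly_fun_intros pk)
   show "poly_fun {0, 1, 2} 2 (%v. A (v 0) (v 1)^2*D2 (v 1) + B (v 0) (v 1)^2*D1 (v 0))"
    by (rule up) (intro poly_fun_intros pk)
  qed
  have "poly_fun {0, 1, 2} 4 f" unfolding f_def
  proof (rule poly_fun_diff)
   show "poly_fun {0, 1, 2} 4 (%v. 4*A (v 0) (v 1)^2*B (v 0) (v 1)^2*D1 (v 0)*D2 (v 1))"
    by (rule up) (intro poly_fun_intros pk)
  qed (rule poly_fun_mult[OF lin lin], simp)
  then obtain P where P: "vars_in {0, 1, 2} P" "deg_in 2 P<=4" "!!v. mpeval P v = f v" unfolding poly_fun_def by blast
  \<comment> \<open>At this point \<open>A\<close> and the last variable vanish and \<open>f\<close>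
    reduces to the fourth power of \<open>be\<close>.\<close>
  have "mpeval P (%i. if i = 1 then 1 else 0)~=0"
   unfolding P(3) f_def using nz by (simp add: A_def B_def K_def D1_def)
  hence "P~=0" by auto
  moreover have "mpeval P (%i. if i = 0 then x else if i = 1 then y else F x y) = 0" if xy: "norm x < r" "norm y < r" for x y
  proof -
   have d: "D1 x * ph x^2 = 1" "D2 y * ps y^2 = 1" using D1 D2 xy by auto
   have "D1 x*D2 y*K x y^2*(F x y*F x y) = D1 x*D2 y*(K x y*F x y)^2" by (simp add: power2_eq_square mult_ac)
   also have "... = A x y^2*D2 y*(D1 x * ph x^2) + B x y^2*D1 x*(D2 y * ps y^2) + 2*A x y*B x y*D1 x*D2 y*(ph x * ps y)"
    unfolding rel'[OF xy] by (simp add: power2_eq_square algebra_simps)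
   finally have e: "D1 x*D2 y*K x y^2*(F x y*F x y) - (A x y^2*D2 y + B x y^2*D1 x) = 2*A x y*B x y*D1 x*D2 y*(ph x * ps y)"
    unfolding d by simp
   have "(2*A x y*B x y*D1 x*D2 y*(ph x * ps y))*(2*A x y*B x y*D1 x*D2 y*(ph x * ps y)) =
    4*A x y^2*B x y^2*D1 x*D2 y*((D1 x * ph x^2)*(D2 y * ps y^2))" by (simp add: power2_eq_square mult_ac)
   also have "... = 4*A x y^2*B x y^2*D1 x*D2 y" unfolding d by simp
   finally show ?thesis unfolding P(3) f_def using e by simp
  qed
  ultimately have "alg_annihilates F P" unfolding alg_annihilates_def using P(1) r by blast
  thus ?thesis using P(2) by blast
 qed
 then obtain P where "alg_annihilates F P" "deg_in 2 P<=4" by blast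
 hence "deg_in 2 P = 4" using low by (simp add: order_antisym)
 thus ?thesis unfolding algebraic_deg2_def using low `alg_annihilates F P` by blast
qed

text \<open>The product of \<open>f\<close> with the square root has square 1 and is continuous with
  value 1 at 0, which fixes the sign.\<close>

lemma reciprocal_csqrt:
 assumes "isCont f 0" "f 0 = 1" "r > 0" "!!x. norm x < r ==> f x^2*(1 - p*x^2) = 1"
 shows "EX r>0. ALL x. norm x < r --> f x = 1 / csqrt (1 - x^2*p)"
proof -
 have "isCont (%x. csqrt (1 - x^2*p)) 0" by (rule isCont_o2[where f = "%x. 1 - x^2*p"]) (auto intro!: continuous_intros continuous_at_csqrt simp: complex_nonpos_Reals_iff)
 hence "isCont (%x. f x * csqrt (1 - x^2*p)) 0" by (intro continuous_intros assms(1))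
 hence "eventually (%x. f x * csqrt (1 - x^2*p) : - {- 1}) (nhds 0)" by (rule isCont_eventually) (use assms(2) in auto)
 then obtain e where e: "e > 0" "!!x. norm x < e ==> f x * csqrt (1 - x^2*p)~=-1"
  unfolding eventually_nhds_metric by (auto simp: dist_norm)
 have "f x = 1 / csqrt (1 - x^2*p)" if x: "norm x < min e r" for x
 proof -
  have "(f x * csqrt (1 - x^2*p))^2 = f x^2*(1 - p*x^2)" by (simp add: power_mult_distrib mult.commute)
  also have "... = 1" using assms(4) x by simp
  finally have "f x * csqrt (1 - x^2*p) = 1" using e(2)[of x] x by (simp add: power2_eq_1_iff)
  thus ?thesis by (metis div_by_1 divide_divide_eq_right mult_zero_right nonzero_mult_div_cancel_right one_neq_zero)
 qed
 thus ?thesis using e(1) assms(3) by (intro exI[of _ "min e r"]) auto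
qed

context kernel_curve
begin

lemma Q_isCont: "isCont (%x. Q x 0) 0" "isCont (%y. Q 0 y) 0"
 using holomorphic_on_imp_continuous_on[OF Q_holomorphic_x[of 0]] holomorphic_on_imp_continuous_on[OF Q_holomorphic_y[of 0]]
 by (auto simp: continuous_on_eq_continuous_at)

theorem rational_case:
 assumes ab: "a + b = a*b" and d11: "d (1, 1) = 0"
 defines "rh == (a*d (1, 0)*t + a*b*d (1, -1)*d (0, 1)*t^2)/(1 - a*b*d (1, -1)*d (-1, 1)*t^2)"
  and "rh' == (b*d (0, 1)*t + a*b*d (-1, 1)*d (1, 0)*t^2)/(1 - a*b*d (1, -1)*d (-1, 1)*t^2)"
 shows "is_rational2 Q & (EX r>0. ALL x y. norm x < r & norm y < r -->
  Q x 0 = 1/(1 - x * cr rh) & Q 0 y = 1/(1 - y * cr rh'))"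
proof -
 define p p' where "p = cr rh" and "p' = cr rh'"
 obtain r1 where r1: "r1 > 0" "!!x. norm x < r1 ==> Q x 0*(1 - p*x) = 1"
  using rational_closed_form(1)[OF ab d11] unfolding p_def rh_def by blast
 obtain r2 where r2: "r2 > 0" "!!y. norm y < r2 ==> Q 0 y*(1 - p'*y) = 1"
  using rational_closed_form(2)[OF ab d11] unfolding p'_def rh'_def by blast
 define r where "r = min 1 (min r1 r2)"
 have r: "r > 0" using r1 r2 by (simp add: r_def)
 have x1: "Q x 0*(1 - p*x) = 1" if "norm x < r" for x using r1(2) that by (simp add: r_def)
 have y1: "Q 0 y*(1 - p'*y) = 1" if "norm y < r" for y using r2(2) that by (simp add: r_def)
 have inv: "q = 1/(1 - x*z)" if "q*(1 - z*x) = 1" for q x z :: complex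
  using that by (metis mult.commute mult_zero_right nonzero_eq_divide_eq zero_neq_one)
 define f g where "f v = (v 0 * v 1 - of_real t * step_poly (v 0) (v 1))*((1 - p * v 0)*(1 - p' * v 1))"
  and "g v = (of_real (1 - 1/a)*(v 0 * v 1) - of_real (t*d (1, -1)) * v 0^2)*(1 - p' * v 1)
   + (of_real (1 - 1/b)*(v 0 * v 1) - of_real (t*d (-1, 1)) * v 1^2)*(1 - p * v 0)" for v :: "nat => complex"
 have v: "poly_fun {0, 1} 0 (%v. v 0)" "poly_fun {0, 1} 0 (%v. v 1)" by (intro poly_fun_var; simp)+
 have "poly_fun {0, 1} 0 f" "poly_fun {0, 1} 0 g" unfolding f_def g_def step_poly_def by (intro poly_fun_intros v)+
 then obtain R P where R: "vars_in {0, 1} R" "!!v. mpeval R v = f v" and P: "vars_in {0, 1} P" "!!v. mpeval P v = g v" unfolding poly_fun_def by blast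
 have "R~=0"
 proof
  assume R0: "R = 0"
  have y: "r/2 > 0" "norm (cr (r/2)) < r" using r by auto
  have "f (%i. if i = 1 then of_real (r/2) else 0) = 0" using R(2) R0 by (metis mpeval_0)
  hence "of_real (t*d (-1, 1)) * cr (r/2)^2*(1 - p' * of_real (r/2)) = 0" by (simp add: f_def step_poly_def)
  moreover have "1 - p' * of_real (r/2)~=0" using y1[OF y(2)] by auto
  ultimately show False using t_pos d_pos r by simp
 qed
 moreover have "Q x y*mpeval R (%i. if i = 0 then x else y) = mpeval P (%i. if i = 0 then x else y)" if xy: "norm x < r" "norm y < r" for x y
 proof -
  have "1/a + 1/b - 1 = 0" using ab ab_pos by (simp add: field_simps)
  hence c0: "cr (1/a + 1/b - 1) = 0" by (simp only: of_real_0)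
  have xy1: "norm x<=1" "norm y<=1" using xy by (auto simp: r_def)
  define k1 k2 where "k1 = of_real (1 - 1/a)*(x*y) - cr (t*d (1, -1))*x^2"
   and "k2 = of_real (1 - 1/b)*(x*y) - cr (t*d (-1, 1))*y^2"
  have FE: "(x*y - of_real t * step_poly x y)*Q x y = k1*Q x 0 + k2*Q 0 y"
   using functional_equation[OF xy1] unfolding c0 k1_def k2_def by simp
  have "Q x y*((x*y - of_real t * step_poly x y)*((1 - p*x)*(1 - p'*y))) = ((x*y - of_real t * step_poly x y)*Q x y)*((1 - p*x)*(1 - p'*y))"
   by (simp only: mult_ac)
  also have "... = k1*(1 - p'*y)*(Q x 0*(1 - p*x)) + k2*(1 - p*x)*(Q 0 y*(1 - p'*y))" unfolding FE by (simp add: algebra_simps)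
  also have "... = k1*(1 - p'*y) + k2*(1 - p*x)" unfolding x1[OF xy(1)] y1[OF xy(2)] by simp
  finally show ?thesis unfolding R(2) P(2) f_def g_def k1_def k2_def by simp
 qed
 ultimately have "is_rational2 Q" unfolding is_rational2_def using R(1) P(1) r by blast
 moreover have "Q x 0 = 1/(1 - x*p) & Q 0 y = 1/(1 - y*p')" if "norm x < r" "norm y < r" for x y
  using inv[OF x1] inv[OF y1] that by blast
 ultimately show ?thesis using r unfolding p_def p'_def by blast
qed

theorem algebraic_case:
 assumes ab: "a = 2" "b = 2" and d0: "d (1, 0) = 0" "d (0, 1) = 0"
 defines "p == 4*d (1, 1)*d (1, -1)*t^2/(1 - 4*d (1, -1)*d (-1, 1)*t^2)"
  and "p' == 4*d (1, 1)*d (-1, 1)*t^2/(1 - 4*d (1, -1)*d (-1, 1)*t^2)"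
 shows "algebraic_deg2 Q 4 & (EX r>0. ALL x y. norm x < r & norm y < r -->
  Q x 0 = 1 / csqrt (1 - x\<^sup>2 * cr p) & Q 0 y = 1 / csqrt (1 - y\<^sup>2 * cr p'))"
proof -
 have d11: "d (1, 1) > 0" using d_nz d0 by simp
 obtain r1 where r1: "r1 > 0" "!!x. norm x < r1 ==> Q x 0^2*(1 - of_real p*x^2) = 1"
  using algebraic_closed_form(1)[OF ab d0] unfolding p_def by blast
 obtain r2 where r2: "r2 > 0" "!!y. norm y < r2 ==> Q 0 y^2*(1 - of_real p'*y^2) = 1"
  using algebraic_closed_form(2)[OF ab d0] unfolding p'_def by blast
 have pnz: "p~=0" "p'~=0" using algebraic_closed_form(3)[OF ab d0] d11 d_pos t_pos unfolding p_def p'_def by simp_all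
 define r where "r = min 1 (min r1 r2)"
 have "algebraic_deg2 Q 4"
 proof (rule algebraic_degree_4[where r = r and al = "of_real (t*d (1, -1))" and be = "of_real (t*d (-1, 1))" and de = "of_real (t*d (1, 1))"
   and p = "of_real p" and p' = "of_real p'" and ph = "%x. Q x 0" and ps = "%y. Q 0 y"])
  fix x y :: complex assume xy: "norm x < r" "norm y < r"
  hence xy1: "norm x<=1" "norm y<=1" by (auto simp: r_def)
  have s: "of_real t * step_poly x y = of_real (t*d (1, -1))*x^2 + of_real (t*d (-1, 1))*y^2 + of_real (t*d (1, 1))*x^2*y^2"
   by (simp add: step_poly_def d0 algebra_simps)
  have c: "cr (1/a + 1/b - 1) = 0" "cr (1 - 1/a) = 1/2" "cr (1 - 1/b) = 1/2" by (simp_all add: ab)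
  show "(x*y - (of_real (t*d (1, -1))*x^2 + of_real (t*d (-1, 1))*y^2 + of_real (t*d (1, 1))*x^2*y^2))*Q x y =
   (x*y/2 - of_real (t*d (1, -1))*x^2)*Q x 0 + (x*y/2 - of_real (t*d (-1, 1))*y^2)*Q 0 y"
   using functional_equation[OF xy1] unfolding s c by simp
 qed (use d_pos t_pos pnz r1 r2 in "auto simp: r_def")
 moreover obtain e1 where e1: "e1 > 0" "!!x. norm x < e1 ==> Q x 0 = 1 / csqrt (1 - x\<^sup>2 * cr p)"
  using reciprocal_csqrt[OF Q_isCont(1) Q_0_0 r1] by blast
 moreover obtain e2 where e2: "e2 > 0" "!!y. norm y < e2 ==> Q 0 y = 1 / csqrt (1 - y\<^sup>2 * cr p')"
  using reciprocal_csqrt[OF Q_isCont(2) Q_0_0 r2] by blast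
 ultimately show ?thesis by (intro conjI exI[of _ "min e1 e2"]) auto
qed

end

section \<open>Assembly of the three cases over the five step sets\<close>

theorem theorem5p8:
  fixes S :: "(int \<times> int) set" and d :: "int \<times> int \<Rightarrow> real" and a b :: real
  assumes "S \<in> {S1, S2, S3, S4, S5}"
    and "\<forall>v\<in>S. d v > 0"
    and "\<forall>v. v \<notin> S \<longrightarrow> d v = 0"
    and "a > 0" and "b > 0"
  shows "\<exists>\<epsilon>>0. \<forall>t. 0 < t \<and> t < \<epsilon> \<and>
      transcendental_over [d (1,-1), d (-1,1), d (1,0), d (0,1), d (1,1), a, b] t \<longrightarrow>
    ((S \<in> {S1, S2} \<and> a + b = a * b) \<longrightarrow>
        is_rational2 (Qgf S d a b t) \<and>
        (\<exists>r>0. \<forall>x y. norm x < r \<and> norm y < r \<longrightarrow>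
           Qgf S d a b t x 0 = 1 / (1 - x * complex_of_real
              ((a * d (1,0) * t + a * b * d (1,-1) * d (0,1) * t^2) /
               (1 - a * b * d (1,-1) * d (-1,1) * t^2))) \<and>
           Qgf S d a b t 0 y = 1 / (1 - y * complex_of_real
              ((b * d (0,1) * t + a * b * d (-1,1) * d (1,0) * t^2) /
               (1 - a * b * d (1,-1) * d (-1,1) * t^2))))) \<and>
    ((S = S3 \<and> a = 2 \<and> b = 2) \<longrightarrow>
        algebraic_deg2 (Qgf S d a b t) 4 \<and>
        (\<exists>r>0. \<forall>x y. norm x < r \<and> norm y < r \<longrightarrow>
           Qgf S d a b t x 0 = 1 / csqrt (1 - x^2 * complex_of_real
              ((4 * d (1,1) * d (1,-1) * t^2) / (1 - 4 * d (1,-1) * d (-1,1) * t^2))) \<and>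
           Qgf S d a b t 0 y = 1 / csqrt (1 - y^2 * complex_of_real
              ((4 * d (1,1) * d (-1,1) * t^2) / (1 - 4 * d (1,-1) * d (-1,1) * t^2))))) \<and>
    ((\<not> (S \<in> {S1, S2} \<and> a + b = a * b) \<and> \<not> (S = S3 \<and> a = 2 \<and> b = 2)) \<longrightarrow>
        \<not> x_D_algebraic (Qgf S d a b t) \<and> \<not> y_D_algebraic (Qgf S d a b t))"
proof -
 have sub: "S<=S5" using assms(1) by (auto simp: S1_def S2_def S3_def S4_def S5_def)
 have QS: "Qgf S d a b t = Qgf S5 d a b t" for t by (rule Qgf_S5[OF sub assms(3)])
 have nn: "0<=d v" for v
 proof (cases "v : S")
  case True
  hence "0 < d v" using assms(2) by blast
  thus ?thesis by simp
 next
  case False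
  hence "d v = 0" using assms(3) by blast
  thus ?thesis by simp
 qed
 have "(1, -1) : S" "(-1, 1) : S" using assms(1) by (auto simp: S1_def S2_def S3_def S4_def S5_def)
 hence pos: "d (1, -1) > 0" "d (-1, 1) > 0" using assms(2) by auto
 have s12: "d (1, 1) = 0 & d (0, 1) > 0" if "S : {S1, S2}"
 proof -
  have "(1, 1) ~: S" "(0, 1) : S" using that by (auto simp: S1_def S2_def)
  thus ?thesis using assms(2,3) by blast
 qed
 have s3: "d (1, 0) = 0 & d (0, 1) = 0" if "S = S3"
 proof -
  have "(1, 0) ~: S" "(0, 1) ~: S" using that by (auto simp: S3_def)
  thus ?thesis using assms(3) by blast
 qed
 have s345: "d (1, 1) > 0" if "S ~: {S1, S2}"
 proof -
  have "(1, 1) : S" using that assms(1) by (auto simp: S3_def S4_def S5_def)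
  thus ?thesis using assms(2) by blast
 qed
 have s45: "d (0, 1) > 0" if "S~=S3" "S ~: {S1, S2}"
 proof -
  have "(0, 1) : S" using that assms(1) by (auto simp: S4_def S5_def)
  thus ?thesis using assms(2) by blast
 qed
 have dnz: "d (1, 0) > 0 | d (0, 1) > 0 | d (1, 1) > 0" using s12 s345 by blast
 obtain ep1 where e1: "ep1 > 0" "!!t. 0 < t ==> t < ep1 ==> EX h>0. kernel_curve d a b t h"
  using ex_kernel_curve[OF nn assms(4,5) pos dnz, of 0] by blast
 obtain ep2 where e2: "ep2 > 0" "!!t. 0 < t ==> t < ep2 ==> ~ (S : {S1, S2} & a + b = a*b) ==> ~ (S = S3 & a = 2 & b = 2) ==>
   ~ x_D_algebraic (Qgf S5 d a b t) & ~ y_D_algebraic (Qgf S5 d a b t)"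
 proof (cases "(S : {S1, S2} & a + b = a*b) | (S = S3 & a = 2 & b = 2)")
  \<comment> \<open>In the two exceptional cases the claim is vacuous and any bound serves.\<close>
  case True thus ?thesis using that[of 1] by auto
 next
  case False
  have "d (1, 1) > 0 & ~ (a = 2 & b = 2 & d (1, 0) = 0 & d (0, 1) = 0) | d (1, 1) = 0 & d (0, 1) > 0 & a + b~=a*b"
  proof (cases "S : {S1, S2}")
   case True thus ?thesis using s12 False by blast
  next
   case S: False
   \<comment> \<open>Among the sets containing (1,1), the weight of the step (0,1) tells
     \<open>S4\<close> and \<open>S5\<close> apart from \<open>S3\<close>.\<close>
   have "~ (a = 2 & b = 2 & d (1, 0) = 0 & d (0, 1) = 0)"
    using False s45[OF _ S] by (cases "S = S3") auto
   thus ?thesis using s345[OF S] by blast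
  qed
  from small_t_transcendental[OF nn assms(4,5) pos this] show ?thesis using that by blast
 qed
 show ?thesis
 proof (rule exI[of _ "min ep1 ep2"], intro conjI allI impI)
  show "min ep1 ep2 > 0" using e1 e2 by simp
 next
  fix t assume t: "0 < t & t < min ep1 ep2 & transcendental_over [d (1,-1), d (-1,1), d (1,0), d (0,1), d (1,1), a, b] t"
   and S: "S : {S1, S2} & a + b = a*b"
  then obtain h where "kernel_curve d a b t h" using e1(2)[of t] by auto
  then interpret kernel_curve d a b t h .
  have d11: "d (1, 1) = 0" and ab: "a + b = a*b" using s12 S by auto
  show "is_rational2 (Qgf S d a b t)" unfolding QS using rational_case[OF ab d11] by blast
  show "EX r>0. ALL x y. norm x < r & norm y < r -->
      Qgf S d a b t x 0 = 1/(1 - x * cr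
       ((a*d (1,0)*t + a*b*d (1,-1)*d (0,1)*t^2) /
        (1 - a*b*d (1,-1)*d (-1,1)*t^2))) &
      Qgf S d a b t 0 y = 1/(1 - y * cr
       ((b*d (0,1)*t + a*b*d (-1,1)*d (1,0)*t^2) /
        (1 - a*b*d (1,-1)*d (-1,1)*t^2)))"
   unfolding QS using rational_case[OF ab d11] by blast
 next
  fix t assume t: "0 < t & t < min ep1 ep2 & transcendental_over [d (1,-1), d (-1,1), d (1,0), d (0,1), d (1,1), a, b] t"
   and S: "S = S3 & a = 2 & b = 2"
  then obtain h where "kernel_curve d a b t h" using e1(2)[of t] by auto
  then interpret kernel_curve d a b t h .
  have ab: "a = 2" "b = 2" and d0: "d (1, 0) = 0" "d (0, 1) = 0" using S s3 by auto
  show "algebraic_deg2 (Qgf S d a b t) 4" unfolding QS using algebraic_case[OF ab d0] by blast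
  show "EX r>0. ALL x y. norm x < r & norm y < r -->
      Qgf S d a b t x 0 = 1 / csqrt (1 - x^2 * cr
       ((4*d (1,1)*d (1,-1)*t^2)/(1 - 4*d (1,-1)*d (-1,1)*t^2))) &
      Qgf S d a b t 0 y = 1 / csqrt (1 - y^2 * cr
       ((4*d (1,1)*d (-1,1)*t^2)/(1 - 4*d (1,-1)*d (-1,1)*t^2)))"
   unfolding QS using algebraic_case[OF ab d0] by blast
 next
  fix t assume t: "0 < t & t < min ep1 ep2 & transcendental_over [d (1,-1), d (-1,1), d (1,0), d (0,1), d (1,1), a, b] t"
   and S: "~ (S : {S1, S2} & a + b = a*b) & ~ (S = S3 & a = 2 & b = 2)"
  show "~ x_D_algebraic (Qgf S d a b t)" "~ y_D_algebraic (Qgf S d a b t)"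
   unfolding QS using e2(2)[of t] t S by auto
 qed
qed

end
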